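(* Let $S$ be a closed oriented surface of genus $g\ge 2$ and let $\Gamma=\pi_1(S)$. There is no measure in the class of the Lebesgue measure on $\chi(\Gamma,\mathrm{Aff}(\mathbb{C}))$ which is invariant under the action of the mapping class group $\mathrm{Mod}(S)$. In particular, there is no $\mathrm{Mod}(S)$-invariant symplectic form on $\chi(\Gamma,\mathrm{Aff}(\mathbb{C}))$.
   Context: $\mathrm{Aff}(\mathbb{C})=\{z\mapsto az+b : (a,b)\in\mathbb{C}^*\times\mathbb{C}\}$ is the group of complex affine transformations of the complex line. A representation $\Gamma\to\mathrm{Aff}(\mathbb{C})$ is called abelian if its image is an abelian subgroup of $\mathrm{Aff}(\mathbb{C})$. The character variety $\chi(\Gamma,\mathrm{Aff}(\mathbb{C}))$ is the quotient of $\mathrm{Hom}(\Gamma,\mathrm{Aff}(\mathbb{C}))\setminus\{\text{abelian representations}\}$ by the action of $\mathrm{Aff}(\mathbb{C})$ by conjugation; it is a differentiable manifold. Using the presentation $\Gamma=\langle a_1,b_1,\dots,a_g,b_g\mid\prod_{i=1}^g[a_i,b_i]=1\rangle$ and writing $\rho(a_i):z\mapsto A_iz+U_i$, $\rho(b_i):z\mapsto B_iz+V_i$, the set $\mathrm{Hom}(\Gamma,\mathrm{Aff}(\mathbb{C}))$ is identified with the algebraic variety of $(A_i,U_i,B_i,V_i)\in(\mathbb{C}^* )^g\times\mathbb{C}^g\times(\mathbb{C}^* )^g\times\mathbb{C}^g$ such that $\sum_{i=1}^g \big((A_i-1)V_i+(1-B_i)U_i\big)=0$. $\mathrm{Mod}(S)=\mathrm{Homeo}^+(S)/\mathrm{Homeo}_0(S)$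 is identified with the subgroup $\mathrm{Out}^+(\Gamma)$ of $\mathrm{Out}(\Gamma)=\mathrm{Aut}(\Gamma)/\mathrm{Inn}(\Gamma)$ preserving the fundamental class in $\mathrm{H}^2(\Gamma,\mathbb{Z})$. The action of $\mathrm{Aut}(\Gamma)$ on $\mathrm{Hom}(\Gamma,\mathrm{Aff}(\mathbb{C}))$ by precomposition induces the action of $\mathrm{Mod}(S)$ on $\chi(\Gamma,\mathrm{Aff}(\mathbb{C}))$, given by $[f]\cdot[\rho]=[\rho\circ f^{-1}]$. The Lebesgue measure on the manifold $\chi(\Gamma,\mathrm{Aff}(\mathbb{C}))$ is not canonically defined, but its class is: a subset has Lebesgue measure zero if its Lebesgue measure in any chart is zero. A measure is in the class of the Lebesgue measure if it has the same sets of measure zero.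
   Formalization: The measure is additionally required to be sigma-finite; without this, the measure that is zero on Lebesgue-null sets and infinite on all other sets is in the Lebesgue class and is invariant under the mapping class group. *)

theory Defs
  imports "HOL-Analysis.Analysis" "HOL-Algebra.Coset" "HOL-Algebra.Bij"
begin

section \<open>Groups given by generators and relators\<close>

text \<open>A letter \<open>(s, False)\<close> stands for the generator \<open>s\<close>, and \<open>(s, True)\<close> for its inverse.\<close>

type_synonym 's word = "('s \<times> bool) list"

definition words :: "'s set \<Rightarrow> 's word set" where
  "words S = lists (S \<times> UNIV)"

definition elementary_reduction :: "'s set \<Rightarrow> 's word set \<Rightarrow> 's word rel" where
  "elementary_reduction S R =
     {(u @ r @ v, u @ v) | u r v. u \<in> words S \<and> v \<in> words S \<and>
        (r \<in> R \<or> (\<exists>s\<in>S. \<exists>e. r = [(s, e), (s, \<not> e)]))}"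

definition word_equiv :: "'s set \<Rightarrow> 's word set \<Rightarrow> 's word rel" where
  "word_equiv S R =
     (elementary_reduction S R \<union> (elementary_reduction S R)\<inverse>)\<^sup>* \<inter> words S \<times> words S"

definition presented_group :: "'s set \<Rightarrow> 's word set \<Rightarrow> 's word set monoid" where
  "presented_group S R =
     \<lparr>carrier = words S // word_equiv S R,
      mult = (\<lambda>X Y. word_equiv S R `` {u @ v | u v. u \<in> X \<and> v \<in> Y}),
      one = word_equiv S R `` {[]}\<rparr>"


section \<open>Surface groups\<close>

datatype surface_gen = GenA nat | GenB nat

definition surface_gens :: "nat \<Rightarrow> surface_gen set" where
  "surface_gens g = GenA ` {1..g} \<union> GenB ` {1..g}"

definition surface_relator :: "nat \<Rightarrow> surface_gen word" where
  "surface_relator g =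
     concat (map (\<lambda>i. [(GenA i, False), (GenB i, False), (GenA i, True), (GenB i, True)])
                 [1..<Suc g])"

type_synonym surface_elt = "surface_gen word set"

definition surface_group :: "nat \<Rightarrow> surface_elt monoid" where
  "surface_group g = presented_group (surface_gens g) {surface_relator g}"

definition surface_gen_elt :: "nat \<Rightarrow> surface_gen \<Rightarrow> surface_elt" where
  "surface_gen_elt g s = word_equiv (surface_gens g) {surface_relator g} `` {[(s, False)]}"


section \<open>Degree two cohomology with integer coefficients and the mapping class group\<close>

definition two_cocycle :: "('a, 'm) monoid_scheme \<Rightarrow> ('a \<Rightarrow> 'a \<Rightarrow> int) \<Rightarrow> bool" where
  "two_cocycle G c \<longleftrightarrow>
     (\<forall>x\<in>carrier G. \<forall>y\<in>carrier G. \<forall>z\<in>carrier G.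
        c y z - c (x \<otimes>\<^bsub>G\<^esub> y) z + c x (y \<otimes>\<^bsub>G\<^esub> z) - c x y = 0)"

definition two_coboundary :: "('a, 'm) monoid_scheme \<Rightarrow> ('a \<Rightarrow> 'a \<Rightarrow> int) \<Rightarrow> bool" where
  "two_coboundary G c \<longleftrightarrow>
     (\<exists>b. \<forall>x\<in>carrier G. \<forall>y\<in>carrier G. c x y = b y - b (x \<otimes>\<^bsub>G\<^esub> y) + b x)"

text \<open>For a surface group, \<open>H\<^sup>2\<close> with integer coefficients is infinite cyclic. An orientation of the
  surface is the choice of one of its two generators, the fundamental class; it is given here by
  a representing cocycle.\<close>

definition fundamental_class :: "('a, 'm) monoid_scheme \<Rightarrow> ('a \<Rightarrow> 'a \<Rightarrow> int) \<Rightarrow> bool" where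
  "fundamental_class G \<kappa> \<longleftrightarrow> two_cocycle G \<kappa> \<and>
     (\<forall>c. two_cocycle G c \<longrightarrow> (\<exists>k. two_coboundary G (\<lambda>x y. c x y - k * \<kappa> x y)))"

definition preserves_class ::
  "('a, 'm) monoid_scheme \<Rightarrow> ('a \<Rightarrow> 'a \<Rightarrow> int) \<Rightarrow> ('a \<Rightarrow> 'a) \<Rightarrow> bool" where
  "preserves_class G \<kappa> f \<longleftrightarrow> two_coboundary G (\<lambda>x y. \<kappa> (f x) (f y) - \<kappa> x y)"

definition inner_automorphisms :: "('a, 'm) monoid_scheme \<Rightarrow> ('a \<Rightarrow> 'a) set" where
  "inner_automorphisms G = {\<lambda>x\<in>carrier G. a \<otimes>\<^bsub>G\<^esub> x \<otimes>\<^bsub>G\<^esub> inv\<^bsub>G\<^esub> a | a. a \<in> carrier G}"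

definition Out_group :: "('a, 'm) monoid_scheme \<Rightarrow> ('a \<Rightarrow> 'a) set monoid" where
  "Out_group G = AutoGroup G Mod inner_automorphisms G"

definition mapping_class_group ::
  "nat \<Rightarrow> (surface_elt \<Rightarrow> surface_elt \<Rightarrow> int) \<Rightarrow> (surface_elt \<Rightarrow> surface_elt) set monoid" where
  "mapping_class_group g \<kappa> =
     Out_group (surface_group g)
       \<lparr>carrier := {F \<in> carrier (Out_group (surface_group g)).
                      \<forall>f\<in>F. preserves_class (surface_group g) \<kappa> f}\<rparr>"


section \<open>The character variety as a set, and the mapping class group action\<close>

definition Aff :: "(complex \<Rightarrow> complex) monoid" where
  "Aff = \<lparr>carrier = {\<lambda>z. a * z + b | a b. a \<noteq> 0}, mult = (\<circ>), one = id\<rparr>"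

definition linear_part :: "(complex \<Rightarrow> complex) \<Rightarrow> complex" where
  "linear_part h = h 1 - h 0"

definition translation_part :: "(complex \<Rightarrow> complex) \<Rightarrow> complex" where
  "translation_part h = h 0"

type_synonym surface_rep = "surface_elt \<Rightarrow> complex \<Rightarrow> complex"

text \<open>Extensionality makes a representation determined by its values on the carrier.\<close>

definition Hom_Aff :: "nat \<Rightarrow> surface_rep set" where
  "Hom_Aff g = hom (surface_group g) Aff \<inter> extensional (carrier (surface_group g))"

definition abelian_rep :: "nat \<Rightarrow> surface_rep \<Rightarrow> bool" where
  "abelian_rep g \<rho> \<longleftrightarrow> comm_group (Aff\<lparr>carrier := \<rho> ` carrier (surface_group g)\<rparr>)"

definition Hom_nonabelian :: "nat \<Rightarrow> surface_rep set" where
  "Hom_nonabelian g = {\<rho> \<in> Hom_Aff g. \<not> abelian_rep g \<rho>}"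

definition conjugate_rep :: "nat \<Rightarrow> (complex \<Rightarrow> complex) \<Rightarrow> surface_rep \<Rightarrow> surface_rep" where
  "conjugate_rep g h \<rho> = (\<lambda>x\<in>carrier (surface_group g). h \<otimes>\<^bsub>Aff\<^esub> \<rho> x \<otimes>\<^bsub>Aff\<^esub> inv\<^bsub>Aff\<^esub> h)"

definition rep_class :: "nat \<Rightarrow> surface_rep \<Rightarrow> surface_rep set" where
  "rep_class g \<rho> = {conjugate_rep g h \<rho> | h. h \<in> carrier Aff}"

definition char_var :: "nat \<Rightarrow> surface_rep set set" where
  "char_var g = rep_class g ` Hom_nonabelian g"

text \<open>The set of all \<open>\<rho> \<circ> f\<^sup>-\<^sup>1\<close> with \<open>f\<close> in an outer class and \<open>\<rho>\<close> in a conjugacy class is again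
  a single conjugacy class, so no choice of representatives is needed.\<close>

definition mcg_action ::
  "nat \<Rightarrow> (surface_elt \<Rightarrow> surface_elt) set \<Rightarrow> surface_rep set \<Rightarrow> surface_rep set" where
  "mcg_action g F X =
     {compose (carrier (surface_group g)) \<rho> (inv\<^bsub>AutoGroup (surface_group g)\<^esub> f) | \<rho> f.
        \<rho> \<in> X \<and> f \<in> F}"


section \<open>The smooth structure on the character variety\<close>

text \<open>For open \<open>W\<close> in a Euclidean space, \<open>Ck_on k W\<close> is the usual class \<open>C\<^sup>k\<close>.\<close>

primrec Ck_on ::
  "nat \<Rightarrow> 'a::real_normed_vector set \<Rightarrow> ('a \<Rightarrow> 'b::real_normed_vector) \<Rightarrow> bool" where
  "Ck_on 0 W f \<longleftrightarrow> continuous_on W f"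
| "Ck_on (Suc k) W f \<longleftrightarrow>
     (\<forall>x\<in>W. f differentiable at x) \<and> (\<forall>v. Ck_on k W (\<lambda>x. frechet_derivative f (at x) v))"

definition smooth_on :: "'a::real_normed_vector set \<Rightarrow> ('a \<Rightarrow> 'b::real_normed_vector) \<Rightarrow> bool" where
  "smooth_on W f \<longleftrightarrow> (\<forall>k. Ck_on k W f)"

text \<open>A smooth map into the nonabelian representations, seen as a submanifold of the space of
  coordinates \<open>(A\<^sub>i, U\<^sub>i, B\<^sub>i, V\<^sub>i)\<close>.\<close>

definition smooth_rep_family ::
  "nat \<Rightarrow> 'e::euclidean_space set \<Rightarrow> ('e \<Rightarrow> surface_rep) \<Rightarrow> bool" where
  "smooth_rep_family g W \<sigma> \<longleftrightarrow> open W \<and> (\<forall>x\<in>W. \<sigma> x \<in> Hom_nonabelian g) \<and>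
     (\<forall>s\<in>surface_gens g.
        smooth_on W (\<lambda>x. linear_part (\<sigma> x (surface_gen_elt g s))) \<and>
        smooth_on W (\<lambda>x. translation_part (\<sigma> x (surface_gen_elt g s))))"

text \<open>The projection from the nonabelian representations onto \<open>char_var g\<close> is a submersion.
  Hence a map into \<open>char_var g\<close> is smooth iff it lifts locally to a smooth family of
  representations, and this determines the smooth structure of the quotient.\<close>

definition smooth_to_char_var ::
  "nat \<Rightarrow> 'e::euclidean_space set \<Rightarrow> ('e \<Rightarrow> surface_rep set) \<Rightarrow> bool" where
  "smooth_to_char_var g W p \<longleftrightarrow> open W \<and>
     (\<forall>x\<in>W. \<exists>W' \<sigma>. x \<in> W' \<and> W' \<subseteq> W \<and> smooth_rep_family g W' \<sigma> \<and>
        (\<forall>y\<in>W'. p y = rep_class g (\<sigma> y)))"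

type_synonym ('p, 'e) chart = "'p set \<times> ('p \<Rightarrow> 'e)"

text \<open>The maximal atlas, i.e. all diffeomorphisms from an open subset of \<open>char_var g\<close> onto an open
  subset of the model space. As the real dimension of \<open>char_var g\<close> is \<open>8 * g - 6\<close> (complex
  dimension \<open>2 * g + (2 * g - 3)\<close>), the model space \<open>'e\<close> has to be of that dimension. The inverses
  of the charts are then among the maps \<open>p\<close> below, which therefore also detect whether \<open>U\<close> is
  open and whether \<open>\<phi>\<close> is smooth.\<close>

definition char_var_atlas :: "nat \<Rightarrow> (surface_rep set, 'e::euclidean_space) chart set" where
  "char_var_atlas g = {(U, \<phi>). U \<subseteq> char_var g \<and> inj_on \<phi> U \<and>
     smooth_to_char_var g (\<phi> ` U) (inv_into U \<phi>) \<and>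
     (\<forall>(W :: 'e set) p. smooth_to_char_var g W p \<longrightarrow>
        open {x \<in> W. p x \<in> U} \<and> smooth_on {x \<in> W. p x \<in> U} (\<phi> \<circ> p))}"


section \<open>Measures and differential forms on a manifold given by an atlas\<close>

definition atlas_open :: "'p set \<Rightarrow> ('p, 'e::euclidean_space) chart set \<Rightarrow> 'p set \<Rightarrow> bool" where
  "atlas_open M \<A> V \<longleftrightarrow> V \<subseteq> M \<and> (\<forall>(U, \<phi>)\<in>\<A>. open (\<phi> ` (V \<inter> U)))"

definition atlas_borel :: "'p set \<Rightarrow> ('p, 'e::euclidean_space) chart set \<Rightarrow> 'p measure" where
  "atlas_borel M \<A> = sigma M {V. atlas_open M \<A> V}"

definition lebesgue_null :: "'p set \<Rightarrow> ('p, 'e::euclidean_space) chart set \<Rightarrow> 'p set \<Rightarrow> bool" where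
  "lebesgue_null M \<A> N \<longleftrightarrow> N \<subseteq> M \<and> (\<forall>(U, \<phi>)\<in>\<A>. \<phi> ` (N \<inter> U) \<in> null_sets lebesgue)"

text \<open>Without sigma-finiteness the measure that is infinite on every non-null set
  would always be in the Lebesgue class, and would be invariant under every diffeomorphism.\<close>

definition in_lebesgue_class ::
  "'p set \<Rightarrow> ('p, 'e::euclidean_space) chart set \<Rightarrow> 'p measure \<Rightarrow> bool" where
  "in_lebesgue_class M \<A> \<mu> \<longleftrightarrow>
     sets \<mu> = sets (atlas_borel M \<A>) \<and> sigma_finite_measure \<mu> \<and>
     (\<forall>N\<in>sets \<mu>. emeasure \<mu> N = 0 \<longleftrightarrow> lebesgue_null M \<A> N)"

definition invariant_measure :: "'p measure \<Rightarrow> ('p \<Rightarrow> 'p) \<Rightarrow> bool" where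
  "invariant_measure \<mu> T \<longleftrightarrow>
     (\<forall>B\<in>sets \<mu>. emeasure \<mu> (T -` B \<inter> space \<mu>) = emeasure \<mu> B)"

text \<open>A 2-form \<open>\<omega>\<close> is given by its expressions \<open>\<omega> (U, \<phi>) x\<close>, bilinear forms on \<open>'e\<close>
  for \<open>x \<in> \<phi> ` U\<close>, in the charts. \<open>preserves_form\<close> says that \<open>T\<^sup>*\<omega> = \<omega>\<close>; for \<open>T = id\<close> this is
  the compatibility of the local expressions under changes of charts.\<close>

type_synonym ('p, 'e) local_forms = "('p, 'e) chart \<Rightarrow> 'e \<Rightarrow> 'e \<Rightarrow> 'e \<Rightarrow> real"

definition preserves_form ::
  "('p, 'e::euclidean_space) chart set \<Rightarrow> ('p, 'e) local_forms \<Rightarrow> ('p \<Rightarrow> 'p) \<Rightarrow> bool" where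
  "preserves_form \<A> \<omega> T \<longleftrightarrow>
     (\<forall>(U, \<phi>)\<in>\<A>. \<forall>(V, \<psi>)\<in>\<A>. \<forall>x\<in>\<phi> ` (U \<inter> T -` V).
        let \<tau> = \<psi> \<circ> T \<circ> inv_into U \<phi>; D = frechet_derivative \<tau> (at x)
        in \<forall>v w. \<omega> (V, \<psi>) (\<tau> x) (D v) (D w) = \<omega> (U, \<phi>) x v w)"

definition two_form ::
  "('p, 'e::euclidean_space) chart set \<Rightarrow> ('p, 'e) local_forms \<Rightarrow> bool" where
  "two_form \<A> \<omega> \<longleftrightarrow>
     (\<forall>(U, \<phi>)\<in>\<A>.
        (\<forall>x\<in>\<phi> ` U. bilinear (\<omega> (U, \<phi>) x) \<and> (\<forall>v. \<omega> (U, \<phi>) x v v = 0)) \<and>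
        (\<forall>v w. smooth_on (\<phi> ` U) (\<lambda>x. \<omega> (U, \<phi>) x v w))) \<and>
     preserves_form \<A> \<omega> id"

definition closed_form ::
  "('p, 'e::euclidean_space) chart set \<Rightarrow> ('p, 'e) local_forms \<Rightarrow> bool" where
  "closed_form \<A> \<omega> \<longleftrightarrow>
     (\<forall>(U, \<phi>)\<in>\<A>. \<forall>x\<in>\<phi> ` U. \<forall>u v w.
        frechet_derivative (\<lambda>y. \<omega> (U, \<phi>) y v w) (at x) u +
        frechet_derivative (\<lambda>y. \<omega> (U, \<phi>) y w u) (at x) v +
        frechet_derivative (\<lambda>y. \<omega> (U, \<phi>) y u v) (at x) w = 0)"

definition nondegenerate_form ::
  "('p, 'e::euclidean_space) chart set \<Rightarrow> ('p, 'e) local_forms \<Rightarrow> bool" where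
  "nondegenerate_form \<A> \<omega> \<longleftrightarrow>
     (\<forall>(U, \<phi>)\<in>\<A>. \<forall>x\<in>\<phi> ` U. \<forall>v. v \<noteq> 0 \<longrightarrow> (\<exists>w. \<omega> (U, \<phi>) x v w \<noteq> 0))"

definition symplectic_form ::
  "('p, 'e::euclidean_space) chart set \<Rightarrow> ('p, 'e) local_forms \<Rightarrow> bool" where
  "symplectic_form \<A> \<omega> \<longleftrightarrow> two_form \<A> \<omega> \<and> closed_form \<A> \<omega> \<and> nondegenerate_form \<A> \<omega>"

end

theory Submission
  imports Defs "HOL-Computational_Algebra.Polynomial"
begin

text \<open>
  In coordinates an affine representation consists of linear parts and translation parts, and the
  translation parts form a cocycle with values in the one-dimensional module given by the linear
  parts. Twists about separating curves of genus one and about their images under a mapping class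
  fix the linear parts, and act on the translation parts by transvections. For neighbouring
  handles two such twists act on a complex plane inside the fibre by an upper and a lower
  parabolic matrix (lemma \<open>transvection_pair_invariance\<close>).

  If the product of the off-diagonal entries of the two matrices is smaller than one in modulus,
  the iteration of Shimizu and Leutbecher shows that they generate a group that is not discrete;
  this happens on an open set of linear parts. Symmetries of a measurable function form a closed
  group, so that a function invariant under the twists is invariant, over this open set, under
  all parabolic matrices, hence under all translations of the fibre and under doubling of the
  fibre (\<open>parabolic_translation_symmetry\<close>, \<open>doubling_invariance\<close>).

  Conjugacy classes correspond to the points of the fibre up to scaling. An invariant measure on
  the character variety, multiplied by the Haar measure of the group of scalings, becomes an
  invariant measure on the space of cocycles. It is invariant under doubling of the fibre, while
  Lebesgue measure is multiplied by a constant; so its density cannot be invariant under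
  doubling, which is the contradiction (\<open>no_twist_invariant_density\<close>,
  \<open>no_invariant_chart_measure\<close>).

  It remains to see that the twists are mapping classes and that the coordinates form a chart.
  The twists are given by substitutions of the generators that fix the relator in the free group.
  Such automorphisms lift to every central extension by the integers and therefore preserve
  classes of degree two (\<open>preserves_class_endomorphism\<close>). The chart is the slice on which the
  last generator fixes the origin and one translation part is equal to one (\<open>chart_in_atlas\<close>).
  A symplectic form is reduced to the case of measures by means of the volume that it defines
  (\<open>gram_change_of_variables\<close>).
\<close>

section \<open>Lebesgue-preserving maps and symmetries of a function\<close>

definition lebesgue_preserving :: "('a::euclidean_space \<Rightarrow> 'a) \<Rightarrow> bool" where
  "lebesgue_preserving f \<longleftrightarrow> f \<in> borel_measurable borel \<and> distr lborel borel f = lborel"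

lemma lebesgue_preservingI:
  assumes "f \<in> borel_measurable borel"
    and "\<And>h. h \<in> borel_measurable borel \<Longrightarrow> (\<integral>\<^sup>+x. h (f x) \<partial>lborel) = (\<integral>\<^sup>+x. h x \<partial>lborel)"
  shows "lebesgue_preserving f"
  unfolding lebesgue_preserving_def
proof (intro conjI measure_eqI)
  show "f \<in> borel_measurable borel" by fact
  show "sets (distr lborel borel f) = sets lborel" by simp
  fix A assume "A \<in> sets (distr lborel borel f)"
  then have A: "A \<in> sets borel" by simp
  then have "emeasure (distr lborel borel f) A = (\<integral>\<^sup>+x. indicator A (f x) \<partial>lborel)"
    using assms(1) by (subst nn_integral_distr[symmetric, where f = "indicator A"]) auto
  also have "\<dots> = (\<integral>\<^sup>+x. indicator A x \<partial>lborel)"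
    by (rule assms(2)) (use A in auto)
  finally show "emeasure (distr lborel borel f) A = emeasure lborel A" using A by simp
qed

lemma lebesgue_preservingD:
  assumes "lebesgue_preserving f"
  shows "f \<in> borel_measurable borel"
    and "h \<in> borel_measurable borel \<Longrightarrow> (\<integral>\<^sup>+x. h (f x) \<partial>lborel) = (\<integral>\<^sup>+x. h x \<partial>lborel)"
proof -
  show m: "f \<in> borel_measurable borel" using assms unfolding lebesgue_preserving_def by auto
  assume h: "h \<in> borel_measurable borel"
  have "(\<integral>\<^sup>+x. h x \<partial>distr lborel borel f) = (\<integral>\<^sup>+x. h (f x) \<partial>lborel)"
    by (rule nn_integral_distr) (use m h in auto)
  then show "(\<integral>\<^sup>+x. h (f x) \<partial>lborel) = (\<integral>\<^sup>+x. h x \<partial>lborel)"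
    using assms unfolding lebesgue_preserving_def by simp
qed

lemma lebesgue_preserving_AE:
  assumes "lebesgue_preserving f" "AE x in lborel. P x"
  shows "AE x in lborel. P (f x)"
proof -
  have f: "f \<in> measurable lborel borel" and d: "distr lborel borel f = lborel"
    using assms(1) unfolding lebesgue_preserving_def by auto
  have "AE x in distr lborel borel f. P x"
    unfolding d by (rule assms(2))
  with f show ?thesis by (rule AE_distrD)
qed

lemma lebesgue_preserving_compose:
  assumes "lebesgue_preserving f" "lebesgue_preserving k"
  shows "lebesgue_preserving (\<lambda>x. f (k x))"
proof (rule lebesgue_preservingI)
  have [measurable]: "f \<in> borel_measurable borel" "k \<in> borel_measurable borel"
    using assms lebesgue_preservingD by auto
  show "(\<lambda>x. f (k x)) \<in> borel_measurable borel" by measurable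
  fix h :: "'a \<Rightarrow> ennreal" assume [measurable]: "h \<in> borel_measurable borel"
  show "(\<integral>\<^sup>+x. h (f (k x)) \<partial>lborel) = (\<integral>\<^sup>+x. h x \<partial>lborel)"
    by (subst lebesgue_preservingD(2)[OF assms(2), where h = "\<lambda>x. h (f x)"])
       (auto intro!: lebesgue_preservingD(2)[OF assms(1)])
qed

lemma lebesgue_preserving_translation: "lebesgue_preserving (\<lambda>x. x + a)"
proof -
  have "(\<lambda>x. x + a) = (+) a" by (auto simp: add.commute)
  then show ?thesis using lborel_distr_plus[of a] unfolding lebesgue_preserving_def by simp
qed

lemma borel_measurable_pair_euclidean:
  fixes f :: "('a::euclidean_space \<times> 'b::euclidean_space) \<Rightarrow> 'c::topological_space"
  assumes "f \<in> borel_measurable borel"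
  shows "f \<in> borel_measurable (borel \<Otimes>\<^sub>M borel)"
  using assms by (simp add: borel_prod)

text \<open>A shear whose amount is constant along the orbits preserves Lebesgue measure: averaging over a
  unit box of amounts and exchanging the two integrals replaces the variable amount by constant
  ones.\<close>

lemma lebesgue_preserving_along_action:
  fixes a :: "'r::euclidean_space \<Rightarrow> 'x::euclidean_space \<Rightarrow> 'x" and s :: "'x \<Rightarrow> 'r"
  assumes meas: "(\<lambda>p. a (fst p) (snd p)) \<in> borel_measurable borel"
    and pres: "\<And>r. lebesgue_preserving (a r)"
    and comp: "\<And>r q x. a r (a q x) = a (r + q) x"
    and s [measurable]: "s \<in> borel_measurable borel"
    and inv: "\<And>r x. s (a r x) = s x"
  shows "lebesgue_preserving (\<lambda>x. a (s x) x)"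
proof (rule lebesgue_preservingI)
  define a' where "a' p = a (fst p) (snd p)" for p
  have a_eq: "a r x = a' (r, x)" for r x by (simp add: a'_def)
  have a2 [measurable]: "a' \<in> borel_measurable (borel \<Otimes>\<^sub>M borel)"
    using borel_measurable_pair_euclidean[OF meas] by (simp add: a'_def[abs_def])
  show "(\<lambda>x. a (s x) x) \<in> borel_measurable borel"
    unfolding a_eq by measurable
  fix h :: "'x \<Rightarrow> ennreal" assume [measurable]: "h \<in> borel_measurable borel"
  define w where "w = (indicator (cbox 0 One) :: 'r \<Rightarrow> ennreal)"
  have w [measurable]: "w \<in> borel_measurable borel" unfolding w_def by measurable
  have w1: "(\<integral>\<^sup>+r. w r \<partial>lborel) = 1"
    unfolding w_def by (simp add: emeasure_lborel_cbox_eq)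
  have m1 [measurable]: "(\<lambda>(x, r). h (a (s x + r) x) * w r) \<in> borel_measurable (lborel \<Otimes>\<^sub>M lborel)"
    unfolding split_beta' a_eq by measurable
  have m2 [measurable]: "(\<lambda>(x, r). h (a r x) * w (r - s x)) \<in> borel_measurable (lborel \<Otimes>\<^sub>M lborel)"
    unfolding split_beta' a_eq by measurable
  have m3 [measurable]: "(\<lambda>(x, r). h x * w (r - s x)) \<in> borel_measurable (lborel \<Otimes>\<^sub>M lborel)"
    unfolding split_beta' by measurable
  define J where "J = (\<integral>\<^sup>+x. h (a (s x) x) \<partial>lborel)"
  have J: "J = (\<integral>\<^sup>+x. h (a (s x + r) x) \<partial>lborel)" for r
  proof -
    have "J = (\<integral>\<^sup>+x. h (a (s (a r x)) (a r x)) \<partial>lborel)"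
      unfolding J_def
      by (rule lebesgue_preservingD(2)[OF pres[of r], symmetric])
         (unfold a_eq, measurable)
    then show ?thesis by (simp add: inv comp)
  qed
  have "J = (\<integral>\<^sup>+r. J * w r \<partial>lborel)"
    using w1 by (simp add: nn_integral_cmult)
  also have "\<dots> = (\<integral>\<^sup>+r. (\<integral>\<^sup>+x. h (a (s x + r) x) * w r \<partial>lborel) \<partial>lborel)"
  proof (rule nn_integral_cong)
    fix r
    have "(\<lambda>x. h (a (s x + r) x)) \<in> borel_measurable lborel"
      unfolding a_eq by measurable
    from nn_integral_multc[OF this, of "w r"] J[of r]
    show "J * w r = (\<integral>\<^sup>+x. h (a (s x + r) x) * w r \<partial>lborel)" by simp
  qed
  also have "\<dots> = (\<integral>\<^sup>+x. (\<integral>\<^sup>+r. h (a (s x + r) x) * w r \<partial>lborel) \<partial>lborel)"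
    by (rule lborel_pair.Fubini'[OF m1])
  also have "\<dots> = (\<integral>\<^sup>+x. (\<integral>\<^sup>+r. h (a r x) * w (r - s x) \<partial>lborel) \<partial>lborel)"
  proof (rule nn_integral_cong)
    fix x
    have "(\<lambda>r. h (a r x) * w (r - s x)) \<in> borel_measurable borel"
      unfolding a_eq by measurable
    from lebesgue_preservingD(2)[OF lebesgue_preserving_translation[of "s x"] this]
    show "(\<integral>\<^sup>+r. h (a (s x + r) x) * w r \<partial>lborel) = (\<integral>\<^sup>+r. h (a r x) * w (r - s x) \<partial>lborel)"
      by (simp add: add.commute)
  qed
  also have "\<dots> = (\<integral>\<^sup>+r. (\<integral>\<^sup>+x. h (a r x) * w (r - s x) \<partial>lborel) \<partial>lborel)"
    by (rule lborel_pair.Fubini'[OF m2, symmetric])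
  also have "\<dots> = (\<integral>\<^sup>+r. (\<integral>\<^sup>+x. h x * w (r - s x) \<partial>lborel) \<partial>lborel)"
  proof (rule nn_integral_cong)
    fix r
    have "(\<integral>\<^sup>+x. h (a r x) * w (r - s (a r x)) \<partial>lborel) = (\<integral>\<^sup>+x. h x * w (r - s x) \<partial>lborel)"
      by (rule lebesgue_preservingD(2)[OF pres, where h = "\<lambda>x. h x * w (r - s x)"]) measurable
    then show "(\<integral>\<^sup>+x. h (a r x) * w (r - s x) \<partial>lborel) = (\<integral>\<^sup>+x. h x * w (r - s x) \<partial>lborel)"
      by (simp add: inv)
  qed
  also have "\<dots> = (\<integral>\<^sup>+x. (\<integral>\<^sup>+r. h x * w (r - s x) \<partial>lborel) \<partial>lborel)"
    by (rule lborel_pair.Fubini'[OF m3])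
  also have "\<dots> = (\<integral>\<^sup>+x. h x \<partial>lborel)"
  proof (rule nn_integral_cong)
    fix x
    have "(\<integral>\<^sup>+r. w (r - s x) \<partial>lborel) = 1"
      using lebesgue_preservingD(2)[OF lebesgue_preserving_translation[of "- s x"] w] w1 by simp
    then show "(\<integral>\<^sup>+r. h x * w (r - s x) \<partial>lborel) = h x"
      by (simp add: nn_integral_cmult)
  qed
  finally show "(\<integral>\<^sup>+x. h (a (s x) x) \<partial>lborel) = (\<integral>\<^sup>+x. h x \<partial>lborel)"
    by (simp add: J_def)
qed

text \<open>Boxes generate the Borel sets and are stable under intersection.\<close>

lemma borel_eq_if_boxes_eq:
  fixes h k :: "'x::euclidean_space \<Rightarrow> ennreal"
  assumes [measurable]: "h \<in> borel_measurable borel" "k \<in> borel_measurable borel"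
    and bd: "\<And>x. h x \<le> 1"
    and eq: "\<And>l u. (\<integral>\<^sup>+x. indicator (box l u) x * h x \<partial>lborel) = (\<integral>\<^sup>+x. indicator (box l u) x * k x \<partial>lborel)"
  shows "AE x in lborel. h x = k x"
proof -
  have "density lborel h = density lborel k"
  proof (rule measure_eqI_generator_eq)
    let ?E = "range (\<lambda>(a, b). box a b::'x set)"
    show "Int_stable ?E"
      by (auto simp: Int_stable_def box_Int_box)
    show "?E \<subseteq> Pow UNIV" "sets (density lborel h) = sigma_sets UNIV ?E"
      "sets (density lborel k) = sigma_sets UNIV ?E"
      by (simp_all add: borel_eq_box)
    let ?A = "\<lambda>n::nat. box (- (real n *\<^sub>R One)) (real n *\<^sub>R One) :: 'x set"
    show "range ?A \<subseteq> ?E" "(\<Union>i. ?A i) = UNIV"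
      unfolding UN_box_eq_UNIV by auto
    show "emeasure (density lborel h) (?A i) \<noteq> \<infinity>" for i
    proof -
      have "emeasure (density lborel h) (?A i) \<le> (\<integral>\<^sup>+x. indicator (?A i) x \<partial>lborel)"
        by (subst emeasure_density)
           (auto intro!: nn_integral_mono simp: bd simp del: nn_integral_indicator split: split_indicator)
      also have "\<dots> < \<infinity>"
        using emeasure_lborel_box_finite[of "- (real i *\<^sub>R One)" "real i *\<^sub>R One :: 'x"] by simp
      finally show ?thesis by simp
    qed
    show "emeasure (density lborel h) X = emeasure (density lborel k) X" if "X \<in> ?E" for X
      using that eq by (auto simp: emeasure_density mult.commute)
  qed
  then show ?thesis
    using sigma_finite_measure.density_unique[OF sigma_finite_lborel, of h k] by simp
qed

text \<open>The inverse is carried along because passing to a limit of symmetries needs control of both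
  directions. The function stays general so that a symmetry may hold only almost everywhere.\<close>

definition symmetry_pair ::
  "('x::euclidean_space \<Rightarrow> ennreal) \<Rightarrow> ('x \<Rightarrow> 'x) \<Rightarrow> ('x \<Rightarrow> 'x) \<Rightarrow> bool" where
  "symmetry_pair h \<gamma> \<delta> \<longleftrightarrow> lebesgue_preserving \<gamma> \<and> lebesgue_preserving \<delta> \<and>
     (\<forall>x. \<gamma> (\<delta> x) = x) \<and> (\<forall>x. \<delta> (\<gamma> x) = x) \<and> (AE x in lborel. h (\<gamma> x) = h x)"

lemma symmetry_pair_inverse: "symmetry_pair h \<gamma> \<delta> \<Longrightarrow> symmetry_pair h \<delta> \<gamma>"
  unfolding symmetry_pair_def using lebesgue_preserving_AE[of \<delta> "\<lambda>x. h (\<gamma> x) = h x"]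
  by (auto elim!: eventually_mono)

lemma symmetry_pair_compose:
  assumes "symmetry_pair h \<gamma> \<delta>" "symmetry_pair h \<gamma>' \<delta>'"
  shows "symmetry_pair h (\<lambda>x. \<gamma> (\<gamma>' x)) (\<lambda>x. \<delta>' (\<delta> x))"
proof -
  have "AE x in lborel. h (\<gamma> (\<gamma>' x)) = h (\<gamma>' x)"
    using assms lebesgue_preserving_AE[of \<gamma>' "\<lambda>x. h (\<gamma> x) = h x"]
    unfolding symmetry_pair_def by auto
  moreover have "AE x in lborel. h (\<gamma>' x) = h x"
    using assms unfolding symmetry_pair_def by auto
  ultimately have "AE x in lborel. h (\<gamma> (\<gamma>' x)) = h x" by eventually_elim simp
  then show ?thesis
    using assms lebesgue_preserving_compose unfolding symmetry_pair_def by auto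
qed

text \<open>The symmetries of a bounded function form a closed group. Tested against the indicator of a box,
  invariance is an identity of integrals, and this identity passes to the limit by dominated
  convergence, since the domain of integration stays in a bounded set.\<close>

lemma symmetry_pair_limit:
  fixes h :: "'x::euclidean_space \<Rightarrow> ennreal"
  assumes [measurable]: "h \<in> borel_measurable borel" and bd: "\<And>x. h x \<le> 1"
    and sym: "\<And>n. symmetry_pair h (\<gamma> n) (\<delta> n)"
    and lim: "\<And>x. (\<lambda>n. \<delta> n x) \<longlonglongrightarrow> \<delta>' x"
    and bounded: "\<And>C. bounded C \<Longrightarrow> \<exists>K. bounded K \<and> (\<forall>n. \<gamma> n ` C \<subseteq> K)"
    and pres: "lebesgue_preserving \<gamma>'" "lebesgue_preserving \<delta>'"
    and inv: "\<And>x. \<gamma>' (\<delta>' x) = x" "\<And>x. \<delta>' (\<gamma>' x) = x"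
  shows "symmetry_pair h \<gamma>' \<delta>'"
proof -
  have [measurable]: "\<gamma>' \<in> borel_measurable borel" "\<delta>' \<in> borel_measurable borel"
    "\<gamma> n \<in> borel_measurable borel" "\<delta> n \<in> borel_measurable borel" for n
    using pres sym[of n] unfolding symmetry_pair_def by (auto dest: lebesgue_preservingD)
  have "AE x in lborel. h x = h (\<gamma>' x)"
  proof (rule borel_eq_if_boxes_eq)
    fix l u :: 'x
    let ?Q = "box l u"
    have 1: "(\<integral>\<^sup>+x. indicator ?Q (\<delta> n x) * h x \<partial>lborel) = (\<integral>\<^sup>+x. indicator ?Q x * h x \<partial>lborel)" for n
    proof -
      have s: "lebesgue_preserving (\<gamma> n)" "\<And>x. \<delta> n (\<gamma> n x) = x" "AE x in lborel. h (\<gamma> n x) = h x"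
        using sym[of n] unfolding symmetry_pair_def by auto
      have "(\<integral>\<^sup>+x. indicator ?Q (\<delta> n x) * h x \<partial>lborel)
          = (\<integral>\<^sup>+x. indicator ?Q (\<delta> n (\<gamma> n x)) * h (\<gamma> n x) \<partial>lborel)"
        by (rule lebesgue_preservingD(2)[OF s(1), symmetric]) measurable
      also have "\<dots> = (\<integral>\<^sup>+x. indicator ?Q x * h x \<partial>lborel)"
        by (rule nn_integral_cong_AE) (use s in \<open>auto elim!: eventually_mono\<close>)
      finally show ?thesis .
    qed
    have 2: "(\<integral>\<^sup>+x. indicator ?Q (\<delta>' x) * h x \<partial>lborel) = (\<integral>\<^sup>+x. indicator ?Q x * h (\<gamma>' x) \<partial>lborel)"
    proof -
      have "(\<integral>\<^sup>+x. indicator ?Q (\<delta>' x) * h x \<partial>lborel)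
          = (\<integral>\<^sup>+x. indicator ?Q (\<delta>' (\<gamma>' x)) * h (\<gamma>' x) \<partial>lborel)"
        by (rule lebesgue_preservingD(2)[OF pres(1), symmetric]) measurable
      then show ?thesis by (simp add: inv)
    qed
    obtain K where K: "bounded K" "\<And>n. \<gamma> n ` ?Q \<subseteq> K"
      using bounded[OF bounded_box] by blast
    obtain r where r: "K \<subseteq> cball 0 r"
      using bounded_subset_ballD[OF K(1), of 0] ball_subset_cball by blast
    have [measurable]: "cball (0::'x) r \<in> sets borel" by simp
    have fr: "AE x in lborel. \<delta>' x \<notin> frontier ?Q"
    proof -
      have "frontier ?Q \<in> null_sets lborel"
      proof -
        have "negligible (frontier ?Q)" by (rule negligible_convex_frontier) simp
        then have "frontier ?Q \<in> null_sets lebesgue" by (simp add: negligible_iff_null_sets)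
        then show ?thesis
          by (auto simp: null_sets_def emeasure_completion)
      qed
      then have "AE x in lborel. x \<notin> frontier ?Q" by (rule AE_not_in)
      from lebesgue_preserving_AE[OF pres(2) this] show ?thesis .
    qed
    have "(\<lambda>n. \<integral>\<^sup>+x. indicator ?Q (\<delta> n x) * h x \<partial>lborel)
        \<longlonglongrightarrow> (\<integral>\<^sup>+x. indicator ?Q (\<delta>' x) * h x \<partial>lborel)"
    proof (rule nn_integral_dominated_convergence[where w = "indicator (cball 0 r)"])
      fix n
      show "AE x in lborel. indicator ?Q (\<delta> n x) * h x \<le> indicator (cball 0 r) x"
      proof (rule AE_I2)
        fix x
        have "x \<in> cball 0 r" if "\<delta> n x \<in> ?Q"
        proof -
          have "\<gamma> n (\<delta> n x) = x" using sym[of n] unfolding symmetry_pair_def by auto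
          then show ?thesis using that K(2)[of n] r by (metis image_eqI subsetD)
        qed
        then show "indicator ?Q (\<delta> n x) * h x \<le> indicator (cball 0 r) x"
          using bd[of x] by (auto split: split_indicator)
      qed
    next
      show "(\<integral>\<^sup>+x. indicator (cball (0::'x) r) x \<partial>lborel) < \<infinity>"
        using emeasure_lborel_cball_finite[of "0::'x" r] by (simp add: top.not_eq_extremum)
      show "AE x in lborel. (\<lambda>n. indicator ?Q (\<delta> n x) * h x) \<longlonglongrightarrow> indicator ?Q (\<delta>' x) * h x"
        using fr
      proof eventually_elim
        fix x assume x: "\<delta>' x \<notin> frontier ?Q"
        have "\<forall>\<^sub>F n in sequentially. (indicator ?Q (\<delta> n x) :: ennreal) = indicator ?Q (\<delta>' x)"
        proof (cases "\<delta>' x \<in> ?Q")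
          case True
          then have "\<forall>\<^sub>F n in sequentially. \<delta> n x \<in> ?Q"
            using lim[of x] open_box by (metis topological_tendstoD)
          then show ?thesis by eventually_elim (use True in simp)
        next
          case False
          then have "\<delta>' x \<in> - closure ?Q"
            using x open_box[of l u] by (auto simp: frontier_def interior_open)
          then have "\<forall>\<^sub>F n in sequentially. \<delta> n x \<in> - closure ?Q"
            using lim[of x] by (metis open_Compl closed_closure topological_tendstoD)
          then show ?thesis
          proof eventually_elim
            case (elim n)
            then have "\<delta> n x \<notin> ?Q" using closure_subset[of ?Q] by blast
            then show ?case using False by simp
          qed
        qed
        then have "\<forall>\<^sub>F n in sequentially. indicator ?Q (\<delta>' x) * h x = indicator ?Q (\<delta> n x) * h x"
          by eventually_elim simp
        then show "(\<lambda>n. indicator ?Q (\<delta> n x) * h x) \<longlonglongrightarrow> indicator ?Q (\<delta>' x) * h x"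
          by (rule Lim_transform_eventually[OF tendsto_const])
      qed
    qed measurable
    then have "(\<integral>\<^sup>+x. indicator ?Q x * h x \<partial>lborel) = (\<integral>\<^sup>+x. indicator ?Q (\<delta>' x) * h x \<partial>lborel)"
      unfolding 1 by (rule LIMSEQ_unique[OF tendsto_const])
    then show "(\<integral>\<^sup>+x. indicator ?Q x * h x \<partial>lborel) = (\<integral>\<^sup>+x. indicator ?Q x * h (\<gamma>' x) \<partial>lborel)"
      unfolding 2 .
  qed (use bd in auto)
  then have "AE x in lborel. h (\<gamma>' x) = h x" by (auto elim!: eventually_mono)
  then show ?thesis using pres inv unfolding symmetry_pair_def by auto
qed

section \<open>Discreteness fails: two parabolic matrices with a small product\<close>

text \<open>The action of a two by two complex matrix, given by its rows.\<close>

definition lin2 :: "complex \<Rightarrow> complex \<Rightarrow> complex \<Rightarrow> complex \<Rightarrow> complex \<times> complex \<Rightarrow> complex \<times> complex" where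
  "lin2 a b c d z = (a * fst z + b * snd z, c * fst z + d * snd z)"

text \<open>The second map is the inverse matrix when the determinant is one.\<close>

definition matrix_symmetry :: "(complex \<times> complex \<Rightarrow> ennreal) \<Rightarrow> complex \<Rightarrow> complex \<Rightarrow> complex \<Rightarrow> complex \<Rightarrow> bool" where
  "matrix_symmetry h a b c d \<longleftrightarrow> symmetry_pair h (lin2 a b c d) (lin2 d (- b) (- c) a)"

lemma matrix_symmetry_compose:
  assumes "matrix_symmetry h a b c d" "matrix_symmetry h a' b' c' d'"
  shows "matrix_symmetry h (a * a' + b * c') (a * b' + b * d') (c * a' + d * c') (c * b' + d * d')"
proof -
  have "(\<lambda>x. lin2 a b c d (lin2 a' b' c' d' x)) = lin2 (a * a' + b * c') (a * b' + b * d') (c * a' + d * c') (c * b' + d * d')"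
    "(\<lambda>x. lin2 d' (- b') (- c') a' (lin2 d (- b) (- c) a x))
      = lin2 (c * b' + d * d') (- (a * b' + b * d')) (- (c * a' + d * c')) (a * a' + b * c')"
    by (auto simp: lin2_def fun_eq_iff algebra_simps)
  then show ?thesis
    using symmetry_pair_compose[OF assms[unfolded matrix_symmetry_def]]
    unfolding matrix_symmetry_def by simp
qed

lemma matrix_symmetry_inverse:
  "matrix_symmetry h a b c d \<Longrightarrow> matrix_symmetry h d (- b) (- c) a"
  unfolding matrix_symmetry_def using symmetry_pair_inverse by fastforce

lemma matrix_symmetry_id: "matrix_symmetry h 1 0 0 1"
proof -
  have "lin2 1 0 0 1 = (\<lambda>x. x + 0)" by (auto simp: lin2_def)
  then show ?thesis
    using lebesgue_preserving_translation[of "0 :: complex \<times> complex"]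
    by (simp add: matrix_symmetry_def symmetry_pair_def)
qed

lemma lebesgue_preserving_shears:
  "lebesgue_preserving (lin2 1 s 0 1)" "lebesgue_preserving (lin2 1 0 s 1)"
proof -
  have "lebesgue_preserving (\<lambda>x :: complex \<times> complex. (\<lambda>r z. z + (r, 0)) (s * snd x) x)"
    by (rule lebesgue_preserving_along_action)
       (auto intro!: lebesgue_preserving_translation borel_measurable_continuous_onI continuous_intros
         simp: add.commute add.left_commute)
  moreover have "(\<lambda>x. (\<lambda>r z. z + (r, 0)) (s * snd x) x) = lin2 1 s 0 1"
    by (auto simp: lin2_def)
  ultimately show "lebesgue_preserving (lin2 1 s 0 1)" by simp
  have "lebesgue_preserving (\<lambda>x :: complex \<times> complex. (\<lambda>r z. z + (0, r)) (s * fst x) x)"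
    by (rule lebesgue_preserving_along_action)
       (auto intro!: lebesgue_preserving_translation borel_measurable_continuous_onI continuous_intros
         simp: add.commute add.left_commute)
  moreover have "(\<lambda>x. (\<lambda>r z. z + (0, r)) (s * fst x) x) = lin2 1 0 s 1"
    by (auto simp: lin2_def)
  ultimately show "lebesgue_preserving (lin2 1 0 s 1)" by simp
qed

lemma matrix_symmetry_shearI:
  "AE z in lborel. h (lin2 1 s 0 1 z) = h z \<Longrightarrow> matrix_symmetry h 1 s 0 1"
  "AE z in lborel. h (lin2 1 0 s 1 z) = h z \<Longrightarrow> matrix_symmetry h 1 0 s 1"
  unfolding matrix_symmetry_def symmetry_pair_def
  using lebesgue_preserving_shears by (auto simp: lin2_def)

lemma matrix_symmetry_limit:
  assumes h: "h \<in> borel_measurable borel" "\<And>x. h x \<le> 1"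
    and sym: "\<And>n. matrix_symmetry h (a n) (b n) (c n) (d n)"
    and lim: "a \<longlonglongrightarrow> 1" "b \<longlonglongrightarrow> s" "c \<longlonglongrightarrow> 0" "d \<longlonglongrightarrow> 1"
  shows "matrix_symmetry h 1 s 0 1"
  unfolding matrix_symmetry_def
proof (rule symmetry_pair_limit[OF h])
  show "symmetry_pair h (lin2 (a n) (b n) (c n) (d n)) (lin2 (d n) (- b n) (- c n) (a n))" for n
    using sym unfolding matrix_symmetry_def by auto
  show "(\<lambda>n. lin2 (d n) (- b n) (- c n) (a n) x) \<longlonglongrightarrow> lin2 1 (- s) (- 0) 1 x" for x
    unfolding lin2_def by (intro tendsto_intros lim)
  show "lebesgue_preserving (lin2 1 s 0 1)" "lebesgue_preserving (lin2 1 (- s) (- 0) 1)"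
    using lebesgue_preserving_shears by auto
  show "lin2 1 s 0 1 (lin2 1 (- s) (- 0) 1 x) = x" "lin2 1 (- s) (- 0) 1 (lin2 1 s 0 1 x) = x" for x
    by (auto simp: lin2_def)
  fix C :: "(complex \<times> complex) set" assume "bounded C"
  then obtain R where R: "\<And>z. z \<in> C \<Longrightarrow> norm z \<le> R" "R \<ge> 0"
    by (metis bounded_pos order_less_imp_le)
  have "\<exists>M. \<forall>n. norm (f n) \<le> M" if "f \<longlonglongrightarrow> l" for f :: "nat \<Rightarrow> complex" and l
    using convergent_imp_Bseq[of f] that unfolding convergent_def Bseq_def by blast
  then obtain Ma Mb Mc Md where M: "\<And>n. norm (a n) \<le> Ma" "\<And>n. norm (b n) \<le> Mb"
    "\<And>n. norm (c n) \<le> Mc" "\<And>n. norm (d n) \<le> Md"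
    using lim by metis
  have M0: "0 \<le> Ma" "0 \<le> Mb" "0 \<le> Mc" "0 \<le> Md"
    using M norm_ge_zero order_trans by blast+
  have "norm (lin2 (a n) (b n) (c n) (d n) z) \<le> (Ma * R + Mb * R) + (Mc * R + Md * R)" if "z \<in> C" for n z
  proof -
    have z: "norm (fst z) \<le> R" "norm (snd z) \<le> R"
      using R(1)[OF that] norm_fst_le[of "fst z" "snd z"] norm_snd_le[of "snd z" "fst z"] by auto
    have "norm (lin2 (a n) (b n) (c n) (d n) z) \<le> norm (a n * fst z + b n * snd z) + norm (c n * fst z + d n * snd z)"
      unfolding lin2_def by (rule norm_Pair_le)
    also have "\<dots> \<le> (norm (a n) * norm (fst z) + norm (b n) * norm (snd z)) + (norm (c n) * norm (fst z) + norm (d n) * norm (snd z))"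
      by (intro add_mono; metis norm_mult norm_triangle_ineq)
    also have "\<dots> \<le> (Ma * R + Mb * R) + (Mc * R + Md * R)"
      by (intro add_mono mult_mono M M0 z) auto
    finally show ?thesis .
  qed
  then show "\<exists>K. bounded K \<and> (\<forall>n. lin2 (a n) (b n) (c n) (d n) ` C \<subseteq> K)"
    by (intro exI[of _ "cball 0 ((Ma * R + Mb * R) + (Mc * R + Md * R))"]) auto
qed

text \<open>The direction of the lower left entries is squared at each step. Angle doubling pushes a small
  nonzero angle away from zero, so directions bounded away from the real line occur infinitely
  often.\<close>

lemma angle_doubling_leaves_reals:
  fixes x y :: "nat \<Rightarrow> real"
  assumes circle: "\<And>k. (x k)\<^sup>2 + (y k)\<^sup>2 = 1"
    and step: "\<And>k. x (Suc k) = (y k)\<^sup>2 - (x k)\<^sup>2"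
    and y0: "\<And>k. y k \<noteq> 0"
  shows "\<exists>k\<ge>N. \<bar>y k\<bar> \<ge> 1/4"
proof (rule ccontr)
  assume "\<not> ?thesis"
  then have small: "\<bar>y k\<bar> < 1/4" if "k \<ge> N" for k using that by force
  have ysq: "(y k)\<^sup>2 < 1/16" if "k \<ge> N" for k
    using power_strict_mono[of "\<bar>y k\<bar>" "1/4" 2] small[OF that] by (simp add: power2_eq_square)
  have neg: "x (Suc k) < 0" if "k \<ge> N" for k
    using step[of k] ysq[OF that] circle[of k] by linarith
  have pos: "1 + x k > 0" for k
  proof -
    have "(y k)\<^sup>2 > 0" using y0 by simp
    then have "(x k)\<^sup>2 < 1" using circle[of k] by linarith
    then show ?thesis by (simp add: abs_square_less_1)
  qed
  have dbl: "1 + x (Suc (Suc k)) \<ge> 2 * (1 + x (Suc k))" if "k \<ge> N" for k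
  proof -
    have "1 + x (Suc (Suc k)) = 2 * (1 - x (Suc k)) * (1 + x (Suc k))"
      using step[of "Suc k"] circle[of "Suc k"] by (simp add: algebra_simps power2_eq_square)
    also have "\<dots> \<ge> 2 * 1 * (1 + x (Suc k))"
      using neg[OF that] pos[of "Suc k"] by (intro mult_right_mono mult_left_mono) auto
    finally show ?thesis by simp
  qed
  have "1 + x (Suc (N + j)) \<ge> 2 ^ j * (1 + x (Suc N))" for j
  proof (induction j)
    case (Suc j)
    then show ?case using dbl[of "N + j"] by simp
  qed simp
  moreover obtain j where "2 ^ j > 1 / (1 + x (Suc N))"
    using real_arch_pow[of 2 "1 / (1 + x (Suc N))"] by auto
  then have "2 ^ j * (1 + x (Suc N)) > 1" using pos[of "Suc N"] by (simp add: field_simps)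
  moreover have "1 + x (Suc (N + j)) < 1" using neg[of "N + j"] by simp
  ultimately show False by (meson less_le_trans not_le order.strict_trans)
qed

primrec shimizu_c :: "complex \<Rightarrow> nat \<Rightarrow> complex" where
  "shimizu_c c 0 = c"
| "shimizu_c c (Suc n) = - (shimizu_c c n)\<^sup>2"

primrec shimizu_a :: "complex \<Rightarrow> nat \<Rightarrow> complex" where
  "shimizu_a c 0 = 1"
| "shimizu_a c (Suc n) = 1 - shimizu_a c n * shimizu_c c n"

lemma norm_shimizu_c: "norm (shimizu_c c n) = norm c ^ (2 ^ n)"
  by (induction n) (auto simp: norm_power power_mult[symmetric] mult.commute)

lemma shimizu_c_tendsto:
  assumes "norm c < 1"
  shows "shimizu_c c \<longlonglongrightarrow> 0"
proof -
  have pow: "(\<lambda>n. norm c ^ n) \<longlonglongrightarrow> 0" using assms by (intro LIMSEQ_power_zero) auto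
  have "norm (shimizu_c c n) \<le> norm c ^ n" for n
    unfolding norm_shimizu_c using assms by (intro power_decreasing) (auto intro: less_imp_le less_exp)
  then have "(\<lambda>n. norm (shimizu_c c n)) \<longlonglongrightarrow> 0"
    by (intro tendsto_sandwich[OF _ _ tendsto_const pow] always_eventually allI) auto
  then show ?thesis by (rule tendsto_norm_zero_cancel)
qed

lemma shimizu_a_tendsto:
  assumes "norm c < 1"
  shows "shimizu_a c \<longlonglongrightarrow> 1"
proof -
  define M where "M = 1 / (1 - norm c)"
  have bd: "norm (shimizu_a c n) \<le> M" for n
  proof (induction n)
    case 0
    then show ?case using assms by (simp add: M_def)
  next
    case (Suc n)
    have "norm (shimizu_c c n) \<le> norm c"
      unfolding norm_shimizu_c using assms power_decreasing[of 1 "2 ^ n" "norm c"] by simp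
    then have "norm (shimizu_a c n) * norm (shimizu_c c n) \<le> M * norm c"
      using Suc by (intro mult_mono) (auto intro: order_trans[OF norm_ge_zero])
    then have "norm (shimizu_a c (Suc n)) \<le> 1 + M * norm c"
      using norm_triangle_ineq4[of 1 "shimizu_a c n * shimizu_c c n"] by (simp add: norm_mult)
    also have "\<dots> = M" using assms by (simp add: M_def field_simps)
    finally show ?case .
  qed
  have "(\<lambda>n. shimizu_a c n * shimizu_c c n) \<longlonglongrightarrow> 0"
  proof (rule Lim_null_comparison)
    show "\<forall>\<^sub>F n in sequentially. norm (shimizu_a c n * shimizu_c c n) \<le> M * norm (shimizu_c c n)"
      by (intro always_eventually allI) (auto simp: norm_mult intro!: mult_right_mono bd)
    show "(\<lambda>n. M * norm (shimizu_c c n)) \<longlonglongrightarrow> 0"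
      using tendsto_mult[OF tendsto_const[of M] tendsto_norm[OF shimizu_c_tendsto[OF assms]]] by simp
  qed
  from tendsto_diff[OF tendsto_const[of 1] this]
  have "(\<lambda>n. shimizu_a c (Suc n)) \<longlonglongrightarrow> 1" by simp
  then show ?thesis by (rule LIMSEQ_imp_Suc)
qed

text \<open>Conjugating the upper parabolic matrix by the current one squares the lower left entry, up to
  sign; this is the iteration in the lemma of Shimizu and Leutbecher. The entries stay inside the
  symmetry group of the function.\<close>

lemma shimizu_symmetry:
  assumes u: "matrix_symmetry h 1 1 0 1" and v: "matrix_symmetry h 1 0 c 1"
  shows "\<exists>b d. matrix_symmetry h (shimizu_a c n) b (shimizu_c c n) d \<and>
    shimizu_a c n * d - b * shimizu_c c n = 1"
proof (induction n)
  case 0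
  show ?case using v by (intro exI[of _ 0] exI[of _ 1]) auto
next
  case (Suc n)
  define a' c' where "a' = shimizu_a c n" and "c' = shimizu_c c n"
  obtain b d where s: "matrix_symmetry h a' b c' d" and det: "a' * d - b * c' = 1"
    using Suc by (auto simp: a'_def c'_def)
  have "matrix_symmetry h ((a' * 1 + b * 0) * d + (a' * 1 + b * 1) * - c')
     ((a' * 1 + b * 0) * - b + (a' * 1 + b * 1) * a')
     ((c' * 1 + d * 0) * d + (c' * 1 + d * 1) * - c')
     ((c' * 1 + d * 0) * - b + (c' * 1 + d * 1) * a')"
    by (rule matrix_symmetry_compose[OF matrix_symmetry_compose[OF s u] matrix_symmetry_inverse[OF s]])
  moreover have "(a' * 1 + b * 0) * d + (a' * 1 + b * 1) * - c' = 1 - a' * c'"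
    "(a' * 1 + b * 0) * - b + (a' * 1 + b * 1) * a' = a'\<^sup>2"
    "(c' * 1 + d * 0) * d + (c' * 1 + d * 1) * - c' = - c'\<^sup>2"
    "(c' * 1 + d * 0) * - b + (c' * 1 + d * 1) * a' = 1 + a' * c'"
    using det by (auto simp: algebra_simps power2_eq_square)
  ultimately have "matrix_symmetry h (1 - a' * c') (a'\<^sup>2) (- c'\<^sup>2) (1 + a' * c')"
    by simp
  then show ?case
    by (intro exI[of _ "a'\<^sup>2"] exI[of _ "1 + a' * c'"])
       (auto simp: a'_def c'_def algebra_simps power2_eq_square)
qed

lemma matrix_symmetry_translations_add:
  "matrix_symmetry h 1 s 0 1 \<Longrightarrow> matrix_symmetry h 1 s' 0 1 \<Longrightarrow> matrix_symmetry h 1 (s + s') 0 1"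
  using matrix_symmetry_compose[of h 1 s 0 1 1 s' 0 1] by (simp add: add.commute)

lemma matrix_symmetry_translations_minus:
  "matrix_symmetry h 1 s 0 1 \<Longrightarrow> matrix_symmetry h 1 (- s) 0 1"
  using matrix_symmetry_inverse[of h 1 s 0 1] by simp

lemma matrix_symmetry_int_translation:
  assumes "matrix_symmetry h 1 1 0 1"
  shows "matrix_symmetry h 1 (of_int m) 0 1"
proof -
  have nat: "matrix_symmetry h 1 (of_nat n) 0 1" for n
  proof (induction n)
    case 0 then show ?case using matrix_symmetry_id by simp
  next
    case (Suc n) then show ?case
      using matrix_symmetry_translations_add[OF assms Suc] by simp
  qed
  show ?thesis
  proof (cases m)
    case (nonneg n) then show ?thesis using nat by simp
  next
    case (neg n) then show ?thesis
      using matrix_symmetry_translations_minus[OF nat[of "Suc n"]] by simp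
  qed
qed

lemma shimizu_commutator_symmetry:
  assumes u: "matrix_symmetry h 1 1 0 1" and v: "matrix_symmetry h 1 0 c 1"
  fixes n and m :: int
  defines "a \<equiv> shimizu_a c n" and "e \<equiv> shimizu_c c n"
  shows "matrix_symmetry h (1 - of_int m * a * e) (of_int m * (a\<^sup>2 - 1) + (of_int m)\<^sup>2 * a * e)
     (- of_int m * e\<^sup>2) (1 + of_int m * a * e + (of_int m)\<^sup>2 * e\<^sup>2)"
proof -
  obtain b d where s: "matrix_symmetry h a b e d" and det: "a * d - b * e = 1"
    using shimizu_symmetry[OF u v, of n] by (auto simp: a_def e_def)
  define M :: complex where "M = of_int m"
  have U: "matrix_symmetry h 1 M 0 1" "matrix_symmetry h 1 (- M) 0 1"
    using matrix_symmetry_int_translation[OF u, of m]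
      matrix_symmetry_int_translation[OF u, of "- m"] by (auto simp: M_def)
  note matrix_symmetry_compose[OF matrix_symmetry_compose[OF matrix_symmetry_compose[OF s U(1)]
        matrix_symmetry_inverse[OF s]] U(2)]
  moreover have det': "d * a = 1 + b * e" using det by (simp add: algebra_simps)
  have "((a * 1 + b * 0) * d + (a * M + b * 1) * - e) = 1 - M * a * e"
    "((a * 1 + b * 0) * - b + (a * M + b * 1) * a) = M * a\<^sup>2"
    "((e * 1 + d * 0) * d + (e * M + d * 1) * - e) = - M * e\<^sup>2"
    "((e * 1 + d * 0) * - b + (e * M + d * 1) * a) = 1 + M * a * e"
    using det' by (auto simp: algebra_simps power2_eq_square)
  ultimately have "matrix_symmetry h ((1 - M * a * e) * 1 + M * a\<^sup>2 * 0) ((1 - M * a * e) * - M + M * a\<^sup>2 * 1)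
     (- M * e\<^sup>2 * 1 + (1 + M * a * e) * 0) (- M * e\<^sup>2 * - M + (1 + M * a * e) * 1)" by metis
  then show ?thesis unfolding M_def[symmetric]
    by (simp add: algebra_simps power2_eq_square)
qed

text \<open>By compactness of the circle a subsequence of the directions of the lower left entries
  converges, and angle doubling lets one choose the subsequence so that the limit is not real.\<close>

lemma shimizu_direction:
  assumes c: "norm c < 1" and nonreal: "\<And>n. c ^ (2 ^ n) \<notin> \<real>"
  shows "\<exists>r \<omega>. strict_mono (r :: nat \<Rightarrow> nat) \<and> \<omega> \<notin> \<real> \<and> norm \<omega> = 1 \<and>
     (\<lambda>k. shimizu_c c (r k) / norm (shimizu_c c (r k))) \<longlonglongrightarrow> \<omega>"
proof -
  define \<omega> where "\<omega> k = shimizu_c c k / norm (shimizu_c c k)" for k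
  have c0: "c \<noteq> 0" using nonreal[of 0] by auto
  have nz: "shimizu_c c k \<noteq> 0" for k
    using norm_shimizu_c[of c k] c0 by auto
  have nonreal': "shimizu_c c k \<notin> \<real>" for k
  proof -
    have "shimizu_c c k = c ^ (2 ^ k) \<or> shimizu_c c k = - (c ^ (2 ^ k))"
    proof (induction k)
      case (Suc k)
      have "c ^ (2 ^ Suc k) = (c ^ (2 ^ k))\<^sup>2" by (subst power_Suc2, subst power_mult) (rule refl)
      then show ?case using Suc by auto
    qed simp
    then show ?thesis using nonreal[of k] by (metis Reals_minus minus_minus)
  qed
  have norm1: "norm (\<omega> k) = 1" for k using nz by (simp add: \<omega>_def norm_divide)
  have step: "\<omega> (Suc k) = - (\<omega> k)\<^sup>2" for k
    by (simp add: \<omega>_def norm_power power_divide)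
  have Im0: "Im (\<omega> k) \<noteq> 0" for k
  proof
    assume "Im (\<omega> k) = 0"
    then have "\<omega> k \<in> \<real>" by (simp add: complex_is_Real_iff)
    then have "\<omega> k * of_real (norm (shimizu_c c k)) \<in> \<real>" by (intro Reals_mult) auto
    then show False using nonreal'[of k] nz[of k] by (simp add: \<omega>_def)
  qed
  have inf: "\<exists>k\<ge>N. \<bar>Im (\<omega> k)\<bar> \<ge> 1/4" for N
  proof (rule angle_doubling_leaves_reals[of "\<lambda>k. Re (\<omega> k)"])
    show "(Re (\<omega> k))\<^sup>2 + (Im (\<omega> k))\<^sup>2 = 1" for k
      using norm1[of k] by (simp add: cmod_def)
    show "Re (\<omega> (Suc k)) = (Im (\<omega> k))\<^sup>2 - (Re (\<omega> k))\<^sup>2" for k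
      by (simp add: step power2_eq_square)
  qed (use Im0 in auto)
  have "infinite {k. \<bar>Im (\<omega> k)\<bar> \<ge> 1/4}"
    unfolding infinite_nat_iff_unbounded_le using inf by auto
  from infinite_enumerate[OF this] obtain q :: "nat \<Rightarrow> nat"
    where q: "strict_mono q" "\<And>k. \<bar>Im (\<omega> (q k))\<bar> \<ge> 1/4" by auto
  have "compact (sphere (0::complex) 1)" by simp
  then obtain l p where lp: "l \<in> sphere 0 1" "strict_mono p" "((\<omega> \<circ> q) \<circ> p) \<longlonglongrightarrow> l"
    using norm1 unfolding compact_def by (metis (no_types, lifting) comp_apply mem_sphere_0)
  have "(\<lambda>k. \<bar>Im (\<omega> (q (p k)))\<bar>) \<longlonglongrightarrow> \<bar>Im l\<bar>"
    using lp(3) by (auto intro!: tendsto_intros simp: o_def)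
  then have "\<bar>Im l\<bar> \<ge> 1/4"
    by (rule LIMSEQ_le_const) (use q in auto)
  then have "l \<notin> \<real>" by (auto simp: complex_is_Real_iff)
  moreover have "strict_mono (q \<circ> p)" using q(1) lp(2) by (rule strict_mono_o)
  ultimately show ?thesis using lp
    by (intro exI[of _ "q \<circ> p"] exI[of _ l]) (auto simp: \<omega>_def o_def)
qed

text \<open>Two opposite parabolic matrices whose product of off-diagonal entries is smaller than one in
  modulus, with no iterated square of it real, generate a group that is not discrete. Combining
  the Shimizu iterates with integer translations of suitable size gives in the limit parabolic
  matrices whose upper right entries run through a curve not contained in a real line, and these
  entries generate all complex numbers. As the symmetry group of a function is closed, all upper
  parabolic matrices are symmetries.\<close>

lemma parabolic_translation_symmetry:
  assumes h: "h \<in> borel_measurable borel" "\<And>x. h x \<le> 1"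
    and u: "matrix_symmetry h 1 1 0 1" and v: "matrix_symmetry h 1 0 c 1"
    and c: "norm c < 1" and nonreal: "\<And>n. c ^ (2 ^ n) \<notin> \<real>"
  shows "matrix_symmetry h 1 s 0 1"
proof -
  obtain r \<omega> where r: "strict_mono r" and \<omega>: "\<omega> \<notin> \<real>" "norm \<omega> = 1"
    and lim: "(\<lambda>k. shimizu_c c (r k) / norm (shimizu_c c (r k))) \<longlonglongrightarrow> \<omega>"
    using shimizu_direction[OF c nonreal] by blast
  define \<epsilon> \<alpha> where "\<epsilon> k = shimizu_c c (r k)" and "\<alpha> k = shimizu_a c (r k)" for k
  have \<epsilon>: "\<epsilon> \<longlonglongrightarrow> 0" and \<alpha>: "\<alpha> \<longlonglongrightarrow> 1"
    using LIMSEQ_subseq_LIMSEQ[OF shimizu_c_tendsto[OF c] r] LIMSEQ_subseq_LIMSEQ[OF shimizu_a_tendsto[OF c] r]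
    by (auto simp: \<epsilon>_def[abs_def] \<alpha>_def[abs_def] o_def)
  have c0: "c \<noteq> 0" using nonreal[of 0] by auto
  have nz: "\<epsilon> k \<noteq> 0" for k
    using norm_shimizu_c[of c "r k"] c0 by (auto simp: \<epsilon>_def)
  have curve: "matrix_symmetry h 1 (- (2 * of_real t * \<omega> + (of_real t * \<omega>)\<^sup>2)) 0 1" for t :: real
  proof -
    define m where "m k = \<lfloor>t / norm (\<epsilon> k)\<rfloor>" for k
    have "(\<lambda>k. of_int (m k) * norm (\<epsilon> k)) \<longlonglongrightarrow> t"
    proof (rule tendsto_sandwich)
      show "\<forall>\<^sub>F k in sequentially. t - norm (\<epsilon> k) \<le> of_int (m k) * norm (\<epsilon> k)"
      proof (intro always_eventually allI)
        fix k
        have "t / norm (\<epsilon> k) - 1 \<le> of_int (m k)" unfolding m_def by linarith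
        then show "t - norm (\<epsilon> k) \<le> of_int (m k) * norm (\<epsilon> k)"
          using nz[of k] by (simp add: field_simps)
      qed
      show "\<forall>\<^sub>F k in sequentially. of_int (m k) * norm (\<epsilon> k) \<le> t"
      proof (intro always_eventually allI)
        fix k
        have "of_int (m k) \<le> t / norm (\<epsilon> k)" unfolding m_def by linarith
        then show "of_int (m k) * norm (\<epsilon> k) \<le> t"
          using nz[of k] by (simp add: field_simps)
      qed
      show "(\<lambda>k. t - norm (\<epsilon> k)) \<longlonglongrightarrow> t"
        using tendsto_diff[OF tendsto_const tendsto_norm[OF \<epsilon>], of t] by simp
    qed auto
    from tendsto_mult[OF tendsto_of_real[OF this, where 'a = complex] lim]
    have m\<epsilon>: "(\<lambda>k. of_int (m k) * \<epsilon> k) \<longlonglongrightarrow> of_real t * \<omega>"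
      using nz by (simp add: \<epsilon>_def)
    define \<mu> where "\<mu> k = of_int (m k) * \<epsilon> k" for k
    have \<mu>: "\<mu> \<longlonglongrightarrow> of_real t * \<omega>" using m\<epsilon> by (simp add: \<mu>_def[abs_def])
    define a where "a k = 1 - \<alpha> k * \<epsilon> k" for k
    have a: "a \<longlonglongrightarrow> 1"
      unfolding a_def[abs_def] using tendsto_diff[OF tendsto_const tendsto_mult[OF \<alpha> \<epsilon>], of 1] by simp
    have sym: "matrix_symmetry h (1 + \<mu> k * \<epsilon> k * a k) (\<mu> k * (- 2 * \<alpha> k + (\<alpha> k)\<^sup>2 * \<epsilon> k) - (\<mu> k)\<^sup>2 * a k)
       (- \<mu> k * \<epsilon> k ^ 3) (1 - \<mu> k * \<epsilon> k * a k + (\<mu> k)\<^sup>2 * (\<epsilon> k)\<^sup>2)" for k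
      using shimizu_commutator_symmetry[OF u v, of "m k" "Suc (r k)"]
      by (simp add: \<mu>_def a_def \<epsilon>_def[symmetric] \<alpha>_def[symmetric] algebra_simps power2_eq_square power3_eq_cube)
    show ?thesis
    proof (rule matrix_symmetry_limit[OF h sym])
      have "(\<lambda>k. 1 + \<mu> k * \<epsilon> k * a k) \<longlonglongrightarrow> 1 + (of_real t * \<omega>) * 0 * 1"
        by (intro tendsto_intros \<mu> \<epsilon> a)
      then show "(\<lambda>k. 1 + \<mu> k * \<epsilon> k * a k) \<longlonglongrightarrow> 1" by simp
      have "(\<lambda>k. \<mu> k * (- 2 * \<alpha> k + (\<alpha> k)\<^sup>2 * \<epsilon> k) - (\<mu> k)\<^sup>2 * a k) \<longlonglongrightarrow>
        (of_real t * \<omega>) * (- 2 * 1 + 1\<^sup>2 * 0) - (of_real t * \<omega>)\<^sup>2 * 1"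
        by (intro tendsto_intros \<mu> \<epsilon> a \<alpha>)
      then show "(\<lambda>k. \<mu> k * (- 2 * \<alpha> k + (\<alpha> k)\<^sup>2 * \<epsilon> k) - (\<mu> k)\<^sup>2 * a k) \<longlonglongrightarrow>
        - (2 * of_real t * \<omega> + (of_real t * \<omega>)\<^sup>2)" by (simp add: algebra_simps)
      have "(\<lambda>k. - \<mu> k * \<epsilon> k ^ 3) \<longlonglongrightarrow> - (of_real t * \<omega>) * 0 ^ 3"
        by (intro tendsto_intros \<mu> \<epsilon>)
      then show "(\<lambda>k. - \<mu> k * \<epsilon> k ^ 3) \<longlonglongrightarrow> 0" by simp
      have "(\<lambda>k. 1 - \<mu> k * \<epsilon> k * a k + (\<mu> k)\<^sup>2 * (\<epsilon> k)\<^sup>2) \<longlonglongrightarrow>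
         1 - (of_real t * \<omega>) * 0 * 1 + (of_real t * \<omega>)\<^sup>2 * 0\<^sup>2"
        by (intro tendsto_intros \<mu> \<epsilon> a)
      then show "(\<lambda>k. 1 - \<mu> k * \<epsilon> k * a k + (\<mu> k)\<^sup>2 * (\<epsilon> k)\<^sup>2) \<longlonglongrightarrow> 1" by simp
    qed
  qed
  have nonpos: "matrix_symmetry h 1 (- (of_real (2 * t\<^sup>2) * \<omega>\<^sup>2)) 0 1" for t :: real
    using matrix_symmetry_translations_add[OF curve[of t] curve[of "- t"]]
    by (simp add: algebra_simps power2_eq_square)
  have sq: "matrix_symmetry h 1 (of_real t * \<omega>\<^sup>2) 0 1" for t :: real
  proof (cases "t \<le> 0")
    case True
    then show ?thesis using nonpos[of "sqrt (- t / 2)"] by simp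
  next
    case False
    then show ?thesis
      using matrix_symmetry_translations_minus[OF nonpos[of "sqrt (t / 2)"]] by simp
  qed
  have lin: "matrix_symmetry h 1 (of_real t * \<omega>) 0 1" for t :: real
  proof -
    have "matrix_symmetry h 1 (- (2 * of_real (- t / 2) * \<omega> + (of_real (- t / 2) * \<omega>)\<^sup>2) + of_real (t\<^sup>2 / 4) * \<omega>\<^sup>2) 0 1"
      by (rule matrix_symmetry_translations_add[OF curve sq])
    moreover have "- (2 * of_real (- t / 2) * \<omega> + (of_real (- t / 2) * \<omega>)\<^sup>2) + of_real (t\<^sup>2 / 4) * \<omega>\<^sup>2 = of_real t * \<omega>"
      by (simp add: field_simps power2_eq_square)
    ultimately show ?thesis by simp
  qed
  obtain p q :: real where pq: "s = of_real p * \<omega> + of_real q * \<omega>\<^sup>2"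
  proof -
    define x y where "x = Re \<omega>" and "y = Im \<omega>"
    have y: "y \<noteq> 0" using \<omega>(1) by (auto simp: y_def complex_is_Real_iff)
    have xy: "x\<^sup>2 + y\<^sup>2 = 1" using \<omega>(2) by (simp add: cmod_def x_def y_def)
    define Q where "Q = (Im s * x - Re s * y) / y"
    define P where "P = (Im s - 2 * x * y * Q) / y"
    have Ims: "P * y + Q * (2 * x * y) = Im s" using y by (simp add: P_def field_simps)
    have Qy: "Q * y = Im s * x - Re s * y" using y by (simp add: Q_def)
    have "y * (P * x + Q * (x\<^sup>2 - y\<^sup>2)) = x * (P * y) + Q * y * (x\<^sup>2 - y\<^sup>2)" by (simp add: algebra_simps)
    also have "P * y = Im s - 2 * x * (Q * y)" using Ims by (simp add: algebra_simps)
    also have "x * (Im s - 2 * x * (Q * y)) + Q * y * (x\<^sup>2 - y\<^sup>2) = x * Im s - Q * y * (x\<^sup>2 + y\<^sup>2)"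
      by (simp add: algebra_simps power2_eq_square)
    also have "\<dots> = y * Re s" unfolding xy Qy by simp
    finally have Res: "P * x + Q * (x\<^sup>2 - y\<^sup>2) = Re s" using y by simp
    have "s = of_real P * \<omega> + of_real Q * \<omega>\<^sup>2"
      using Ims Res by (simp add: complex_eq_iff x_def y_def power2_eq_square algebra_simps)
    then show ?thesis using that by blast
  qed
  show ?thesis unfolding pq by (rule matrix_symmetry_translations_add[OF lin sq])
qed

section \<open>Families of transvections in two complex directions\<close>

lemma AE_lborel_const: "(AE x in (lborel :: 'a::euclidean_space measure). P) \<longleftrightarrow> P"
  by (cases P) (auto simp: eventually_False trivial_limit_def[symmetric] ae_filter_eq_bot_iff)

lemma borel_measurable_fst_snd [measurable]:
  "(fst :: 'a::euclidean_space \<times> 'b::euclidean_space \<Rightarrow> 'a) \<in> borel_measurable borel"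
  "(snd :: 'a::euclidean_space \<times> 'b::euclidean_space \<Rightarrow> 'b) \<in> borel_measurable borel"
  by (auto intro!: borel_measurable_continuous_onI continuous_intros)

lemma borel_measurable_Pair_euclidean:
  fixes f :: "'m \<Rightarrow> 'a::euclidean_space" and g :: "'m \<Rightarrow> 'b::euclidean_space"
  assumes "f \<in> borel_measurable M" "g \<in> borel_measurable M"
  shows "(\<lambda>x. (f x, g x)) \<in> borel_measurable M"
  using measurable_Pair[OF assms] by (simp add: borel_prod)

text \<open>An upper parabolic matrix with arbitrary entry moves the first coordinate by an arbitrary amount
  as soon as the second one is nonzero, and Fubini's theorem turns this into invariance under
  horizontal translations. The remaining translations come from the lower parabolic matrix.\<close>

lemma planar_translation_invariance:
  fixes h :: "complex \<times> complex \<Rightarrow> ennreal"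
  assumes h: "h \<in> borel_measurable borel" "\<And>x. h x \<le> 1"
    and u: "AE z in lborel. h (fst z + snd z, snd z) = h z"
    and v: "AE z in lborel. h (fst z, snd z + c * fst z) = h z"
    and c: "norm c < 1" "\<And>n. c ^ (2 ^ n) \<notin> \<real>"
  shows "AE z in lborel. h (z + d) = h z"
proof -
  note [measurable] = h(1) borel_measurable_Pair_euclidean
  have U: "matrix_symmetry h 1 1 0 1"
    by (rule matrix_symmetry_shearI) (use u in \<open>simp add: lin2_def\<close>)
  have V: "matrix_symmetry h 1 0 c 1"
    by (rule matrix_symmetry_shearI) (use v in \<open>simp add: lin2_def add.commute\<close>)
  have shear: "AE z in lborel. h (fst z + s * snd z, snd z) = h z" for s
    using parabolic_translation_symmetry[OF h U V c, of s]
    unfolding matrix_symmetry_def symmetry_pair_def by (simp add: lin2_def)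
  have ms: "{x \<in> space (lborel \<Otimes>\<^sub>M lborel). h (fst (snd x) + fst x * snd (snd x), snd (snd x)) = h (snd x)}
      \<in> sets (lborel \<Otimes>\<^sub>M (lborel :: (complex \<times> complex) measure))"
    by measurable
  have "AE s in (lborel :: complex measure). AE z in lborel. h (fst z + s * snd z, snd z) = h z"
    using shear by simp
  then have A: "AE z in lborel. AE s in lborel. h (fst z + s * snd z, snd z) = h z"
    using lborel_pair.AE_commute[OF ms] by simp
  have hor: "AE z in lborel. h (z + (d, 0)) = h z" for d :: complex
  proof -
    have B: "AE z in lborel. AE s in lborel. h (fst (z + (d, 0)) + s * snd (z + (d, 0)), snd (z + (d, 0))) = h (z + (d, 0))"
      by (rule lebesgue_preserving_AE[OF lebesgue_preserving_translation A])
    have nz: "AE z in (lborel :: (complex \<times> complex) measure). snd z \<noteq> 0"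
    proof -
      have "AE p in (lborel :: complex measure) \<Otimes>\<^sub>M lborel. snd p \<noteq> (0::complex)"
      proof (rule lborel_pair.AE_pair_measure)
        show "{p \<in> space (lborel \<Otimes>\<^sub>M lborel). snd p \<noteq> (0::complex)} \<in> sets ((lborel :: complex measure) \<Otimes>\<^sub>M lborel)"
          by measurable
      qed (auto simp: AE_lborel_singleton)
      then show ?thesis unfolding lborel_prod .
    qed
    show ?thesis using A B nz
    proof eventually_elim
      case (elim z)
      have "AE s in lborel. h (fst z + (s + d / snd z) * snd z, snd z) = h z"
        by (rule lebesgue_preserving_AE[OF lebesgue_preserving_translation elim(1)])
      with elim(2) have "AE s in (lborel :: complex measure). h (z + (d, 0)) = h z"
        by eventually_elim (use elim(3) in \<open>simp add: algebra_simps\<close>)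
      then show ?case unfolding AE_lborel_const .
    qed
  qed
  have sym_hor: "symmetry_pair h (\<lambda>z. z + (d, 0)) (\<lambda>z. z + (- d, 0))" for d
    using hor[of d] lebesgue_preserving_translation by (auto simp: symmetry_pair_def zero_prod_def)
  have c0: "c \<noteq> 0" using c(2)[of 0] by auto
  have ver: "AE z in lborel. h (z + (0, d)) = h z" for d :: complex
  proof -
    note V' = V[unfolded matrix_symmetry_def]
    note symmetry_pair_compose[OF sym_hor[of "- (d / c)"] symmetry_pair_compose[OF symmetry_pair_compose[OF V' sym_hor[of "d / c"]] symmetry_pair_inverse[OF V']]]
    moreover have "(lin2 1 0 c 1 (lin2 1 (- 0) (- c) 1 x + (d / c, 0)) + (- (d / c), 0)) = x + (0, d)" for x
      using c0 by (cases x) (simp add: lin2_def algebra_simps)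
    ultimately show ?thesis unfolding symmetry_pair_def by simp
  qed
  have "AE z in lborel. h (z + (fst d, 0) + (0, snd d)) = h (z + (fst d, 0))"
    by (rule lebesgue_preserving_AE[OF lebesgue_preserving_translation ver])
  moreover have "AE z in lborel. h (z + (fst d, 0)) = h z" by (rule hor)
  ultimately show ?thesis
    by eventually_elim (simp add: plus_prod_def)
qed

text \<open>Fibrewise version of the planar statement. The two shears move only the pair of coordinates
  given by the two linear functions, and act on this pair by an upper and a lower parabolic
  matrix, with product of off-diagonal entries depending on the fibre only. Disintegration along
  the fibres reduces the claim to the plane.\<close>

lemma transvection_pair_invariance:
  fixes h :: "'x::euclidean_space \<Rightarrow> ennreal"
    and E E' :: "'x \<Rightarrow> complex \<Rightarrow> 'x" and t t' c \<rho> :: "'x \<Rightarrow> complex"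
  assumes h: "h \<in> borel_measurable borel" "\<And>x. h x \<le> 1"
    and meas: "(\<lambda>p. E (fst p) (snd p)) \<in> borel_measurable borel"
      "(\<lambda>p. E' (fst p) (snd p)) \<in> borel_measurable borel"
      "t \<in> borel_measurable borel" "t' \<in> borel_measurable borel"
      "c \<in> borel_measurable borel" "\<rho> \<in> borel_measurable borel" "Measurable.pred borel R"
    and add: "\<And>z r q. E z (r + q) = E z r + E z q" "\<And>z r q. E' z (r + q) = E' z r + E' z q"
    and const: "\<And>z r. E (z + E z r) = E z" "\<And>z r. E (z + E' z r) = E z"
      "\<And>z r. E' (z + E z r) = E' z" "\<And>z r. E' (z + E' z r) = E' z"
      "\<And>z r. c (z + E z r) = c z" "\<And>z r. c (z + E' z r) = c z"
      "\<And>z r. \<rho> (z + E z r) = \<rho> z" "\<And>z r. \<rho> (z + E' z r) = \<rho> z"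
      "\<And>z r. R (z + E z r) = R z" "\<And>z r. R (z + E' z r) = R z"
    and t: "\<And>z r. R z \<Longrightarrow> t (z + E z r) = t z" "\<And>z r. R z \<Longrightarrow> t (z + E' z r) = t z + r"
    and t': "\<And>z r. R z \<Longrightarrow> t' (z + E z r) = t' z + c z * r" "\<And>z r. R z \<Longrightarrow> t' (z + E' z r) = t' z"
    and pres: "\<And>r. lebesgue_preserving (\<lambda>z. z + E z r)" "\<And>r. lebesgue_preserving (\<lambda>z. z + E' z r)"
    and T: "AE z in lborel. h (z + E z (t z)) = h z"
    and T': "AE z in lborel. h (z + E' z (t' z)) = h z"
    and good: "AE z in lborel. R z \<longrightarrow> norm (c z) < 1 \<and> (\<forall>n. c z ^ (2 ^ n) \<notin> \<real>)"
  shows "(AE z in lborel. R z \<longrightarrow> h (z + E z (\<rho> z)) = h z) \<and>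
    (AE z in lborel. R z \<longrightarrow> h (z + E' z (\<rho> z)) = h z)"
proof -
  define e e' where "e p = E (fst p) (snd p)" and "e' p = E' (fst p) (snd p)" for p
  have e: "E z r = e (z, r)" "E' z r = e' (z, r)" for z r by (simp_all add: e_def e'_def)
  have [measurable]: "e \<in> borel_measurable (borel \<Otimes>\<^sub>M borel)" "e' \<in> borel_measurable (borel \<Otimes>\<^sub>M borel)"
    using meas(1,2) by (auto simp: e_def[abs_def] e'_def[abs_def] borel_prod)
  note [measurable] = h(1) meas(3-7)
  define Z where "Z z p = z + E z (fst p) + E' z (snd p)" for z p
  have zero: "E z 0 = 0" "E' z 0 = 0" for z
    using add(1)[of z 0 0] add(2)[of z 0 0] by auto
  have ZE: "E (Z z p) = E z" "E' (Z z p) = E' z" "R (Z z p) = R z" "\<rho> (Z z p) = \<rho> z" for z p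
    unfolding Z_def
    using const(1,3,9,7)[of z "fst p"] const(2,4,10,8)[of "z + E z (fst p)" "snd p"] by simp_all
  have cE: "c (z + E z r) = c z" for z r by (rule const)
  have tZ: "t (Z z p) = t z + snd p" if "R z" for z p
    using t(2)[of "z + E z (fst p)" "snd p"] t(1)[of z "fst p"] that const(9) const(3)[of z "fst p"]
    by (simp add: Z_def)
  have t'Z: "t' (Z z p) = t' z + c z * fst p" if "R z" for z p
    using t'(2)[of "z + E z (fst p)" "snd p"] t'(1)[of z "fst p"] that const(9) const(3)[of z "fst p"]
    by (simp add: Z_def)
  have ZZ: "Z (Z z p) q = Z z (p + q)" for z p q
    unfolding Z_def[of "Z z p" q] ZE by (simp add: Z_def add algebra_simps)
  have presZ: "lebesgue_preserving (\<lambda>z. Z z p)" for p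
    using lebesgue_preserving_compose[OF pres(2)[of "snd p"] pres(1)[of "fst p"]]
    by (simp add: Z_def const)
  have mZ: "(\<lambda>x. Z (f x) (g x)) \<in> borel_measurable M"
    if [measurable]: "f \<in> borel_measurable M" "g \<in> borel_measurable M"
    for f g and M :: "((complex \<times> complex) \<times> 'x) measure"
    unfolding Z_def e by measurable
  have mZ2 [measurable]: "(\<lambda>p. Z z p) \<in> borel_measurable borel" for z
    unfolding Z_def[abs_def] e by measurable
  have fib: "AE z in lborel. AE p in lborel. R z \<longrightarrow> h (Z z (fst p + snd p + t z, snd p)) = h (Z z p)"
  proof -
    have ms: "{x \<in> space (lborel \<Otimes>\<^sub>M lborel). R (snd x) \<longrightarrow> h (Z (snd x) (fst (fst x) + snd (fst x) + t (snd x), snd (fst x))) = h (Z (snd x) (fst x))}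
      \<in> sets ((lborel :: (complex \<times> complex) measure) \<Otimes>\<^sub>M lborel)"
    proof -
      have [measurable]: "(\<lambda>x. Z (snd x) (fst x)) \<in> borel_measurable (lborel \<Otimes>\<^sub>M lborel)"
        "(\<lambda>x. Z (snd x) (fst (fst x) + snd (fst x) + t (snd x), snd (fst x))) \<in> borel_measurable (lborel \<Otimes>\<^sub>M lborel)"
        by (intro mZ borel_measurable_Pair_euclidean; measurable)+
      show ?thesis by measurable
    qed
    have "AE z in lborel. R z \<longrightarrow> h (Z z (fst p + snd p + t z, snd p)) = h (Z z p)" for p
      using lebesgue_preserving_AE[OF presZ[of p] T]
    proof eventually_elim
      case (elim z)
      have "R z \<Longrightarrow> Z z p + E (Z z p) (t (Z z p)) = Z z (fst p + snd p + t z, snd p)"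
        by (simp only: ZE tZ) (simp add: Z_def add algebra_simps)
      with elim show ?case by auto
    qed
    then have "AE p in lborel. AE z in lborel. R z \<longrightarrow> h (Z z (fst p + snd p + t z, snd p)) = h (Z z p)"
      by simp
    then show ?thesis using lborel_pair.AE_commute[OF ms] by simp
  qed
  have fib': "AE z in lborel. AE p in lborel. R z \<longrightarrow> h (Z z (fst p, snd p + t' z + c z * fst p)) = h (Z z p)"
  proof -
    have ms: "{x \<in> space (lborel \<Otimes>\<^sub>M lborel). R (snd x) \<longrightarrow> h (Z (snd x) (fst (fst x), snd (fst x) + t' (snd x) + c (snd x) * fst (fst x))) = h (Z (snd x) (fst x))}
      \<in> sets ((lborel :: (complex \<times> complex) measure) \<Otimes>\<^sub>M lborel)"
    proof -
      have [measurable]: "(\<lambda>x. Z (snd x) (fst x)) \<in> borel_measurable (lborel \<Otimes>\<^sub>M lborel)"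
        "(\<lambda>x. Z (snd x) (fst (fst x), snd (fst x) + t' (snd x) + c (snd x) * fst (fst x))) \<in> borel_measurable (lborel \<Otimes>\<^sub>M lborel)"
        by (intro mZ borel_measurable_Pair_euclidean; measurable)+
      show ?thesis by measurable
    qed
    have "AE z in lborel. R z \<longrightarrow> h (Z z (fst p, snd p + t' z + c z * fst p)) = h (Z z p)" for p
      using lebesgue_preserving_AE[OF presZ[of p] T']
    proof eventually_elim
      case (elim z)
      have "R z \<Longrightarrow> Z z p + E' (Z z p) (t' (Z z p)) = Z z (fst p, snd p + t' z + c z * fst p)"
        by (simp only: ZE t'Z) (simp add: Z_def add algebra_simps)
      with elim show ?case by auto
    qed
    then have "AE p in lborel. AE z in lborel. R z \<longrightarrow> h (Z z (fst p, snd p + t' z + c z * fst p)) = h (Z z p)"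
      by simp
    then show ?thesis using lborel_pair.AE_commute[OF ms] by simp
  qed
  have trans: "AE z in lborel. R z \<longrightarrow> (\<forall>d. AE p in lborel. h (Z z (p + d)) = h (Z z p))"
    using fib fib' good
  proof eventually_elim
    case (elim z)
    show ?case
    proof (intro impI allI)
      fix d assume R: "R z"
      have c: "norm (c z) < 1" "\<And>n. c z ^ (2 ^ n) \<notin> \<real>" and c0: "c z \<noteq> 0"
        using elim(3) R by (auto dest: spec[of _ 0])
      define o' where "o' = (- (t' z / c z), - t z)"
      have "AE p in lborel. h (Z z (p + d + o')) = h (Z z (p + o'))"
      proof (rule planar_translation_invariance[of "\<lambda>p. h (Z z (p + o'))" "c z"])
        show "(\<lambda>p. h (Z z (p + o'))) \<in> borel_measurable borel" by measurable
        show "h (Z z (x + o')) \<le> 1" for x by (rule h)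
        have "AE p in lborel. h (Z z (fst (p + o') + snd (p + o') + t z, snd (p + o'))) = h (Z z (p + o'))"
          using lebesgue_preserving_AE[OF lebesgue_preserving_translation[of o'] elim(1)] R by simp
        then show "AE p in lborel. h (Z z ((fst p + snd p, snd p) + o')) = h (Z z (p + o'))"
          by eventually_elim (simp add: o'_def algebra_simps)
        have "AE p in lborel. h (Z z (fst (p + o'), snd (p + o') + t' z + c z * fst (p + o'))) = h (Z z (p + o'))"
          using lebesgue_preserving_AE[OF lebesgue_preserving_translation[of o'] elim(2)] R by simp
        then show "AE p in lborel. h (Z z ((fst p, snd p + c z * fst p) + o')) = h (Z z (p + o'))"
          by eventually_elim (use c0 in \<open>simp add: o'_def algebra_simps\<close>)
      qed (use c in auto)
      from lebesgue_preserving_AE[OF lebesgue_preserving_translation[of "- o'"] this]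
      show "AE p in lborel. h (Z z (p + d)) = h (Z z p)"
        by eventually_elim (simp add: algebra_simps)
    qed
  qed
  have key: "AE z in lborel. R z \<longrightarrow> h (Z z (\<delta> z)) = h z"
    if [measurable]: "\<delta> \<in> borel_measurable borel" and inv: "\<And>z p. \<delta> (Z z p) = \<delta> z" for \<delta>
  proof -
    have ms: "{x \<in> space (lborel \<Otimes>\<^sub>M lborel). R (snd x) \<longrightarrow> h (Z (snd x) (fst x + \<delta> (snd x))) = h (Z (snd x) (fst x))}
      \<in> sets ((lborel :: (complex \<times> complex) measure) \<Otimes>\<^sub>M lborel)"
    proof -
      have [measurable]: "(\<lambda>x. Z (snd x) (fst x)) \<in> borel_measurable (lborel \<Otimes>\<^sub>M lborel)"
        "(\<lambda>x. Z (snd x) (fst x + \<delta> (snd x))) \<in> borel_measurable (lborel \<Otimes>\<^sub>M lborel)"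
        by (intro mZ borel_measurable_add; measurable)+
      show ?thesis by measurable
    qed
    have "AE z in lborel. AE p in lborel. R z \<longrightarrow> h (Z z (p + \<delta> z)) = h (Z z p)"
      using trans by eventually_elim (auto simp del: split_paired_All)
    then have "AE p in lborel. AE z in lborel. R z \<longrightarrow> h (Z z (p + \<delta> z)) = h (Z z p)"
      using lborel_pair.AE_commute[OF ms] by simp
    then have "\<exists>p. AE z in lborel. R z \<longrightarrow> h (Z z (p + \<delta> z)) = h (Z z p)"
      using AE_lborel_const[of False] by (metis (mono_tags, lifting) eventually_mono)
    then obtain p where p: "AE z in lborel. R z \<longrightarrow> h (Z z (p + \<delta> z)) = h (Z z p)" by blast
    have Z0: "Z z 0 = z" for z by (simp add: Z_def zero)
    from lebesgue_preserving_AE[OF presZ[of "- p"] p] show ?thesis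
      by (simp add: ZZ ZE inv Z0)
  qed
  show ?thesis
  proof
    show "AE z in lborel. R z \<longrightarrow> h (z + E z (\<rho> z)) = h z"
      using key[of "\<lambda>z. (\<rho> z, 0)"] by (simp add: ZE borel_measurable_Pair_euclidean meas) (simp add: Z_def zero)
    show "AE z in lborel. R z \<longrightarrow> h (z + E' z (\<rho> z)) = h z"
      using key[of "\<lambda>z. (0, \<rho> z)"] by (simp add: ZE borel_measurable_Pair_euclidean meas) (simp add: Z_def zero)
  qed
qed

text \<open>Fubini in the direction of the line.\<close>

lemma null_if_null_on_lines:
  fixes N :: "'x::euclidean_space set" and d :: 'x
  assumes N: "N \<in> sets borel" and lines: "\<And>z. emeasure lborel {x :: real. z + x *\<^sub>R d \<in> N} = 0"
  shows "N \<in> null_sets lborel"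
proof -
  have m: "(\<lambda>x. indicator N (fst x + snd x *\<^sub>R d) * indicator {0..1} (snd x) :: ennreal) \<in> borel_measurable (lborel \<Otimes>\<^sub>M lborel)"
    using N by measurable
  have "emeasure lborel N = (\<integral>\<^sup>+x. emeasure lborel N * indicator {0..1::real} x \<partial>lborel)"
    by (simp add: nn_integral_cmult)
  also have "\<dots> = (\<integral>\<^sup>+x. (\<integral>\<^sup>+z. indicator N (z + x *\<^sub>R d) * indicator {0..1} x \<partial>lborel) \<partial>lborel)"
  proof (rule nn_integral_cong)
    fix x :: real
    have "(\<integral>\<^sup>+z. indicator N (z + x *\<^sub>R d) \<partial>lborel) = emeasure lborel N"
      using lebesgue_preservingD(2)[OF lebesgue_preserving_translation[of "x *\<^sub>R d"], of "indicator N"] N by simp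
    then show "emeasure lborel N * indicator {0..1} x = (\<integral>\<^sup>+z. indicator N (z + x *\<^sub>R d) * indicator {0..1} x \<partial>lborel)"
      using N by (subst nn_integral_multc) auto
  qed
  also have "\<dots> = (\<integral>\<^sup>+z. (\<integral>\<^sup>+x. indicator N (z + x *\<^sub>R d) * indicator {0..1} x \<partial>lborel) \<partial>lborel)"
    using lborel_pair.Fubini'[of "\<lambda>z x. indicator N (z + x *\<^sub>R d) * indicator {0..1} x"] m by (simp add: split_beta')
  also have "\<dots> = (\<integral>\<^sup>+z. 0 \<partial>(lborel :: 'x measure))"
  proof (rule nn_integral_cong)
    fix z
    have "(\<lambda>x. z + x *\<^sub>R d) \<in> borel_measurable borel" by measurable
    then have s: "{x :: real. z + x *\<^sub>R d \<in> N} \<in> sets borel"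
      using measurable_sets[of "\<lambda>x. z + x *\<^sub>R d" borel borel N] N by (simp add: vimage_def)
    have "(\<integral>\<^sup>+x. indicator N (z + x *\<^sub>R d) * indicator {0..1} x \<partial>lborel) \<le> (\<integral>\<^sup>+x. indicator {x. z + x *\<^sub>R d \<in> N} x \<partial>lborel)"
      by (rule nn_integral_mono) (auto split: split_indicator)
    also have "\<dots> = 0" using lines[of z] s by simp
    finally show "(\<integral>\<^sup>+x. indicator N (z + x *\<^sub>R d) * indicator {0..1} x \<partial>lborel) = 0" by simp
  qed
  finally show ?thesis using N by (auto simp: null_sets_def)
qed

section \<open>The linear coordinates of cocycles and the twist maps\<close>

lemma AE_linear_bijection:
  fixes f k :: "'x::euclidean_space \<Rightarrow> 'x"
  assumes f: "linear f" and k: "linear k" and inv: "\<And>x. f (k x) = x" "\<And>x. k (f x) = x"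
    and P: "AE x in lborel. P x"
  shows "AE x in lborel. P (f x)"
proof -
  obtain N where N: "{x. \<not> P x} \<subseteq> N" "N \<in> null_sets lborel"
    using AE_E[OF P] by (auto simp: null_sets_def)
  have "negligible N" using N(2) by (simp add: negligible_iff_null_sets null_sets_completionI)
  then have "negligible (k ` N)"
    by (rule negligible_differentiable_image_negligible[OF order_refl])
       (use k in \<open>simp add: linear_imp_differentiable_on\<close>)
  moreover have "k ` N = f -` N"
  proof (intro equalityI subsetI)
    fix x assume "x \<in> f -` N"
    then have "k (f x) \<in> k ` N" by blast
    then show "x \<in> k ` N" using inv by simp
  qed (use inv in auto)
  ultimately have n: "f -` N \<in> null_sets lebesgue" by (simp add: negligible_iff_null_sets)
  have [measurable]: "f \<in> borel_measurable borel"
    using f linear_continuous_on[of f] linear_conv_bounded_linear by (auto intro!: borel_measurable_continuous_onI)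
  have "f -` N \<in> sets borel"
    using measurable_sets[of f borel borel N] N(2) by (auto simp: null_sets_def)
  with n have "f -` N \<in> null_sets lborel" by (auto simp: null_sets_def emeasure_completion)
  then show ?thesis
    by (rule AE_I') (use N(1) in auto)
qed

text \<open>The condition is a real algebraic equation for a real variable, and it is not an identity
  because the polynomial does not vanish at one explicit complex point.\<close>

lemma finite_real_shifts:
  fixes b k :: complex
  assumes "k \<noteq> 0" "Im b \<noteq> 0" and N: "N > 0"
  shows "finite {x :: real. b + of_real x \<noteq> 0 \<and> (k * (b + of_real x - 1)\<^sup>2 / (b + of_real x)) ^ N \<in> \<real>}"
proof -
  define p q where "p = smult k ([:b - 1, 1:]\<^sup>2 * [:cnj b, 1:])"
    and "q = smult (cnj k) ([:cnj b - 1, 1:]\<^sup>2 * [:b, 1:])"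
  have conj: "poly q (of_real x) = cnj (poly p (of_real x))" for x
    by (simp add: p_def q_def)
  have "poly q (- b) = 0" by (simp add: q_def)
  moreover have "poly p (- b) \<noteq> 0"
    using assms by (auto simp: p_def complex_eq_iff)
  ultimately have "poly (p ^ N - q ^ N) (- b) \<noteq> 0" using N by (simp add: zero_power)
  then have "p ^ N - q ^ N \<noteq> 0" by (metis poly_0)
  then have fin: "finite {z. poly (p ^ N - q ^ N) z = 0}" by (rule poly_roots_finite)
  have "poly (p ^ N - q ^ N) (of_real x) = 0"
    if "b + of_real x \<noteq> 0" "(k * (b + of_real x - 1)\<^sup>2 / (b + of_real x)) ^ N \<in> \<real>" for x
  proof -
    define w where "w = b + of_real x"
    have w: "w \<noteq> 0" "(k * (w - 1)\<^sup>2 / w) ^ N \<in> \<real>" using that by (simp_all add: w_def)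
    have "poly p (of_real x) = k * (w - 1)\<^sup>2 * cnj w"
      by (simp add: p_def w_def algebra_simps)
    also have "\<dots> = (k * (w - 1)\<^sup>2 / w) * of_real ((cmod w)\<^sup>2)"
      using w(1) complex_norm_square[of w] by (simp add: field_simps)
    finally have pw: "poly p (of_real x) = (k * (w - 1)\<^sup>2 / w) * of_real ((cmod w)\<^sup>2)" .
    have "poly p (of_real x) ^ N = (k * (w - 1)\<^sup>2 / w) ^ N * of_real ((cmod w)\<^sup>2) ^ N"
      unfolding pw by (rule power_mult_distrib)
    then have "poly p (of_real x) ^ N \<in> \<real>" using w(2) by (auto intro: Reals_mult Reals_power)
    then show ?thesis by (simp add: conj Reals_cnj_iff)
  qed
  then have "{x :: real. b + of_real x \<noteq> 0 \<and> (k * (b + of_real x - 1)\<^sup>2 / (b + of_real x)) ^ N \<in> \<real>}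
     \<subseteq> of_real -` {z. poly (p ^ N - q ^ N) z = 0}" by auto
  then show ?thesis
    by (rule finite_subset) (intro finite_vimageI fin inj_of_real)
qed

locale affine_cocycle_space =
  fixes g :: nat and A B U V :: "nat \<Rightarrow> 'x::euclidean_space \<Rightarrow> complex"
    and dU dV :: "nat \<Rightarrow> complex \<Rightarrow> 'x" and dB dB' :: "nat \<Rightarrow> 'x"
  assumes g2: "g \<ge> 2"
    and lin: "\<And>i. linear (A i)" "\<And>i. linear (B i)" "\<And>i. linear (U i)" "\<And>i. linear (V i)"
      "\<And>i. linear (dU i)" "\<And>i. linear (dV i)"
    and AB_fibre: "\<And>i j r. i \<in> {1..g} \<Longrightarrow> j \<in> {1..<g} \<Longrightarrow> A i (dU j r) = 0 \<and> A i (dV j r) = 0 \<and> B i (dU j r) = 0 \<and> B i (dV j r) = 0"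
    and UV_fibre: "\<And>i j r. i \<in> {1..<g} \<Longrightarrow> j \<in> {1..<g} \<Longrightarrow> U i (dU j r) = (if i = j then r else 0) \<and> U i (dV j r) = 0
       \<and> V i (dU j r) = 0 \<and> V i (dV j r) = (if i = j then r else 0)"
    and B_dB: "\<And>i j. i \<in> {1..g} \<Longrightarrow> j \<in> {1..g} \<Longrightarrow> B i (dB j) = (if i = j then 1 else 0) \<and> B i (dB' j) = (if i = j then \<i> else 0)"
begin

lemma coord_add:
  "A i (x + y) = A i x + A i y" "B i (x + y) = B i x + B i y"
  "U i (x + y) = U i x + U i y" "V i (x + y) = V i x + V i y"
  "dU i (r + q) = dU i r + dU i q" "dV i (r + q) = dV i r + dV i q"
  using lin by (auto simp: linear_add)

lemma coord_zero:
  "A i 0 = 0" "B i 0 = 0" "U i 0 = 0" "V i 0 = 0" "dU i 0 = 0" "dV i 0 = 0"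
  using lin by (auto simp: linear_0)

lemma linear_borel: "linear f \<Longrightarrow> f \<in> borel_measurable borel"
  for f :: "'a::euclidean_space \<Rightarrow> 'b::euclidean_space"
  using linear_continuous_on[of f] linear_conv_bounded_linear by (auto intro!: borel_measurable_continuous_onI)

lemma coord_borel [measurable]:
  "A i \<in> borel_measurable borel" "B i \<in> borel_measurable borel"
  "U i \<in> borel_measurable borel" "V i \<in> borel_measurable borel"
  "dU i \<in> borel_measurable borel" "dV i \<in> borel_measurable borel"
  by (auto intro!: linear_borel lin)

text \<open>The base coordinates are the linear parts and the fibre coordinates are the free translation
  parts, so that this is the projection to the fibre.\<close>

definition fibre_part :: "'x \<Rightarrow> 'x" where
  "fibre_part z = (\<Sum>i\<in>{1..<g}. dU i (U i z) + dV i (V i z))"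

lemma linear_fibre_part: "linear fibre_part"
  unfolding fibre_part_def[abs_def]
  by (intro linear_compose_sum ballI linear_compose_add
      linear_compose[OF lin(3) lin(5), unfolded o_def] linear_compose[OF lin(4) lin(6), unfolded o_def])

lemma fibre_part_borel [measurable]: "fibre_part \<in> borel_measurable borel"
  by (rule linear_borel[OF linear_fibre_part])

lemma fibre_part_add: "fibre_part (x + y) = fibre_part x + fibre_part y"
  using linear_fibre_part by (simp add: linear_add)

lemma fibre_part_dUV:
  assumes "j \<in> {1..<g}"
  shows "fibre_part (dU j r) = dU j r" "fibre_part (dV j r) = dV j r"
proof -
  have "fibre_part (dU j r) = (\<Sum>i\<in>{1..<g}. if i = j then dU j r else 0)"
    unfolding fibre_part_def using UV_fibre[OF _ assms] by (intro sum.cong) (auto simp: coord_zero)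
  then show "fibre_part (dU j r) = dU j r" using assms by simp
  have "fibre_part (dV j r) = (\<Sum>i\<in>{1..<g}. if i = j then dV j r else 0)"
    unfolding fibre_part_def using UV_fibre[OF _ assms] by (intro sum.cong) (auto simp: coord_zero)
  then show "fibre_part (dV j r) = dV j r" using assms by simp
qed

lemma linear_sum_coord:
  "A i (sum f S) = (\<Sum>x\<in>S. A i (f x))" "B i (sum f S) = (\<Sum>x\<in>S. B i (f x))"
  "U i (sum f S) = (\<Sum>x\<in>S. U i (f x))" "V i (sum f S) = (\<Sum>x\<in>S. V i (f x))"
  using lin by (auto simp: linear_sum)

lemma fibre_part_coord:
  "i \<in> {1..g} \<Longrightarrow> A i (fibre_part z) = 0" "i \<in> {1..g} \<Longrightarrow> B i (fibre_part z) = 0"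
  using AB_fibre by (auto simp: fibre_part_def linear_sum_coord coord_add intro!: sum.neutral)

lemma fibre_part_idem: "fibre_part (fibre_part z) = fibre_part z"
proof -
  have "fibre_part (fibre_part z) = (\<Sum>i\<in>{1..<g}. fibre_part (dU i (U i z) + dV i (V i z)))"
    by (subst fibre_part_def[of z]) (simp add: linear_sum[OF linear_fibre_part])
  also have "\<dots> = fibre_part z"
    by (subst fibre_part_def[of z]) (intro sum.cong refl; simp add: fibre_part_add fibre_part_dUV)
  finally show ?thesis .
qed

text \<open>Functions of the linear parts of the representation only.\<close>

definition base_function :: "('x \<Rightarrow> 'b) \<Rightarrow> bool" where
  "base_function f \<longleftrightarrow> (\<forall>z r. f (z + fibre_part r) = f z)"

lemma base_functionD: "base_function f \<Longrightarrow> fibre_part w = w \<Longrightarrow> f (z + w) = f z"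
  unfolding base_function_def by metis

lemma base_function_coord:
  "i \<in> {1..g} \<Longrightarrow> base_function (A i)" "i \<in> {1..g} \<Longrightarrow> base_function (B i)"
  by (auto simp: base_function_def coord_add fibre_part_coord)

lemma base_function_comp:
  "base_function (\<lambda>z. c)"
  "base_function f \<Longrightarrow> base_function (\<lambda>z. k (f z))"
  "base_function f \<Longrightarrow> base_function f' \<Longrightarrow> base_function (\<lambda>z. k' (f z) (f' z))"
  by (auto simp: base_function_def)

lemma lebesgue_preserving_base_shear:
  assumes [measurable]: "w \<in> borel_measurable borel" and w: "base_function w" "\<And>z. fibre_part (w z) = w z"
  shows "lebesgue_preserving (\<lambda>z. z + w z)"
proof -
  have "lebesgue_preserving (\<lambda>z. (\<lambda>r z. z + fibre_part r) (w z) z)"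
  proof (rule lebesgue_preserving_along_action[where a = "\<lambda>r z. z + fibre_part r"])
    show "(\<lambda>p. snd p + fibre_part (fst p)) \<in> borel_measurable borel" by measurable
  qed (use w in \<open>auto simp: base_function_def fibre_part_add algebra_simps intro: lebesgue_preserving_translation\<close>)
  then show ?thesis using w by simp
qed

text \<open>The translation part of the commutator of the two generators of a handle.\<close>

definition t :: "nat \<Rightarrow> 'x \<Rightarrow> complex" where
  "t i z = (A i z - 1) * V i z + (1 - B i z) * U i z"

text \<open>The last translation part is determined by the relation; the gauge is chosen such that the last
  generator of the second kind has no translation part.\<close>

definition Uf :: "nat \<Rightarrow> 'x \<Rightarrow> complex" where
  "Uf i z = (if i < g then U i z else - (\<Sum>j\<in>{1..<g}. t j z) / (1 - B g z))"

definition Vf :: "nat \<Rightarrow> 'x \<Rightarrow> complex" where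
  "Vf i z = (if i < g then V i z else 0)"

text \<open>The analogue of the translation part of a commutator for the curve that runs through two
  neighbouring handles.\<close>

definition t' :: "nat \<Rightarrow> 'x \<Rightarrow> complex" where
  "t' i z = t i z + ((1 - B (Suc i) z) * V i z
     - (1 - B i z) * (A (Suc i) z * Vf (Suc i) z + (1 - B (Suc i) z) * Uf (Suc i) z)) / B i z"

text \<open>A twist adds a multiple of this fibre direction; the direction depends on the linear parts only.\<close>

definition E :: "nat \<Rightarrow> 'x \<Rightarrow> complex \<Rightarrow> 'x" where
  "E i z r = dU i (r * (1 - A i z)) + dV i (r * (1 - B i z))"

definition E' :: "nat \<Rightarrow> 'x \<Rightarrow> complex \<Rightarrow> 'x" where
  "E' i z r = dU i (r * (1 - A i z / B (Suc i) z)) + dV i (r * ((1 - B i z) / B (Suc i) z))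
     + (if Suc i < g then dU (Suc i) (r * ((1 - B i z) / B (Suc i) z)) else 0)"

definition regular :: "'x \<Rightarrow> bool" where
  "regular z \<longleftrightarrow> (\<forall>i\<in>{1..g}. B i z \<noteq> 0 \<and> B i z \<noteq> 1)"

text \<open>The product of the two quantities below is the product of the off-diagonal entries of the two
  parabolic matrices by which a pair of twists acts.\<close>

definition \<kappa> :: "nat \<Rightarrow> 'x \<Rightarrow> complex" where
  "\<kappa> i z = (1 - B i z) * (1 - B (Suc i) z) / B i z"

definition \<kappa>' :: "nat \<Rightarrow> 'x \<Rightarrow> complex" where
  "\<kappa>' i z = - ((1 - B i z) * (1 - B (Suc i) z) / B (Suc i) z)"

lemma fibre_part_E:
  "i \<in> {1..<g} \<Longrightarrow> fibre_part (E i z r) = E i z r"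
  "i \<in> {1..<g} \<Longrightarrow> fibre_part (E' i z r) = E' i z r"
  by (auto simp: E_def E'_def fibre_part_add fibre_part_dUV linear_0[OF linear_fibre_part])

lemma base_function_E:
  assumes "i \<in> {1..<g}"
  shows "base_function (E i)" "base_function (E' i)" "base_function (\<kappa> i)" "base_function (\<kappa>' i)"
    "base_function (\<lambda>z. \<kappa> i z * \<kappa>' i z)"
  using assms by (auto simp: base_function_def E_def[abs_def] E'_def[abs_def] \<kappa>_def \<kappa>'_def coord_add fibre_part_coord)

lemma base_function_regular: "base_function regular"
  by (auto simp: base_function_def regular_def coord_add fibre_part_coord)

lemma coord_E:
  assumes "i \<in> {1..<g}" "j \<in> {1..<g}"
  shows "U j (E i z r) = (if j = i then r * (1 - A i z) else 0)"
    "V j (E i z r) = (if j = i then r * (1 - B i z) else 0)"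
    "U j (E' i z r) = (if j = i then r * (1 - A i z / B (Suc i) z) else if j = Suc i then r * ((1 - B i z) / B (Suc i) z) else 0)"
    "V j (E' i z r) = (if j = i then r * ((1 - B i z) / B (Suc i) z) else 0)"
  using assms UV_fibre by (auto simp: E_def E'_def coord_add coord_zero)

lemma AB_E:
  assumes "i \<in> {1..<g}" "j \<in> {1..g}"
  shows "A j (z + E i y r) = A j z" "B j (z + E i y r) = B j z"
    "A j (z + E' i y r) = A j z" "B j (z + E' i y r) = B j z"
  using base_functionD[OF base_function_coord(1)[OF assms(2)] fibre_part_E(1)[OF assms(1)]]
    base_functionD[OF base_function_coord(1)[OF assms(2)] fibre_part_E(2)[OF assms(1)]]
    base_functionD[OF base_function_coord(2)[OF assms(2)] fibre_part_E(1)[OF assms(1)]]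
    base_functionD[OF base_function_coord(2)[OF assms(2)] fibre_part_E(2)[OF assms(1)]] by auto

lemma t_E:
  assumes "i \<in> {1..<g}" "j \<in> {1..<g}"
  shows "t j (z + E i z r) = t j z"
  using assms AB_E[of i j] by (auto simp: t_def coord_add coord_E algebra_simps)

lemma t_E':
  assumes "i \<in> {1..<g}" "j \<in> {1..<g}" "regular z"
  shows "t j (z + E' i z r) = t j z + (if j = i then \<kappa>' i z * r
     else if j = Suc i then (1 - B j z) * ((1 - B i z) / B j z) * r else 0)"
proof -
  have "B (Suc i) z \<noteq> 0" using assms by (auto simp: regular_def)
  then show ?thesis
    using assms(1,2) AB_E[of i j] by (auto simp: t_def \<kappa>'_def coord_add coord_E field_simps)
qed

lemma UVf_E:
  assumes "i \<in> {1..<g}"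
  shows "Uf (Suc i) (z + E i z r) = Uf (Suc i) z" "Vf (Suc i) (z + E i z r) = Vf (Suc i) z"
    "Vf (Suc i) (z + E' i z r) = Vf (Suc i) z"
proof -
  show "Vf (Suc i) (z + E i z r) = Vf (Suc i) z" "Vf (Suc i) (z + E' i z r) = Vf (Suc i) z"
    using assms by (auto simp: Vf_def coord_add coord_E)
  show "Uf (Suc i) (z + E i z r) = Uf (Suc i) z"
  proof (cases "Suc i < g")
    case True
    then show ?thesis using assms by (simp add: Uf_def coord_add coord_E)
  next
    case False
    have "B g (z + E i z r) = B g z" using assms g2 by (intro AB_E) auto
    moreover have "(\<Sum>j\<in>{1..<g}. t j (z + E i z r)) = (\<Sum>j\<in>{1..<g}. t j z)"
      using assms by (intro sum.cong refl t_E) auto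
    ultimately show ?thesis using False by (simp only: Uf_def if_False)
  qed
qed

lemma Uf_E':
  assumes i: "i \<in> {1..<g}" and z: "regular z"
  shows "Uf (Suc i) (z + E' i z r) = Uf (Suc i) z + r * ((1 - B i z) / B (Suc i) z)"
proof (cases "Suc i < g")
  case True
  then show ?thesis using i by (simp add: Uf_def coord_add coord_E)
next
  case False
  then have g: "Suc i = g" using i by auto
  have "(\<Sum>j\<in>{1..<g}. t j (z + E' i z r)) = (\<Sum>j\<in>{1..<g}. t j z + (if j = i then \<kappa>' i z * r else 0))"
    using t_E'[OF i _ z] g by (intro sum.cong) auto
  also have "\<dots> = (\<Sum>j\<in>{1..<g}. t j z) + \<kappa>' i z * r" using i by (simp add: sum.distrib)
  finally have s: "(\<Sum>j\<in>{1..<g}. t j (z + E' i z r)) = (\<Sum>j\<in>{1..<g}. t j z) + \<kappa>' i z * r" .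
  have nz: "1 - B g z \<noteq> 0" "B g z \<noteq> 0" using z g2 by (auto simp: regular_def)
  have "\<kappa>' i z / (1 - B g z) = - ((1 - B i z) / B g z)"
    using nz by (simp add: \<kappa>'_def g)
  then have k: "(\<kappa>' i z * r) / (1 - B g z) = - (r * ((1 - B i z) / B g z))"
    by (metis mult.commute mult_minus_right times_divide_eq_right)
  have "Uf (Suc i) (z + E' i z r) = - ((\<Sum>j\<in>{1..<g}. t j z) + \<kappa>' i z * r) / (1 - B g z)"
    using s g AB_E(4)[OF i, of g] g2 by (simp add: Uf_def)
  also have "\<dots> = Uf (Suc i) z - (\<kappa>' i z * r) / (1 - B g z)"
    using g by (simp add: Uf_def add_divide_distrib diff_divide_distrib)
  finally show ?thesis unfolding k using g by simp
qed

lemma t'_E: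
  assumes i: "i \<in> {1..<g}" and z: "regular z"
  shows "t' i (z + E i z r) = t' i z + \<kappa> i z * r"
    and "t' i (z + E' i z r) = t' i z"
proof -
  have nz: "B i z \<noteq> 0" "B (Suc i) z \<noteq> 0" using z i by (auto simp: regular_def)
  have i': "i \<in> {1..g}" "Suc i \<in> {1..g}" using i by auto
  show "t' i (z + E i z r) = t' i z + \<kappa> i z * r"
    unfolding t'_def t_E[OF i i] UVf_E[OF i] AB_E[OF i i'(1)] AB_E[OF i i'(2)] \<kappa>_def
    using i nz by (simp add: coord_add coord_E) (simp add: field_simps)
  show "t' i (z + E' i z r) = t' i z"
    unfolding t'_def t_E'[OF i i z] UVf_E[OF i] AB_E[OF i i'(1)] AB_E[OF i i'(2)] Uf_E'[OF i z] \<kappa>'_def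
    using i nz by (simp add: coord_add coord_E) (simp add: field_simps)
qed

definition twist :: "nat \<Rightarrow> complex \<Rightarrow> 'x \<Rightarrow> 'x" where
  "twist i r z = (if regular z then z + E i z (r * t i z) else z)"

definition twist' :: "nat \<Rightarrow> complex \<Rightarrow> 'x \<Rightarrow> 'x" where
  "twist' i r z = (if regular z then z + E' i z (r * t' i z) else z)"

lemma borel_t [measurable]: "t i \<in> borel_measurable borel" "t' i \<in> borel_measurable borel"
  "\<kappa> i \<in> borel_measurable borel" "\<kappa>' i \<in> borel_measurable borel"
proof -
  have [measurable]: "t i \<in> borel_measurable borel" for i unfolding t_def[abs_def] by measurable
  have [measurable]: "Uf j \<in> borel_measurable borel" "Vf j \<in> borel_measurable borel" for j
    unfolding Uf_def[abs_def] Vf_def[abs_def] by measurable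
  show "t i \<in> borel_measurable borel" "t' i \<in> borel_measurable borel"
    "\<kappa> i \<in> borel_measurable borel" "\<kappa>' i \<in> borel_measurable borel"
    unfolding t'_def[abs_def] \<kappa>_def[abs_def] \<kappa>'_def[abs_def] by measurable
qed

lemma borel_regular [measurable]: "Measurable.pred borel regular"
  unfolding regular_def[abs_def] by measurable

lemma borel_E:
  assumes [measurable]: "f \<in> borel_measurable M" "r \<in> borel_measurable M"
  shows "(\<lambda>x. E i (f x) (r x)) \<in> borel_measurable M" "(\<lambda>x. E' i (f x) (r x)) \<in> borel_measurable M"
  unfolding E_def E'_def by measurable

lemma E_add: "E i z (r + q) = E i z r + E i z q" "E' i z (r + q) = E' i z r + E' i z q"
  by (auto simp: E_def E'_def coord_add distrib_right add_divide_distrib add_ac)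

lemma lebesgue_preserving_E:
  assumes i: "i \<in> {1..<g}"
  shows "lebesgue_preserving (\<lambda>z. z + E i z r)" "lebesgue_preserving (\<lambda>z. z + E' i z r)"
  by (rule lebesgue_preserving_base_shear;
      use base_function_E[OF i] fibre_part_E[OF i] in \<open>auto simp: base_function_def intro!: borel_E\<close>)+

text \<open>A twist is a shear along the fibres, and its amount is constant along the direction in which it
  moves.\<close>

lemma lebesgue_preserving_twist:
  assumes i: "i \<in> {1..<g}"
  shows "lebesgue_preserving (twist i r)" "lebesgue_preserving (twist' i r)"
proof -
  have E0: "E i z 0 = 0" "E' i z 0 = 0" for z by (auto simp: E_def E'_def coord_zero)
  have reg: "regular (z + E i z q) = regular z" "regular (z + E' i z q) = regular z"
    "E i (z + E i z q) = E i z" "E' i (z + E' i z q) = E' i z" for z q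
    using base_functionD[OF base_function_regular] base_functionD[OF base_function_E(1)[OF i]]
      base_functionD[OF base_function_E(2)[OF i]] fibre_part_E[OF i] by auto
  have "lebesgue_preserving (\<lambda>z. (\<lambda>q z. z + E i z q) (if regular z then r * t i z else 0) z)"
  proof (rule lebesgue_preserving_along_action[where a = "\<lambda>q z. z + E i z q"])
    show "(\<lambda>p. snd p + E i (snd p) (fst p)) \<in> borel_measurable borel"
      by (intro borel_measurable_add borel_E) auto
  qed (auto simp: reg E_add add.commute add.left_commute t_E[OF i i] lebesgue_preserving_E[OF i])
  moreover have "(\<lambda>z. (\<lambda>q z. z + E i z q) (if regular z then r * t i z else 0) z) = twist i r"
    by (auto simp: twist_def E0)
  ultimately show "lebesgue_preserving (twist i r)" by simp
  have "lebesgue_preserving (\<lambda>z. (\<lambda>q z. z + E' i z q) (if regular z then r * t' i z else 0) z)"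
  proof (rule lebesgue_preserving_along_action[where a = "\<lambda>q z. z + E' i z q"])
    show "(\<lambda>p. snd p + E' i (snd p) (fst p)) \<in> borel_measurable borel"
      by (intro borel_measurable_add borel_E) auto
  qed (auto simp: reg E_add add.commute add.left_commute t'_E[OF i] lebesgue_preserving_E[OF i])
  moreover have "(\<lambda>z. (\<lambda>q z. z + E' i z q) (if regular z then r * t' i z else 0) z) = twist' i r"
    by (auto simp: twist'_def E0)
  ultimately show "lebesgue_preserving (twist' i r)" by simp
qed

text \<open>The open region of linear parts on which the parabolic matrices of all handles satisfy the
  smallness condition.\<close>

definition contracting :: "'x \<Rightarrow> bool" where
  "contracting z \<longleftrightarrow> regular z \<and> (\<forall>i\<in>{1..<g}. norm (\<kappa> i z * \<kappa>' i z) < 1)"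

lemma base_function_contracting: "base_function contracting"
proof -
  have "regular (z + fibre_part r) = regular z" for z r
    by (rule base_functionD[OF base_function_regular fibre_part_idem])
  moreover have "\<kappa> i (z + fibre_part r) * \<kappa>' i (z + fibre_part r) = \<kappa> i z * \<kappa>' i z" if "i \<in> {1..<g}" for i z r
    by (rule base_functionD[OF base_function_E(5)[OF that] fibre_part_idem])
  ultimately show ?thesis by (simp add: contracting_def[abs_def] base_function_def)
qed

lemma borel_contracting [measurable]: "Measurable.pred borel contracting"
  unfolding contracting_def[abs_def] by measurable

text \<open>Moving one eigenvalue along a real line meets the exceptional condition only finitely often.\<close>

lemma AE_nonreal_power:
  assumes i: "i \<in> {1..<g}"
  shows "AE z in lborel. regular z \<longrightarrow> (\<forall>n. (\<kappa> i z * \<kappa>' i z) ^ (2 ^ n) \<notin> \<real>)"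
proof -
  have i': "i \<in> {1..g}" "Suc i \<in> {1..g}" using i by auto
  have "{z. Im (B i z) = 0} \<in> null_sets lborel"
  proof (rule null_if_null_on_lines[where d = "dB' i"])
    show "{z. Im (B i z) = 0} \<in> sets borel" by measurable
    fix z
    have "Im (B i (z + x *\<^sub>R dB' i)) = Im (B i z) + x" for x
      using B_dB[OF i'(1) i'(1)] by (simp add: coord_add linear_scale[OF lin(2)])
    then have "{x. z + x *\<^sub>R dB' i \<in> {z. Im (B i z) = 0}} \<subseteq> {- Im (B i z)}" by auto
    then have "countable {x. z + x *\<^sub>R dB' i \<in> {z. Im (B i z) = 0}}"
      using countable_subset by blast
    then show "emeasure lborel {x. z + x *\<^sub>R dB' i \<in> {z. Im (B i z) = 0}} = 0"
      by (rule emeasure_lborel_countable)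
  qed
  then have 1: "AE z in lborel. Im (B i z) \<noteq> 0" by (auto dest: AE_not_in)
  have 2: "AE z in lborel. \<not> (regular z \<and> Im (B i z) \<noteq> 0 \<and> (\<kappa> i z * \<kappa>' i z) ^ (2 ^ n) \<in> \<real>)" for n
  proof -
    let ?N = "{z. regular z \<and> Im (B i z) \<noteq> 0 \<and> (\<kappa> i z * \<kappa>' i z) ^ (2 ^ n) \<in> \<real>}"
    have "?N \<in> null_sets lborel"
    proof (rule null_if_null_on_lines[where d = "dB i"])
      show "?N \<in> sets borel" unfolding complex_is_Real_iff by measurable
      fix z
      have B: "B i (z + x *\<^sub>R dB i) = B i z + of_real x" "B (Suc i) (z + x *\<^sub>R dB i) = B (Suc i) z" for x
        using B_dB[OF i'(1) i'(1)] B_dB[OF i'(2) i'(1)]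
        by (auto simp: coord_add linear_scale[OF lin(2)] scaleR_conv_of_real)
      define k where "k = - ((1 - B (Suc i) z)\<^sup>2 / B (Suc i) z)"
      have sub: "{x. z + x *\<^sub>R dB i \<in> ?N} \<subseteq> (if k \<noteq> 0 \<and> Im (B i z) \<noteq> 0 then {x :: real. B i z + of_real x \<noteq> 0 \<and>
           (k * (B i z + of_real x - 1)\<^sup>2 / (B i z + of_real x)) ^ (2 ^ n) \<in> \<real>} else {})"
      proof
        fix x assume "x \<in> {x. z + x *\<^sub>R dB i \<in> ?N}"
        then have r: "regular (z + x *\<^sub>R dB i)" "Im (B i z) \<noteq> 0"
          "(\<kappa> i (z + x *\<^sub>R dB i) * \<kappa>' i (z + x *\<^sub>R dB i)) ^ (2 ^ n) \<in> \<real>" by (auto simp: B)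
        have nz: "B i z + of_real x \<noteq> 0" "B (Suc i) z \<noteq> 0" "B (Suc i) z \<noteq> 1"
          using r(1) i' unfolding regular_def by (metis B)+
        have "\<kappa> i (z + x *\<^sub>R dB i) * \<kappa>' i (z + x *\<^sub>R dB i) = k * (B i z + of_real x - 1)\<^sup>2 / (B i z + of_real x)"
          using nz by (simp add: \<kappa>_def \<kappa>'_def k_def B field_simps power2_eq_square)
        moreover have "k \<noteq> 0" using nz by (simp add: k_def)
        ultimately show "x \<in> (if k \<noteq> 0 \<and> Im (B i z) \<noteq> 0 then {x :: real. B i z + of_real x \<noteq> 0 \<and>
           (k * (B i z + of_real x - 1)\<^sup>2 / (B i z + of_real x)) ^ (2 ^ n) \<in> \<real>} else {})"
          using r nz by auto
      qed
      have "finite {x. z + x *\<^sub>R dB i \<in> ?N}"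
        by (rule finite_subset[OF sub]) (simp add: finite_real_shifts)
      then show "emeasure lborel {x. z + x *\<^sub>R dB i \<in> ?N} = 0"
        by (intro emeasure_lborel_countable countable_finite)
    qed
    then show ?thesis by (auto dest: AE_not_in)
  qed
  have "AE z in lborel. \<forall>n. \<not> (regular z \<and> Im (B i z) \<noteq> 0 \<and> (\<kappa> i z * \<kappa>' i z) ^ (2 ^ n) \<in> \<real>)"
    by (rule AE_all_countable[THEN iffD2]) (use 2 in blast)
  with 1 show ?thesis by eventually_elim auto
qed

end

section \<open>Invariant densities of the twist maps\<close>

context affine_cocycle_space
begin

text \<open>The two twists of a handle form a pair of transvections in each fibre.\<close>

lemma fibre_directions_invariance:
  fixes h :: "'x \<Rightarrow> ennreal"
  assumes h: "h \<in> borel_measurable borel" "\<And>x. h x \<le> 1" and i: "i \<in> {1..<g}"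
    and T: "AE z in lborel. h (twist i 1 z) = h z" "AE z in lborel. h (twist' i 1 z) = h z"
    and \<rho>: "\<rho> \<in> borel_measurable borel" "base_function \<rho>"
  shows "AE z in lborel. contracting z \<longrightarrow> h (z + E i z (\<rho> z)) = h z"
    and "AE z in lborel. contracting z \<longrightarrow> h (z + E' i z (\<rho> z)) = h z"
proof -
  define F where "F z r = E i z (\<kappa>' i z * r)" for z r
  define s where "s z = (if contracting z then t i z / \<kappa>' i z else 0)" for z
  define s' where "s' z = (if contracting z then t' i z else 0)" for z
  have reg: "regular z" if "contracting z" for z using that by (simp add: contracting_def)
  have \<kappa>0: "\<kappa>' i z \<noteq> 0" if "contracting z" for z
    using reg[OF that] i by (auto simp: regular_def \<kappa>'_def)
  note bf = base_functionD[OF base_function_E(1)[OF i]] base_functionD[OF base_function_E(2)[OF i]]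
    base_functionD[OF base_function_E(3)[OF i]] base_functionD[OF base_function_E(4)[OF i]]
    base_functionD[OF base_function_contracting] base_functionD[OF \<rho>(2)]
  note fp = fibre_part_E[OF i]
  have E0: "E i z 0 = 0" "E' i z 0 = 0" for z by (auto simp: E_def E'_def coord_zero)
  have [measurable]: "s \<in> borel_measurable borel" "s' \<in> borel_measurable borel"
    unfolding s_def[abs_def] s'_def[abs_def] by measurable
  have [measurable]: "\<rho> \<in> borel_measurable borel" by fact
  have *: "(AE z in lborel. contracting z \<longrightarrow> h (z + F z (\<sigma> z)) = h z) \<and>
       (AE z in lborel. contracting z \<longrightarrow> h (z + E' i z (\<sigma> z)) = h z)"
    if \<sigma>: "\<sigma> \<in> borel_measurable borel" "base_function \<sigma>" for \<sigma>
  proof (rule transvection_pair_invariance[OF h, where c = "\<lambda>z. \<kappa> i z * \<kappa>' i z" and t = s and t' = s' and E = F and E' = "E' i" and R = contracting])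
    have "(\<lambda>p. E i (fst p) (\<kappa>' i (fst p) * snd p)) \<in> borel_measurable borel"
      by (rule borel_E) measurable
    then show "(\<lambda>p. F (fst p) (snd p)) \<in> borel_measurable borel" by (simp add: F_def)
    show "(\<lambda>p. E' i (fst p) (snd p)) \<in> borel_measurable borel"
      by (rule borel_E) measurable
    show "F z (r + q) = F z r + F z q" "E' i z (r + q) = E' i z r + E' i z q" for z r q
      by (simp_all add: F_def E_add distrib_left)
    show "lebesgue_preserving (\<lambda>z. z + F z r)" for r
      unfolding F_def
      by (rule lebesgue_preserving_base_shear)
         (use base_function_E[OF i] fp in \<open>auto simp: base_function_def intro!: borel_E\<close>)
    show "lebesgue_preserving (\<lambda>z. z + E' i z r)" for r
      by (rule lebesgue_preserving_E[OF i])
    show "AE z in lborel. h (z + F z (s z)) = h z" using T(1)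
    proof eventually_elim
      case (elim z)
      then show ?case using \<kappa>0[of z] reg[of z]
        by (cases "contracting z") (auto simp: F_def s_def E0 twist_def)
    qed
    show "AE z in lborel. h (z + E' i z (s' z)) = h z" using T(2)
    proof eventually_elim
      case (elim z)
      then show ?case using reg[of z]
        by (cases "contracting z") (auto simp: s'_def E0 twist'_def)
    qed
    show "AE z in lborel. contracting z \<longrightarrow> cmod (\<kappa> i z * \<kappa>' i z) < 1 \<and> (\<forall>n. (\<kappa> i z * \<kappa>' i z) ^ 2 ^ n \<notin> \<real>)"
      using AE_nonreal_power[OF i] by eventually_elim (use i in \<open>auto simp: contracting_def\<close>)
    show "s (z + F z r) = s z" "s (z + E' i z r) = s z + r" "s' (z + F z r) = s' z + \<kappa> i z * \<kappa>' i z * r"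
        "s' (z + E' i z r) = s' z" if "contracting z" for z r
      using that \<kappa>0[OF that] reg[OF that]
      by (auto simp: s_def s'_def F_def bf fp t_E[OF i i] t_E'[OF i i] t'_E[OF i] field_simps)
  qed (use \<sigma> in \<open>auto simp: F_def bf fp base_functionD[OF \<sigma>(2)]\<close>)
  show "AE z in lborel. contracting z \<longrightarrow> h (z + E' i z (\<rho> z)) = h z"
    using *[OF \<rho>] by blast
  have "(\<lambda>z. \<rho> z / \<kappa>' i z) \<in> borel_measurable borel" "base_function (\<lambda>z. \<rho> z / \<kappa>' i z)"
    using base_function_comp(3)[OF \<rho>(2) base_function_E(4)[OF i]] by auto
  from *[OF this] have "AE z in lborel. contracting z \<longrightarrow> h (z + F z (\<rho> z / \<kappa>' i z)) = h z" by blast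
  then show "AE z in lborel. contracting z \<longrightarrow> h (z + E i z (\<rho> z)) = h z"
    by eventually_elim (auto simp: F_def \<kappa>0)
qed

definition fibre_shear :: "('x \<Rightarrow> 'x) \<Rightarrow> bool" where
  "fibre_shear w \<longleftrightarrow> w \<in> borel_measurable borel \<and> base_function w \<and> (\<forall>z. fibre_part (w z) = w z)"

lemma fibre_shear_dUV:
  assumes "i \<in> {1..<g}" "\<rho> \<in> borel_measurable borel" "base_function \<rho>"
  shows "fibre_shear (\<lambda>z. dU i (\<rho> z))" "fibre_shear (\<lambda>z. dV i (\<rho> z))"
    "fibre_shear (\<lambda>z. E i z (\<rho> z))" "fibre_shear (\<lambda>z. E' i z (\<rho> z))"
  using assms fibre_part_dUV[OF assms(1)] fibre_part_E[OF assms(1)] base_function_comp(2)[OF assms(3)]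
    base_function_E(1,2)[OF assms(1)] borel_E[of "\<lambda>x. x" borel \<rho>]
  by (auto simp: fibre_shear_def base_function_def intro: measurable_compose)

lemma fibre_shear_add_invariance:
  assumes w: "fibre_shear w" "AE z in lborel. contracting z \<longrightarrow> h (z + w z) = h z"
    and w': "fibre_shear w'" "AE z in lborel. contracting z \<longrightarrow> h (z + w' z) = h z"
  shows "AE z in lborel. contracting z \<longrightarrow> h (z + (w z + w' z)) = h z"
proof -
  have "lebesgue_preserving (\<lambda>z. z + w' z)"
    using w'(1) by (auto simp: fibre_shear_def intro: lebesgue_preserving_base_shear)
  note pres = this
  have "AE z in lborel. contracting z \<longrightarrow> h (z + w' z + w z) = h (z + w' z)"
  proof -
    have "contracting (z + w' z) = contracting z" "w (z + w' z) = w z" for z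
      using w(1) w'(1) base_functionD[OF base_function_contracting, of "w' z" z] base_functionD[of w "w' z" z]
      by (simp_all add: fibre_shear_def)
    then show ?thesis using lebesgue_preserving_AE[OF pres w(2)] by simp
  qed
  with w'(2) show ?thesis by eventually_elim (auto simp: add_ac)
qed

text \<open>The directions of the twists, multiplied by functions on the base, span all fibre coordinates.\<close>

lemma coordinate_shear_invariance:
  fixes h :: "'x \<Rightarrow> ennreal"
  assumes h: "h \<in> borel_measurable borel" "\<And>x. h x \<le> 1"
    and T: "\<And>i. i \<in> {1..<g} \<Longrightarrow> AE z in lborel. h (twist i 1 z) = h z"
      "\<And>i. i \<in> {1..<g} \<Longrightarrow> AE z in lborel. h (twist' i 1 z) = h z"
    and i: "i \<in> {1..<g}" and \<rho>: "\<rho> \<in> borel_measurable borel" "base_function \<rho>"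
  shows "(AE z in lborel. contracting z \<longrightarrow> h (z + dU i (\<rho> z)) = h z) \<and>
    (AE z in lborel. contracting z \<longrightarrow> h (z + dV i (\<rho> z)) = h z)"
  using i \<rho>
proof (induction "g - i" arbitrary: i \<rho> rule: less_induct)
  case less
  note i = less.prems(1) and [measurable] = less.prems(2)
  have i': "i \<in> {1..g}" "Suc i \<in> {1..g}" using i by auto
  have b: "base_function (A i)" "base_function (B i)" "base_function (B (Suc i))"
    using base_function_coord i' by auto
  define x y where "x z = - (\<rho> z / (1 - 1 / B (Suc i) z)) / B (Suc i) z"
    and "y z = \<rho> z / (1 - 1 / B (Suc i) z)" for z
  define x' y' where "x' z = (1 - A i z / B (Suc i) z) * \<rho> z / ((1 - B i z) * (1 - 1 / B (Suc i) z))"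
    and "y' z = - ((1 - A i z) * \<rho> z / ((1 - B i z) * (1 - 1 / B (Suc i) z)))" for z
  have bx: "base_function x" "base_function y" "base_function x'" "base_function y'"
    using less.prems(3) b unfolding x_def y_def x'_def y'_def base_function_def by simp_all
  have mx [measurable]: "x \<in> borel_measurable borel" "y \<in> borel_measurable borel"
    "x' \<in> borel_measurable borel" "y' \<in> borel_measurable borel"
    unfolding x_def[abs_def] y_def[abs_def] x'_def[abs_def] y'_def[abs_def] by measurable
  define c where "c Y z = - (Y z * ((1 - B i z) / B (Suc i) z))" for Y :: "'x \<Rightarrow> complex" and z
  have bc: "base_function (c Y)" "c Y \<in> borel_measurable borel"
    if "base_function Y" and [measurable]: "Y \<in> borel_measurable borel" for Y
    using that(1) b unfolding c_def[abs_def] base_function_def by (simp_all) measurable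
  have combine: "AE z in lborel. contracting z \<longrightarrow>
     h (z + (E i z (X z) + (E' i z (Y z) + (if Suc i < g then dU (Suc i) (c Y z) else 0)))) = h z"
    if X: "X \<in> borel_measurable borel" "base_function X" and Y: "Y \<in> borel_measurable borel" "base_function Y" for X Y
  proof -
    let ?w = "\<lambda>z. if Suc i < g then dU (Suc i) (c Y z) else 0"
    have w: "fibre_shear ?w \<and> (AE z in lborel. contracting z \<longrightarrow> h (z + ?w z) = h z)"
    proof (cases "Suc i < g")
      case True
      then show ?thesis
        using less.hyps[of "Suc i" "c Y"] bc[OF Y(2,1)] fibre_shear_dUV(1)[of "Suc i" "c Y"] by auto
    qed (auto simp: fibre_shear_def base_function_def linear_0[OF linear_fibre_part])
    note EE = fibre_directions_invariance[OF h i T(1)[OF i] T(2)[OF i]]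
    note sh = fibre_shear_dUV(3,4)[OF i]
    have s1: "fibre_shear (\<lambda>z. E' i z (Y z) + ?w z)"
      using sh(2)[OF Y] w by (auto simp: fibre_shear_def base_function_def fibre_part_add simp del: if_split)
    show ?thesis
      using fibre_shear_add_invariance[OF sh(1)[OF X] EE(1)[OF X] s1
          fibre_shear_add_invariance[OF sh(2)[OF Y] EE(2)[OF Y] conjunct1[OF w] conjunct2[OF w]]] .
  qed
  have EE: "E i z X + (dU i P + dV i Q) = dU i (X * (1 - A i z) + P) + dV i (X * (1 - B i z) + Q)" for z X P Q
    by (simp add: E_def coord_add add_ac)
  have E2: "E' i z (Y z) + (if Suc i < g then dU (Suc i) (c Y z) else 0)
      = dU i (Y z * (1 - A i z / B (Suc i) z)) + dV i (Y z * ((1 - B i z) / B (Suc i) z))" for Y z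
    using coord_add(5)[of "Suc i" "Y z * ((1 - B i z) / B (Suc i) z)" "c Y z"]
    by (auto simp: E'_def c_def coord_zero add.assoc)
  have nz: "B i z \<noteq> 0" "B (Suc i) z \<noteq> 0" "B i z \<noteq> 1" "B (Suc i) z \<noteq> 1" if "contracting z" for z
    using that i' by (auto simp: contracting_def regular_def)
  show ?case
  proof
    have "E i z (x z) + (dU i (y z * (1 - A i z / B (Suc i) z)) + dV i (y z * ((1 - B i z) / B (Suc i) z))) = dU i (\<rho> z)"
      if "contracting z" for z
    proof -
      have "x z * (1 - A i z) + y z * (1 - A i z / B (Suc i) z) = \<rho> z"
        "x z * (1 - B i z) + y z * ((1 - B i z) / B (Suc i) z) = 0"
      proof -
        have "x z * (1 - A i z) + y z * (1 - A i z / B (Suc i) z)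
          = \<rho> z / (1 - 1 / B (Suc i) z) * ((1 - A i z / B (Suc i) z) - (1 - A i z) / B (Suc i) z)"
        proof -
          define q where "q = \<rho> z / (1 - 1 / B (Suc i) z)"
          have xy: "x z = - q / B (Suc i) z" "y z = q" by (simp_all add: x_def y_def q_def)
          show ?thesis unfolding q_def[symmetric] xy by (simp add: right_diff_distrib diff_divide_distrib)
        qed
        also have "(1 - A i z / B (Suc i) z) - (1 - A i z) / B (Suc i) z = 1 - 1 / B (Suc i) z"
          by (simp add: diff_divide_distrib)
        also have "\<rho> z / (1 - 1 / B (Suc i) z) * (1 - 1 / B (Suc i) z) = \<rho> z"
          by (rule nonzero_eq_divide_eq[THEN iffD1, OF _ refl]) (use nz[OF that] in simp)
        finally show "x z * (1 - A i z) + y z * (1 - A i z / B (Suc i) z) = \<rho> z" .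
        show "x z * (1 - B i z) + y z * ((1 - B i z) / B (Suc i) z) = 0"
          by (simp add: x_def y_def)
      qed
      then show ?thesis
        unfolding EE by (simp add: coord_zero)
    qed
    then show "AE z in lborel. contracting z \<longrightarrow> h (z + dU i (\<rho> z)) = h z"
      using combine[OF mx(1) bx(1) mx(2) bx(2)] unfolding E2
      by (auto elim!: eventually_mono)
    have "E i z (x' z) + (dU i (y' z * (1 - A i z / B (Suc i) z)) + dV i (y' z * ((1 - B i z) / B (Suc i) z))) = dV i (\<rho> z)"
      if "contracting z" for z
    proof -
      have "x' z * (1 - A i z) + y' z * (1 - A i z / B (Suc i) z) = 0"
        by (simp add: x'_def y'_def)
      moreover have "x' z * (1 - B i z) + y' z * ((1 - B i z) / B (Suc i) z) = \<rho> z"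
      proof -
        have "x' z * (1 - B i z) + y' z * ((1 - B i z) / B (Suc i) z)
          = ((1 - A i z / B (Suc i) z) - (1 - A i z) / B (Suc i) z) * \<rho> z / (1 - 1 / B (Suc i) z)"
        proof -
          define q b where "q = \<rho> z / ((1 - B i z) * (1 - 1 / B (Suc i) z))" and "b = 1 - B i z"
          have xy: "x' z = (1 - A i z / B (Suc i) z) * q" "y' z = - ((1 - A i z) * q)"
            by (simp_all add: x'_def y'_def q_def)
          have qb: "q * b = \<rho> z / (1 - 1 / B (Suc i) z)"
            using nz[OF that] by (simp add: q_def b_def)
          have "x' z * b + y' z * (b / B (Suc i) z)
            = ((1 - A i z / B (Suc i) z) - (1 - A i z) / B (Suc i) z) * (q * b)"
            unfolding xy by (simp add: left_diff_distrib diff_divide_distrib mult.assoc)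
          then show ?thesis unfolding qb unfolding b_def times_divide_eq_right .
        qed
        also have "(1 - A i z / B (Suc i) z) - (1 - A i z) / B (Suc i) z = 1 - 1 / B (Suc i) z"
          by (simp add: diff_divide_distrib)
        finally show ?thesis using nz[OF that] by simp
      qed
      ultimately show ?thesis
        unfolding EE by (simp add: coord_zero)
    qed
    then show "AE z in lborel. contracting z \<longrightarrow> h (z + dV i (\<rho> z)) = h z"
      using combine[OF mx(3) bx(3) mx(4) bx(4)] unfolding E2
      by (auto elim!: eventually_mono)
  qed
qed

lemma fibre_translation_invariance:
  fixes h :: "'x \<Rightarrow> ennreal"
  assumes h: "h \<in> borel_measurable borel" "\<And>x. h x \<le> 1"
    and T: "\<And>i. i \<in> {1..<g} \<Longrightarrow> AE z in lborel. h (twist i 1 z) = h z"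
      "\<And>i. i \<in> {1..<g} \<Longrightarrow> AE z in lborel. h (twist' i 1 z) = h z"
  shows "AE z in lborel. contracting z \<longrightarrow> h (z + fibre_part r) = h z"
proof -
  have "finite I \<Longrightarrow> I \<subseteq> {1..<g} \<Longrightarrow> fibre_shear (\<lambda>z. \<Sum>i\<in>I. dU i (U i r) + dV i (V i r)) \<and>
    (AE z in lborel. contracting z \<longrightarrow> h (z + (\<Sum>i\<in>I. dU i (U i r) + dV i (V i r))) = h z)" for I
  proof (induction I rule: finite_induct)
    case empty
    then show ?case by (auto simp: fibre_shear_def base_function_def linear_0[OF linear_fibre_part])
  next
    case (insert i I)
    then have i: "i \<in> {1..<g}" and IH: "fibre_shear (\<lambda>z. \<Sum>i\<in>I. dU i (U i r) + dV i (V i r))"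
      "AE z in lborel. contracting z \<longrightarrow> h (z + (\<Sum>i\<in>I. dU i (U i r) + dV i (V i r))) = h z" by auto
    have c: "(\<lambda>z. U i r) \<in> borel_measurable borel" "base_function (\<lambda>z. U i r)"
      "(\<lambda>z. V i r) \<in> borel_measurable borel" "base_function (\<lambda>z. V i r)"
      by (auto simp: base_function_def)
    note inv = coordinate_shear_invariance[OF h T i]
    have uv: "AE z in lborel. contracting z \<longrightarrow> h (z + (dU i (U i r) + dV i (V i r))) = h z"
      using fibre_shear_add_invariance[OF fibre_shear_dUV(1)[OF i c(1,2)] _ fibre_shear_dUV(2)[OF i c(3,4)]]
        inv[OF _ _ c(1,2)] inv[OF _ _ c(3,4)] by blast
    have sh: "fibre_shear (\<lambda>z. dU i (U i r) + dV i (V i r))"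
      using i by (auto simp: fibre_shear_def base_function_def fibre_part_add fibre_part_dUV)
    have "fibre_shear (\<lambda>z. (dU i (U i r) + dV i (V i r)) + (\<Sum>i\<in>I. dU i (U i r) + dV i (V i r)))"
      using sh IH(1) by (auto simp: fibre_shear_def base_function_def fibre_part_add)
    then show ?case
      using insert(1,2) fibre_shear_add_invariance[OF sh uv IH] by simp
  qed
  from this[of "{1..<g}"] show ?thesis by (simp add: fibre_part_def)
qed

lemma linear_doubling: "linear (\<lambda>z. z + fibre_part z)" "linear (\<lambda>z. z - (1/2) *\<^sub>R fibre_part z)"
  using linear_fibre_part
  by (auto intro!: linear_compose_add linear_compose_sub linear_ident linear_compose_scale_right simp: id_def)

lemma doubling_inverse:
  "(z - (1/2) *\<^sub>R fibre_part z) + fibre_part (z - (1/2) *\<^sub>R fibre_part z) = z"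
  "(z + fibre_part z) - (1/2) *\<^sub>R fibre_part (z + fibre_part z) = z"
proof -
  have half: "x = (1/2) *\<^sub>R x + (1/2) *\<^sub>R x" for x :: 'x
    by (simp flip: scaleR_left_distrib)
  have f: "fibre_part (z - (1/2) *\<^sub>R fibre_part z) = (1/2) *\<^sub>R fibre_part z"
    using half[of "fibre_part z"] linear_fibre_part
    by (simp add: linear_diff linear_scale fibre_part_idem algebra_simps)
  show "(z - (1/2) *\<^sub>R fibre_part z) + fibre_part (z - (1/2) *\<^sub>R fibre_part z) = z"
    unfolding f by simp
  have "(1/2) *\<^sub>R fibre_part (z + fibre_part z) = fibre_part z"
    using half[of "fibre_part z"] by (simp add: fibre_part_add fibre_part_idem scaleR_add_right)
  then show "(z + fibre_part z) - (1/2) *\<^sub>R fibre_part (z + fibre_part z) = z" by simp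
qed

text \<open>By Fubini's theorem, invariance under all translations of the fibre allows the amount of the
  translation to depend on the point.\<close>

lemma doubling_invariance:
  fixes h :: "'x \<Rightarrow> ennreal"
  assumes h: "h \<in> borel_measurable borel" "\<And>x. h x \<le> 1"
    and T: "\<And>i. i \<in> {1..<g} \<Longrightarrow> AE z in lborel. h (twist i 1 z) = h z"
      "\<And>i. i \<in> {1..<g} \<Longrightarrow> AE z in lborel. h (twist' i 1 z) = h z"
  shows "AE z in lborel. contracting z \<longrightarrow> h (z + fibre_part z) = h z"
proof -
  note [measurable] = h(1)
  have ms: "{x \<in> space (lborel \<Otimes>\<^sub>M lborel). contracting (snd x) \<longrightarrow> h (snd x + fibre_part (fst x)) = h (snd x)}
      \<in> sets ((lborel :: 'x measure) \<Otimes>\<^sub>M (lborel :: 'x measure))" by measurable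
  have "AE r in lborel. AE z in lborel. contracting z \<longrightarrow> h (z + fibre_part r) = h z"
    using fibre_translation_invariance[OF h T] by simp
  then have A: "AE z in lborel. AE r in lborel. contracting z \<longrightarrow> h (z + fibre_part r) = h z"
    using lborel_pair.AE_commute[OF ms] by simp
  have B: "AE z in lborel. AE r in lborel. contracting (z + fibre_part z) \<longrightarrow>
      h ((z + fibre_part z) + fibre_part r) = h (z + fibre_part z)"
    by (rule AE_linear_bijection[OF linear_doubling doubling_inverse A])
  show ?thesis using A B
  proof eventually_elim
    case (elim z)
    have "AE r in lborel. contracting z \<longrightarrow> h (z + fibre_part (r + z)) = h z"
      by (rule lebesgue_preserving_AE[OF lebesgue_preserving_translation elim(1)])
    with elim(2) have "AE r in (lborel :: 'x measure). contracting z \<longrightarrow> h (z + fibre_part z) = h z"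
    proof eventually_elim
      case (elim r)
      then show ?case
        using base_functionD[OF base_function_contracting fibre_part_idem]
        by (auto simp: fibre_part_add add_ac)
    qed
    then show ?case unfolding AE_lborel_const .
  qed
qed

text \<open>The density is bounded after composing with the decreasing map sending x to 1/(1+x). By the
  closedness of the symmetry group, invariance under the twists implies invariance under all fibre
  translations over the contracting region, hence under doubling of the fibre. The scaling law
  says that doubling divides the density by a constant larger than one. A finite positive value is
  impossible.\<close>

theorem no_twist_invariant_density:
  fixes F :: "'x \<Rightarrow> ennreal"
  assumes F: "F \<in> borel_measurable borel"
    and T: "\<And>i. i \<in> {1..<g} \<Longrightarrow> AE z in lborel. F (twist i 1 z) = F z"
      "\<And>i. i \<in> {1..<g} \<Longrightarrow> AE z in lborel. F (twist' i 1 z) = F z"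
    and K: "AE z in lborel. K * F (z + fibre_part z) = F z" "1 < K" "K < \<infinity>"
    and C: "C \<in> sets borel" "\<And>z. z \<in> C \<Longrightarrow> contracting z"
  shows "(\<integral>\<^sup>+z. F z * indicator C z \<partial>lborel) \<in> {0, \<infinity>}"
proof -
  note [measurable] = F C(1)
  define h where "h z = inverse (1 + F z)" for z
  have h_real: "h z = ennreal (inverse (1 + r))" if "F z = ennreal r" "r \<ge> 0" for z r
  proof -
    have "1 + ennreal r = ennreal (1 + r)" using that(2) by (simp add: ennreal_plus)
    then show ?thesis unfolding h_def that(1) using that(2) by (simp only: inverse_ennreal)
  qed
  have h_top: "h z = 0" if "F z = top_class.top" for z using that by (simp add: h_def)
  have h1: "h z \<le> 1" for z
    by (cases "F z") (auto simp: h_top h_real inverse_le_1_iff)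
  have inj: "F z = F y" if "h z = h y" for z y
    by (cases "F z"; cases "F y") (use that in \<open>auto simp: h_top h_real ennreal_inj\<close>)
  have "AE z in lborel. contracting z \<longrightarrow> h (z + fibre_part z) = h z"
  proof (rule doubling_invariance)
    show "h \<in> borel_measurable borel" unfolding h_def[abs_def] by measurable
    show "AE z in lborel. h (twist i 1 z) = h z" if "i \<in> {1..<g}" for i
      using T(1)[OF that] by eventually_elim (simp add: h_def)
    show "AE z in lborel. h (twist' i 1 z) = h z" if "i \<in> {1..<g}" for i
      using T(2)[OF that] by eventually_elim (simp add: h_def)
  qed (rule h1)
  with K(1) have F0: "AE z in lborel. contracting z \<longrightarrow> F z = 0 \<or> F z = \<infinity>"
  proof eventually_elim
    case (elim z)
    show ?case
    proof
      assume "contracting z"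
      then have eq: "K * F z = F z" using elim inj by metis
      show "F z = 0 \<or> F z = \<infinity>"
      proof (rule ccontr)
        assume "\<not> ?thesis"
        then have f: "F z \<noteq> 0" "F z < \<infinity>" by (auto simp: top.not_eq_extremum)
        then have "1 * F z < K * F z" using K(2) by (intro ennreal_mult_strict_right_mono) (auto simp: zero_less_iff_neq_zero)
        then show False using eq by simp
      qed
    qed
  qed
  show ?thesis
  proof (cases "AE z in lborel. F z * indicator C z = 0")
    case True
    then show ?thesis by (simp add: nn_integral_0_iff_AE)
  next
    case False
    have "(\<integral>\<^sup>+z. F z * indicator C z \<partial>lborel) = (\<integral>\<^sup>+z. \<infinity> * (F z * indicator C z) \<partial>lborel)"
      by (rule nn_integral_cong_AE) (use F0 C(2) in \<open>auto elim!: eventually_mono split: split_indicator simp: ennreal_top_mult\<close>)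
    also have "\<dots> = \<infinity> * (\<integral>\<^sup>+z. F z * indicator C z \<partial>lborel)"
      by (rule nn_integral_cmult) measurable
    also have "\<dots> = \<infinity>"
      using False by (simp add: nn_integral_0_iff_AE ennreal_top_mult)
    finally show ?thesis by simp
  qed
qed

end

section \<open>Words and presented groups\<close>

lemma words_simps [simp]:
  "[] \<in> words S" "l # w \<in> words S \<longleftrightarrow> fst l \<in> S \<and> w \<in> words S"
  "u @ v \<in> words S \<longleftrightarrow> u \<in> words S \<and> v \<in> words S"
  by (cases l; auto simp: words_def)+

lemma words_concat: "concat ws \<in> words S \<longleftrightarrow> set ws \<subseteq> words S"
  by (induction ws) auto

subsection \<open>Evaluation of words\<close>

definition eval_word :: "('a, 'm) monoid_scheme \<Rightarrow> ('s \<Rightarrow> 'a) \<Rightarrow> 's word \<Rightarrow> 'a" where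
  "eval_word G \<phi> w = foldr (\<lambda>l y. (if snd l then inv\<^bsub>G\<^esub> (\<phi> (fst l)) else \<phi> (fst l)) \<otimes>\<^bsub>G\<^esub> y) w \<one>\<^bsub>G\<^esub>"

definition word_inverse :: "'s word \<Rightarrow> 's word" where
  "word_inverse w = rev (map (\<lambda>l. (fst l, \<not> snd l)) w)"

definition substitute :: "('s \<Rightarrow> 's word) \<Rightarrow> 's word \<Rightarrow> 's word" where
  "substitute \<sigma> w = concat (map (\<lambda>l. if snd l then word_inverse (\<sigma> (fst l)) else \<sigma> (fst l)) w)"

lemma word_inverse_in_words [simp]: "word_inverse w \<in> words S \<longleftrightarrow> w \<in> words S"
  by (induction w) (auto simp: word_inverse_def)

lemma substitute_simps [simp]:
  "substitute \<sigma> [] = []"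
  "substitute \<sigma> (l # w) = (if snd l then word_inverse (\<sigma> (fst l)) else \<sigma> (fst l)) @ substitute \<sigma> w"
  "substitute \<sigma> (u @ v) = substitute \<sigma> u @ substitute \<sigma> v"
  by (auto simp: substitute_def)

lemma substitute_in_words:
  assumes "\<sigma> \<in> S \<rightarrow> words S" "w \<in> words S"
  shows "substitute \<sigma> w \<in> words S"
  using assms(2) by (induction w) (use assms(1) in auto)

context group
begin

lemma eval_word_Nil [simp]: "eval_word G \<phi> [] = \<one>"
  by (simp add: eval_word_def)

lemma eval_word_Cons [simp]:
  "eval_word G \<phi> (l # w) = (if snd l then inv (\<phi> (fst l)) else \<phi> (fst l)) \<otimes> eval_word G \<phi> w"
  by (simp add: eval_word_def)

lemma eval_word_closed:
  assumes "\<phi> \<in> S \<rightarrow> carrier G" "w \<in> words S"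
  shows "eval_word G \<phi> w \<in> carrier G"
  using assms(2) by (induction w) (use assms(1) in auto)

lemma eval_word_append:
  assumes "\<phi> \<in> S \<rightarrow> carrier G" "u \<in> words S" "v \<in> words S"
  shows "eval_word G \<phi> (u @ v) = eval_word G \<phi> u \<otimes> eval_word G \<phi> v"
  using assms(2) eval_word_closed[OF assms(1) assms(3)]
proof (induction u)
  case (Cons l u)
  then show ?case using eval_word_closed[OF assms(1), of u] assms(1) by (auto simp: m_assoc Pi_iff)
qed simp

lemma eval_word_inverse:
  assumes "\<phi> \<in> S \<rightarrow> carrier G" "w \<in> words S"
  shows "eval_word G \<phi> (word_inverse w) = inv (eval_word G \<phi> w)"
  using assms(2)
proof (induction w)
  case Nil
  then show ?case by (simp add: word_inverse_def)
next
  case (Cons l w)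
  have "word_inverse (l # w) = word_inverse w @ [(fst l, \<not> snd l)]" by (simp add: word_inverse_def)
  moreover have "eval_word G \<phi> (word_inverse w @ [(fst l, \<not> snd l)])
    = eval_word G \<phi> (word_inverse w) \<otimes> eval_word G \<phi> [(fst l, \<not> snd l)]"
    using Cons.prems by (intro eval_word_append[OF assms(1)]) auto
  ultimately show ?case
    using Cons eval_word_closed[OF assms(1), of w] assms(1) by (auto simp: inv_mult_group Pi_iff)
qed

lemma eval_word_substitute:
  assumes "\<phi> \<in> S \<rightarrow> carrier G" "\<sigma> \<in> S \<rightarrow> words S" "w \<in> words S"
  shows "eval_word G \<phi> (substitute \<sigma> w) = eval_word G (\<lambda>s. eval_word G \<phi> (\<sigma> s)) w"
  using assms(3)
proof (induction w)
  case (Cons l w)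
  then have l: "fst l \<in> S" "w \<in> words S" by auto
  have "eval_word G \<phi> ((if snd l then word_inverse (\<sigma> (fst l)) else \<sigma> (fst l)) @ substitute \<sigma> w)
    = eval_word G \<phi> (if snd l then word_inverse (\<sigma> (fst l)) else \<sigma> (fst l)) \<otimes> eval_word G \<phi> (substitute \<sigma> w)"
    by (rule eval_word_append[OF assms(1)]) (use l assms(2) substitute_in_words[OF assms(2), of w] in \<open>auto simp: Pi_iff\<close>)
  moreover have "\<sigma> (fst l) \<in> words S" using l assms(2) by auto
  ultimately show ?case using Cons l eval_word_inverse[OF assms(1), of "\<sigma> (fst l)"] by simp
qed simp

lemma eval_word_cong:
  assumes "\<And>s. s \<in> S \<Longrightarrow> \<phi> s = \<psi> s" "w \<in> words S"
  shows "eval_word G \<phi> w = eval_word G \<psi> w"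
  using assms(2) by (induction w) (auto simp: assms(1))

text \<open>Reductions do not change the value of a word once the relators evaluate to one.\<close>

lemma eval_word_equiv:
  assumes \<phi>: "\<phi> \<in> S \<rightarrow> carrier G" and R: "R \<subseteq> words S" "\<And>r. r \<in> R \<Longrightarrow> eval_word G \<phi> r = \<one>"
    and eq: "(u, v) \<in> word_equiv S R"
  shows "eval_word G \<phi> u = eval_word G \<phi> v"
proof -
  have red: "eval_word G \<phi> u = eval_word G \<phi> v" if uv: "(u, v) \<in> elementary_reduction S R" for u v
  proof -
    obtain x r y where 1: "u = x @ r @ y" "v = x @ y" "x \<in> words S" "y \<in> words S"
      and r: "r \<in> R \<or> (\<exists>s\<in>S. \<exists>e. r = [(s, e), (s, \<not> e)])"
      using uv unfolding elementary_reduction_def by blast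
    have "eval_word G \<phi> r = \<one>" using r \<phi> R(2) by (auto simp: Pi_iff)
    moreover have rw: "r \<in> words S" using r R(1) by auto
    ultimately show ?thesis
      using 1 rw by (simp add: eval_word_append[OF \<phi>] eval_word_closed[OF \<phi>])
  qed
  have "(u, v) \<in> (elementary_reduction S R \<union> (elementary_reduction S R)\<inverse>)\<^sup>*"
    using eq unfolding word_equiv_def by auto
  then show ?thesis
    by (induction rule: rtrancl_induct) (auto dest: red)
qed

end

lemma hom_eval_word:
  assumes "group G" "group H" "f \<in> hom G H" "\<phi> \<in> S \<rightarrow> carrier G" "w \<in> words S"
  shows "f (eval_word G \<phi> w) = eval_word H (\<lambda>s. f (\<phi> s)) w"
proof -
  interpret G: group G by fact
  interpret H: group H by fact
  interpret f: group_hom G H f using assms by (simp add: group_hom_def group_hom_axioms_def)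
  show ?thesis using assms(5)
  proof (induction w)
    case (Cons l w)
    then show ?case using assms(4) G.eval_word_closed[OF assms(4), of w] by (auto simp: Pi_iff)
  qed simp
qed

subsection \<open>Presented groups\<close>

lemma equiv_word_equiv: "equiv (words S) (word_equiv S R)"
proof (rule equivI)
  have "sym ((elementary_reduction S R \<union> (elementary_reduction S R)\<inverse>)\<^sup>*)"
    by (intro sym_rtrancl) (simp add: sym_Un_converse)
  then show "sym (word_equiv S R)" unfolding word_equiv_def by (intro sym_Int) (auto simp: sym_def)
  show "trans (word_equiv S R)" unfolding word_equiv_def by (intro trans_Int trans_rtrancl) (auto simp: trans_def)
qed (auto simp: word_equiv_def refl_on_def)

lemma word_equiv_append:
  assumes "(u, u') \<in> word_equiv S R" "(v, v') \<in> word_equiv S R"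
  shows "(u @ v, u' @ v') \<in> word_equiv S R"
proof -
  let ?Q = "elementary_reduction S R \<union> (elementary_reduction S R)\<inverse>"
  have w: "u \<in> words S" "u' \<in> words S" "v \<in> words S" "v' \<in> words S"
    using assms by (auto simp: word_equiv_def)
  have ext: "(x @ u @ y, x @ v @ y) \<in> ?Q" if "(u, v) \<in> ?Q" "x \<in> words S" "y \<in> words S" for u v x y
  proof -
    have *: "(x @ u @ y, x @ v @ y) \<in> elementary_reduction S R" if uv: "(u, v) \<in> elementary_reduction S R" for u v
    proof -
      obtain a r b where "u = a @ r @ b" "v = a @ b" "a \<in> words S" "b \<in> words S"
        "r \<in> R \<or> (\<exists>s\<in>S. \<exists>e. r = [(s, e), (s, \<not> e)])"
        using uv unfolding elementary_reduction_def by blast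
      then have "x @ u @ y = (x @ a) @ r @ (b @ y)" "x @ v @ y = (x @ a) @ (b @ y)"
        "x @ a \<in> words S" "b @ y \<in> words S" "r \<in> R \<or> (\<exists>s\<in>S. \<exists>e. r = [(s, e), (s, \<not> e)])"
        using \<open>x \<in> words S\<close> \<open>y \<in> words S\<close> by auto
      then show ?thesis unfolding elementary_reduction_def by blast
    qed
    show ?thesis using that(1) * by auto
  qed
  have "(u, u') \<in> ?Q\<^sup>*" "(v, v') \<in> ?Q\<^sup>*" using assms by (auto simp: word_equiv_def)
  have "(u @ v, u' @ v) \<in> ?Q\<^sup>*" using \<open>(u, u') \<in> ?Q\<^sup>*\<close>
  proof (induction rule: rtrancl_induct)
    case (step y z)
    then show ?case using ext[of y z "[]" v] w by (auto intro: rtrancl_into_rtrancl)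
  qed simp
  moreover have "(u' @ v, u' @ v') \<in> ?Q\<^sup>*" using \<open>(v, v') \<in> ?Q\<^sup>*\<close>
  proof (induction rule: rtrancl_induct)
    case (step y z)
    then show ?case using ext[of y z u' "[]"] w by (auto intro: rtrancl_into_rtrancl)
  qed simp
  ultimately show ?thesis using w by (auto simp: word_equiv_def)
qed

lemma word_equiv_reduction:
  assumes "u \<in> words S" "v \<in> words S" "r \<in> words S" "r \<in> R \<or> (\<exists>s\<in>S. \<exists>e. r = [(s, e), (s, \<not> e)])"
  shows "(u @ r @ v, u @ v) \<in> word_equiv S R"
proof -
  have "(u @ r @ v, u @ v) \<in> elementary_reduction S R"
    using assms unfolding elementary_reduction_def by blast
  then show ?thesis using assms by (auto simp: word_equiv_def)
qed

lemma word_equiv_mono: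
  assumes "R \<subseteq> R'"
  shows "word_equiv S R \<subseteq> word_equiv S R'"
proof -
  have "elementary_reduction S R \<subseteq> elementary_reduction S R'"
    using assms unfolding elementary_reduction_def by blast
  then have "(elementary_reduction S R \<union> (elementary_reduction S R)\<inverse>)\<^sup>*
     \<subseteq> (elementary_reduction S R' \<union> (elementary_reduction S R')\<inverse>)\<^sup>*"
    by (intro rtrancl_mono) auto
  then show ?thesis unfolding word_equiv_def by auto
qed

definition word_class :: "'s set \<Rightarrow> 's word set \<Rightarrow> 's word \<Rightarrow> 's word set" where
  "word_class S R w = word_equiv S R `` {w}"

lemma word_class_eq_iff:
  "u \<in> words S \<Longrightarrow> v \<in> words S \<Longrightarrow> word_class S R u = word_class S R v \<longleftrightarrow> (u, v) \<in> word_equiv S R"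
  unfolding word_class_def using equiv_word_equiv by (metis eq_equiv_class_iff)

lemma carrier_presented_group: "carrier (presented_group S R) = word_class S R ` words S"
  unfolding presented_group_def word_class_def quotient_def by auto

lemma one_presented_group: "\<one>\<^bsub>presented_group S R\<^esub> = word_class S R []"
  unfolding presented_group_def word_class_def by simp

lemma mult_presented_group:
  assumes "u \<in> words S" "v \<in> words S"
  shows "word_class S R u \<otimes>\<^bsub>presented_group S R\<^esub> word_class S R v = word_class S R (u @ v)"
proof -
  have "word_equiv S R `` {u' @ v' |u' v'. u' \<in> word_class S R u \<and> v' \<in> word_class S R v} = word_class S R (u @ v)"
  proof (intro equalityI subsetI)
    fix x assume "x \<in> word_equiv S R `` {u' @ v' |u' v'. u' \<in> word_class S R u \<and> v' \<in> word_class S R v}"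
    then obtain u' v' where "(u' @ v', x) \<in> word_equiv S R" "(u, u') \<in> word_equiv S R" "(v, v') \<in> word_equiv S R"
      unfolding word_class_def by auto
    then show "x \<in> word_class S R (u @ v)"
      using word_equiv_append equiv_word_equiv unfolding word_class_def equiv_def trans_def by blast
  next
    fix x assume "x \<in> word_class S R (u @ v)"
    moreover have "u \<in> word_class S R u" "v \<in> word_class S R v"
      using assms equiv_word_equiv unfolding word_class_def equiv_def refl_on_def by auto
    ultimately show "x \<in> word_equiv S R `` {u' @ v' |u' v'. u' \<in> word_class S R u \<and> v' \<in> word_class S R v}"
      unfolding word_class_def by blast
  qed
  then show ?thesis unfolding presented_group_def by simp
qed

lemma word_inverse_equiv:
  assumes "w \<in> words S"
  shows "(word_inverse w @ w, []) \<in> word_equiv S R"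
  using assms
proof (induction w)
  case Nil
  then show ?case using equiv_word_equiv[of S R] by (auto simp: word_inverse_def equiv_def refl_on_def)
next
  case (Cons l w)
  have "word_inverse (l # w) @ (l # w) = word_inverse w @ [(fst l, \<not> snd l), (fst l, \<not> \<not> snd l)] @ w"
    by (simp add: word_inverse_def)
  moreover have "(word_inverse w @ [(fst l, \<not> snd l), (fst l, \<not> \<not> snd l)] @ w, word_inverse w @ w) \<in> word_equiv S R"
    by (rule word_equiv_reduction) (use Cons.prems in auto)
  ultimately show ?case
    using Cons equiv_word_equiv[of S R] unfolding equiv_def trans_def by (metis words_simps(2))
qed

lemma group_presented_group: "group (presented_group S R)"
proof (rule groupI)
  show "\<one>\<^bsub>presented_group S R\<^esub> \<in> carrier (presented_group S R)"
    unfolding carrier_presented_group one_presented_group by auto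
  fix x assume x: "x \<in> carrier (presented_group S R)"
  then obtain u where u: "u \<in> words S" "x = word_class S R u" by (auto simp: carrier_presented_group)
  show "\<one>\<^bsub>presented_group S R\<^esub> \<otimes>\<^bsub>presented_group S R\<^esub> x = x"
    using u by (simp add: one_presented_group mult_presented_group)
  have "word_class S R (word_inverse u) \<otimes>\<^bsub>presented_group S R\<^esub> x = \<one>\<^bsub>presented_group S R\<^esub>"
    using u by (simp add: one_presented_group mult_presented_group word_class_eq_iff word_inverse_equiv)
  then show "\<exists>y\<in>carrier (presented_group S R). y \<otimes>\<^bsub>presented_group S R\<^esub> x = \<one>\<^bsub>presented_group S R\<^esub>"
    using u by (auto simp: carrier_presented_group intro!: bexI[of _ "word_class S R (word_inverse u)"])
  fix y assume "y \<in> carrier (presented_group S R)"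
  then obtain v where v: "v \<in> words S" "y = word_class S R v" by (auto simp: carrier_presented_group)
  show "x \<otimes>\<^bsub>presented_group S R\<^esub> y \<in> carrier (presented_group S R)"
    using u v by (auto simp: mult_presented_group carrier_presented_group)
  fix z assume "z \<in> carrier (presented_group S R)"
  then obtain w where w: "w \<in> words S" "z = word_class S R w" by (auto simp: carrier_presented_group)
  show "x \<otimes>\<^bsub>presented_group S R\<^esub> y \<otimes>\<^bsub>presented_group S R\<^esub> z =
     x \<otimes>\<^bsub>presented_group S R\<^esub> (y \<otimes>\<^bsub>presented_group S R\<^esub> z)"
    using u v w by (simp add: mult_presented_group)
qed

lemma word_class_in_carrier: "w \<in> words S \<Longrightarrow> word_class S R w \<in> carrier (presented_group S R)"
  by (simp add: carrier_presented_group)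

lemma inv_presented_group:
  assumes "w \<in> words S"
  shows "inv\<^bsub>presented_group S R\<^esub> (word_class S R w) = word_class S R (word_inverse w)"
proof -
  interpret group "presented_group S R" by (rule group_presented_group)
  show ?thesis
    by (rule inv_equality)
       (use assms in \<open>auto simp: mult_presented_group one_presented_group word_class_eq_iff word_inverse_equiv
          intro: word_class_in_carrier\<close>)
qed

lemma eval_word_presented_group:
  assumes "w \<in> words S"
  shows "eval_word (presented_group S R) (\<lambda>s. word_class S R [(s, False)]) w = word_class S R w"
proof -
  interpret group "presented_group S R" by (rule group_presented_group)
  show ?thesis using assms
  proof (induction w)
    case Nil
    then show ?case by (simp add: one_presented_group)
  next
    case (Cons l w)
    then show ?case
      by (cases l) (auto simp: mult_presented_group inv_presented_group word_inverse_def)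
  qed
qed

text \<open>The value on a class is read off from any representing word.\<close>

definition presented_lift :: "'s set \<Rightarrow> 's word set \<Rightarrow> ('a, 'm) monoid_scheme \<Rightarrow> ('s \<Rightarrow> 'a) \<Rightarrow> 's word set \<Rightarrow> 'a" where
  "presented_lift S R G \<phi> = (\<lambda>X\<in>carrier (presented_group S R). eval_word G \<phi> (SOME w. w \<in> words S \<and> X = word_class S R w))"

locale presented_assignment = group G for G (structure) +
  fixes S :: "'s set" and R and \<phi> :: "'s \<Rightarrow> 'a"
  assumes assign: "\<phi> \<in> S \<rightarrow> carrier G"
    and relators: "R \<subseteq> words S" "\<And>r. r \<in> R \<Longrightarrow> eval_word G \<phi> r = \<one>"
begin

lemma presented_lift_class:
  assumes "w \<in> words S"
  shows "presented_lift S R G \<phi> (word_class S R w) = eval_word G \<phi> w"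
proof -
  define v where "v = (SOME v. v \<in> words S \<and> word_class S R w = word_class S R v)"
  have v: "v \<in> words S \<and> word_class S R w = word_class S R v"
    unfolding v_def by (rule someI[of _ w]) (use assms in auto)
  then have e: "(w, v) \<in> word_equiv S R" using word_class_eq_iff[of w S v R] assms by blast
  have "eval_word G \<phi> w = eval_word G \<phi> v"
    by (rule eval_word_equiv[OF assign relators(1) relators(2) e])
  then show ?thesis using assms by (simp add: presented_lift_def word_class_in_carrier v_def)
qed

lemma presented_lift_hom: "presented_lift S R G \<phi> \<in> hom (presented_group S R) G"
  by (rule homI)
     (auto simp: carrier_presented_group presented_lift_class mult_presented_group
        eval_word_append[OF assign] intro: eval_word_closed[OF assign])

end

lemma presented_hom_eqI:
  assumes "group G" "f \<in> hom (presented_group S R) G" "f' \<in> hom (presented_group S R) G"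
    and "\<And>s. s \<in> S \<Longrightarrow> f (word_class S R [(s, False)]) = f' (word_class S R [(s, False)])"
    and "x \<in> carrier (presented_group S R)"
  shows "f x = f' x"
proof -
  interpret G: group G by fact
  obtain w where w: "w \<in> words S" "x = word_class S R w" using assms(5) by (auto simp: carrier_presented_group)
  have "k x = eval_word G (\<lambda>s. k (word_class S R [(s, False)])) w" if k: "k \<in> hom (presented_group S R) G" for k
    using hom_eval_word[OF group_presented_group assms(1) k, where S = S and \<phi> = "\<lambda>s. word_class S R [(s, False)]" and w = w] w
    by (simp add: eval_word_presented_group word_class_in_carrier)
  note k = this
  show ?thesis unfolding k[OF assms(2)] k[OF assms(3)]
    by (rule G.eval_word_cong[OF _ w(1)]) (rule assms(4))
qed

section \<open>One-relator groups and their second cohomology\<close>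

subsection \<open>Central extensions\<close>

text \<open>The group law on pairs attached to a two-cocycle. The unit is not (1, 0) because the cocycle
  need not be normalized.\<close>

definition central_extension :: "('a, 'm) monoid_scheme \<Rightarrow> ('a \<Rightarrow> 'a \<Rightarrow> int) \<Rightarrow> ('a \<times> int) monoid" where
  "central_extension G c = \<lparr>carrier = carrier G \<times> UNIV,
     mult = (\<lambda>p q. (fst p \<otimes>\<^bsub>G\<^esub> fst q, snd p + snd q + c (fst p) (fst q))),
     one = (\<one>\<^bsub>G\<^esub>, - c \<one>\<^bsub>G\<^esub> \<one>\<^bsub>G\<^esub>)\<rparr>"

lemma central_extension_simps [simp]:
  "carrier (central_extension G c) = carrier G \<times> UNIV"
  "p \<otimes>\<^bsub>central_extension G c\<^esub> q = (fst p \<otimes>\<^bsub>G\<^esub> fst q, snd p + snd q + c (fst p) (fst q))"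
  "\<one>\<^bsub>central_extension G c\<^esub> = (\<one>\<^bsub>G\<^esub>, - c \<one>\<^bsub>G\<^esub> \<one>\<^bsub>G\<^esub>)"
  by (auto simp: central_extension_def)

context group
begin

lemma two_cocycle_one:
  assumes "two_cocycle G c" "x \<in> carrier G"
  shows "c \<one> x = c \<one> \<one>" "c x \<one> = c \<one> \<one>"
proof -
  have "c \<one> x - c (\<one> \<otimes> \<one>) x + c \<one> (\<one> \<otimes> x) - c \<one> \<one> = 0"
    "c \<one> \<one> - c (x \<otimes> \<one>) \<one> + c x (\<one> \<otimes> \<one>) - c x \<one> = 0"
    using assms unfolding two_cocycle_def by blast+
  then show "c \<one> x = c \<one> \<one>" using assms(2) by simp
  have "c \<one> \<one> - c (x \<otimes> \<one>) \<one> + c x (\<one> \<otimes> \<one>) - c x \<one> = 0"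
    "c \<one> x - c (x \<otimes> \<one>) x + c x (\<one> \<otimes> x) - c x \<one> = 0"
    using assms unfolding two_cocycle_def by blast+
  then show "c x \<one> = c \<one> \<one>" using assms(2) \<open>c \<one> x = c \<one> \<one>\<close> by simp
qed

lemma group_central_extension:
  assumes c: "two_cocycle G c"
  shows "group (central_extension G c)"
proof (rule groupI)
  fix p q r assume "p \<in> carrier (central_extension G c)" "q \<in> carrier (central_extension G c)" "r \<in> carrier (central_extension G c)"
  then have x: "fst p \<in> carrier G" "fst q \<in> carrier G" "fst r \<in> carrier G" by auto
  then have "c (fst q) (fst r) - c (fst p \<otimes> fst q) (fst r) + c (fst p) (fst q \<otimes> fst r) - c (fst p) (fst q) = 0"
    using c unfolding two_cocycle_def by blast
  then show "p \<otimes>\<^bsub>central_extension G c\<^esub> q \<otimes>\<^bsub>central_extension G c\<^esub> r = p \<otimes>\<^bsub>central_extension G c\<^esub> (q \<otimes>\<^bsub>central_extension G c\<^esub> r)"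
    using x by (simp add: m_assoc)
next
  fix p assume p: "p \<in> carrier (central_extension G c)"
  then have x: "fst p \<in> carrier G" by auto
  show "\<one>\<^bsub>central_extension G c\<^esub> \<otimes>\<^bsub>central_extension G c\<^esub> p = p"
    using x two_cocycle_one[OF c x] by (simp add: prod_eq_iff)
  show "\<exists>q\<in>carrier (central_extension G c). q \<otimes>\<^bsub>central_extension G c\<^esub> p = \<one>\<^bsub>central_extension G c\<^esub>"
    using x by (intro bexI[of _ "(inv (fst p), - snd p - c (inv (fst p)) (fst p) - c \<one> \<one>)"]) auto
qed auto

lemma inv_central_extension:
  assumes c: "two_cocycle G c" and p: "p \<in> carrier (central_extension G c)"
  shows "inv\<^bsub>central_extension G c\<^esub> p = (inv (fst p), - snd p - c (inv (fst p)) (fst p) - c \<one> \<one>)"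
proof -
  interpret E: group "central_extension G c" by (rule group_central_extension[OF c])
  show ?thesis
    by (rule E.inv_equality) (use p in auto)
qed

end

subsection \<open>Automorphisms of a one-relator group\<close>

locale one_relator =
  fixes S :: "'s set" and r :: "'s word"
  assumes relator_word: "r \<in> words S"
begin

abbreviation "\<Gamma> \<equiv> presented_group S {r}"
abbreviation "cl \<equiv> word_class S {r}"

sublocale \<Gamma>: group \<Gamma>
  by (rule group_presented_group)

lemma cl_relator: "cl r = \<one>\<^bsub>\<Gamma>\<^esub>"
  using word_equiv_reduction[of "[]" S "[]" r "{r}"] relator_word
  by (simp add: one_presented_group word_class_eq_iff)

lemma cl_closed [simp]: "w \<in> words S \<Longrightarrow> cl w \<in> carrier \<Gamma>"
  by (rule word_class_in_carrier)

lemma fst_eval_extension: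
  assumes c: "two_cocycle \<Gamma> c" and w: "w \<in> words S"
  shows "fst (eval_word (central_extension \<Gamma> c) (\<lambda>s. (cl [(s, False)], k s)) w) = cl w"
proof -
  interpret E: group "central_extension \<Gamma> c" by (rule \<Gamma>.group_central_extension[OF c])
  have "fst \<in> hom (central_extension \<Gamma> c) \<Gamma>" by (auto simp: hom_def)
  from hom_eval_word[OF E.is_group \<Gamma>.is_group this, where S = S and \<phi> = "\<lambda>s. (cl [(s, False)], k s)" and w = w]
  show ?thesis using w by (simp add: eval_word_presented_group)
qed

text \<open>A homomorphism lifts to the central extension exactly when it preserves the class; for a one-
  relator group a lift exists as soon as the relator keeps its value in the extension. The second
  component of the lift is the cochain that is needed.\<close>

lemma preserves_class_if_lift:
  assumes \<kappa>: "two_cocycle \<Gamma> \<kappa>" and f: "f \<in> hom \<Gamma> \<Gamma>"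
    and lift: "\<psi> \<in> S \<rightarrow> carrier (central_extension \<Gamma> \<kappa>)" "\<And>s. s \<in> S \<Longrightarrow> fst (\<psi> s) = f (cl [(s, False)])"
      "eval_word (central_extension \<Gamma> \<kappa>) \<psi> r = eval_word (central_extension \<Gamma> \<kappa>) (\<lambda>s. (cl [(s, False)], 0)) r"
  shows "preserves_class \<Gamma> \<kappa> f"
proof -
  define c where "c x y = \<kappa> (f x) (f y) - \<kappa> x y" for x y
  interpret f: group_hom \<Gamma> \<Gamma> f
    using f by (simp add: group_hom_def group_hom_axioms_def \<Gamma>.is_group)
  have c: "two_cocycle \<Gamma> c"
    unfolding two_cocycle_def
  proof (intro ballI)
    fix x y z assume xyz: "x \<in> carrier \<Gamma>" "y \<in> carrier \<Gamma>" "z \<in> carrier \<Gamma>"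
    then have "f x \<in> carrier \<Gamma>" "f y \<in> carrier \<Gamma>" "f z \<in> carrier \<Gamma>" by auto
    then have "\<kappa> (f y) (f z) - \<kappa> (f x \<otimes>\<^bsub>\<Gamma>\<^esub> f y) (f z) + \<kappa> (f x) (f y \<otimes>\<^bsub>\<Gamma>\<^esub> f z) - \<kappa> (f x) (f y) = 0"
      "\<kappa> y z - \<kappa> (x \<otimes>\<^bsub>\<Gamma>\<^esub> y) z + \<kappa> x (y \<otimes>\<^bsub>\<Gamma>\<^esub> z) - \<kappa> x y = 0"
      using \<kappa> xyz unfolding two_cocycle_def by blast+
    then show "c y z - c (x \<otimes>\<^bsub>\<Gamma>\<^esub> y) z + c x (y \<otimes>\<^bsub>\<Gamma>\<^esub> z) - c x y = 0"
      using xyz by (simp add: c_def)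
  qed
  let ?E = "central_extension \<Gamma> \<kappa>" and ?Q = "central_extension \<Gamma> c"
  interpret E: group ?E by (rule \<Gamma>.group_central_extension[OF \<kappa>])
  interpret Q: group ?Q by (rule \<Gamma>.group_central_extension[OF c])
  define \<phi> where "\<phi> s = (cl [(s, False)], 0 :: int)" for s
  define q where "q s = (cl [(s, False)], snd (\<psi> s))" for s
  have \<phi>: "\<phi> \<in> S \<rightarrow> carrier ?E" by (auto simp: \<phi>_def)
  have q: "q \<in> S \<rightarrow> carrier ?Q" by (auto simp: q_def)
  have c1: "c \<one>\<^bsub>\<Gamma>\<^esub> \<one>\<^bsub>\<Gamma>\<^esub> = 0" by (simp add: c_def)
  have ev: "fst (eval_word ?E \<psi> w) = f (fst (eval_word ?E \<phi> w)) \<and>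
     eval_word ?Q q w = (fst (eval_word ?E \<phi> w), snd (eval_word ?E \<psi> w) - snd (eval_word ?E \<phi> w))"
    if "w \<in> words S" for w
    using that
  proof (induction w)
    case Nil
    then show ?case by (simp add: c1)
  next
    case (Cons l w)
    then have l: "fst l \<in> S" and w: "w \<in> words S" by auto
    have \<psi>l: "\<psi> (fst l) \<in> carrier ?E" "fst (\<psi> (fst l)) = f (cl [(fst l, False)])" and \<phi>l: "\<phi> (fst l) \<in> carrier ?E"
      and ql: "q (fst l) \<in> carrier ?Q"
      using lift(2) l funcset_mem[OF lift(1) l] funcset_mem[OF \<phi> l] funcset_mem[OF q l] by auto
    have ew: "fst (eval_word ?E \<phi> w) \<in> carrier \<Gamma>"
      using E.eval_word_closed[OF \<phi> w] by auto
    have cll: "cl [(fst l, False)] \<in> carrier \<Gamma>" using l by simp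
    have vals: "\<phi> (fst l) = (cl [(fst l, False)], 0)" "q (fst l) = (cl [(fst l, False)], snd (\<psi> (fst l)))"
      by (simp_all add: \<phi>_def q_def)
    note cv = c_def[of "cl [(fst l, False)]" "fst (eval_word ?E \<phi> w)"]
      c_def[of "inv\<^bsub>\<Gamma>\<^esub> cl [(fst l, False)]" "fst (eval_word ?E \<phi> w)"]
      c_def[of "inv\<^bsub>\<Gamma>\<^esub> cl [(fst l, False)]" "cl [(fst l, False)]"]
    show ?case
    proof (cases "snd l")
      case False
      then show ?thesis using Cons.IH[OF w] \<psi>l \<phi>l ew cll
        by (simp add: vals cv)
    next
      case True
      then show ?thesis using Cons.IH[OF w] \<psi>l \<phi>l ql ew cll
        by (simp add: \<Gamma>.inv_central_extension[OF \<kappa>] \<Gamma>.inv_central_extension[OF c] c1 vals cv)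
    qed
  qed
  have "fst (eval_word ?E \<phi> r) = \<one>\<^bsub>\<Gamma>\<^esub>"
    using fst_eval_extension[OF \<kappa> relator_word, of "\<lambda>s. 0"] by (simp add: \<phi>_def[abs_def] cl_relator)
  then have "eval_word ?Q q r = \<one>\<^bsub>?Q\<^esub>"
    using ev[OF relator_word] lift(3) by (simp add: \<phi>_def[abs_def] c1)
  then interpret L: presented_assignment ?Q S "{r}" q
    by unfold_locales (use q relator_word in auto)
  define \<Phi> where "\<Phi> = presented_lift S {r} ?Q q"
  have \<Phi>: "\<Phi> \<in> hom \<Gamma> ?Q" unfolding \<Phi>_def by (rule L.presented_lift_hom)
  have "fst (\<Phi> x) = x" if "x \<in> carrier \<Gamma>" for x
  proof (rule presented_hom_eqI[OF \<Gamma>.is_group _ _ _ that, where f' = "\<lambda>x. x" and f = "\<lambda>x. fst (\<Phi> x)"])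
    show "(\<lambda>x. fst (\<Phi> x)) \<in> hom \<Gamma> \<Gamma>" using \<Phi> by (force simp: hom_def Pi_iff)
    show "(\<lambda>x. x) \<in> hom \<Gamma> \<Gamma>" by (auto simp: hom_def)
    show "fst (\<Phi> (cl [(s, False)])) = cl [(s, False)]" if "s \<in> S" for s
    proof -
      have "\<Phi> (cl [(s, False)]) = eval_word ?Q q [(s, False)]"
        unfolding \<Phi>_def by (rule L.presented_lift_class) (use that in simp)
      then show ?thesis using q that by (simp add: q_def)
    qed
  qed
  then have "snd (\<Phi> (x \<otimes>\<^bsub>\<Gamma>\<^esub> y)) = snd (\<Phi> x) + snd (\<Phi> y) + c x y" if "x \<in> carrier \<Gamma>" "y \<in> carrier \<Gamma>" for x y
    using hom_mult[OF \<Phi> that] that by simp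
  then have "two_coboundary \<Gamma> c"
    unfolding two_coboundary_def by (intro exI[of _ "\<lambda>x. - snd (\<Phi> x)"]) auto
  then show ?thesis unfolding preserves_class_def c_def .
qed

lemma preserves_class_compose:
  assumes "preserves_class \<Gamma> \<kappa> f" "preserves_class \<Gamma> \<kappa> f'" "f' \<in> hom \<Gamma> \<Gamma>"
  shows "preserves_class \<Gamma> \<kappa> (compose (carrier \<Gamma>) f f')"
proof -
  obtain b b' where b: "\<And>x y. x \<in> carrier \<Gamma> \<Longrightarrow> y \<in> carrier \<Gamma> \<Longrightarrow> \<kappa> (f x) (f y) - \<kappa> x y = b y - b (x \<otimes>\<^bsub>\<Gamma>\<^esub> y) + b x"
    and b': "\<And>x y. x \<in> carrier \<Gamma> \<Longrightarrow> y \<in> carrier \<Gamma> \<Longrightarrow> \<kappa> (f' x) (f' y) - \<kappa> x y = b' y - b' (x \<otimes>\<^bsub>\<Gamma>\<^esub> y) + b' x"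
    using assms(1,2) unfolding preserves_class_def two_coboundary_def by blast
  have "\<kappa> (f (f' x)) (f (f' y)) - \<kappa> x y = (b (f' y) + b' y) - (b (f' (x \<otimes>\<^bsub>\<Gamma>\<^esub> y)) + b' (x \<otimes>\<^bsub>\<Gamma>\<^esub> y)) + (b (f' x) + b' x)"
    if "x \<in> carrier \<Gamma>" "y \<in> carrier \<Gamma>" for x y
    using b[of "f' x" "f' y"] b'[OF that] that hom_mult[OF assms(3) that] hom_in_carrier[OF assms(3)] by simp
  then show ?thesis
    unfolding preserves_class_def two_coboundary_def
    by (intro exI[of _ "\<lambda>x. b (f' x) + b' x"]) (auto simp: compose_def)
qed

definition conjugation :: "'s word set \<Rightarrow> 's word set \<Rightarrow> 's word set" where
  "conjugation a = (\<lambda>x\<in>carrier \<Gamma>. a \<otimes>\<^bsub>\<Gamma>\<^esub> x \<otimes>\<^bsub>\<Gamma>\<^esub> inv\<^bsub>\<Gamma>\<^esub> a)"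

lemma group_conjugation_hom:
  assumes "group G" "a \<in> carrier G"
  shows "(\<lambda>x. a \<otimes>\<^bsub>G\<^esub> x \<otimes>\<^bsub>G\<^esub> inv\<^bsub>G\<^esub> a) \<in> hom G G"
proof -
  interpret group G by fact
  show ?thesis
  proof (rule homI)
    fix x y assume "x \<in> carrier G" "y \<in> carrier G"
    then show "a \<otimes>\<^bsub>G\<^esub> (x \<otimes>\<^bsub>G\<^esub> y) \<otimes>\<^bsub>G\<^esub> inv\<^bsub>G\<^esub> a = a \<otimes>\<^bsub>G\<^esub> x \<otimes>\<^bsub>G\<^esub> inv\<^bsub>G\<^esub> a \<otimes>\<^bsub>G\<^esub> (a \<otimes>\<^bsub>G\<^esub> y \<otimes>\<^bsub>G\<^esub> inv\<^bsub>G\<^esub> a)"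
      using assms by (simp add: m_assoc inv_solve_left'[symmetric] flip: m_assoc[of "inv\<^bsub>G\<^esub> a" a])
  qed (use assms in auto)
qed

lemma conjugation_hom: "a \<in> carrier \<Gamma> \<Longrightarrow> conjugation a \<in> hom \<Gamma> \<Gamma>"
  using group_conjugation_hom[OF \<Gamma>.is_group, of a] unfolding conjugation_def hom_def by auto

text \<open>Conjugation lifts to conjugation in the central extension.\<close>

lemma preserves_class_conjugation:
  assumes \<kappa>: "two_cocycle \<Gamma> \<kappa>" and a: "a \<in> carrier \<Gamma>"
  shows "preserves_class \<Gamma> \<kappa> (conjugation a)"
proof (rule preserves_class_if_lift[OF \<kappa> conjugation_hom[OF a]])
  let ?E = "central_extension \<Gamma> \<kappa>"
  interpret E: group ?E by (rule \<Gamma>.group_central_extension[OF \<kappa>])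
  let ?\<phi> = "\<lambda>s. (cl [(s, False)], 0 :: int)"
  have aE: "(a, 0) \<in> carrier ?E" using a by simp
  have \<phi>: "?\<phi> \<in> S \<rightarrow> carrier ?E" by auto
  let ?\<psi> = "\<lambda>s. (a, 0) \<otimes>\<^bsub>?E\<^esub> ?\<phi> s \<otimes>\<^bsub>?E\<^esub> inv\<^bsub>?E\<^esub> (a, 0)"
  show "?\<psi> \<in> S \<rightarrow> carrier ?E" using aE \<phi> E.m_closed E.inv_closed by blast
  show "fst (?\<psi> s) = conjugation a (cl [(s, False)])" if "s \<in> S" for s
    using that a \<Gamma>.inv_central_extension[OF \<kappa> aE] by (simp add: conjugation_def)
  have "eval_word ?E ?\<psi> r = (a, 0) \<otimes>\<^bsub>?E\<^esub> eval_word ?E ?\<phi> r \<otimes>\<^bsub>?E\<^esub> inv\<^bsub>?E\<^esub> (a, 0)"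
    by (rule hom_eval_word[OF E.is_group E.is_group group_conjugation_hom[OF E.is_group aE] \<phi> relator_word, symmetric])
  also have "(a, 0) \<otimes>\<^bsub>?E\<^esub> eval_word ?E ?\<phi> r = eval_word ?E ?\<phi> r \<otimes>\<^bsub>?E\<^esub> (a, 0)"
    using fst_eval_extension[OF \<kappa> relator_word, of "\<lambda>s. 0"] \<Gamma>.two_cocycle_one[OF \<kappa> a] a
    by (simp add: cl_relator)
  also have "eval_word ?E ?\<phi> r \<otimes>\<^bsub>?E\<^esub> (a, 0) \<otimes>\<^bsub>?E\<^esub> inv\<^bsub>?E\<^esub> (a, 0) = eval_word ?E ?\<phi> r"
    by (rule E.inv_solve_right'[THEN iffD2]) (use aE E.eval_word_closed[OF \<phi> relator_word] in auto)
  finally show "eval_word ?E ?\<psi> r = eval_word ?E ?\<phi> r" .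
qed

text \<open>The relator is preserved in the free group, and not only up to conjugation or inversion; this is
  what makes the automorphism orientation preserving.\<close>

definition relator_substitution :: "('s \<Rightarrow> 's word) \<Rightarrow> bool" where
  "relator_substitution \<sigma> \<longleftrightarrow> \<sigma> \<in> S \<rightarrow> words S \<and> (substitute \<sigma> r, r) \<in> word_equiv S {}"

definition endomorphism :: "('s \<Rightarrow> 's word) \<Rightarrow> 's word set \<Rightarrow> 's word set" where
  "endomorphism \<sigma> = presented_lift S {r} \<Gamma> (\<lambda>s. cl (\<sigma> s))"

lemma cl_cong: "(u, v) \<in> word_equiv S {} \<Longrightarrow> cl u = cl v"
  using word_equiv_mono[of "{}" "{r}" S] word_class_eq_iff[of u S v "{r}"]
  by (auto simp: word_equiv_def)

lemma eval_cl_substitute: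
  assumes "\<sigma> \<in> S \<rightarrow> words S" "w \<in> words S"
  shows "eval_word \<Gamma> (\<lambda>s. cl (\<sigma> s)) w = cl (substitute \<sigma> w)"
proof -
  have "eval_word \<Gamma> (\<lambda>s. cl (\<sigma> s)) w = eval_word \<Gamma> (\<lambda>s. eval_word \<Gamma> (\<lambda>s. cl [(s, False)]) (\<sigma> s)) w"
    by (rule \<Gamma>.eval_word_cong[OF _ assms(2)]) (use assms(1) in \<open>auto simp: eval_word_presented_group Pi_iff\<close>)
  also have "\<dots> = eval_word \<Gamma> (\<lambda>s. cl [(s, False)]) (substitute \<sigma> w)"
    by (rule \<Gamma>.eval_word_substitute[OF _ assms, symmetric]) auto
  also have "\<dots> = cl (substitute \<sigma> w)"
    by (rule eval_word_presented_group[OF substitute_in_words[OF assms]])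
  finally show ?thesis .
qed

lemma endomorphism_assignment:
  assumes "relator_substitution \<sigma>"
  shows "presented_assignment \<Gamma> S {r} (\<lambda>s. cl (\<sigma> s))"
proof -
  have \<sigma>: "\<sigma> \<in> S \<rightarrow> words S" "(substitute \<sigma> r, r) \<in> word_equiv S {}"
    using assms by (auto simp: relator_substitution_def)
  show ?thesis
    by unfold_locales
       (use \<sigma> relator_word eval_cl_substitute[OF \<sigma>(1) relator_word] cl_cong[OF \<sigma>(2)] cl_relator in \<open>auto simp: Pi_iff\<close>)
qed

lemma endomorphism_cl:
  assumes "relator_substitution \<sigma>" "w \<in> words S"
  shows "endomorphism \<sigma> (cl w) = cl (substitute \<sigma> w)"
  using presented_assignment.presented_lift_class[OF endomorphism_assignment[OF assms(1)] assms(2)]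
    eval_cl_substitute[OF _ assms(2)] assms(1) by (simp add: endomorphism_def relator_substitution_def)

lemma endomorphism_hom: "relator_substitution \<sigma> \<Longrightarrow> endomorphism \<sigma> \<in> hom \<Gamma> \<Gamma>"
  unfolding endomorphism_def by (rule presented_assignment.presented_lift_hom[OF endomorphism_assignment])

text \<open>A substitution that fixes the relator as an element of the free group also fixes its value in
  every central extension, so that the homomorphism lifts.\<close>

lemma preserves_class_endomorphism:
  assumes \<kappa>: "two_cocycle \<Gamma> \<kappa>" and \<sigma>: "relator_substitution \<sigma>"
  shows "preserves_class \<Gamma> \<kappa> (endomorphism \<sigma>)"
proof (rule preserves_class_if_lift[OF \<kappa> endomorphism_hom[OF \<sigma>]])
  let ?E = "central_extension \<Gamma> \<kappa>"
  interpret E: group ?E by (rule \<Gamma>.group_central_extension[OF \<kappa>])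
  let ?\<phi> = "\<lambda>s. (cl [(s, False)], 0 :: int)"
  have \<phi>: "?\<phi> \<in> S \<rightarrow> carrier ?E" by auto
  have \<sigma>': "\<sigma> \<in> S \<rightarrow> words S" "(substitute \<sigma> r, r) \<in> word_equiv S {}"
    using \<sigma> by (auto simp: relator_substitution_def)
  let ?\<psi> = "\<lambda>s. eval_word ?E ?\<phi> (\<sigma> s)"
  show "?\<psi> \<in> S \<rightarrow> carrier ?E" using E.eval_word_closed[OF \<phi>] \<sigma>'(1) by blast
  show "fst (?\<psi> s) = endomorphism \<sigma> (cl [(s, False)])" if "s \<in> S" for s
  proof -
    have "\<sigma> s \<in> words S" using \<sigma>' that by auto
    then show ?thesis
      using that fst_eval_extension[OF \<kappa>, of "\<sigma> s" "\<lambda>s. 0"] endomorphism_cl[OF \<sigma>, of "[(s, False)]"] by simp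
  qed
  have "eval_word ?E ?\<psi> r = eval_word ?E ?\<phi> (substitute \<sigma> r)"
    by (rule E.eval_word_substitute[OF \<phi> \<sigma>'(1) relator_word, symmetric])
  also have "\<dots> = eval_word ?E ?\<phi> r"
    by (rule E.eval_word_equiv[OF \<phi> _ _ \<sigma>'(2)]) auto
  finally show "eval_word ?E ?\<psi> r = eval_word ?E ?\<phi> r" .
qed

definition inverse_substitutions :: "('s \<Rightarrow> 's word) \<Rightarrow> ('s \<Rightarrow> 's word) \<Rightarrow> bool" where
  "inverse_substitutions \<sigma> \<tau> \<longleftrightarrow> relator_substitution \<sigma> \<and> relator_substitution \<tau> \<and>
     (\<forall>s\<in>S. (substitute \<sigma> (\<tau> s), [(s, False)]) \<in> word_equiv S {} \<and>
            (substitute \<tau> (\<sigma> s), [(s, False)]) \<in> word_equiv S {})"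

lemma inverse_substitutions_sym: "inverse_substitutions \<sigma> \<tau> \<Longrightarrow> inverse_substitutions \<tau> \<sigma>"
  by (auto simp: inverse_substitutions_def)

lemma endomorphism_inverse:
  assumes "inverse_substitutions \<sigma> \<tau>" "x \<in> carrier \<Gamma>"
  shows "endomorphism \<sigma> (endomorphism \<tau> x) = x"
proof -
  have \<sigma>: "relator_substitution \<sigma>" and \<tau>: "relator_substitution \<tau>"
    using assms(1) by (auto simp: inverse_substitutions_def)
  show ?thesis
  proof (rule presented_hom_eqI[OF \<Gamma>.is_group _ _ _ assms(2), where f' = "\<lambda>x. x" and f = "\<lambda>x. endomorphism \<sigma> (endomorphism \<tau> x)"])
    show "(\<lambda>x. endomorphism \<sigma> (endomorphism \<tau> x)) \<in> hom \<Gamma> \<Gamma>"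
      using endomorphism_hom[OF \<sigma>] endomorphism_hom[OF \<tau>] by (auto simp: hom_def Pi_iff)
    show "(\<lambda>x. x) \<in> hom \<Gamma> \<Gamma>" by (auto simp: hom_def)
    fix s assume s: "s \<in> S"
    then have "\<tau> s \<in> words S" using \<tau> by (auto simp: relator_substitution_def)
    then show "endomorphism \<sigma> (endomorphism \<tau> (cl [(s, False)])) = cl [(s, False)]"
      using s assms(1) cl_cong endomorphism_cl[OF \<tau>, of "[(s, False)]"] endomorphism_cl[OF \<sigma>, of "\<tau> s"]
      by (auto simp: inverse_substitutions_def)
  qed
qed

lemma endomorphism_auto:
  assumes "inverse_substitutions \<sigma> \<tau>"
  shows "endomorphism \<sigma> \<in> auto \<Gamma>"
proof -
  have \<sigma>: "relator_substitution \<sigma>" and \<tau>: "relator_substitution \<tau>"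
    using assms by (auto simp: inverse_substitutions_def)
  note inv = endomorphism_inverse[OF assms] endomorphism_inverse[OF inverse_substitutions_sym[OF assms]]
  have "bij_betw (endomorphism \<sigma>) (carrier \<Gamma>) (carrier \<Gamma>)"
    by (rule bij_betwI[where g = "endomorphism \<tau>"])
       (use inv endomorphism_hom[OF \<sigma>] endomorphism_hom[OF \<tau>] in \<open>auto simp: hom_def\<close>)
  moreover have "endomorphism \<sigma> \<in> extensional (carrier \<Gamma>)"
    by (simp add: endomorphism_def presented_lift_def)
  ultimately show ?thesis using endomorphism_hom[OF \<sigma>] by (auto simp: auto_def Bij_def)
qed

text \<open>The coset of the inner automorphisms.\<close>

definition outer_class :: "('s \<Rightarrow> 's word) \<Rightarrow> ('s word set \<Rightarrow> 's word set) set" where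
  "outer_class \<tau> = {compose (carrier \<Gamma>) (conjugation a) (endomorphism \<tau>) | a. a \<in> carrier \<Gamma>}"

lemma conjugation_inverse:
  assumes "a \<in> carrier \<Gamma>" "x \<in> carrier \<Gamma>"
  shows "conjugation a (conjugation (inv\<^bsub>\<Gamma>\<^esub> a) x) = x"
  using assms by (simp add: conjugation_def \<Gamma>.m_assoc)
     (simp flip: \<Gamma>.m_assoc)

lemma conjugation_auto: "a \<in> carrier \<Gamma> \<Longrightarrow> conjugation a \<in> auto \<Gamma>"
proof -
  assume a: "a \<in> carrier \<Gamma>"
  have "bij_betw (conjugation a) (carrier \<Gamma>) (carrier \<Gamma>)"
    by (rule bij_betwI[where g = "conjugation (inv\<^bsub>\<Gamma>\<^esub> a)"])
       (use a conjugation_inverse[of a] conjugation_inverse[of "inv\<^bsub>\<Gamma>\<^esub> a"] conjugation_hom[of a] conjugation_hom[of "inv\<^bsub>\<Gamma>\<^esub> a"]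
         in \<open>auto simp: hom_def\<close>)
  then show ?thesis using conjugation_hom[OF a]
    by (auto simp: auto_def Bij_def conjugation_def)
qed

lemma auto_mult:
  assumes "f \<in> auto \<Gamma>" "f' \<in> auto \<Gamma>"
  shows "f \<otimes>\<^bsub>AutoGroup \<Gamma>\<^esub> f' = compose (carrier \<Gamma>) f f'"
  using assms by (auto simp: AutoGroup_def BijGroup_def auto_def)

lemma outer_class_carrier:
  assumes "inverse_substitutions \<sigma> \<tau>"
  shows "outer_class \<tau> \<in> carrier (Out_group \<Gamma>)"
proof -
  note \<tau> = endomorphism_auto[OF inverse_substitutions_sym[OF assms]]
  have "outer_class \<tau> = inner_automorphisms \<Gamma> #>\<^bsub>AutoGroup \<Gamma>\<^esub> endomorphism \<tau>"
    using auto_mult[OF conjugation_auto \<tau>]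
    by (auto simp: outer_class_def r_coset_def inner_automorphisms_def conjugation_def[symmetric])
  moreover have "endomorphism \<tau> \<in> carrier (AutoGroup \<Gamma>)" using \<tau> by (simp add: AutoGroup_def)
  ultimately show ?thesis unfolding Out_group_def FactGroup_def RCOSETS_def by auto
qed

lemma outer_class_preserves_class:
  assumes "inverse_substitutions \<sigma> \<tau>" "two_cocycle \<Gamma> \<kappa>" "f \<in> outer_class \<tau>"
  shows "preserves_class \<Gamma> \<kappa> f"
  using assms preserves_class_compose[OF preserves_class_conjugation preserves_class_endomorphism endomorphism_hom]
  by (auto simp: outer_class_def inverse_substitutions_def)

text \<open>Evaluates the inverse automorphism that occurs in the action on representations.\<close>

lemma outer_class_inverse:
  assumes inv: "inverse_substitutions \<sigma> \<tau>" and a: "a \<in> carrier \<Gamma>" and y: "y \<in> carrier \<Gamma>"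
  shows "(inv\<^bsub>AutoGroup \<Gamma>\<^esub> (compose (carrier \<Gamma>) (conjugation a) (endomorphism \<tau>))) y =
    endomorphism \<sigma> (inv\<^bsub>\<Gamma>\<^esub> a \<otimes>\<^bsub>\<Gamma>\<^esub> y \<otimes>\<^bsub>\<Gamma>\<^esub> a)"
proof -
  interpret A: group "AutoGroup \<Gamma>" by (rule \<Gamma>.AutoGroup)
  define f where "f = compose (carrier \<Gamma>) (conjugation a) (endomorphism \<tau>)"
  have au: "carrier (AutoGroup \<Gamma>) = auto \<Gamma>" by (simp add: AutoGroup_def)
  note \<tau> = endomorphism_auto[OF inverse_substitutions_sym[OF inv]]
  have f: "f \<in> auto \<Gamma>" using A.m_closed[of "conjugation a" "endomorphism \<tau>"] conjugation_auto[OF a] \<tau>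
    by (simp add: auto_mult au f_def)
  define k where "k = inv\<^bsub>AutoGroup \<Gamma>\<^esub> f"
  have k: "k \<in> auto \<Gamma>" using A.inv_closed[of f] f by (simp add: au k_def)
  have "compose (carrier \<Gamma>) f k = (\<lambda>x\<in>carrier \<Gamma>. x)"
    using A.r_inv[of f] f k by (simp add: au k_def[symmetric] auto_mult) (simp add: AutoGroup_def BijGroup_def)
  then have fk: "f (k y) = y" using y by (metis compose_eq restrict_apply')
  have ky: "k y \<in> carrier \<Gamma>" using k y by (auto simp: auto_def hom_def)
  have \<tau>c: "endomorphism \<tau> (k y) \<in> carrier \<Gamma>" using \<tau> ky by (auto simp: auto_def hom_def)
  have "a \<otimes>\<^bsub>\<Gamma>\<^esub> endomorphism \<tau> (k y) \<otimes>\<^bsub>\<Gamma>\<^esub> inv\<^bsub>\<Gamma>\<^esub> a = y"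
    using fk ky \<tau>c by (simp add: f_def compose_eq conjugation_def)
  then have "inv\<^bsub>\<Gamma>\<^esub> a \<otimes>\<^bsub>\<Gamma>\<^esub> y \<otimes>\<^bsub>\<Gamma>\<^esub> a = endomorphism \<tau> (k y)"
    using conjugation_inverse[of "inv\<^bsub>\<Gamma>\<^esub> a" "endomorphism \<tau> (k y)"] a \<tau>c y by (simp add: conjugation_def)
  then show ?thesis
    using endomorphism_inverse[OF inv ky] by (simp add: k_def f_def)
qed

end

section \<open>Twists of the surface group\<close>

subsection \<open>Composition of substitutions\<close>

lemma word_inverse_simps [simp]:
  "word_inverse [] = []"
  "word_inverse (l # w) = word_inverse w @ [(fst l, \<not> snd l)]"
  "word_inverse (u @ v) = word_inverse v @ word_inverse u"
  "word_inverse (word_inverse w) = w"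
  by (auto simp: word_inverse_def rev_map[symmetric] comp_def map_idI)

lemma substitute_word_inverse: "substitute \<sigma> (word_inverse w) = word_inverse (substitute \<sigma> w)"
  by (induction w) auto

definition substitution_comp :: "('s \<Rightarrow> 's word) \<Rightarrow> ('s \<Rightarrow> 's word) \<Rightarrow> 's \<Rightarrow> 's word" where
  "substitution_comp \<sigma> \<tau> s = substitute \<sigma> (\<tau> s)"

lemma substitute_comp: "substitute (substitution_comp \<sigma> \<tau>) w = substitute \<sigma> (substitute \<tau> w)"
  by (induction w) (auto simp: substitution_comp_def substitute_word_inverse)

text \<open>Free equality of words can be checked by evaluation in the free group.\<close>

lemma word_equivI_eval:
  assumes "\<sigma> \<in> S \<rightarrow> words S" "u \<in> words S" "v \<in> words S"
    and "\<And>\<phi>. \<phi> \<in> S \<rightarrow> carrier (presented_group S {}) \<Longrightarrow>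
      eval_word (presented_group S {}) (\<lambda>s. eval_word (presented_group S {}) \<phi> (\<sigma> s)) u = eval_word (presented_group S {}) \<phi> v"
  shows "(substitute \<sigma> u, v) \<in> word_equiv S {}"
proof -
  let ?F = "presented_group S {}" and ?\<phi> = "\<lambda>s. word_class S {} [(s, False)]"
  interpret F: group ?F by (rule group_presented_group)
  have \<phi>: "?\<phi> \<in> S \<rightarrow> carrier ?F" by (auto intro: word_class_in_carrier)
  have "word_class S {} (substitute \<sigma> u) = word_class S {} v"
    using assms(4)[OF \<phi>] F.eval_word_substitute[OF \<phi> assms(1,2)] assms(3)
      substitute_in_words[OF assms(1,2)] by (simp add: eval_word_presented_group)
  then show ?thesis
    using word_class_eq_iff[OF substitute_in_words[OF assms(1,2)] assms(3)] by blast
qed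

lemma substitute_equiv:
  assumes "\<sigma> \<in> S \<rightarrow> words S" "(u, v) \<in> word_equiv S {}"
  shows "(substitute \<sigma> u, substitute \<sigma> v) \<in> word_equiv S {}"
proof (rule word_equivI_eval[OF assms(1)])
  have uv: "u \<in> words S" "v \<in> words S" using assms(2) by (auto simp: word_equiv_def)
  then show "u \<in> words S" by simp
  from uv show "substitute \<sigma> v \<in> words S" using substitute_in_words[OF assms(1)] by blast
  let ?F = "presented_group S {}"
  interpret F: group ?F by (rule group_presented_group)
  fix \<phi> assume \<phi>: "\<phi> \<in> S \<rightarrow> carrier ?F"
  have "(\<lambda>s. eval_word ?F \<phi> (\<sigma> s)) \<in> S \<rightarrow> carrier ?F"
    using assms(1) F.eval_word_closed[OF \<phi>] by blast
  then have "eval_word ?F (\<lambda>s. eval_word ?F \<phi> (\<sigma> s)) u = eval_word ?F (\<lambda>s. eval_word ?F \<phi> (\<sigma> s)) v"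
    by (rule F.eval_word_equiv[OF _ _ _ assms(2)]) auto
  then show "eval_word ?F (\<lambda>s. eval_word ?F \<phi> (\<sigma> s)) u = eval_word ?F \<phi> (substitute \<sigma> v)"
    using F.eval_word_substitute[OF \<phi> assms(1) uv(2)] by simp
qed

lemma word_equiv_trans: "(u, v) \<in> word_equiv S R \<Longrightarrow> (v, w) \<in> word_equiv S R \<Longrightarrow> (u, w) \<in> word_equiv S R"
  using equiv_word_equiv[of S R] unfolding equiv_def trans_def by blast

context one_relator
begin

lemma relator_substitution_comp:
  assumes "relator_substitution \<sigma>" "relator_substitution \<tau>"
  shows "relator_substitution (substitution_comp \<sigma> \<tau>)"
proof -
  have *: "\<sigma> \<in> S \<rightarrow> words S" "\<tau> \<in> S \<rightarrow> words S" "(substitute \<sigma> r, r) \<in> word_equiv S {}" "(substitute \<tau> r, r) \<in> word_equiv S {}"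
    using assms by (auto simp: relator_substitution_def)
  then have "(substitute \<sigma> (substitute \<tau> r), r) \<in> word_equiv S {}"
    using substitute_equiv word_equiv_trans by metis
  moreover have "substitution_comp \<sigma> \<tau> \<in> S \<rightarrow> words S"
    by (intro funcsetI, unfold substitution_comp_def) (rule substitute_in_words[OF *(1) funcset_mem[OF *(2)]])
  ultimately show ?thesis by (simp add: relator_substitution_def substitute_comp)
qed

lemma inverse_substitutions_comp:
  assumes "inverse_substitutions \<sigma> \<tau>" "inverse_substitutions \<sigma>' \<tau>'"
  shows "inverse_substitutions (substitution_comp \<sigma> \<sigma>') (substitution_comp \<tau>' \<tau>)"
proof -
  have half: "(substitute (substitution_comp \<sigma> \<sigma>') (substitution_comp \<tau>' \<tau> s), [(s, False)]) \<in> word_equiv S {}"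
    if i: "inverse_substitutions \<sigma> \<tau>" "inverse_substitutions \<sigma>' \<tau>'" and s: "s \<in> S" for \<sigma> \<tau> \<sigma>' \<tau>' s
  proof -
    have w: "\<sigma> \<in> S \<rightarrow> words S" "\<tau> \<in> S \<rightarrow> words S" "\<sigma>' \<in> S \<rightarrow> words S" "\<tau>' \<in> S \<rightarrow> words S"
      using i by (auto simp: inverse_substitutions_def relator_substitution_def)
    have id: "(substitute \<sigma>' (substitute \<tau>' u), u) \<in> word_equiv S {}" if "u \<in> words S" for u
    proof -
      have "(substitute (substitution_comp \<sigma>' \<tau>') u, u) \<in> word_equiv S {}"
      proof (rule word_equivI_eval[OF _ that that])
        show sc: "substitution_comp \<sigma>' \<tau>' \<in> S \<rightarrow> words S"
          by (intro funcsetI, unfold substitution_comp_def) (rule substitute_in_words[OF w(3) funcset_mem[OF w(4)]])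
        let ?F = "presented_group S {}"
        interpret F: group ?F by (rule group_presented_group)
        fix \<phi> :: "'s \<Rightarrow> 's word set" assume \<phi>: "\<phi> \<in> S \<rightarrow> carrier ?F"
        show "eval_word ?F (\<lambda>s. eval_word ?F \<phi> (substitution_comp \<sigma>' \<tau>' s)) u = eval_word ?F \<phi> u"
        proof (rule F.eval_word_cong[OF _ that])
          fix s assume s: "s \<in> S"
          have "eval_word ?F \<phi> (substitution_comp \<sigma>' \<tau>' s) = eval_word ?F \<phi> [(s, False)]"
            by (rule F.eval_word_equiv[OF \<phi>, of "{}"])
               (use i(2) s in \<open>auto simp: inverse_substitutions_def substitution_comp_def\<close>)
          then show "eval_word ?F \<phi> (substitution_comp \<sigma>' \<tau>' s) = \<phi> s"
            using funcset_mem[OF \<phi> s] by simp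
        qed
      qed
      then show ?thesis by (simp add: substitute_comp)
    qed
    have "\<tau> s \<in> words S" using w s by auto
    from substitute_equiv[OF w(1) id[OF this]]
    have "(substitute \<sigma> (substitute \<sigma>' (substitute \<tau>' (\<tau> s))), substitute \<sigma> (\<tau> s)) \<in> word_equiv S {}" .
    moreover have "(substitute \<sigma> (\<tau> s), [(s, False)]) \<in> word_equiv S {}"
      using i(1) s by (auto simp: inverse_substitutions_def)
    ultimately show ?thesis
      unfolding substitute_comp by (simp add: substitution_comp_def word_equiv_trans)
  qed
  have "relator_substitution (substitution_comp \<sigma> \<sigma>')" "relator_substitution (substitution_comp \<tau>' \<tau>)"
    using assms relator_substitution_comp by (auto simp: inverse_substitutions_def)
  then show ?thesis
    using half[OF assms] half[OF inverse_substitutions_sym[OF assms(2)] inverse_substitutions_sym[OF assms(1)]]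
    by (simp add: inverse_substitutions_def)
qed

end

subsection \<open>The surface relator and its symmetries\<close>

lemma surface_gens_iff [simp]:
  "GenA i \<in> surface_gens g \<longleftrightarrow> i \<in> {1..g}" "GenB i \<in> surface_gens g \<longleftrightarrow> i \<in> {1..g}"
  by (auto simp: surface_gens_def)

lemma surface_relator_word: "surface_relator g \<in> words (surface_gens g)"
  unfolding surface_relator_def words_concat by auto

interpretation surface: one_relator "surface_gens g" "surface_relator g" for g
  by unfold_locales (rule surface_relator_word)

definition (in group) commutator :: "'a \<Rightarrow> 'a \<Rightarrow> 'a" where
  "commutator x y = x \<otimes> (y \<otimes> (inv x \<otimes> inv y))"

context group
begin

lemma cancel_left: "x \<in> carrier G \<Longrightarrow> y \<in> carrier G \<Longrightarrow> inv x \<otimes> (x \<otimes> y) = y"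
  "x \<in> carrier G \<Longrightarrow> y \<in> carrier G \<Longrightarrow> x \<otimes> (inv x \<otimes> y) = y"
  by (simp_all add: m_assoc[symmetric])

lemmas group_word_simps = m_assoc inv_mult_group cancel_left

lemma commutator_closed [simp]: "x \<in> carrier G \<Longrightarrow> y \<in> carrier G \<Longrightarrow> commutator x y \<in> carrier G"
  by (simp add: commutator_def)

lemma eval_surface_relator_upt:
  assumes "\<phi> \<in> surface_gens g \<rightarrow> carrier G" "set is \<subseteq> {1..g}"
  shows "eval_word G \<phi> (concat (map (\<lambda>i. [(GenA i, False), (GenB i, False), (GenA i, True), (GenB i, True)]) is))
    = foldr (\<lambda>i y. commutator (\<phi> (GenA i)) (\<phi> (GenB i)) \<otimes> y) is \<one> \<and>
    foldr (\<lambda>i y. commutator (\<phi> (GenA i)) (\<phi> (GenB i)) \<otimes> y) is \<one> \<in> carrier G"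
  using assms(2)
proof (induction "is")
  case (Cons i "is")
  then have i: "\<phi> (GenA i) \<in> carrier G" "\<phi> (GenB i) \<in> carrier G" using assms(1) by (auto simp: Pi_iff)
  then show ?case using Cons by (simp add: commutator_def m_assoc)
qed simp

lemma eval_surface_relator:
  assumes "\<phi> \<in> surface_gens g \<rightarrow> carrier G"
  shows "eval_word G \<phi> (surface_relator g) = foldr (\<lambda>i y. commutator (\<phi> (GenA i)) (\<phi> (GenB i)) \<otimes> y) [1..<Suc g] \<one>"
  unfolding surface_relator_def
  by (rule conjunct1[OF eval_surface_relator_upt[OF assms]]) (auto simp del: upt_Suc)

lemma eval_surface_relator_eqI:
  assumes "\<phi> \<in> surface_gens g \<rightarrow> carrier G" "\<psi> \<in> surface_gens g \<rightarrow> carrier G"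
    and "\<And>i. i \<in> {1..g} \<Longrightarrow> commutator (\<phi> (GenA i)) (\<phi> (GenB i)) = commutator (\<psi> (GenA i)) (\<psi> (GenB i))"
  shows "eval_word G \<phi> (surface_relator g) = eval_word G \<psi> (surface_relator g)"
  unfolding eval_surface_relator[OF assms(1)] eval_surface_relator[OF assms(2)]
  by (rule foldr_cong) (use assms(3) in auto)

lemma eval_surface_relator_eqI2:
  assumes \<phi>: "\<phi> \<in> surface_gens g \<rightarrow> carrier G" and \<psi>: "\<psi> \<in> surface_gens g \<rightarrow> carrier G" and i: "i \<in> {1..<g}"
    and ne: "\<And>j. j \<in> {1..g} \<Longrightarrow> j \<noteq> i \<Longrightarrow> j \<noteq> Suc i \<Longrightarrow> commutator (\<phi> (GenA j)) (\<phi> (GenB j)) = commutator (\<psi> (GenA j)) (\<psi> (GenB j))"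
    and eq: "commutator (\<phi> (GenA i)) (\<phi> (GenB i)) \<otimes> commutator (\<phi> (GenA (Suc i))) (\<phi> (GenB (Suc i)))
      = commutator (\<psi> (GenA i)) (\<psi> (GenB i)) \<otimes> commutator (\<psi> (GenA (Suc i))) (\<psi> (GenB (Suc i)))"
  shows "eval_word G \<phi> (surface_relator g) = eval_word G \<psi> (surface_relator g)"
proof -
  have split: "[1..<Suc g] = [1..<i] @ [i, Suc i] @ [Suc (Suc i)..<Suc g]"
  proof -
    have "[1..<Suc g] = [1..<i] @ [i..<Suc g]" using i upt_add_eq_append[of 1 i "Suc g - i"] by simp
    also have "[i..<Suc g] = i # Suc i # [Suc (Suc i)..<Suc g]" using i by (simp add: upt_conv_Cons)
    finally show ?thesis by simp
  qed
  define X where "X = foldr (\<lambda>i y. commutator (\<phi> (GenA i)) (\<phi> (GenB i)) \<otimes> y) [Suc (Suc i)..<Suc g] \<one>"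
  have X: "X = foldr (\<lambda>i y. commutator (\<psi> (GenA i)) (\<psi> (GenB i)) \<otimes> y) [Suc (Suc i)..<Suc g] \<one>"
    unfolding X_def by (rule foldr_cong) (use ne i in auto)
  have Xc: "X \<in> carrier G"
    unfolding X_def by (rule conjunct2[OF eval_surface_relator_upt[OF \<phi>]]) (auto simp del: upt_Suc)
  have c: "f (GenA j) \<in> carrier G" "f (GenB j) \<in> carrier G" if "f \<in> surface_gens g \<rightarrow> carrier G" "j \<in> {1..g}" for f j
    using that by (auto simp: Pi_iff)
  have ig: "i \<in> {1..g}" "Suc i \<in> {1..g}" using i by auto
  have mid: "commutator (\<phi> (GenA i)) (\<phi> (GenB i)) \<otimes> (commutator (\<phi> (GenA (Suc i))) (\<phi> (GenB (Suc i))) \<otimes> X)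
      = commutator (\<psi> (GenA i)) (\<psi> (GenB i)) \<otimes> (commutator (\<psi> (GenA (Suc i))) (\<psi> (GenB (Suc i))) \<otimes> X)"
    using eq Xc c[OF \<phi> ig(1)] c[OF \<phi> ig(2)] c[OF \<psi> ig(1)] c[OF \<psi> ig(2)] by (simp flip: m_assoc)
  have "foldr (\<lambda>i y. commutator (\<phi> (GenA i)) (\<phi> (GenB i)) \<otimes> y) [1..<Suc g] \<one>
      = foldr (\<lambda>i y. commutator (\<phi> (GenA i)) (\<phi> (GenB i)) \<otimes> y) [1..<i]
         (commutator (\<phi> (GenA i)) (\<phi> (GenB i)) \<otimes> (commutator (\<phi> (GenA (Suc i))) (\<phi> (GenB (Suc i))) \<otimes> X))"
    unfolding split X_def by (simp del: upt_Suc)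
  also have "\<dots> = foldr (\<lambda>i y. commutator (\<psi> (GenA i)) (\<psi> (GenB i)) \<otimes> y) [1..<i]
         (commutator (\<psi> (GenA i)) (\<psi> (GenB i)) \<otimes> (commutator (\<psi> (GenA (Suc i))) (\<psi> (GenB (Suc i))) \<otimes> X))"
    by (rule foldr_cong[OF mid refl]) (use ne i in auto)
  also have "\<dots> = foldr (\<lambda>i y. commutator (\<psi> (GenA i)) (\<psi> (GenB i)) \<otimes> y) [1..<Suc g] \<one>"
    unfolding split X by (simp del: upt_Suc)
  finally show ?thesis
    unfolding eval_surface_relator[OF \<phi>] eval_surface_relator[OF \<psi>] .
qed

end

definition commutator_word :: "nat \<Rightarrow> surface_gen word" where
  "commutator_word i = [(GenA i, False), (GenB i, False), (GenA i, True), (GenB i, True)]"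

text \<open>The word by which the bridge substitution changes the generators of two neighbouring handles.\<close>

definition bridge_word :: "nat \<Rightarrow> surface_gen word" where
  "bridge_word i = [(GenB i, True), (GenA (Suc i), False), (GenB (Suc i), False), (GenA (Suc i), True)]"

text \<open>Conjugation of one handle by the given word. With the commutator of the handle this is the Dehn
  twist about its boundary curve.\<close>

definition twist_substitution :: "surface_gen word \<Rightarrow> nat \<Rightarrow> surface_gen \<Rightarrow> surface_gen word" where
  "twist_substitution c i s =
     (if s = GenA i \<or> s = GenB i then c @ [(s, False)] @ word_inverse c else [(s, False)])"

text \<open>An automorphism of two neighbouring handles that keeps the product of their commutators;
  conjugating a handle twist by it gives a twist about another curve inside the two handles.\<close>

definition bridge_substitution :: "surface_gen word \<Rightarrow> nat \<Rightarrow> surface_gen \<Rightarrow> surface_gen word" where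
  "bridge_substitution d i s =
     (if s = GenA i then [(s, False)] @ word_inverse d
      else if s = GenB i then d @ [(s, False)] @ word_inverse d
      else if s = GenA (Suc i) then d @ [(s, False)] else [(s, False)])"

text \<open>Conjugating both generators of a handle by their commutator fixes this commutator, hence the
  relator.\<close>

lemma inverse_twist_substitutions:
  assumes "i \<in> {1..g}"
  shows "surface.inverse_substitutions g (twist_substitution (commutator_word i) i)
     (twist_substitution (word_inverse (commutator_word i)) i)"
proof -
  let ?S = "surface_gens g" and ?F = "presented_group (surface_gens g) {}"
  interpret F: group ?F by (rule group_presented_group)
  have w: "twist_substitution c i \<in> ?S \<rightarrow> words ?S" if "c \<in> words ?S" for c
    using that by (auto simp: twist_substitution_def)
  have cw: "commutator_word i \<in> words ?S" "word_inverse (commutator_word i) \<in> words ?S"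
    using assms by (auto simp: commutator_word_def)
  have rel: "(substitute (twist_substitution c i) (surface_relator g), surface_relator g) \<in> word_equiv ?S {}"
    if c: "c = commutator_word i \<or> c = word_inverse (commutator_word i)" for c
  proof (rule word_equivI_eval[OF w surface_relator_word surface_relator_word])
    show "c \<in> words ?S" using c cw by auto
    fix \<phi> :: "surface_gen \<Rightarrow> surface_gen word set" assume \<phi>: "\<phi> \<in> ?S \<rightarrow> carrier ?F"
    have ab: "\<phi> (GenA j) \<in> carrier ?F" "\<phi> (GenB j) \<in> carrier ?F" if "j \<in> {1..g}" for j
      using \<phi> that by (auto simp: Pi_iff)
    show "eval_word ?F (\<lambda>s. eval_word ?F \<phi> (twist_substitution c i s)) (surface_relator g) = eval_word ?F \<phi> (surface_relator g)"
    proof (rule F.eval_surface_relator_eqI[OF _ \<phi>])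
      show "(\<lambda>s. eval_word ?F \<phi> (twist_substitution c i s)) \<in> ?S \<rightarrow> carrier ?F"
        using w[of c] c cw F.eval_word_closed[OF \<phi>] by blast
      fix j assume "j \<in> {1..g}"
      then show "F.commutator (eval_word ?F \<phi> (twist_substitution c i (GenA j))) (eval_word ?F \<phi> (twist_substitution c i (GenB j)))
        = F.commutator (\<phi> (GenA j)) (\<phi> (GenB j))"
        using c ab[of j] by (auto simp: twist_substitution_def commutator_word_def F.commutator_def F.group_word_simps)
    qed
  qed
  have inv: "(substitute (twist_substitution c i) (twist_substitution (word_inverse c) i s), [(s, False)]) \<in> word_equiv ?S {}"
    if c: "c = commutator_word i \<or> c = word_inverse (commutator_word i)" and s: "s \<in> ?S" for c s
  proof (rule word_equivI_eval[OF w])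
    show cS: "c \<in> words ?S" using c cw by auto
    show "twist_substitution (word_inverse c) i s \<in> words ?S" "[(s, False)] \<in> words ?S"
      using w[of "word_inverse c"] cS s by auto
    fix \<phi> :: "surface_gen \<Rightarrow> surface_gen word set" assume \<phi>: "\<phi> \<in> ?S \<rightarrow> carrier ?F"
    have ab: "\<phi> (GenA i) \<in> carrier ?F" "\<phi> (GenB i) \<in> carrier ?F" "\<phi> s \<in> carrier ?F"
      using \<phi> assms s by (auto simp: Pi_iff)
    then show "eval_word ?F (\<lambda>s. eval_word ?F \<phi> (twist_substitution c i s)) (twist_substitution (word_inverse c) i s) = eval_word ?F \<phi> [(s, False)]"
      using c by (auto simp: twist_substitution_def commutator_word_def F.group_word_simps)
  qed
  show ?thesis
    using rel inv w cw by (fastforce simp: surface.inverse_substitutions_def surface.relator_substitution_def)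
qed

text \<open>Only the product of the commutators of the two handles has to be compared.\<close>

lemma inverse_bridge_substitutions:
  assumes i: "i \<in> {1..<g}"
  shows "surface.inverse_substitutions g (bridge_substitution (bridge_word i) i)
     (bridge_substitution (word_inverse (bridge_word i)) i)"
proof -
  let ?S = "surface_gens g" and ?F = "presented_group (surface_gens g) {}"
  interpret F: group ?F by (rule group_presented_group)
  have w: "bridge_substitution c i \<in> ?S \<rightarrow> words ?S" if "c \<in> words ?S" for c
    using that by (auto simp: bridge_substitution_def)
  have cw: "bridge_word i \<in> words ?S" "word_inverse (bridge_word i) \<in> words ?S"
    using i by (auto simp: bridge_word_def)
  have rel: "(substitute (bridge_substitution c i) (surface_relator g), surface_relator g) \<in> word_equiv ?S {}"
    if c: "c = bridge_word i \<or> c = word_inverse (bridge_word i)" for c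
  proof (rule word_equivI_eval[OF w surface_relator_word surface_relator_word])
    show "c \<in> words ?S" using c cw by auto
    fix \<phi> :: "surface_gen \<Rightarrow> surface_gen word set" assume \<phi>: "\<phi> \<in> ?S \<rightarrow> carrier ?F"
    have ab: "\<phi> (GenA j) \<in> carrier ?F" "\<phi> (GenB j) \<in> carrier ?F" if "j \<in> {1..g}" for j
      using \<phi> that by (auto simp: Pi_iff)
    show "eval_word ?F (\<lambda>s. eval_word ?F \<phi> (bridge_substitution c i s)) (surface_relator g) = eval_word ?F \<phi> (surface_relator g)"
    proof (rule F.eval_surface_relator_eqI2[OF _ \<phi> i])
      show "(\<lambda>s. eval_word ?F \<phi> (bridge_substitution c i s)) \<in> ?S \<rightarrow> carrier ?F"
        using w[of c] c cw F.eval_word_closed[OF \<phi>] by blast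
      show "F.commutator (eval_word ?F \<phi> (bridge_substitution c i (GenA j))) (eval_word ?F \<phi> (bridge_substitution c i (GenB j)))
        = F.commutator (\<phi> (GenA j)) (\<phi> (GenB j))" if "j \<in> {1..g}" "j \<noteq> i" "j \<noteq> Suc i" for j
        using ab[of j] that by (simp add: bridge_substitution_def)
      show "F.commutator (eval_word ?F \<phi> (bridge_substitution c i (GenA i))) (eval_word ?F \<phi> (bridge_substitution c i (GenB i))) \<otimes>\<^bsub>?F\<^esub>
         F.commutator (eval_word ?F \<phi> (bridge_substitution c i (GenA (Suc i)))) (eval_word ?F \<phi> (bridge_substitution c i (GenB (Suc i))))
        = F.commutator (\<phi> (GenA i)) (\<phi> (GenB i)) \<otimes>\<^bsub>?F\<^esub> F.commutator (\<phi> (GenA (Suc i))) (\<phi> (GenB (Suc i)))"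
        using c ab[of i] ab[of "Suc i"] i
        by (auto simp: bridge_substitution_def bridge_word_def F.commutator_def F.group_word_simps)
    qed
  qed
  have inv: "(substitute (bridge_substitution c i) (bridge_substitution (word_inverse c) i s), [(s, False)]) \<in> word_equiv ?S {}"
    if c: "c = bridge_word i \<or> c = word_inverse (bridge_word i)" and s: "s \<in> ?S" for c s
  proof (rule word_equivI_eval[OF w])
    show cS: "c \<in> words ?S" using c cw by auto
    show "bridge_substitution (word_inverse c) i s \<in> words ?S" "[(s, False)] \<in> words ?S"
      using w[of "word_inverse c"] cS s by auto
    fix \<phi> :: "surface_gen \<Rightarrow> surface_gen word set" assume \<phi>: "\<phi> \<in> ?S \<rightarrow> carrier ?F"
    have ab: "\<phi> (GenA i) \<in> carrier ?F" "\<phi> (GenB i) \<in> carrier ?F" "\<phi> (GenA (Suc i)) \<in> carrier ?F"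
      "\<phi> (GenB (Suc i)) \<in> carrier ?F" "\<phi> s \<in> carrier ?F"
      using \<phi> i s by (auto simp: Pi_iff)
    then show "eval_word ?F (\<lambda>s. eval_word ?F \<phi> (bridge_substitution c i s)) (bridge_substitution (word_inverse c) i s) = eval_word ?F \<phi> [(s, False)]"
      using c by (auto simp: bridge_substitution_def bridge_word_def F.group_word_simps)
  qed
  show ?thesis
    using rel inv w cw by (fastforce simp: surface.inverse_substitutions_def surface.relator_substitution_def)
qed

definition bridge_twist_substitution :: "surface_gen word \<Rightarrow> nat \<Rightarrow> surface_gen \<Rightarrow> surface_gen word" where
  "bridge_twist_substitution c i =
     substitution_comp (bridge_substitution (bridge_word i) i)
       (substitution_comp (twist_substitution c i) (bridge_substitution (word_inverse (bridge_word i)) i))"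

lemma substitution_comp_assoc:
  "substitution_comp (substitution_comp \<sigma> \<tau>) \<upsilon> = substitution_comp \<sigma> (substitution_comp \<tau> \<upsilon>)"
  by (simp add: fun_eq_iff substitution_comp_def substitute_comp)

lemma inverse_bridge_twist_substitutions:
  assumes i: "i \<in> {1..<g}"
  shows "surface.inverse_substitutions g (bridge_twist_substitution (commutator_word i) i)
     (bridge_twist_substitution (word_inverse (commutator_word i)) i)"
proof -
  have i': "i \<in> {1..g}" using i by auto
  note b = inverse_bridge_substitutions[OF i] and t = inverse_twist_substitutions[OF i']
  from surface.inverse_substitutions_comp[OF b
      surface.inverse_substitutions_comp[OF t surface.inverse_substitutions_sym[OF b]]]
  show ?thesis unfolding bridge_twist_substitution_def substitution_comp_assoc .
qed

section \<open>Affine representations and mapping classes\<close>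

subsection \<open>The affine group\<close>

definition affine_map :: "complex \<Rightarrow> complex \<Rightarrow> complex \<Rightarrow> complex" where
  "affine_map a u = (\<lambda>z. a * z + u)"

lemma affine_map_eq_iff [simp]: "affine_map a u = affine_map b v \<longleftrightarrow> a = b \<and> u = v"
proof
  assume "affine_map a u = affine_map b v"
  then have "affine_map a u 0 = affine_map b v 0" "affine_map a u 1 = affine_map b v 1" by simp_all
  then show "a = b \<and> u = v" by (simp add: affine_map_def)
qed simp

lemma carrier_Aff: "carrier Aff = {affine_map a u | a u. a \<noteq> 0}"
  by (simp add: Aff_def affine_map_def[abs_def])

lemma affine_map_in_Aff [simp]: "affine_map a u \<in> carrier Aff \<longleftrightarrow> a \<noteq> 0"
  by (auto simp: carrier_Aff)

lemma one_Aff: "\<one>\<^bsub>Aff\<^esub> = affine_map 1 0"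
  by (simp add: Aff_def affine_map_def fun_eq_iff)

lemma mult_Aff [simp]: "affine_map a u \<otimes>\<^bsub>Aff\<^esub> affine_map b v = affine_map (a * b) (a * v + u)"
  by (simp add: Aff_def affine_map_def fun_eq_iff algebra_simps)

lemma group_Aff: "group Aff"
proof (rule groupI)
  fix x y z assume "x \<in> carrier Aff" "y \<in> carrier Aff" "z \<in> carrier Aff"
  then show "x \<otimes>\<^bsub>Aff\<^esub> y \<in> carrier Aff" "x \<otimes>\<^bsub>Aff\<^esub> y \<otimes>\<^bsub>Aff\<^esub> z = x \<otimes>\<^bsub>Aff\<^esub> (y \<otimes>\<^bsub>Aff\<^esub> z)"
    "\<one>\<^bsub>Aff\<^esub> \<otimes>\<^bsub>Aff\<^esub> x = x"
    by (auto simp: carrier_Aff one_Aff algebra_simps)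
next
  fix x assume "x \<in> carrier Aff"
  then obtain a u where "x = affine_map a u" "a \<noteq> 0" by (auto simp: carrier_Aff)
  then show "\<exists>y\<in>carrier Aff. y \<otimes>\<^bsub>Aff\<^esub> x = \<one>\<^bsub>Aff\<^esub>"
    by (intro bexI[of _ "affine_map (1 / a) (- (u / a))"]) (auto simp: one_Aff)
qed (simp add: one_Aff)

interpretation Aff: group Aff by (rule group_Aff)

lemma inv_Aff [simp]: "a \<noteq> 0 \<Longrightarrow> inv\<^bsub>Aff\<^esub> (affine_map a u) = affine_map (1 / a) (- (u / a))"
  by (rule Aff.inv_equality) (auto simp: one_Aff)

lemma affine_parts [simp]: "linear_part (affine_map a u) = a" "translation_part (affine_map a u) = u"
  by (simp_all add: linear_part_def translation_part_def affine_map_def)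

lemma Aff_eq_affine_map: "h \<in> carrier Aff \<Longrightarrow> h = affine_map (linear_part h) (translation_part h)"
  by (auto simp: carrier_Aff)

subsection \<open>Coordinates of representations\<close>

definition gen_map :: "(nat \<Rightarrow> complex) \<Rightarrow> (nat \<Rightarrow> complex) \<Rightarrow> (nat \<Rightarrow> complex) \<Rightarrow> (nat \<Rightarrow> complex) \<Rightarrow> surface_gen \<Rightarrow> complex \<Rightarrow> complex" where
  "gen_map A U B V s = (case s of GenA i \<Rightarrow> affine_map (A i) (U i) | GenB i \<Rightarrow> affine_map (B i) (V i))"

lemma gen_map_simps [simp]:
  "gen_map A U B V (GenA i) = affine_map (A i) (U i)" "gen_map A U B V (GenB i) = affine_map (B i) (V i)"
  by (simp_all add: gen_map_def)

definition rep :: "nat \<Rightarrow> (nat \<Rightarrow> complex) \<Rightarrow> (nat \<Rightarrow> complex) \<Rightarrow> (nat \<Rightarrow> complex) \<Rightarrow> (nat \<Rightarrow> complex) \<Rightarrow> surface_rep" where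
  "rep g A U B V = presented_lift (surface_gens g) {surface_relator g} Aff (gen_map A U B V)"

definition rep_coords :: "nat \<Rightarrow> (nat \<Rightarrow> complex) \<Rightarrow> (nat \<Rightarrow> complex) \<Rightarrow> (nat \<Rightarrow> complex) \<Rightarrow> (nat \<Rightarrow> complex) \<Rightarrow> bool" where
  "rep_coords g A U B V \<longleftrightarrow> (\<forall>i\<in>{1..g}. A i \<noteq> 0 \<and> B i \<noteq> 0) \<and>
     (\<Sum>i\<in>{1..g}. (A i - 1) * V i + (1 - B i) * U i) = 0"

lemma gen_map_funcset:
  "(\<forall>i\<in>{1..g}. A i \<noteq> 0 \<and> B i \<noteq> 0) \<Longrightarrow> gen_map A U B V \<in> surface_gens g \<rightarrow> carrier Aff"
  by (auto simp: surface_gens_def)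

lemma Aff_commutator:
  assumes "a \<noteq> 0" "b \<noteq> 0"
  shows "Aff.commutator (affine_map a u) (affine_map b v) = affine_map 1 ((a - 1) * v + (1 - b) * u)"
  using assms by (simp add: Aff.commutator_def field_simps)

lemma eval_relator_Aff:
  assumes "\<forall>i\<in>{1..g}. A i \<noteq> 0 \<and> B i \<noteq> 0"
  shows "eval_word Aff (gen_map A U B V) (surface_relator g) = affine_map 1 (\<Sum>i\<in>{1..g}. (A i - 1) * V i + (1 - B i) * U i)"
proof -
  have "foldr (\<lambda>i y. Aff.commutator (gen_map A U B V (GenA i)) (gen_map A U B V (GenB i)) \<otimes>\<^bsub>Aff\<^esub> y) is \<one>\<^bsub>Aff\<^esub>
    = affine_map 1 (\<Sum>i\<leftarrow>is. (A i - 1) * V i + (1 - B i) * U i)" if "set is \<subseteq> {1..g}" for "is"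
    using that by (induction "is") (use assms in \<open>auto simp: one_Aff Aff_commutator add.commute\<close>)
  from this[of "[1..<Suc g]"] show ?thesis
    unfolding Aff.eval_surface_relator[OF gen_map_funcset[OF assms]]
    by (simp add: interv_sum_list_conv_sum_set_nat atLeastLessThanSuc_atLeastAtMost del: upt_Suc)
qed

lemma rep_assignment:
  assumes "rep_coords g A U B V"
  shows "presented_assignment Aff (surface_gens g) {surface_relator g} (gen_map A U B V)"
  by unfold_locales
     (use assms gen_map_funcset[of g A B U V] eval_relator_Aff[of g A B U V] surface_relator_word
       in \<open>auto simp: rep_coords_def one_Aff\<close>)

lemma rep_in_Hom_Aff: "rep_coords g A U B V \<Longrightarrow> rep g A U B V \<in> Hom_Aff g"
  using presented_assignment.presented_lift_hom[OF rep_assignment]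
  by (auto simp: Hom_Aff_def surface_group_def rep_def presented_lift_def)

lemma surface_gen_elt_eq: "surface_gen_elt g s = word_class (surface_gens g) {surface_relator g} [(s, False)]"
  by (simp add: surface_gen_elt_def word_class_def)

lemma rep_gen:
  assumes "rep_coords g A U B V" "s \<in> surface_gens g"
  shows "rep g A U B V (surface_gen_elt g s) = gen_map A U B V s"
proof -
  interpret presented_assignment Aff "surface_gens g" "{surface_relator g}" "gen_map A U B V"
    by (rule rep_assignment[OF assms(1)])
  show ?thesis
    using presented_lift_class[of "[(s, False)]"] assms(2) funcset_mem[OF assign assms(2)]
    by (simp add: rep_def surface_gen_elt_eq)
qed

text \<open>A homomorphism is determined by its values on the generators.\<close>

lemma Hom_Aff_eq_rep:
  assumes \<rho>: "\<rho> \<in> Hom_Aff g" and gen: "\<And>s. s \<in> surface_gens g \<Longrightarrow> \<rho> (surface_gen_elt g s) = gen_map A U B V s"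
  shows "rep_coords g A U B V \<and> \<rho> = rep g A U B V"
proof -
  let ?S = "surface_gens g" and ?r = "surface_relator g"
  have hom: "\<rho> \<in> hom (presented_group ?S {?r}) Aff" and ext: "\<rho> \<in> extensional (carrier (presented_group ?S {?r}))"
    using \<rho> by (auto simp: Hom_Aff_def surface_group_def)
  have nz: "\<forall>i\<in>{1..g}. A i \<noteq> 0 \<and> B i \<noteq> 0"
  proof
    fix i assume i: "i \<in> {1..g}"
    have "\<rho> (surface_gen_elt g s) \<in> carrier Aff" if "s \<in> ?S" for s
      using hom that by (auto simp: surface_gen_elt_eq hom_def Pi_iff word_class_in_carrier)
    then have "gen_map A U B V s \<in> carrier Aff" if "s \<in> ?S" for s
      using gen[OF that] that by metis
    from this[of "GenA i"] this[of "GenB i"] show "A i \<noteq> 0 \<and> B i \<noteq> 0" using i by simp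
  qed
  have "eval_word Aff (gen_map A U B V) ?r = eval_word Aff (\<lambda>s. \<rho> (word_class ?S {?r} [(s, False)])) ?r"
    by (rule Aff.eval_word_cong[OF _ surface_relator_word]) (use gen in \<open>simp add: surface_gen_elt_eq\<close>)
  also have "\<dots> = \<rho> (eval_word (presented_group ?S {?r}) (\<lambda>s. word_class ?S {?r} [(s, False)]) ?r)"
    by (rule hom_eval_word[OF group_presented_group group_Aff hom _ surface_relator_word, symmetric])
       (auto intro: word_class_in_carrier)
  also have "\<dots> = \<rho> \<one>\<^bsub>presented_group ?S {?r}\<^esub>"
    using eval_word_presented_group[OF surface_relator_word] surface.cl_relator by simp
  also have "\<dots> = \<one>\<^bsub>Aff\<^esub>"
    using hom_one[OF hom group_presented_group group_Aff] .
  finally have c: "rep_coords g A U B V"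
    using nz eval_relator_Aff[OF nz] by (simp add: rep_coords_def one_Aff)
  moreover have "\<rho> = rep g A U B V"
  proof (rule extensionalityI[OF ext])
    show "rep g A U B V \<in> extensional (carrier (presented_group ?S {?r}))"
      by (simp add: rep_def presented_lift_def)
    fix x assume x: "x \<in> carrier (presented_group ?S {?r})"
    have "rep g A U B V \<in> hom (presented_group ?S {?r}) Aff"
      using rep_in_Hom_Aff[OF c] by (simp add: Hom_Aff_def surface_group_def)
    then show "\<rho> x = rep g A U B V x"
      using presented_hom_eqI[OF group_Aff hom _ _ x] gen rep_gen[OF c] by (simp add: surface_gen_elt_eq)
  qed
  ultimately show ?thesis by simp
qed

definition coordA :: "nat \<Rightarrow> surface_rep \<Rightarrow> nat \<Rightarrow> complex" where
  "coordA g \<rho> i = linear_part (\<rho> (surface_gen_elt g (GenA i)))"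
definition coordU :: "nat \<Rightarrow> surface_rep \<Rightarrow> nat \<Rightarrow> complex" where
  "coordU g \<rho> i = translation_part (\<rho> (surface_gen_elt g (GenA i)))"
definition coordB :: "nat \<Rightarrow> surface_rep \<Rightarrow> nat \<Rightarrow> complex" where
  "coordB g \<rho> i = linear_part (\<rho> (surface_gen_elt g (GenB i)))"
definition coordV :: "nat \<Rightarrow> surface_rep \<Rightarrow> nat \<Rightarrow> complex" where
  "coordV g \<rho> i = translation_part (\<rho> (surface_gen_elt g (GenB i)))"

lemma Hom_Aff_coords:
  assumes "\<rho> \<in> Hom_Aff g"
  shows "rep_coords g (coordA g \<rho>) (coordU g \<rho>) (coordB g \<rho>) (coordV g \<rho>) \<and>
    \<rho> = rep g (coordA g \<rho>) (coordU g \<rho>) (coordB g \<rho>) (coordV g \<rho>)"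
proof (rule Hom_Aff_eq_rep[OF assms])
  fix s assume "s \<in> surface_gens g"
  then have "\<rho> (surface_gen_elt g s) \<in> carrier Aff"
    using assms by (auto simp: Hom_Aff_def surface_group_def surface_gen_elt_eq hom_def Pi_iff word_class_in_carrier)
  then show "\<rho> (surface_gen_elt g s) = gen_map (coordA g \<rho>) (coordU g \<rho>) (coordB g \<rho>) (coordV g \<rho>) s"
    by (cases s) (auto simp: coordA_def coordU_def coordB_def coordV_def dest: Aff_eq_affine_map)
qed

lemma rep_cong:
  assumes c: "rep_coords g A U B V"
    and "\<And>i. i \<in> {1..g} \<Longrightarrow> A i = A' i \<and> U i = U' i \<and> B i = B' i \<and> V i = V' i"
  shows "rep_coords g A' U' B' V' \<and> rep g A U B V = rep g A' U' B' V'"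
proof (rule Hom_Aff_eq_rep[OF rep_in_Hom_Aff[OF c]])
  fix s assume s: "s \<in> surface_gens g"
  show "rep g A U B V (surface_gen_elt g s) = gen_map A' U' B' V' s"
    unfolding rep_gen[OF c s] using s assms(2) by (cases s) auto
qed

lemma rep_coords_rep:
  assumes "rep_coords g A U B V" "i \<in> {1..g}"
  shows "coordA g (rep g A U B V) i = A i" "coordU g (rep g A U B V) i = U i"
    "coordB g (rep g A U B V) i = B i" "coordV g (rep g A U B V) i = V i"
  using rep_gen[OF assms(1)] assms(2) by (auto simp: coordA_def coordU_def coordB_def coordV_def)

lemma conjugate_in_Hom_Aff:
  assumes "\<rho> \<in> Hom_Aff g" "h \<in> carrier Aff"
  shows "conjugate_rep g h \<rho> \<in> Hom_Aff g"
proof -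
  have "(\<lambda>x. h \<otimes>\<^bsub>Aff\<^esub> x \<otimes>\<^bsub>Aff\<^esub> inv\<^bsub>Aff\<^esub> h) \<in> hom Aff Aff"
    by (rule surface.group_conjugation_hom[OF group_Aff assms(2)])
  moreover have G: "group (surface_group g)" by (simp add: surface_group_def group_presented_group)
  ultimately have "(\<lambda>x. h \<otimes>\<^bsub>Aff\<^esub> \<rho> x \<otimes>\<^bsub>Aff\<^esub> inv\<^bsub>Aff\<^esub> h) \<in> hom (surface_group g) Aff"
    using assms(1) by (auto simp: Hom_Aff_def hom_def Pi_iff)
  then show ?thesis using group.is_monoid[OF G]
    by (auto simp: Hom_Aff_def conjugate_rep_def hom_def Pi_iff monoid.m_closed)
qed

text \<open>Conjugation acts on the translation parts by scaling and by adding a coboundary.\<close>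

lemma conjugate_rep_rep:
  fixes b :: complex
  assumes c: "rep_coords g A U B V" and l: "l \<noteq> 0"
  defines "U' \<equiv> \<lambda>i. l * U i + (1 - A i) * b" and "V' \<equiv> \<lambda>i. l * V i + (1 - B i) * b"
  shows "rep_coords g A U' B V' \<and> conjugate_rep g (affine_map l b) (rep g A U B V) = rep g A U' B V'"
proof (rule Hom_Aff_eq_rep[OF conjugate_in_Hom_Aff[OF rep_in_Hom_Aff[OF c]]])
  show "affine_map l b \<in> carrier Aff" using l by simp
  fix s assume s: "s \<in> surface_gens g"
  have "surface_gen_elt g s \<in> carrier (surface_group g)"
    using s by (simp add: surface_group_def surface_gen_elt_eq word_class_in_carrier)
  then show "conjugate_rep g (affine_map l b) (rep g A U B V) (surface_gen_elt g s) = gen_map A U' B V' s"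
    using rep_gen[OF c s] l by (cases s) (simp_all add: conjugate_rep_def U'_def V'_def field_simps)
qed

lemma conjugate_rep_conjugate:
  assumes "\<rho> \<in> Hom_Aff g" "h \<in> carrier Aff" "h' \<in> carrier Aff"
  shows "conjugate_rep g h (conjugate_rep g h' \<rho>) = conjugate_rep g (h \<otimes>\<^bsub>Aff\<^esub> h') \<rho>"
  using assms by (auto simp: conjugate_rep_def Hom_Aff_def hom_def Pi_iff Aff.m_assoc Aff.inv_mult_group)

lemma rep_class_conjugate:
  assumes "\<rho> \<in> Hom_Aff g" "h \<in> carrier Aff"
  shows "rep_class g (conjugate_rep g h \<rho>) = rep_class g \<rho>"
proof (intro equalityI subsetI)
  fix x assume "x \<in> rep_class g (conjugate_rep g h \<rho>)"
  then show "x \<in> rep_class g \<rho>"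
    using assms by (auto simp: rep_class_def conjugate_rep_conjugate)
next
  fix x assume "x \<in> rep_class g \<rho>"
  then obtain k where k: "k \<in> carrier Aff" "x = conjugate_rep g k \<rho>" by (auto simp: rep_class_def)
  then have "x = conjugate_rep g (k \<otimes>\<^bsub>Aff\<^esub> inv\<^bsub>Aff\<^esub> h) (conjugate_rep g h \<rho>)"
    using assms by (simp add: conjugate_rep_conjugate Aff.m_assoc)
  then show "x \<in> rep_class g (conjugate_rep g h \<rho>)"
    using assms k by (auto simp: rep_class_def)
qed

lemma self_in_rep_class: "\<rho> \<in> Hom_Aff g \<Longrightarrow> \<rho> \<in> rep_class g \<rho>"
proof -
  assume \<rho>: "\<rho> \<in> Hom_Aff g"
  have "conjugate_rep g \<one>\<^bsub>Aff\<^esub> \<rho> = \<rho>"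
    using \<rho> by (auto simp: conjugate_rep_def Hom_Aff_def hom_def Pi_iff extensional_def fun_eq_iff)
  then show ?thesis unfolding rep_class_def using Aff.one_closed by (metis (mono_tags, lifting) mem_Collect_eq)
qed

lemma rep_class_eqD:
  assumes "\<rho> \<in> Hom_Aff g" "rep_class g \<rho> = rep_class g \<rho>'"
  shows "\<exists>h\<in>carrier Aff. \<rho> = conjugate_rep g h \<rho>'"
  using self_in_rep_class[OF assms(1)] assms(2) by (auto simp: rep_class_def)

text \<open>One pair of generators with noncommuting images suffices.\<close>

lemma noncommuting_imp_nonabelian:
  assumes c: "rep_coords g A U B V" and s: "s \<in> surface_gens g" "s' \<in> surface_gens g"
    and ne: "gen_map A U B V s \<otimes>\<^bsub>Aff\<^esub> gen_map A U B V s' \<noteq> gen_map A U B V s' \<otimes>\<^bsub>Aff\<^esub> gen_map A U B V s"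
  shows "rep g A U B V \<in> Hom_nonabelian g"
proof -
  have "\<not> abelian_rep g (rep g A U B V)"
  proof
    assume "abelian_rep g (rep g A U B V)"
    then interpret comm_group "Aff\<lparr>carrier := rep g A U B V ` carrier (surface_group g)\<rparr>"
      by (simp add: abelian_rep_def)
    have "gen_map A U B V s \<in> rep g A U B V ` carrier (surface_group g)" if "s \<in> surface_gens g" for s
      using rep_gen[OF c that] that
      by (metis image_eqI surface_gen_elt_eq surface_group_def word_class_in_carrier words_simps(1,2) fst_conv)
    then show False using m_comm[of "gen_map A U B V s" "gen_map A U B V s'"] s ne by simp
  qed
  then show ?thesis using rep_in_Hom_Aff[OF c] by (simp add: Hom_nonabelian_def)
qed

subsection \<open>Action of substitutions\<close>

lemma compose_endomorphism_rep:
  assumes c: "rep_coords g A U B V" and \<sigma>: "surface.relator_substitution g \<sigma>"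
    and gen: "\<And>s. s \<in> surface_gens g \<Longrightarrow> eval_word Aff (gen_map A U B V) (\<sigma> s) = gen_map A' U' B' V' s"
  shows "rep_coords g A' U' B' V' \<and>
    compose (carrier (surface_group g)) (rep g A U B V) (surface.endomorphism g \<sigma>) = rep g A' U' B' V'"
proof (rule Hom_Aff_eq_rep)
  have e: "surface.endomorphism g \<sigma> \<in> hom (surface_group g) (surface_group g)"
    using surface.endomorphism_hom[OF \<sigma>] by (simp add: surface_group_def)
  have "group (surface_group g)" by (simp add: surface_group_def group_presented_group)
  then show "compose (carrier (surface_group g)) (rep g A U B V) (surface.endomorphism g \<sigma>) \<in> Hom_Aff g"
    using group.hom_compose[OF _ e, of "rep g A U B V" Aff] rep_in_Hom_Aff[OF c] by (simp add: Hom_Aff_def)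
  fix s assume s: "s \<in> surface_gens g"
  interpret presented_assignment Aff "surface_gens g" "{surface_relator g}" "gen_map A U B V"
    by (rule rep_assignment[OF c])
  have \<sigma>s: "\<sigma> s \<in> words (surface_gens g)" using \<sigma> s by (auto simp: surface.relator_substitution_def)
  have "surface.endomorphism g \<sigma> (surface_gen_elt g s) = word_class (surface_gens g) {surface_relator g} (\<sigma> s)"
    using surface.endomorphism_cl[OF \<sigma>, of "[(s, False)]"] s by (simp add: surface_gen_elt_eq)
  then have "compose (carrier (surface_group g)) (rep g A U B V) (surface.endomorphism g \<sigma>) (surface_gen_elt g s)
      = eval_word Aff (gen_map A U B V) (\<sigma> s)"
    using presented_lift_class[OF \<sigma>s] s
    by (simp add: compose_def rep_def surface_gen_elt_eq surface_group_def word_class_in_carrier)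
  then show "compose (carrier (surface_group g)) (rep g A U B V) (surface.endomorphism g \<sigma>) (surface_gen_elt g s) = gen_map A' U' B' V' s"
    using gen[OF s] by simp
qed

definition csign :: "bool \<Rightarrow> complex" where
  "csign e = (if e then - 1 else 1)"

definition signed_word :: "bool \<Rightarrow> 's word \<Rightarrow> 's word" where
  "signed_word e w = (if e then word_inverse w else w)"

lemma eval_twist:
  fixes A U B V :: "nat \<Rightarrow> complex"
  assumes nz: "\<forall>i\<in>{1..g}. A i \<noteq> 0 \<and> B i \<noteq> 0" and i: "i \<in> {1..g}" and s: "s \<in> surface_gens g"
  defines "t \<equiv> (A i - 1) * V i + (1 - B i) * U i"
  shows "eval_word Aff (gen_map A U B V) (twist_substitution (signed_word e (commutator_word i)) i s)
    = gen_map A (U(i := U i + csign e * t * (1 - A i))) B (V(i := V i + csign e * t * (1 - B i))) s"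
proof -
  note \<phi> = gen_map_funcset[OF nz, of U V]
  have AB: "A i \<noteq> 0" "B i \<noteq> 0" using nz i by auto
  have cw: "commutator_word i \<in> words (surface_gens g)" using i by (auto simp: commutator_word_def)
  have c0: "eval_word Aff (gen_map A U B V) (commutator_word i) = affine_map 1 t"
    using AB by (simp add: commutator_word_def t_def one_Aff field_simps)
  then have c: "eval_word Aff (gen_map A U B V) (signed_word e (commutator_word i)) = affine_map 1 (csign e * t)"
    "eval_word Aff (gen_map A U B V) (word_inverse (signed_word e (commutator_word i))) = affine_map 1 (- (csign e * t))"
    using Aff.eval_word_inverse[OF \<phi> cw] by (auto simp: signed_word_def csign_def)
  have cw': "signed_word e (commutator_word i) \<in> words (surface_gens g)"
    "word_inverse (signed_word e (commutator_word i)) \<in> words (surface_gens g)"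
    using cw by (auto simp: signed_word_def)
  have ss: "[(s, False)] \<in> words (surface_gens g)" using s by simp
  have "eval_word Aff (gen_map A U B V) (signed_word e (commutator_word i) @ [(s, False)] @ word_inverse (signed_word e (commutator_word i)))
    = affine_map 1 (csign e * t) \<otimes>\<^bsub>Aff\<^esub> (eval_word Aff (gen_map A U B V) [(s, False)] \<otimes>\<^bsub>Aff\<^esub> affine_map 1 (- (csign e * t)))"
    using cw' ss by (simp add: Aff.eval_word_append[OF \<phi>] c del: Aff.eval_word_Cons append_Cons)
  moreover have "eval_word Aff (gen_map A U B V) [(s, False)] = gen_map A U B V s"
    using funcset_mem[OF \<phi> s] by simp
  ultimately show ?thesis
    by (cases s) (auto simp: twist_substitution_def one_Aff algebra_simps)
qed

lemma eval_bridge: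
  fixes A U B V :: "nat \<Rightarrow> complex"
  assumes nz: "\<forall>i\<in>{1..g}. A i \<noteq> 0 \<and> B i \<noteq> 0" and i: "i \<in> {1..<g}" and s: "s \<in> surface_gens g"
  defines "D \<equiv> B (Suc i) / B i" and "W \<equiv> (A (Suc i) * V (Suc i) + (1 - B (Suc i)) * U (Suc i) - V i) / B i"
  shows "eval_word Aff (gen_map A U B V) (bridge_substitution (bridge_word i) i s)
    = gen_map (A(i := A i / D, Suc i := D * A (Suc i))) (U(i := U i - A i * W / D, Suc i := D * U (Suc i) + W))
        B (V(i := D * V i + (1 - B i) * W)) s"
    and "eval_word Aff (gen_map A U B V) (bridge_substitution (word_inverse (bridge_word i)) i s)
    = gen_map (A(i := A i * D, Suc i := A (Suc i) / D)) (U(i := A i * W + U i, Suc i := (U (Suc i) - W) / D))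
        B (V(i := (V i - (1 - B i) * W) / D)) s"
proof -
  note \<phi> = gen_map_funcset[OF nz, of U V]
  have AB: "A i \<noteq> 0" "B i \<noteq> 0" "A (Suc i) \<noteq> 0" "B (Suc i) \<noteq> 0" using nz i by auto
  have D: "D \<noteq> 0" using AB by (simp add: D_def)
  have cw: "bridge_word i \<in> words (surface_gens g)" "word_inverse (bridge_word i) \<in> words (surface_gens g)"
    using i by (auto simp: bridge_word_def)
  have c0: "eval_word Aff (gen_map A U B V) (bridge_word i) = affine_map D W"
    using AB by (simp add: bridge_word_def D_def W_def one_Aff field_simps)
  have c1: "eval_word Aff (gen_map A U B V) (word_inverse (bridge_word i)) = affine_map (1 / D) (- (W / D))"
    using Aff.eval_word_inverse[OF \<phi> cw(1)] c0 D by simp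
  have ss: "[(s, False)] \<in> words (surface_gens g)" using s by simp
  have es: "eval_word Aff (gen_map A U B V) [(s, False)] = gen_map A U B V s"
    using funcset_mem[OF \<phi> s] by simp
  note ev = Aff.eval_word_append[OF \<phi>] c0 c1 es cw ss
  have "eval_word Aff (gen_map A U B V) ([(s, False)] @ word_inverse (bridge_word i)) = gen_map A U B V s \<otimes>\<^bsub>Aff\<^esub> affine_map (1 / D) (- (W / D))"
    "eval_word Aff (gen_map A U B V) ([(s, False)] @ bridge_word i) = gen_map A U B V s \<otimes>\<^bsub>Aff\<^esub> affine_map D W"
    "eval_word Aff (gen_map A U B V) (bridge_word i @ [(s, False)]) = affine_map D W \<otimes>\<^bsub>Aff\<^esub> gen_map A U B V s"
    "eval_word Aff (gen_map A U B V) (word_inverse (bridge_word i) @ [(s, False)]) = affine_map (1 / D) (- (W / D)) \<otimes>\<^bsub>Aff\<^esub> gen_map A U B V s"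
    "eval_word Aff (gen_map A U B V) (bridge_word i @ [(s, False)] @ word_inverse (bridge_word i))
       = affine_map D W \<otimes>\<^bsub>Aff\<^esub> (gen_map A U B V s \<otimes>\<^bsub>Aff\<^esub> affine_map (1 / D) (- (W / D)))"
    "eval_word Aff (gen_map A U B V) (word_inverse (bridge_word i) @ [(s, False)] @ bridge_word i)
       = affine_map (1 / D) (- (W / D)) \<otimes>\<^bsub>Aff\<^esub> (gen_map A U B V s \<otimes>\<^bsub>Aff\<^esub> affine_map D W)"
    using ev by (simp_all del: Aff.eval_word_Cons append_Cons append.simps words_simps(2) add: words_simps(3))
  note evs = this
  show "eval_word Aff (gen_map A U B V) (bridge_substitution (bridge_word i) i s)
    = gen_map (A(i := A i / D, Suc i := D * A (Suc i))) (U(i := U i - A i * W / D, Suc i := D * U (Suc i) + W))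
        B (V(i := D * V i + (1 - B i) * W)) s"
    unfolding bridge_substitution_def using D evs es
    by (cases s) (auto simp: field_simps)
  show "eval_word Aff (gen_map A U B V) (bridge_substitution (word_inverse (bridge_word i)) i s)
    = gen_map (A(i := A i * D, Suc i := A (Suc i) / D)) (U(i := A i * W + U i, Suc i := (U (Suc i) - W) / D))
        B (V(i := (V i - (1 - B i) * W) / D)) s"
    unfolding bridge_substitution_def using D evs es
    by (cases s) (auto simp: field_simps)
qed


text \<open>The commutator of a handle acts as a translation, so that conjugation by it adds a coboundary
  supported on this handle.\<close>

lemma twist_rep:
  fixes e :: bool
  assumes c: "rep_coords g A U B V" and i: "i \<in> {1..g}"
  defines "t \<equiv> (A i - 1) * V i + (1 - B i) * U i"
  defines "U' \<equiv> U(i := U i + csign e * t * (1 - A i))" and "V' \<equiv> V(i := V i + csign e * t * (1 - B i))"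
  shows "rep_coords g A U' B V' \<and>
    compose (carrier (surface_group g)) (rep g A U B V)
      (surface.endomorphism g (twist_substitution (signed_word e (commutator_word i)) i)) = rep g A U' B V'"
proof (rule compose_endomorphism_rep[OF c])
  show "surface.relator_substitution g (twist_substitution (signed_word e (commutator_word i)) i)"
    using inverse_twist_substitutions[OF i] by (auto simp: surface.inverse_substitutions_def signed_word_def)
  show "eval_word Aff (gen_map A U B V) (twist_substitution (signed_word e (commutator_word i)) i s) = gen_map A U' B V' s"
    if "s \<in> surface_gens g" for s
    unfolding U'_def V'_def t_def by (rule eval_twist[OF _ i that]) (use c in \<open>simp add: rep_coords_def\<close>)
qed

lemma endomorphism_comp:
  assumes "surface.relator_substitution g \<sigma>" "surface.relator_substitution g \<tau>" "x \<in> carrier (surface_group g)"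
  shows "surface.endomorphism g (substitution_comp \<sigma> \<tau>) x = surface.endomorphism g \<sigma> (surface.endomorphism g \<tau> x)"
proof -
  obtain w where w: "w \<in> words (surface_gens g)" "x = word_class (surface_gens g) {surface_relator g} w"
    using assms(3) by (auto simp: surface_group_def carrier_presented_group)
  have "substitute \<tau> w \<in> words (surface_gens g)"
    using assms(2) w by (auto simp: surface.relator_substitution_def intro: substitute_in_words)
  then show ?thesis
    using surface.endomorphism_cl[OF surface.relator_substitution_comp[OF assms(1,2)] w(1)]
      surface.endomorphism_cl[OF assms(2) w(1)] surface.endomorphism_cl[OF assms(1), of "substitute \<tau> w"] w(2)
    by (simp add: substitute_comp)
qed

lemma compose_endomorphism_comp:
  assumes "surface.relator_substitution g \<sigma>" "surface.relator_substitution g \<tau>"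
  shows "compose (carrier (surface_group g)) \<rho> (surface.endomorphism g (substitution_comp \<sigma> \<tau>))
    = compose (carrier (surface_group g)) (compose (carrier (surface_group g)) \<rho> (surface.endomorphism g \<sigma>)) (surface.endomorphism g \<tau>)"
proof -
  have "surface.endomorphism g \<tau> x \<in> carrier (surface_group g)" if "x \<in> carrier (surface_group g)" for x
    using surface.endomorphism_hom[OF assms(2)] that by (auto simp: surface_group_def hom_def)
  then show ?thesis using endomorphism_comp[OF assms] by (auto simp: compose_def fun_eq_iff)
qed

text \<open>The identities between rational functions that result from applying the bridge substitution, the
  twist and the inverse bridge substitution to the coordinates.\<close>

lemma bridge_twist_algebra:
  fixes a u b v a' u' b' v' \<epsilon> :: complex
  assumes nz: "b \<noteq> 0" "b' \<noteq> 0"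
  defines "D \<equiv> b' / b" and "W \<equiv> (a' * v' + (1 - b') * u' - v) / b"
  defines "t' \<equiv> (a - 1) * v + (1 - b) * u + ((1 - b') * v - (1 - b) * (a' * v' + (1 - b') * u')) / b"
  defines "t1 \<equiv> (a / D - 1) * (D * v + (1 - b) * W) + (1 - b) * (u - a * W / D)"
  defines "v2 \<equiv> D * v + (1 - b) * W + \<epsilon> * t1 * (1 - b)" and "u2 \<equiv> u - a * W / D + \<epsilon> * t1 * (1 - a / D)"
  defines "W2 \<equiv> (D * a' * v' + (1 - b') * (D * u' + W) - v2) / b"
  shows "a / D * W2 + u2 = u + \<epsilon> * t' * (1 - a / b')"
    and "(D * u' + W - W2) / D = u' + \<epsilon> * t' * ((1 - b) / b')"
    and "(v2 - (1 - b) * W2) / D = v + \<epsilon> * t' * ((1 - b) / b')"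
proof -
  have D: "D \<noteq> 0" "D * b = b'" using nz by (simp_all add: D_def)
  have Wb: "W * b = a' * v' + (1 - b') * u' - v" using nz by (simp add: W_def)
  define k where "k = a / D"
  have k: "k * D = a" "a * W / D = k * W" using D(1) by (simp_all add: k_def)
  have "t1 = (k - 1) * (D * v + (1 - b) * W) + (1 - b) * (u - k * W)"
    unfolding t1_def k(2) k_def[symmetric] ..
  also have "\<dots> = (k * D) * v - D * v - (1 - b) * W + (1 - b) * u" by (simp add: algebra_simps)
  finally have t1: "t1 = a * v - D * v - (1 - b) * W + (1 - b) * u" unfolding k(1) .
  have t'_b: "t' * b = ((a - 1) * v + (1 - b) * u) * b + ((1 - b') * v - (1 - b) * (a' * v' + (1 - b') * u'))"
    using nz by (simp add: t'_def distrib_right)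
  have "t1 * b = a * v * b - (D * b) * v - (1 - b) * (W * b) + (1 - b) * u * b"
    unfolding t1 by (simp add: algebra_simps)
  also have "\<dots> = t' * b" unfolding t'_b Wb D(2) by (simp add: algebra_simps)
  finally have tt: "t1 = t'" using nz by simp
  have "W2 * b = D * a' * v' + (1 - b') * (D * u' + W) - v2"
    using nz by (simp add: W2_def)
  also have "\<dots> = D * (a' * v' + (1 - b') * u') + (1 - b') * W - D * v - (1 - b) * W - \<epsilon> * t' * (1 - b)"
    unfolding v2_def tt by (simp add: algebra_simps)
  also have "\<dots> = (D * b) * W - b' * W + b * W - \<epsilon> * t' * (1 - b)"
  proof -
    have "a' * v' + (1 - b') * u' = W * b + v" using Wb by simp
    then show ?thesis by (simp add: algebra_simps)
  qed
  also have "\<dots> = (W - \<epsilon> * t' * ((1 - b) / b)) * b"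
  proof -
    have q: "(\<epsilon> * t' * ((1 - b) / b)) * b = \<epsilon> * t' * (1 - b)" using nz by simp
    show ?thesis unfolding left_diff_distrib q D(2) by simp
  qed
  finally have "W2 * b = (W - \<epsilon> * t' * ((1 - b) / b)) * b" .
  then have W2: "W2 = W - \<epsilon> * t' * ((1 - b) / b)" using nz by simp
  show "a / D * W2 + u2 = u + \<epsilon> * t' * (1 - a / b')"
    unfolding W2 u2_def tt using nz by (simp add: D_def field_simps)
  show "(D * u' + W - W2) / D = u' + \<epsilon> * t' * ((1 - b) / b')"
    unfolding W2 using nz by (simp add: D_def field_simps)
  show "(v2 - (1 - b) * W2) / D = v + \<epsilon> * t' * ((1 - b) / b')"
    unfolding W2 v2_def tt using nz by (simp add: D_def field_simps)
qed

text \<open>Transport of the handle twist by the bridge substitution.\<close>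

lemma bridge_twist_rep:
  fixes e :: bool
  assumes c: "rep_coords g A U B V" and i: "i \<in> {1..<g}"
  defines "t' \<equiv> (A i - 1) * V i + (1 - B i) * U i +
      ((1 - B (Suc i)) * V i - (1 - B i) * (A (Suc i) * V (Suc i) + (1 - B (Suc i)) * U (Suc i))) / B i"
  defines "U' \<equiv> U(i := U i + csign e * t' * (1 - A i / B (Suc i)), Suc i := U (Suc i) + csign e * t' * ((1 - B i) / B (Suc i)))"
    and "V' \<equiv> V(i := V i + csign e * t' * ((1 - B i) / B (Suc i)))"
  shows "rep_coords g A U' B V' \<and>
    compose (carrier (surface_group g)) (rep g A U B V)
      (surface.endomorphism g (bridge_twist_substitution (signed_word e (commutator_word i)) i)) = rep g A U' B V'"
proof -
  let ?C = "carrier (surface_group g)"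
  let ?b = "bridge_substitution (bridge_word i) i" and ?b' = "bridge_substitution (word_inverse (bridge_word i)) i"
  let ?t = "twist_substitution (signed_word e (commutator_word i)) i"
  have ig: "i \<in> {1..g}" "Suc i \<in> {1..g}" using i by auto
  have rs: "surface.relator_substitution g ?b" "surface.relator_substitution g ?b'" "surface.relator_substitution g ?t"
    using inverse_twist_substitutions[OF ig(1)] inverse_bridge_substitutions[OF i]
    by (auto simp: surface.inverse_substitutions_def signed_word_def)
  define D W where "D = B (Suc i) / B i" and "W = (A (Suc i) * V (Suc i) + (1 - B (Suc i)) * U (Suc i) - V i) / B i"
  define A1 U1 V1 where "A1 = A(i := A i / D, Suc i := D * A (Suc i))"
    and "U1 = U(i := U i - A i * W / D, Suc i := D * U (Suc i) + W)" and "V1 = V(i := D * V i + (1 - B i) * W)"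
  have nz: "\<forall>i\<in>{1..g}. A i \<noteq> 0 \<and> B i \<noteq> 0" using c by (simp add: rep_coords_def)
  have 1: "rep_coords g A1 U1 B V1 \<and> compose ?C (rep g A U B V) (surface.endomorphism g ?b) = rep g A1 U1 B V1"
    by (rule compose_endomorphism_rep[OF c rs(1)])
       (simp add: eval_bridge(1)[OF nz i] A1_def U1_def V1_def D_def W_def)
  define U2 V2 where "U2 = U1(i := U1 i + csign e * ((A1 i - 1) * V1 i + (1 - B i) * U1 i) * (1 - A1 i))"
    and "V2 = V1(i := V1 i + csign e * ((A1 i - 1) * V1 i + (1 - B i) * U1 i) * (1 - B i))"
  have 2: "rep_coords g A1 U2 B V2 \<and> compose ?C (rep g A1 U1 B V1) (surface.endomorphism g ?t) = rep g A1 U2 B V2"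
    unfolding U2_def V2_def by (rule twist_rep) (use 1 ig in auto)
  define W2 where "W2 = (A1 (Suc i) * V2 (Suc i) + (1 - B (Suc i)) * U2 (Suc i) - V2 i) / B i"
  define A3 U3 V3 where "A3 = A1(i := A1 i * D, Suc i := A1 (Suc i) / D)"
    and "U3 = U2(i := A1 i * W2 + U2 i, Suc i := (U2 (Suc i) - W2) / D)" and "V3 = V2(i := (V2 i - (1 - B i) * W2) / D)"
  have nz1: "\<forall>i\<in>{1..g}. A1 i \<noteq> 0 \<and> B i \<noteq> 0" using 2 by (simp add: rep_coords_def)
  have 3: "rep_coords g A3 U3 B V3 \<and> compose ?C (rep g A1 U2 B V2) (surface.endomorphism g ?b') = rep g A3 U3 B V3"
    by (rule compose_endomorphism_rep[OF _ rs(2)])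
       (use 2 in \<open>simp_all add: eval_bridge(2)[OF nz1 i] A3_def U3_def V3_def D_def W2_def\<close>)
  have b: "B i \<noteq> 0" "B (Suc i) \<noteq> 0" using nz ig by auto
  have D: "D \<noteq> 0" using b by (simp add: D_def)
  note alg = bridge_twist_algebra[OF b, where a' = "A (Suc i)" and v' = "V (Suc i)" and u' = "U (Suc i)"
      and v = "V i" and a = "A i" and u = "U i" and \<epsilon> = "csign e", folded D_def, folded W_def t'_def]
  have A3: "A3 j = A j" for j using D by (simp add: A3_def A1_def)
  have V2s: "V2 (Suc i) = V (Suc i)" by (simp add: V2_def V1_def)
  have U2s: "U2 (Suc i) = D * U (Suc i) + W" by (simp add: U2_def U1_def)
  have V3: "V3 j = V' j" for j
    using alg(3) by (simp add: V3_def V'_def W2_def U2s V2s) (simp add: V2_def U2_def U1_def V1_def A1_def)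
  have U3: "U3 j = U' j" for j
    using alg(1,2) by (simp add: U3_def U'_def W2_def U2s V2s) (simp add: V2_def U2_def U1_def V1_def A1_def)
  have "compose ?C (rep g A U B V) (surface.endomorphism g (bridge_twist_substitution (signed_word e (commutator_word i)) i)) = rep g A3 U3 B V3"
    unfolding bridge_twist_substitution_def
    using 1 2 3 rs by (simp add: compose_endomorphism_comp surface.relator_substitution_comp)
  moreover have "A3 = A" "U3 = U'" "V3 = V'" using A3 U3 V3 by auto
  ultimately show ?thesis using 3 by simp
qed

subsection \<open>Mapping classes and their action\<close>

text \<open>The set of all compositions with representatives of the outer class collapses to one conjugacy
  class because inner automorphisms act by conjugation.\<close>

lemma mcg_action_outer_class:
  assumes inv: "surface.inverse_substitutions g \<sigma> \<tau>" and \<rho>: "\<rho> \<in> Hom_Aff g"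
  shows "mcg_action g (surface.outer_class g \<tau>) (rep_class g \<rho>)
    = rep_class g (compose (carrier (surface_group g)) \<rho> (surface.endomorphism g \<sigma>))"
proof -
  let ?G = "surface_group g" and ?C = "carrier (surface_group g)"
  interpret G: group ?G by (simp add: surface_group_def group_presented_group)
  have inv': "surface.inverse_substitutions g \<tau> \<sigma>" by (rule surface.inverse_substitutions_sym[OF inv])
  have \<sigma>: "surface.relator_substitution g \<sigma>" using inv by (simp add: surface.inverse_substitutions_def)
  have hom: "surface.endomorphism g \<sigma> \<in> hom ?G ?G"
    using surface.endomorphism_hom[OF \<sigma>] by (simp add: surface_group_def)
  have \<rho>h: "\<rho> \<in> hom ?G Aff" using \<rho> by (simp add: Hom_Aff_def)
  interpret e: group_hom ?G ?G "surface.endomorphism g \<sigma>"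
    using hom by (simp add: group_hom_def group_hom_axioms_def G.is_group)
  interpret r: group_hom ?G Aff \<rho>
    using \<rho>h by (simp add: group_hom_def group_hom_axioms_def G.is_group group_Aff)
  have key: "compose ?C (conjugate_rep g h \<rho>) (inv\<^bsub>AutoGroup ?G\<^esub> (compose ?C (surface.conjugation g a) (surface.endomorphism g \<tau>)))
    = conjugate_rep g (h \<otimes>\<^bsub>Aff\<^esub> inv\<^bsub>Aff\<^esub> \<rho> (surface.endomorphism g \<sigma> a)) (compose ?C \<rho> (surface.endomorphism g \<sigma>))"
    if h: "h \<in> carrier Aff" and a: "a \<in> ?C" for h a
  proof
    fix y
    let ?e = "surface.endomorphism g \<sigma>"
    show "compose ?C (conjugate_rep g h \<rho>) (inv\<^bsub>AutoGroup ?G\<^esub> (compose ?C (surface.conjugation g a) (surface.endomorphism g \<tau>))) y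
      = conjugate_rep g (h \<otimes>\<^bsub>Aff\<^esub> inv\<^bsub>Aff\<^esub> \<rho> (?e a)) (compose ?C \<rho> ?e) y"
    proof (cases "y \<in> ?C")
      case True
      have "(inv\<^bsub>AutoGroup ?G\<^esub> (compose ?C (surface.conjugation g a) (surface.endomorphism g \<tau>))) y = ?e (inv\<^bsub>?G\<^esub> a \<otimes>\<^bsub>?G\<^esub> y \<otimes>\<^bsub>?G\<^esub> a)"
        using surface.outer_class_inverse[OF inv, of a y] a True by (simp add: surface_group_def)
      moreover have "?e (inv\<^bsub>?G\<^esub> a \<otimes>\<^bsub>?G\<^esub> y \<otimes>\<^bsub>?G\<^esub> a) = inv\<^bsub>?G\<^esub> (?e a) \<otimes>\<^bsub>?G\<^esub> ?e y \<otimes>\<^bsub>?G\<^esub> ?e a"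
        using a True by simp
      moreover have c: "?e a \<in> ?C" "?e y \<in> ?C" using a True hom by (auto simp: hom_def)
      moreover have "\<rho> (inv\<^bsub>?G\<^esub> (?e a) \<otimes>\<^bsub>?G\<^esub> ?e y \<otimes>\<^bsub>?G\<^esub> ?e a) = inv\<^bsub>Aff\<^esub> (\<rho> (?e a)) \<otimes>\<^bsub>Aff\<^esub> \<rho> (?e y) \<otimes>\<^bsub>Aff\<^esub> \<rho> (?e a)"
        using c by simp
      moreover have "\<rho> (?e a) \<in> carrier Aff" "\<rho> (?e y) \<in> carrier Aff" using c \<rho>h by (auto simp: hom_def)
      ultimately show ?thesis
        using True h a by (simp add: compose_def conjugate_rep_def Aff.m_assoc Aff.inv_mult_group)
    qed (simp add: compose_def conjugate_rep_def)
  qed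
  have \<rho>c: "\<rho> (surface.endomorphism g \<sigma> a) \<in> carrier Aff" if "a \<in> ?C" for a
    using that hom \<rho>h by (auto simp: hom_def)
  show ?thesis
  proof (intro equalityI subsetI)
    fix x assume "x \<in> mcg_action g (surface.outer_class g \<tau>) (rep_class g \<rho>)"
    then obtain h a where "h \<in> carrier Aff" "a \<in> ?C"
      "x = compose ?C (conjugate_rep g h \<rho>) (inv\<^bsub>AutoGroup ?G\<^esub> (compose ?C (surface.conjugation g a) (surface.endomorphism g \<tau>)))"
      by (auto simp: mcg_action_def rep_class_def surface.outer_class_def surface_group_def)
    then show "x \<in> rep_class g (compose ?C \<rho> (surface.endomorphism g \<sigma>))"
      using key \<rho>c unfolding rep_class_def by (metis (mono_tags, lifting) Aff.inv_closed Aff.m_closed mem_Collect_eq)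
  next
    fix x assume "x \<in> rep_class g (compose ?C \<rho> (surface.endomorphism g \<sigma>))"
    then obtain h where h: "h \<in> carrier Aff" "x = conjugate_rep g h (compose ?C \<rho> (surface.endomorphism g \<sigma>))"
      by (auto simp: rep_class_def)
    have one: "\<rho> (surface.endomorphism g \<sigma> \<one>\<^bsub>?G\<^esub>) = \<one>\<^bsub>Aff\<^esub>"
      using hom_one[OF hom G.is_group G.is_group] hom_one[OF \<rho>h G.is_group group_Aff] by simp
    have "x = compose ?C (conjugate_rep g h \<rho>) (inv\<^bsub>AutoGroup ?G\<^esub> (compose ?C (surface.conjugation g \<one>\<^bsub>?G\<^esub>) (surface.endomorphism g \<tau>)))"
      using key[OF h(1) G.one_closed] h by (simp add: one)
    then show "x \<in> mcg_action g (surface.outer_class g \<tau>) (rep_class g \<rho>)"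
      using h(1) G.one_closed unfolding mcg_action_def rep_class_def surface.outer_class_def surface_group_def by blast
  qed
qed

lemma outer_class_in_mapping_class_group:
  assumes "surface.inverse_substitutions g \<sigma> \<tau>" "fundamental_class (surface_group g) \<kappa>"
  shows "surface.outer_class g \<tau> \<in> carrier (mapping_class_group g \<kappa>)"
  using surface.outer_class_carrier[OF assms(1)] surface.outer_class_preserves_class[OF assms(1), of \<kappa>] assms(2)
  by (simp add: mapping_class_group_def fundamental_class_def surface_group_def)

section \<open>Smooth maps\<close>

subsection \<open>Calculus of smooth maps\<close>

text \<open>The defining recursion uses derivatives at points, so that openness of the domain is what allows
  changing a function outside of it.\<close>

lemma Ck_on_cong:
  assumes "open W" "\<And>x. x \<in> W \<Longrightarrow> f x = h x" "Ck_on k W f"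
  shows "Ck_on k W h"
  using assms(2,3)
proof (induction k arbitrary: f h)
  case 0
  then show ?case using continuous_on_cong[of W W f h] by simp
next
  case (Suc k)
  have d: "f differentiable at x" if "x \<in> W" for x using Suc.prems(2) that by simp
  have "(h has_derivative frechet_derivative f (at x)) (at x)" if "x \<in> W" for x
    using has_derivative_transform_within_open[OF _ assms(1) that, of f "frechet_derivative f (at x)" UNIV h]
      d[OF that] Suc.prems(1) by (simp add: frechet_derivative_works)
  note h = this
  have "Ck_on k W (\<lambda>x. frechet_derivative h (at x) v)" for v
    by (rule Suc.IH[of "\<lambda>x. frechet_derivative f (at x) v"])
       (use Suc.prems(2) frechet_derivative_at[OF h] in auto)
  then show ?case using h by (auto simp: differentiable_def)
qed

lemma Ck_on_SucI:
  assumes "open W" "\<And>x. x \<in> W \<Longrightarrow> (f has_derivative f' x) (at x)" "\<And>v. Ck_on k W (\<lambda>x. f' x v)"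
  shows "Ck_on (Suc k) W f"
proof -
  have "Ck_on k W (\<lambda>x. frechet_derivative f (at x) v)" for v
    by (rule Ck_on_cong[OF assms(1) _ assms(3)[of v]]) (use frechet_derivative_at[OF assms(2)] in auto)
  then show ?thesis using assms(2) by (auto simp: differentiable_def)
qed

lemma Ck_on_SucD:
  assumes "Ck_on (Suc k) W f" "x \<in> W"
  shows "(f has_derivative frechet_derivative f (at x)) (at x)"
  using assms by (simp add: frechet_derivative_works)

lemma Ck_on_subset: "Ck_on k W f \<Longrightarrow> W' \<subseteq> W \<Longrightarrow> Ck_on k W' f"
  by (induction k arbitrary: f) (auto intro: continuous_on_subset)

lemma Ck_on_local:
  assumes "\<And>x. x \<in> W \<Longrightarrow> \<exists>W'. open W' \<and> x \<in> W' \<and> Ck_on k W' f"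
  shows "Ck_on k W f"
  using assms
proof (induction k arbitrary: f)
  case 0
  then have "isCont f x" if "x \<in> W" for x
    using that continuous_on_eq_continuous_at by (metis Ck_on.simps(1))
  then show ?case by (simp add: continuous_at_imp_continuous_on)
next
  case (Suc k)
  have "Ck_on k W (\<lambda>x. frechet_derivative f (at x) v)" for v
  proof (rule Suc.IH)
    fix x assume "x \<in> W"
    then obtain W' where "open W'" "x \<in> W'" "Ck_on (Suc k) W' f" using Suc.prems by blast
    then show "\<exists>W'. open W' \<and> x \<in> W' \<and> Ck_on k W' (\<lambda>x. frechet_derivative f (at x) v)" by auto
  qed
  moreover have "f differentiable at x" if "x \<in> W" for x
    using Suc.prems[OF that] by auto
  ultimately show ?case by simp
qed

lemma Ck_on_Suc_imp: "Ck_on (Suc k) W f \<Longrightarrow> Ck_on k W f"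
proof (induction k arbitrary: f)
  case 0
  then have "continuous (at x) f" if "x \<in> W" for x
    using that differentiable_imp_continuous_within[of f x UNIV] by simp
  then show ?case by (simp add: continuous_at_imp_continuous_on)
qed auto

lemma Ck_on_const: "Ck_on k W (\<lambda>x. c)"
  by (induction k arbitrary: c) auto

lemma Ck_on_bounded_linear:
  assumes L: "bounded_linear L" and W: "open W"
  shows "Ck_on k W f \<Longrightarrow> Ck_on k W (\<lambda>x. L (f x))"
proof (induction k arbitrary: f)
  case 0
  then show ?case using bounded_linear.continuous_on[OF L] by simp
next
  case (Suc k)
  show ?case
  proof (rule Ck_on_SucI[OF W])
    show "((\<lambda>x. L (f x)) has_derivative (\<lambda>v. L (frechet_derivative f (at x) v))) (at x)" if "x \<in> W" for x
      using bounded_linear.has_derivative[OF L Ck_on_SucD[OF Suc.prems that]] .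
    show "Ck_on k W (\<lambda>x. L (frechet_derivative f (at x) v))" for v
      using Suc by simp
  qed
qed

lemma Ck_on_linear:
  assumes L: "bounded_linear L" and W: "open W"
  shows "Ck_on k W L"
proof (cases k)
  case 0
  then show ?thesis using linear_continuous_on[OF L] by simp
next
  case (Suc j)
  show ?thesis unfolding Suc
    by (rule Ck_on_SucI[OF W bounded_linear_imp_has_derivative[OF L]]) (rule Ck_on_const)
qed

lemma Ck_on_add:
  assumes W: "open W"
  shows "Ck_on k W f \<Longrightarrow> Ck_on k W h \<Longrightarrow> Ck_on k W (\<lambda>x. f x + h x)"
proof (induction k arbitrary: f h)
  case 0
  then show ?case by (simp add: continuous_on_add)
next
  case (Suc k)
  show ?case
    by (rule Ck_on_SucI[OF W has_derivative_add[OF Ck_on_SucD[OF Suc.prems(1)] Ck_on_SucD[OF Suc.prems(2)]]])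
       (use Suc in auto)
qed

lemma Ck_on_mult:
  fixes f h :: "_ \<Rightarrow> 'b::real_normed_algebra"
  assumes W: "open W"
  shows "Ck_on k W f \<Longrightarrow> Ck_on k W h \<Longrightarrow> Ck_on k W (\<lambda>x. f x * h x)"
proof (induction k arbitrary: f h)
  case 0
  then show ?case by (simp add: continuous_on_mult)
next
  case (Suc k)
  show ?case
  proof (rule Ck_on_SucI[OF W has_derivative_mult[OF Ck_on_SucD[OF Suc.prems(1)] Ck_on_SucD[OF Suc.prems(2)]]])
    show "Ck_on k W (\<lambda>x. f x * frechet_derivative h (at x) v + frechet_derivative f (at x) v * h x)" for v
      using Suc.prems Ck_on_Suc_imp[OF Suc.prems(1)] Ck_on_Suc_imp[OF Suc.prems(2)]
      by (intro Ck_on_add[OF W] Suc.IH) auto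
  qed
qed

lemma Ck_on_inverse:
  fixes f :: "_ \<Rightarrow> 'b::real_normed_field"
  assumes W: "open W"
  shows "Ck_on k W f \<Longrightarrow> (\<And>x. x \<in> W \<Longrightarrow> f x \<noteq> 0) \<Longrightarrow> Ck_on k W (\<lambda>x. inverse (f x))"
proof (induction k arbitrary: f)
  case 0
  then show ?case by (simp add: continuous_on_inverse)
next
  case (Suc k)
  have inv: "Ck_on k W (\<lambda>x. inverse (f x))" by (rule Suc.IH[OF Ck_on_Suc_imp[OF Suc.prems(1)] Suc.prems(2)])
  show ?case
  proof (rule Ck_on_SucI[OF W])
    show "((\<lambda>x. inverse (f x)) has_derivative (\<lambda>v. - 1 * (inverse (f x) * frechet_derivative f (at x) v * inverse (f x)))) (at x)"
      if "x \<in> W" for x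
      using Deriv.has_derivative_inverse[OF Suc.prems(2)[OF that] Ck_on_SucD[OF Suc.prems(1) that]] by simp
    show "Ck_on k W (\<lambda>x. - 1 * (inverse (f x) * frechet_derivative f (at x) v * inverse (f x)))" for v
      using Suc.prems(1) by (intro Ck_on_mult[OF W] Ck_on_const inv) auto
  qed
qed

lemma Ck_on_sum:
  assumes "open W" "\<And>i. i \<in> I \<Longrightarrow> Ck_on k W (f i)"
  shows "Ck_on k W (\<lambda>x. \<Sum>i\<in>I. f i x)"
  using assms(2) by (induction I rule: infinite_finite_induct) (auto intro: Ck_on_const Ck_on_add[OF assms(1)])

lemma smooth_on_intros:
  assumes W: "open W"
  shows "smooth_on W (\<lambda>x. c)"
    and "bounded_linear L0 \<Longrightarrow> smooth_on W L0"
    and "bounded_linear L \<Longrightarrow> smooth_on W f \<Longrightarrow> smooth_on W (\<lambda>x. L (f x))"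
    and "smooth_on W f1 \<Longrightarrow> smooth_on W f2 \<Longrightarrow> smooth_on W (\<lambda>x. f1 x + f2 x)"
    and "smooth_on W f1 \<Longrightarrow> smooth_on W f2 \<Longrightarrow> smooth_on W (\<lambda>x. f1 x - f2 x)"
    and "(\<And>i. i \<in> I \<Longrightarrow> smooth_on W (fs i)) \<Longrightarrow> smooth_on W (\<lambda>x. \<Sum>i\<in>I. fs i x)"
  using Ck_on_add[OF W, of _ f1 "\<lambda>x. - f2 x"] Ck_on_bounded_linear[OF bounded_linear_minus[OF bounded_linear_ident] W, of _ f2]
  by (auto simp: smooth_on_def intro: Ck_on_const Ck_on_linear[OF _ W] Ck_on_bounded_linear[OF _ W] Ck_on_add[OF W] Ck_on_sum[OF W])

lemma smooth_on_mult_intros: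
  fixes h1 h2 :: "'a::real_normed_vector \<Rightarrow> complex"
  assumes W: "open W"
  shows "smooth_on W h1 \<Longrightarrow> smooth_on W h2 \<Longrightarrow> smooth_on W (\<lambda>x. h1 x * h2 x)"
    and "smooth_on W h1 \<Longrightarrow> smooth_on W h2 \<Longrightarrow> (\<And>x. x \<in> W \<Longrightarrow> h2 x \<noteq> 0) \<Longrightarrow> smooth_on W (\<lambda>x. h1 x / h2 x)"
  by (auto simp: smooth_on_def divide_inverse intro!: Ck_on_mult[OF W] Ck_on_inverse[OF W])

lemma smooth_on_subset: "smooth_on W f \<Longrightarrow> W' \<subseteq> W \<Longrightarrow> smooth_on W' f"
  by (auto simp: smooth_on_def intro: Ck_on_subset)

lemma smooth_on_cong: "open W \<Longrightarrow> (\<And>x. x \<in> W \<Longrightarrow> f x = h x) \<Longrightarrow> smooth_on W f \<Longrightarrow> smooth_on W h"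
  unfolding smooth_on_def using Ck_on_cong by blast

text \<open>Smoothness is a local property.\<close>

lemma smooth_on_local:
  assumes "\<And>x. x \<in> W \<Longrightarrow> \<exists>W'. open W' \<and> x \<in> W' \<and> smooth_on W' f"
  shows "smooth_on W f"
  unfolding smooth_on_def
proof (intro allI Ck_on_local)
  fix k x assume "x \<in> W"
  then obtain W' where "open W'" "x \<in> W'" "smooth_on W' f" using assms by blast
  then show "\<exists>W'. open W' \<and> x \<in> W' \<and> Ck_on k W' f" unfolding smooth_on_def by blast
qed

lemma smooth_on_imp_continuous_on: "smooth_on W f \<Longrightarrow> continuous_on W f"
  unfolding smooth_on_def by (metis Ck_on.simps(1))

lemma smooth_on_imp_differentiable: "smooth_on W f \<Longrightarrow> x \<in> W \<Longrightarrow> f differentiable at x"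
  unfolding smooth_on_def by (metis Ck_on.simps(2))

section \<open>Change of variables for the volume of a bilinear form\<close>

text \<open>An index type with as many elements as the dimension, so that the change of variables formula
  for real coordinate space becomes applicable to an arbitrary Euclidean space.\<close>

typedef (overloaded) ('e::euclidean_space) dim_index = "{..<DIM('e)} :: nat set"
  by (rule exI[of _ 0]) simp

instantiation dim_index :: (euclidean_space) wellorder
begin

definition less_eq_dim_index :: "'a dim_index \<Rightarrow> 'a dim_index \<Rightarrow> bool" where
  "less_eq_dim_index i j \<longleftrightarrow> Rep_dim_index i \<le> Rep_dim_index j"

definition less_dim_index :: "'a dim_index \<Rightarrow> 'a dim_index \<Rightarrow> bool" where
  "less_dim_index i j \<longleftrightarrow> Rep_dim_index i < Rep_dim_index j"

instance
proof
  fix P and a :: "'a dim_index"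
  assume step: "\<And>x :: 'a dim_index. (\<And>y. y < x \<Longrightarrow> P y) \<Longrightarrow> P x"
  show "P a"
  proof (induction a rule: measure_induct_rule[where f = Rep_dim_index])
    case (less x)
    show ?case by (rule step, rule less.IH) (simp only: less_dim_index_def)
  qed
qed (auto simp: less_eq_dim_index_def less_dim_index_def Rep_dim_index_inject)

end

lemma bij_dim_index: "bij_betw Rep_dim_index (UNIV :: 'e dim_index set) {..<DIM('e::euclidean_space)}"
  by (metis type_definition.Rep_inject type_definition.Rep_range type_definition_dim_index bij_betw_def injI)

instance dim_index :: (euclidean_space) finite
  by standard (use bij_betw_finite[OF bij_dim_index] in simp)

definition basis_elt :: "'e::euclidean_space dim_index \<Rightarrow> 'e" where
  "basis_elt = (SOME e. bij_betw e UNIV Basis)"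

lemma bij_basis_elt: "bij_betw basis_elt UNIV (Basis :: 'e::euclidean_space set)"
proof -
  have "card (UNIV :: 'e dim_index set) = card (Basis :: 'e set)"
    using bij_betw_same_card[OF bij_dim_index] by simp
  then have "\<exists>e. bij_betw e (UNIV :: 'e dim_index set) (Basis :: 'e set)"
    by (intro finite_same_card_bij) auto
  then show ?thesis unfolding basis_elt_def by (rule someI_ex)
qed

lemma inner_basis_elt: "basis_elt i \<bullet> basis_elt j = (if i = j then 1 else 0)"
  using bij_basis_elt unfolding bij_betw_def inj_on_def by (metis UNIV_I imageI inner_Basis)

definition of_coords :: "real ^ 'e dim_index \<Rightarrow> 'e::euclidean_space" where
  "of_coords v = (\<Sum>i\<in>UNIV. v $ i *\<^sub>R basis_elt i)"

definition to_coords :: "'e::euclidean_space \<Rightarrow> real ^ 'e dim_index" where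
  "to_coords x = (\<chi> i. x \<bullet> basis_elt i)"

lemma linear_of_coords: "linear of_coords"
  by (rule linearI) (auto simp: of_coords_def scaleR_add_left sum.distrib scaleR_sum_right)

lemma linear_to_coords: "linear to_coords"
  by (rule linearI) (auto simp: to_coords_def vec_eq_iff inner_add_left)

lemma of_coords_inner: "of_coords v \<bullet> basis_elt i = v $ i"
proof -
  have "of_coords v \<bullet> basis_elt i = (\<Sum>j\<in>UNIV. if j = i then v $ j else 0)"
    unfolding of_coords_def inner_sum_left by (intro sum.cong) (auto simp: inner_basis_elt)
  then show ?thesis by simp
qed

lemma to_of_coords: "to_coords (of_coords v) = v"
  by (simp add: to_coords_def vec_eq_iff of_coords_inner)

lemma of_to_coords: "of_coords (to_coords x) = x"
proof -
  have "x = (\<Sum>b\<in>Basis. (x \<bullet> b) *\<^sub>R b)" by (simp add: euclidean_representation)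
  also have "\<dots> = of_coords (to_coords x)"
    using sum.reindex_bij_betw[OF bij_basis_elt, of "\<lambda>b. (x \<bullet> b) *\<^sub>R b"] by (simp add: of_coords_def to_coords_def)
  finally show ?thesis ..
qed

lemma of_coords_axis: "of_coords (axis i 1) = basis_elt i"
proof -
  have "to_coords (basis_elt i) = axis i 1"
    by (auto simp: to_coords_def vec_eq_iff axis_def inner_basis_elt)
  then show ?thesis by (metis of_to_coords)
qed

lemma borel_of_coords [measurable]: "of_coords \<in> borel_measurable borel"
  using linear_continuous_on[OF linear_conv_bounded_linear[THEN iffD1, OF linear_of_coords]]
  by (intro borel_measurable_continuous_onI)

lemma lborel_of_coords: "distr lborel borel of_coords = (lborel :: 'e::euclidean_space measure)"
proof (rule lborel_eqI[symmetric])
  fix l u :: 'e assume lu: "\<And>b. b \<in> Basis \<Longrightarrow> l \<bullet> b \<le> u \<bullet> b"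
  have ax: "Basis = range (\<lambda>i :: 'e dim_index. axis i (1::real))" by (auto simp: Basis_vec_def)
  have B: "range basis_elt = (Basis :: 'e set)" by (rule bij_betw_imp_surj_on[OF bij_basis_elt])
  have "of_coords -` box l u = box (to_coords l) (to_coords u)"
    unfolding box_def ax by (auto simp: B[symmetric] of_coords_inner inner_axis to_coords_def)
  then have "emeasure (distr lborel borel of_coords) (box l u) = emeasure lborel (box (to_coords l) (to_coords u))"
    by (subst emeasure_distr) auto
  also have "\<dots> = ennreal (\<Prod>b\<in>Basis. (to_coords u - to_coords l) \<bullet> b)"
  proof (rule emeasure_lborel_box)
    have "l \<bullet> basis_elt i \<le> u \<bullet> basis_elt i" for i using lu[of "basis_elt i"] B by blast
    then show "to_coords l \<bullet> b \<le> to_coords u \<bullet> b" if "b \<in> Basis" for b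
      using that by (auto simp: ax to_coords_def inner_axis)
  qed
  also have "(\<Prod>b\<in>Basis. (to_coords u - to_coords l) \<bullet> b) = (\<Prod>i\<in>UNIV. (to_coords u - to_coords l) $ i)"
    unfolding ax by (subst prod.reindex) (auto simp: inj_on_def axis_eq_axis inner_axis)
  also have "\<dots> = (\<Prod>i\<in>UNIV. (u - l) \<bullet> basis_elt i)" by (simp add: to_coords_def inner_diff_left)
  also have "\<dots> = (\<Prod>b\<in>Basis. (u - l) \<bullet> b)"
    by (rule prod.reindex_bij_betw[OF bij_basis_elt])
  finally show "emeasure (distr lborel borel of_coords) (box l u) = ennreal (\<Prod>b\<in>Basis. (u - l) \<bullet> b)" .
qed simp

lemma nn_integral_of_coords:
  fixes h :: "'e::euclidean_space \<Rightarrow> ennreal"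
  assumes [measurable]: "h \<in> borel_measurable borel"
  shows "(\<integral>\<^sup>+x. h x \<partial>lborel) = (\<integral>\<^sup>+v. h (of_coords v) \<partial>lborel)"
proof -
  have "(\<integral>\<^sup>+x. h x \<partial>lborel) = (\<integral>\<^sup>+x. h x \<partial>distr lborel borel of_coords)" by (simp only: lborel_of_coords)
  also have "\<dots> = (\<integral>\<^sup>+v. h (of_coords v) \<partial>lborel)" by (rule nn_integral_distr) measurable
  finally show ?thesis .
qed

text \<open>The determinant of the Gram matrix; the square root of its absolute value is the density of the
  volume that the form defines.\<close>

definition gram_det :: "('e::euclidean_space \<Rightarrow> 'e \<Rightarrow> real) \<Rightarrow> real" where
  "gram_det W = det (\<chi> i j. W (basis_elt i) (basis_elt j) :: real ^ 'e dim_index ^ 'e dim_index)"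

lemma linear_bilinear:
  assumes "bilinear W"
  shows "linear (\<lambda>v. W v w)" "linear (W v)"
  using assms by (auto simp: bilinear_def)

lemma bilinear_of_coords:
  fixes W :: "'e::euclidean_space \<Rightarrow> 'e \<Rightarrow> real"
  assumes W: "bilinear W"
  shows "W (of_coords v) (of_coords w) = (\<Sum>k\<in>UNIV. \<Sum>l\<in>UNIV. v $ k * w $ l * W (basis_elt k) (basis_elt l))"
  unfolding of_coords_def linear_sum[OF linear_bilinear(1)[OF W]] linear_sum[OF linear_bilinear(2)[OF W]]
    linear_scale[OF linear_bilinear(1)[OF W]] linear_scale[OF linear_bilinear(2)[OF W]]
  by (subst sum.swap) (simp add: sum_distrib_left mult_ac)

text \<open>The Gram matrix of a pullback is obtained by multiplying with the Jacobian matrix on both sides.\<close>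

lemma gram_det_pullback:
  fixes W W' :: "'e::euclidean_space \<Rightarrow> 'e \<Rightarrow> real"
  assumes W': "bilinear W'" and eq: "\<And>v w. W' (D v) (D w) = W v w"
  shows "gram_det W = (det (matrix (to_coords \<circ> D \<circ> of_coords)))\<^sup>2 * gram_det W'"
proof -
  let ?A = "matrix (to_coords \<circ> D \<circ> of_coords)"
  let ?G = "\<chi> i j. W' (basis_elt i) (basis_elt j) :: real ^ 'e dim_index ^ 'e dim_index"
  have "D (basis_elt i) = of_coords (column i ?A)" for i
    by (simp add: column_def matrix_def of_coords_axis of_to_coords vec_lambda_eta)
  then have W_eq: "W (basis_elt i) (basis_elt j) = (\<Sum>k\<in>UNIV. \<Sum>l\<in>UNIV. ?A $ k $ i * ?A $ l $ j * W' (basis_elt k) (basis_elt l))" for i j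
    unfolding eq[symmetric] by (simp only: bilinear_of_coords[OF W']) (simp add: column_def)
  have T_eq: "(transpose ?A ** ?G ** ?A) $ i $ j = (\<Sum>l\<in>UNIV. \<Sum>k\<in>UNIV. ?A $ k $ i * ?A $ l $ j * W' (basis_elt k) (basis_elt l))" for i j
    by (simp add: matrix_matrix_mult_def transpose_def sum_distrib_left sum_distrib_right mult_ac)
  have "W (basis_elt i) (basis_elt j) = (transpose ?A ** ?G ** ?A) $ i $ j" for i j
    unfolding W_eq T_eq by (rule sum.swap)
  then have "(\<chi> i j. W (basis_elt i) (basis_elt j)) = transpose ?A ** ?G ** ?A"
    by (simp only: vec_eq_iff vec_lambda_beta simp_thms)
  then show ?thesis
    unfolding gram_det_def by (simp add: det_mul det_transpose power2_eq_square)
qed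

lemma gram_det_nonzero:
  fixes W :: "'e::euclidean_space \<Rightarrow> 'e \<Rightarrow> real"
  assumes W: "bilinear W" and nd: "\<And>v. v \<noteq> 0 \<Longrightarrow> \<exists>w. W v w \<noteq> 0"
  shows "gram_det W \<noteq> 0"
proof
  assume "gram_det W = 0"
  let ?G = "\<chi> i j. W (basis_elt i) (basis_elt j) :: real ^ 'e dim_index ^ 'e dim_index"
  have "det (transpose ?G) = 0" using \<open>gram_det W = 0\<close> by (simp add: det_transpose gram_det_def)
  then obtain x where x: "x \<noteq> 0" "transpose ?G *v x = 0"
    using invertible_det_nz invertible_left_inverse matrix_left_invertible_ker by metis
  have 0: "(\<Sum>i\<in>UNIV. W (basis_elt i) (basis_elt j) * x $ i) = 0" for j
    using arg_cong[OF x(2), of "\<lambda>v. v $ j"] by (simp add: matrix_vector_mult_def transpose_def)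
  have "W (of_coords x) w = 0" for w
  proof -
    have "W (of_coords x) (of_coords (to_coords w)) = (\<Sum>l\<in>UNIV. \<Sum>k\<in>UNIV. x $ k * to_coords w $ l * W (basis_elt k) (basis_elt l))"
      unfolding bilinear_of_coords[OF W] by (rule sum.swap)
    also have "\<dots> = (\<Sum>l\<in>UNIV. to_coords w $ l * (\<Sum>k\<in>UNIV. W (basis_elt k) (basis_elt l) * x $ k))"
      by (simp add: sum_distrib_left mult_ac)
    finally show ?thesis by (simp add: 0 of_to_coords)
  qed
  moreover have "of_coords x \<noteq> 0"
    using x(1) to_of_coords[of x] linear_0[OF linear_to_coords] by metis
  ultimately show False using nd by blast
qed

lemma continuous_on_gram_det:
  assumes "\<And>v w. continuous_on S (\<lambda>x. W x v w)"
  shows "continuous_on S (\<lambda>x. gram_det (W x))"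
  unfolding gram_det_def det_def using assms by (auto intro!: continuous_intros)

lemma has_integral_iff_nn_integral:
  fixes f :: "'x::euclidean_space \<Rightarrow> real"
  assumes [measurable]: "f \<in> borel_measurable borel" "S \<in> sets borel" and f: "\<And>x. 0 \<le> f x" and r: "0 \<le> r"
  shows "(f has_integral r) S \<longleftrightarrow> (\<integral>\<^sup>+x. ennreal (f x) * indicator S x \<partial>lborel) = ennreal r"
proof -
  let ?f = "\<lambda>x. if x \<in> S then f x else 0"
  have [measurable]: "?f \<in> borel_measurable borel" by measurable
  have "(\<integral>\<^sup>+x. ennreal (f x) * indicator S x \<partial>lborel) = (\<integral>\<^sup>+x. ennreal (?f x) \<partial>lborel)"
    by (intro nn_integral_cong) (auto simp: indicator_def)
  moreover have "(f has_integral r) S \<longleftrightarrow> (?f has_integral r) UNIV" by (simp add: has_integral_restrict_UNIV)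
  moreover have "(?f has_integral r) UNIV \<longleftrightarrow> (\<integral>\<^sup>+x. ennreal (?f x) \<partial>lborel) = ennreal r"
    using nn_integral_has_integral_lborel[of ?f r] nn_integral_has_integral[of ?f r] f r by auto
  ultimately show ?thesis by simp
qed

lemma ennreal_eqI_finite:
  fixes a c :: ennreal
  assumes "\<And>r. 0 \<le> r \<Longrightarrow> a = ennreal r \<longleftrightarrow> c = ennreal r"
  shows "a = c"
proof (cases a rule: ennreal_cases)
  case (real r)
  then show ?thesis using assms[of r] by simp
next
  case top
  show ?thesis
  proof (cases c rule: ennreal_cases)
    case (real r)
    then show ?thesis using assms[of r] by simp
  qed (simp add: top)
qed

text \<open>A diffeomorphism that preserves the bilinear forms multiplies the square root of the Gram
  determinant by the inverse of the Jacobian, which is exactly the factor in the change of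
  variables formula.\<close>

theorem gram_change_of_variables:
  fixes W :: "'e::euclidean_space \<Rightarrow> 'e \<Rightarrow> 'e \<Rightarrow> real"
  assumes S [measurable]: "S \<in> sets borel" and T [measurable]: "T \<in> sets borel"
    and der: "\<And>x. x \<in> S \<Longrightarrow> (\<tau> has_derivative D x) (at x)" "\<And>y. y \<in> T \<Longrightarrow> (\<tau>' has_derivative D' y) (at y)"
    and inv: "\<And>x. x \<in> S \<Longrightarrow> \<tau> x \<in> T \<and> \<tau>' (\<tau> x) = x" "\<And>y. y \<in> T \<Longrightarrow> \<tau>' y \<in> S \<and> \<tau> (\<tau>' y) = y"
    and id: "\<And>y. y \<in> T \<Longrightarrow> D' y \<circ> D (\<tau>' y) = id"
    and W: "\<And>y. y \<in> T \<Longrightarrow> bilinear (W y)" "\<And>x v w. x \<in> S \<Longrightarrow> W (\<tau> x) (D x v) (D x w) = W x v w"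
    and f [measurable]: "f \<in> borel_measurable borel" and f0: "\<And>x. 0 \<le> f x"
    and f_eq: "\<And>x. x \<in> S \<union> T \<Longrightarrow> f x = sqrt \<bar>gram_det (W x)\<bar>"
  shows "(\<integral>\<^sup>+x. ennreal (f x) * indicator S x \<partial>lborel) = (\<integral>\<^sup>+x. ennreal (f x) * indicator T x \<partial>lborel)"
proof -
  let ?S = "of_coords -` S" and ?T = "of_coords -` T"
  have ST [measurable]: "?S \<in> sets borel" "?T \<in> sets borel"
    using measurable_sets[OF borel_of_coords S] measurable_sets[OF borel_of_coords T] by auto
  have F [measurable]: "(\<lambda>v. f (of_coords v)) \<in> borel_measurable borel" by measurable
  define g h where "g = to_coords \<circ> \<tau> \<circ> of_coords" and "h = to_coords \<circ> \<tau>' \<circ> of_coords"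
  define g' h' where "g' v = to_coords \<circ> D (of_coords v) \<circ> of_coords" and "h' v = to_coords \<circ> D' (of_coords v) \<circ> of_coords" for v
  note lin_der = linear_imp_has_derivative[OF linear_of_coords] linear_imp_has_derivative[OF linear_to_coords]
  have chain: "((to_coords \<circ> t \<circ> of_coords) has_derivative (to_coords \<circ> d \<circ> of_coords)) (at v within X)"
    if "(t has_derivative d) (at (of_coords v))" for t d and v :: "real ^ 'e dim_index" and X
    by (rule has_derivative_at_withinI[OF diff_chain_at[OF lin_der(1) diff_chain_at[OF that lin_der(2)]]])
  have sq: "sqrt \<bar>a\<^sup>2 * c\<bar> = \<bar>a\<bar> * sqrt \<bar>c\<bar>" for a c :: real by (simp add: abs_mult real_sqrt_mult)
  have jac: "\<bar>det (matrix (g' v))\<bar> * f (of_coords (g v)) = f (of_coords v)" if "v \<in> ?S" for v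
  proof -
    have v: "of_coords v \<in> S" using that by simp
    have gv: "of_coords (g v) = \<tau> (of_coords v)" by (simp add: g_def of_to_coords)
    have "gram_det (W (of_coords v)) = (det (matrix (g' v)))\<^sup>2 * gram_det (W (\<tau> (of_coords v)))"
      unfolding g'_def using inv(1)[OF v] v by (intro gram_det_pullback W) auto
    then have "sqrt \<bar>gram_det (W (of_coords v))\<bar> = \<bar>det (matrix (g' v))\<bar> * sqrt \<bar>gram_det (W (\<tau> (of_coords v)))\<bar>"
      by (simp only: sq)
    then show ?thesis using inv(1)[OF v] v by (simp add: gv f_eq)
  qed
  have "((\<lambda>v. f (of_coords v)) has_integral r) ?S \<longleftrightarrow> ((\<lambda>v. f (of_coords v)) has_integral r) ?T" for r
  proof -
    have "((\<lambda>v. \<bar>det (matrix (g' v))\<bar> * f (of_coords (g v))) has_integral r) ?S \<longleftrightarrow> ((\<lambda>v. f (of_coords v)) has_integral r) ?T"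
    proof (rule cov_invertible_nonneg_eq[where h = h and h' = h'])
      show "(g has_derivative g' v) (at v within ?S)" if "v \<in> ?S" for v
        unfolding g_def g'_def by (rule chain[OF der(1)]) (use that in simp)
      show "(h has_derivative h' v) (at v within ?T)" if "v \<in> ?T" for v
        unfolding h_def h'_def by (rule chain[OF der(2)]) (use that in simp)
      show "g v \<in> ?T \<and> h (g v) = v" if "v \<in> ?S" for v
        using inv(1)[of "of_coords v"] that by (simp add: g_def h_def of_to_coords to_of_coords)
      show "h v \<in> ?S \<and> g (h v) = v" if "v \<in> ?T" for v
        using inv(2)[of "of_coords v"] that by (simp add: g_def h_def of_to_coords to_of_coords)
      show "h' v \<circ> g' (h v) = id" if "v \<in> ?T" for v
      proof
        fix x
        have "(h' v \<circ> g' (h v)) x = to_coords ((D' (of_coords v) \<circ> D (\<tau>' (of_coords v))) (of_coords x))"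
          by (simp add: g'_def h'_def h_def of_to_coords)
        also have "D' (of_coords v) \<circ> D (\<tau>' (of_coords v)) = id" using id that by simp
        finally show "(h' v \<circ> g' (h v)) x = id x" by (simp add: to_of_coords)
      qed
    qed (rule f0)
    moreover have "((\<lambda>v. \<bar>det (matrix (g' v))\<bar> * f (of_coords (g v))) has_integral r) ?S \<longleftrightarrow> ((\<lambda>v. f (of_coords v)) has_integral r) ?S"
      by (rule has_integral_cong) (rule jac)
    ultimately show ?thesis by (simp only:)
  qed
  then have "(\<integral>\<^sup>+v. ennreal (f (of_coords v)) * indicator ?S v \<partial>lborel) = ennreal r \<longleftrightarrow>
      (\<integral>\<^sup>+v. ennreal (f (of_coords v)) * indicator ?T v \<partial>lborel) = ennreal r" if "0 \<le> r" for r
    using has_integral_iff_nn_integral[OF F ST(1) f0 that] has_integral_iff_nn_integral[OF F ST(2) f0 that] by simp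
  then have "(\<integral>\<^sup>+v. ennreal (f (of_coords v)) * indicator ?S v \<partial>lborel) = (\<integral>\<^sup>+v. ennreal (f (of_coords v)) * indicator ?T v \<partial>lborel)"
    by (rule ennreal_eqI_finite)
  moreover have "(\<integral>\<^sup>+x. ennreal (f x) * indicator Q x \<partial>lborel)
      = (\<integral>\<^sup>+v. ennreal (f (of_coords v)) * indicator (of_coords -` Q) v \<partial>lborel)" if [measurable]: "Q \<in> sets borel" for Q :: "'e set"
    unfolding nn_integral_of_coords[of "\<lambda>x. ennreal (f x) * indicator Q x", simplified] by (simp add: indicator_def)
  ultimately show ?thesis using S T by simp
qed

section \<open>A chart of the character variety\<close>

locale surface_chart =
  fixes g :: nat and b :: "nat \<Rightarrow> 'e::euclidean_space"
  assumes genus: "2 \<le> g" and b: "bij_betw b {..<8 * g - 6} Basis"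
begin

definition n :: nat where "n = 4 * g - 3"

text \<open>The complex coordinates of the model space: linear parts first, then the free translation parts.\<close>

definition cc :: "nat \<Rightarrow> 'e \<Rightarrow> complex" where
  "cc k p = Complex (p \<bullet> b (2 * k)) (p \<bullet> b (2 * k + 1))"

definition cs :: "nat \<Rightarrow> complex \<Rightarrow> 'e" where
  "cs k r = Re r *\<^sub>R b (2 * k) + Im r *\<^sub>R b (2 * k + 1)"

lemma b_inner: "i < 2 * n \<Longrightarrow> j < 2 * n \<Longrightarrow> b i \<bullet> b j = (if i = j then 1 else 0)"
proof -
  assume ij: "i < 2 * n" "j < 2 * n"
  have "2 * n = 8 * g - 6" by (simp add: n_def)
  then have "b i \<in> Basis" "b j \<in> Basis" "b i = b j \<longleftrightarrow> i = j"
    using b ij unfolding bij_betw_def inj_on_def by auto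
  then show ?thesis by (simp add: inner_Basis)
qed

lemma cc_cs: "j < n \<Longrightarrow> k < n \<Longrightarrow> cc j (cs k r) = (if j = k then r else 0)"
  by (auto simp: cc_def cs_def inner_add_left b_inner complex_eq_iff)

lemma linear_cc: "linear (cc k)"
  by (rule linearI) (auto simp: cc_def inner_add_left complex_eq_iff)

lemma linear_cs: "linear (cs k)"
  by (rule linearI) (auto simp: cs_def scaleR_add_left scaleR_add_right algebra_simps)

lemma cc_expansion: "(\<Sum>k<n. cs k (cc k p)) = p"
proof -
  have 2: "8 * g - 6 = 2 * n" by (simp add: n_def)
  have "p = (\<Sum>x\<in>Basis. (p \<bullet> x) *\<^sub>R x)" by (simp add: euclidean_representation)
  also have "\<dots> = (\<Sum>j<2 * n. (p \<bullet> b j) *\<^sub>R b j)"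
    using sum.reindex_bij_betw[OF b, of "\<lambda>x. (p \<bullet> x) *\<^sub>R x"] unfolding 2 by simp
  also have "\<dots> = (\<Sum>k<m. cs k (cc k p))" if "m = n" for m
    unfolding that[symmetric] by (induction m) (auto simp: cs_def cc_def add.assoc)
  finally show ?thesis by simp
qed

lemma cc_eqI:
  assumes "\<And>k. k < n \<Longrightarrow> cc k p = cc k q"
  shows "p = q"
proof -
  have "(\<Sum>k<n. cs k (cc k p)) = (\<Sum>k<n. cs k (cc k q))"
    using assms by (intro sum.cong) auto
  then show ?thesis by (simp only: cc_expansion)
qed

lemma cc_sum: "j < n \<Longrightarrow> cc j (\<Sum>k<n. cs k (f k)) = f j"
  by (simp add: linear_sum[OF linear_cc] cc_cs)

definition cA :: "nat \<Rightarrow> 'e \<times> complex \<Rightarrow> complex" where "cA i z = cc (i - 1) (fst z)"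
definition cB :: "nat \<Rightarrow> 'e \<times> complex \<Rightarrow> complex" where "cB i z = cc (g + i - 1) (fst z)"
definition cU :: "nat \<Rightarrow> 'e \<times> complex \<Rightarrow> complex" where "cU i z = cc (2 * g + i - 1) (fst z)"
text \<open>The first translation part of the second kind is the extra factor; on the slice it is equal to
  one.\<close>

definition cV :: "nat \<Rightarrow> 'e \<times> complex \<Rightarrow> complex" where
  "cV i z = (if i = 1 then snd z else cc (3 * g + i - 3) (fst z))"
definition dU :: "nat \<Rightarrow> complex \<Rightarrow> 'e \<times> complex" where "dU i r = (cs (2 * g + i - 1) r, 0)"
definition dV :: "nat \<Rightarrow> complex \<Rightarrow> 'e \<times> complex" where
  "dV i r = (if i = 1 then (0, r) else (cs (3 * g + i - 3) r, 0))"

lemma linear_fst_cc: "linear (\<lambda>z. cc k (fst z))" "linear (\<lambda>r. (cs k r, 0))"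
  by (rule linearI; simp add: linear_add[OF linear_cc] linear_scale[OF linear_cc] linear_add[OF linear_cs] linear_scale[OF linear_cs])+

sublocale affine_cocycle_space g cA cB cU cV dU dV
  "\<lambda>i. (b (2 * (g + i - 1)), 0)" "\<lambda>i. (b (2 * (g + i - 1) + 1), 0)"
proof (rule affine_cocycle_space.intro)
  have z: "cc k 0 = 0" for k by (rule linear_0[OF linear_cc])
  show "linear (cA i)" "linear (cB i)" "linear (cU i)" "linear (cV i)" "linear (dU i)" "linear (dV i)" for i
  proof -
    show "linear (cA i)" "linear (cB i)" "linear (cU i)" "linear (dU i)"
      unfolding cA_def[abs_def] cB_def[abs_def] cU_def[abs_def] dU_def[abs_def] by (rule linear_fst_cc)+
    show "linear (cV i)"
      by (cases "i = 1") (auto simp: cV_def[abs_def] linear_fst_cc intro!: linear_snd)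
    show "linear (dV i)"
      by (cases "i = 1") (auto simp: dV_def[abs_def] linear_fst_cc intro!: linearI)
  qed
  show "2 \<le> g" by (rule genus)
  show "cA i (dU j r) = 0 \<and> cA i (dV j r) = 0 \<and> cB i (dU j r) = 0 \<and> cB i (dV j r) = 0"
    if "i \<in> {1..g}" "j \<in> {1..<g}" for i j r
    using that genus by (auto simp: cA_def cB_def dU_def dV_def cc_cs n_def z)
  show "cU i (dU j r) = (if i = j then r else 0) \<and> cU i (dV j r) = 0 \<and> cV i (dU j r) = 0 \<and> cV i (dV j r) = (if i = j then r else 0)"
    if "i \<in> {1..<g}" "j \<in> {1..<g}" for i j r
    using that genus by (auto simp: cU_def cV_def dU_def dV_def cc_cs n_def z)
  have bs: "b (2 * k) = cs k 1" "b (2 * k + 1) = cs k \<i>" for k by (simp_all add: cs_def)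
  show "cB i (b (2 * (g + j - 1)), 0) = (if i = j then 1 else 0) \<and> cB i (b (2 * (g + j - 1) + 1), 0) = (if i = j then \<i> else 0)"
    if "i \<in> {1..g}" "j \<in> {1..g}" for i j
    using that genus unfolding bs by (auto simp: cB_def cc_cs n_def)
qed

subsection \<open>Representations with given coordinates\<close>

definition admissible :: "'e \<times> complex \<Rightarrow> bool" where
  "admissible z \<longleftrightarrow> regular z \<and> (\<forall>i\<in>{1..g}. cA i z \<noteq> 0)"

text \<open>The representation with the given coordinates, in the gauge where the last generator of the
  second kind fixes the origin.\<close>

definition Rz :: "'e \<times> complex \<Rightarrow> surface_rep" where
  "Rz z = rep g (\<lambda>i. cA i z) (\<lambda>i. Uf i z) (\<lambda>i. cB i z) (\<lambda>i. Vf i z)"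

lemma sum_upto_g: "(\<Sum>i\<in>{1..g}. f i) = (\<Sum>i\<in>{1..<g}. f i) + (f g :: complex)"
  using genus by (simp add: sum.last_plus add.commute)

lemma rep_coords_Rz:
  assumes "admissible z"
  shows "rep_coords g (\<lambda>i. cA i z) (\<lambda>i. Uf i z) (\<lambda>i. cB i z) (\<lambda>i. Vf i z)"
proof -
  have "cB g z \<noteq> 1" using assms genus by (auto simp: admissible_def regular_def)
  moreover have "(\<Sum>i\<in>{1..<g}. (cA i z - 1) * Vf i z + (1 - cB i z) * Uf i z) = (\<Sum>i\<in>{1..<g}. t i z)"
    by (intro sum.cong) (auto simp: t_def Uf_def Vf_def)
  ultimately show ?thesis
    using assms unfolding rep_coords_def sum_upto_g
    by (auto simp: admissible_def regular_def Uf_def Vf_def)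
qed

lemma Rz_Hom: "admissible z \<Longrightarrow> Rz z \<in> Hom_Aff g"
  unfolding Rz_def by (rule rep_in_Hom_Aff[OF rep_coords_Rz])

lemma coord_Rz:
  assumes "admissible z" "i \<in> {1..g}"
  shows "coordA g (Rz z) i = cA i z" "coordU g (Rz z) i = Uf i z" "coordB g (Rz z) i = cB i z" "coordV g (Rz z) i = Vf i z"
  unfolding Rz_def using rep_coords_rep[OF rep_coords_Rz[OF assms(1)] assms(2)] by auto

lemma admissible_twist:
  assumes "i \<in> {1..<g}"
  shows "admissible (twist i r z) = admissible z" "admissible (twist' i r z) = admissible z"
  using AB_E[OF assms] by (auto simp: admissible_def regular_def twist_def twist'_def)

lemma UVf_twist:
  assumes i: "i \<in> {1..<g}" and j: "j \<in> {1..g}" and z: "regular z"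
  shows "Uf j (twist i r z) = Uf j z + (if j = i then r * t i z * (1 - cA i z) else 0)"
    "Vf j (twist i r z) = Vf j z + (if j = i then r * t i z * (1 - cB i z) else 0)"
    "Uf j (twist' i r z) = Uf j z + (if j = i then r * t' i z * (1 - cA i z / cB (Suc i) z)
       else if j = Suc i then r * t' i z * ((1 - cB i z) / cB (Suc i) z) else 0)"
    "Vf j (twist' i r z) = Vf j z + (if j = i then r * t' i z * ((1 - cB i z) / cB (Suc i) z) else 0)"
proof -
  have g': "Suc i = g \<or> Suc i < g" using i by auto
  have AB: "cB g (z + E i z q) = cB g z" "cB g (z + E' i z q) = cB g z" for q using AB_E[OF i, of g] genus by auto
  show "Vf j (twist i r z) = Vf j z + (if j = i then r * t i z * (1 - cB i z) else 0)"
    "Vf j (twist' i r z) = Vf j z + (if j = i then r * t' i z * ((1 - cB i z) / cB (Suc i) z) else 0)"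
    using z i j by (auto simp: twist_def twist'_def Vf_def coord_add coord_E)
  show "Uf j (twist i r z) = Uf j z + (if j = i then r * t i z * (1 - cA i z) else 0)"
  proof (cases "j < g")
    case True
    then show ?thesis using z i j by (auto simp: twist_def Uf_def coord_add coord_E)
  next
    case False
    have "(\<Sum>k\<in>{1..<g}. t k (z + E i z q)) = (\<Sum>k\<in>{1..<g}. t k z)" for q
      by (intro sum.cong refl t_E[OF i])
    then show ?thesis using False z i AB by (simp add: twist_def Uf_def)
  qed
  show "Uf j (twist' i r z) = Uf j z + (if j = i then r * t' i z * (1 - cA i z / cB (Suc i) z)
       else if j = Suc i then r * t' i z * ((1 - cB i z) / cB (Suc i) z) else 0)"
  proof (cases "j < g")
    case True
    then show ?thesis using z i j by (auto simp: twist'_def Uf_def coord_add coord_E)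
  next
    case False
    then have jg: "j = g" using j by auto
    show ?thesis
    proof (cases "Suc i = g")
      case True
      then show ?thesis using Uf_E'[OF i z, of "r * t' i z"] z jg by (auto simp: twist'_def)
    next
      case False
      then have si: "Suc i \<in> {1..<g}" using g' by auto
      have nz: "cB (Suc i) z \<noteq> 0" using z i by (auto simp: regular_def)
      define q where "q = r * t' i z"
      have "(\<Sum>k\<in>{1..<g}. t k (z + E' i z q)) = (\<Sum>k\<in>{1..<g}. t k z + ((if k = i then \<kappa>' i z * q else 0)
          + (if k = Suc i then (1 - cB (Suc i) z) * ((1 - cB i z) / cB (Suc i) z) * q else 0)))"
        using t_E'[OF i _ z] by (intro sum.cong) auto
      also have "\<dots> = (\<Sum>k\<in>{1..<g}. t k z) + (\<kappa>' i z * q + (1 - cB (Suc i) z) * ((1 - cB i z) / cB (Suc i) z) * q)"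
        using i si by (simp add: sum.distrib)
      also have "\<kappa>' i z * q + (1 - cB (Suc i) z) * ((1 - cB i z) / cB (Suc i) z) * q = 0"
        by (simp add: \<kappa>'_def algebra_simps)
      finally show ?thesis
        using jg False z i AB by (auto simp: twist'_def Uf_def q_def)
    qed
  qed
qed

lemma Rz_twist:
  assumes z: "admissible z" and i: "i \<in> {1..<g}"
  shows "compose (carrier (surface_group g)) (Rz z)
      (surface.endomorphism g (twist_substitution (signed_word e (commutator_word i)) i)) = Rz (twist i (csign e) z)"
    and "compose (carrier (surface_group g)) (Rz z)
      (surface.endomorphism g (bridge_twist_substitution (signed_word e (commutator_word i)) i)) = Rz (twist' i (csign e) z)"
proof -
  have ig: "i \<in> {1..g}" and r: "regular z" using i z by (auto simp: admissible_def)
  have iUV: "Uf i z = cU i z" "Vf i z = cV i z" using i by (auto simp: Uf_def Vf_def)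
  note AB = AB_E[OF i]
  have ABt: "cA j (twist i s z) = cA j z" "cB j (twist i s z) = cB j z" "cA j (twist' i s z) = cA j z" "cB j (twist' i s z) = cB j z"
    if "j \<in> {1..g}" for j s using AB[OF that] by (auto simp: twist_def twist'_def)
  show "compose (carrier (surface_group g)) (Rz z)
      (surface.endomorphism g (twist_substitution (signed_word e (commutator_word i)) i)) = Rz (twist i (csign e) z)"
    unfolding Rz_def conjunct2[OF twist_rep[OF rep_coords_Rz[OF z] ig]]
    by (rule conjunct2[OF rep_cong[OF conjunct1[OF twist_rep[OF rep_coords_Rz[OF z] ig]]]])
       (auto simp: UVf_twist[OF i _ r] ABt t_def iUV)
  show "compose (carrier (surface_group g)) (Rz z)
      (surface.endomorphism g (bridge_twist_substitution (signed_word e (commutator_word i)) i)) = Rz (twist' i (csign e) z)"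
    unfolding Rz_def conjunct2[OF bridge_twist_rep[OF rep_coords_Rz[OF z] i]]
    by (rule conjunct2[OF rep_cong[OF conjunct1[OF bridge_twist_rep[OF rep_coords_Rz[OF z] i]]]])
       (auto simp: UVf_twist[OF i _ r] ABt t_def t'_def iUV)
qed

subsection \<open>The slice and its chart\<close>

text \<open>The slice: conjugation by scalings is used up by setting the extra coordinate to one.\<close>

definition \<Omega> :: "'e set" where "\<Omega> = {p. admissible (p, 1)}"

definition pt :: "'e \<Rightarrow> surface_rep set" where "pt p = rep_class g (Rz (p, 1))"

lemma open_\<Omega>: "open \<Omega>"
proof -
  have c: "continuous_on UNIV (\<lambda>p. cA i (p, 1))" "continuous_on UNIV (\<lambda>p. cB i (p, 1))" for i
    unfolding cA_def cB_def fst_conv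
    using linear_continuous_on[OF linear_conv_bounded_linear[THEN iffD1, OF linear_cc]] by auto
  have "\<Omega> = (\<Inter>i\<in>{1..g}. {p. cA i (p, 1) \<noteq> 0} \<inter> {p. cB i (p, 1) \<noteq> 0} \<inter> {p. cB i (p, 1) \<noteq> 1})"
    by (auto simp: \<Omega>_def admissible_def regular_def)
  also have "open \<dots>"
    by (intro open_INT open_Int finite_atLeastAtMost ballI open_Collect_neq c continuous_on_const)
  finally show ?thesis .
qed

lemma Rz_nonabelian:
  assumes "p \<in> \<Omega>"
  shows "Rz (p, 1) \<in> Hom_nonabelian g"
  unfolding Rz_def
proof (rule noncommuting_imp_nonabelian[OF rep_coords_Rz, where s = "GenB 1" and s' = "GenB g"])
  show "admissible (p, 1)" using assms by (simp add: \<Omega>_def)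
  then have "cB g (p, 1) \<noteq> 1" using genus by (auto simp: admissible_def regular_def)
  then show "gen_map (\<lambda>i. cA i (p, 1)) (\<lambda>i. Uf i (p, 1)) (\<lambda>i. cB i (p, 1)) (\<lambda>i. Vf i (p, 1)) (GenB 1) \<otimes>\<^bsub>Aff\<^esub>
    gen_map (\<lambda>i. cA i (p, 1)) (\<lambda>i. Uf i (p, 1)) (\<lambda>i. cB i (p, 1)) (\<lambda>i. Vf i (p, 1)) (GenB g) \<noteq>
    gen_map (\<lambda>i. cA i (p, 1)) (\<lambda>i. Uf i (p, 1)) (\<lambda>i. cB i (p, 1)) (\<lambda>i. Vf i (p, 1)) (GenB g) \<otimes>\<^bsub>Aff\<^esub>
    gen_map (\<lambda>i. cA i (p, 1)) (\<lambda>i. Uf i (p, 1)) (\<lambda>i. cB i (p, 1)) (\<lambda>i. Vf i (p, 1)) (GenB 1)"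
    using genus by (auto simp: Vf_def cV_def)
qed (use genus in auto)

text \<open>The translation parts after conjugating the fixed point of the last generator of the second kind
  to the origin, up to a common factor.\<close>

definition gaugeU :: "surface_rep \<Rightarrow> nat \<Rightarrow> complex" where
  "gaugeU \<rho> i = coordU g \<rho> i * (1 - coordB g \<rho> g) - (1 - coordA g \<rho> i) * coordV g \<rho> g"

definition gaugeV :: "surface_rep \<Rightarrow> nat \<Rightarrow> complex" where
  "gaugeV \<rho> i = coordV g \<rho> i * (1 - coordB g \<rho> g) - (1 - coordB g \<rho> i) * coordV g \<rho> g"

definition nform_coord :: "surface_rep \<Rightarrow> nat \<Rightarrow> complex" where
  "nform_coord \<rho> k = (if k < g then coordA g \<rho> (k + 1) else if k < 2 * g then coordB g \<rho> (k - g + 1)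
     else if k < 3 * g - 1 then gaugeU \<rho> (k - 2 * g + 1) / gaugeV \<rho> 1 else gaugeV \<rho> (k + 3 - 3 * g) / gaugeV \<rho> 1)"

definition nform :: "surface_rep \<Rightarrow> 'e" where
  "nform \<rho> = (\<Sum>k<n. cs k (nform_coord \<rho> k))"

definition generic_rep :: "surface_rep \<Rightarrow> bool" where
  "generic_rep \<rho> \<longleftrightarrow> (\<forall>i\<in>{1..g}. coordB g \<rho> i \<noteq> 1) \<and> gaugeV \<rho> 1 \<noteq> 0"

lemma nform_coords:
  "i \<in> {1..g} \<Longrightarrow> cA i (nform \<rho>, x) = coordA g \<rho> i"
  "i \<in> {1..g} \<Longrightarrow> cB i (nform \<rho>, x) = coordB g \<rho> i"
  "i \<in> {1..<g} \<Longrightarrow> cU i (nform \<rho>, x) = gaugeU \<rho> i / gaugeV \<rho> 1"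
  "i \<in> {1..<g} \<Longrightarrow> gaugeV \<rho> 1 \<noteq> 0 \<Longrightarrow> cV i (nform \<rho>, 1) = gaugeV \<rho> i / gaugeV \<rho> 1"
  using genus by (auto simp: cA_def cB_def cU_def cV_def nform_def cc_sum[unfolded n_def] n_def nform_coord_def)

text \<open>Conjugating by the affine map that moves the fixed point of the last generator to the origin and
  normalizes one translation part yields a point of the slice.\<close>

lemma nform_class:
  assumes \<rho>: "\<rho> \<in> Hom_Aff g" and gen: "generic_rep \<rho>"
  shows "nform \<rho> \<in> \<Omega>" "rep_class g \<rho> = pt (nform \<rho>)"
proof -
  let ?A = "coordA g \<rho>" and ?U = "coordU g \<rho>" and ?B = "coordB g \<rho>" and ?V = "coordV g \<rho>"
  have c: "rep_coords g ?A ?U ?B ?V" "\<rho> = rep g ?A ?U ?B ?V" using Hom_Aff_coords[OF \<rho>] by auto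
  have gg: "g \<in> {1..g}" using genus by auto
  have nz: "gaugeV \<rho> 1 \<noteq> 0" "?B g \<noteq> 1" using gen gg by (auto simp: generic_rep_def)
  show \<Omega>: "nform \<rho> \<in> \<Omega>"
    using c(1) gen by (auto simp: \<Omega>_def admissible_def regular_def nform_coords generic_rep_def rep_coords_def)
  then have adm: "admissible (nform \<rho>, 1)" by (simp add: \<Omega>_def)
  define l m where "l = (1 - ?B g) / gaugeV \<rho> 1" and "m = - (?V g / gaugeV \<rho> 1)"
  have l: "l \<noteq> 0" using nz by (simp add: l_def)
  define U' V' where "U' i = l * ?U i + (1 - ?A i) * m" and "V' i = l * ?V i + (1 - ?B i) * m" for i
  note conj = conjugate_rep_rep[OF c(1) l, of m, folded U'_def V'_def]
  have U': "U' i = gaugeU \<rho> i / gaugeV \<rho> 1" for i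
    unfolding U'_def l_def m_def gaugeU_def divide_inverse by (simp add: algebra_simps)
  have V': "V' i = gaugeV \<rho> i / gaugeV \<rho> 1" for i
    unfolding V'_def l_def m_def gaugeV_def divide_inverse by (simp add: algebra_simps)
  have Vg: "V' g = 0" unfolding V' by (simp add: gaugeV_def mult.commute)
  have "rep g ?A U' ?B V' = Rz (nform \<rho>, 1)"
    unfolding Rz_def
  proof (rule conjunct2[OF rep_cong])
    show c': "rep_coords g ?A U' ?B V'" using conj by simp
    fix i assume i: "i \<in> {1..g}"
    have Vi: "V' i = Vf i (nform \<rho>, 1)" if "i \<in> {1..g}" for i
      using that nform_coords(4)[of i \<rho>] nz Vg by (cases "i = g") (auto simp: Vf_def V')
    have Ui: "U' i = Uf i (nform \<rho>, 1)" if "i \<in> {1..<g}" for i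
      using that nform_coords(3)[of i \<rho> 1] by (auto simp: Uf_def U')
    have "(\<Sum>i\<in>{1..<g}. (?A i - 1) * V' i + (1 - ?B i) * U' i) = (\<Sum>i\<in>{1..<g}. t i (nform \<rho>, 1))"
      using Vi Ui by (intro sum.cong) (auto simp: t_def nform_coords Uf_def Vf_def)
    then have "(\<Sum>i\<in>{1..<g}. t i (nform \<rho>, 1)) + (1 - ?B g) * U' g = 0"
      using c' unfolding rep_coords_def sum_upto_g by (simp add: Vg)
    then have "U' g = Uf g (nform \<rho>, 1)"
      using nz gg by (simp add: Uf_def nform_coords field_simps)
    then show "?A i = cA i (nform \<rho>, 1) \<and> U' i = Uf i (nform \<rho>, 1) \<and> ?B i = cB i (nform \<rho>, 1) \<and> V' i = Vf i (nform \<rho>, 1)"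
      using i Vi[OF i] Ui[of i] by (cases "i = g") (auto simp: nform_coords)
  qed
  then have "conjugate_rep g (affine_map l m) \<rho> = Rz (nform \<rho>, 1)" using conj c(2) by simp
  then show "rep_class g \<rho> = pt (nform \<rho>)"
    using rep_class_conjugate[OF \<rho>, of "affine_map l m"] l by (simp add: pt_def)
qed

text \<open>The normalized coordinates are quotients on which the conjugating map cancels.\<close>

lemma nform_unique:
  assumes \<rho>: "\<rho> \<in> Hom_Aff g" and p: "p \<in> \<Omega>" and eq: "rep_class g \<rho> = pt p"
  shows "generic_rep \<rho>" "nform \<rho> = p"
proof -
  have adm: "admissible (p, 1)" using p by (simp add: \<Omega>_def)
  obtain h where h: "h \<in> carrier Aff" "\<rho> = conjugate_rep g h (Rz (p, 1))"
    using rep_class_eqD[OF \<rho>] eq by (auto simp: pt_def)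
  obtain l m where l: "h = affine_map l m" "l \<noteq> 0" using h(1) by (auto simp: carrier_Aff)
  note c = conjugate_rep_rep[OF rep_coords_Rz[OF adm] l(2), of m]
  have co: "coordA g \<rho> i = cA i (p, 1)" "coordB g \<rho> i = cB i (p, 1)"
    "coordU g \<rho> i = l * Uf i (p, 1) + (1 - cA i (p, 1)) * m" "coordV g \<rho> i = l * Vf i (p, 1) + (1 - cB i (p, 1)) * m"
    if "i \<in> {1..g}" for i
    using rep_coords_rep[OF conjunct1[OF c] that] c h(2) l(1) by (auto simp: Rz_def)
  have gg: "g \<in> {1..g}" "1 \<in> {1..g}" using genus by auto
  have B: "cB i (p, 1) \<noteq> 1" if "i \<in> {1..g}" for i using adm that by (auto simp: admissible_def regular_def)
  have Vg: "Vf g (p, 1) = 0" by (simp add: Vf_def)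
  have gV: "gaugeV \<rho> i = l * (1 - cB g (p, 1)) * Vf i (p, 1)" "gaugeU \<rho> i = l * (1 - cB g (p, 1)) * Uf i (p, 1)" if "i \<in> {1..g}" for i
    unfolding gaugeV_def gaugeU_def co[OF that] co[OF gg(1)] Vg by (simp_all add: algebra_simps)
  have V1: "Vf 1 (p, 1) = 1" using genus by (simp add: Vf_def cV_def)
  have g1: "gaugeV \<rho> 1 = l * (1 - cB g (p, 1))" unfolding gV(1)[OF gg(2)] V1 by simp
  then have nz: "gaugeV \<rho> 1 \<noteq> 0" using l B[OF gg(1)] by simp
  then show "generic_rep \<rho>" using B co(2) by (auto simp: generic_rep_def)
  have gq: "gaugeV \<rho> i / gaugeV \<rho> 1 = Vf i (p, 1)" "gaugeU \<rho> i / gaugeV \<rho> 1 = Uf i (p, 1)" if "i \<in> {1..g}" for i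
    unfolding gV[OF that] g1 using nz g1 by auto
  show "nform \<rho> = p"
  proof (rule cc_eqI)
    fix k assume k: "k < n"
    consider "k < g" | "g \<le> k" "k < 2 * g" | "2 * g \<le> k" "k < 3 * g - 1" | "3 * g - 1 \<le> k" by linarith
    then have "nform_coord \<rho> k = cc k p"
    proof cases
      case 1
      then show ?thesis using co(1)[of "k + 1"] by (simp add: nform_coord_def cA_def)
    next
      case 2
      then show ?thesis using co(2)[of "k - g + 1"] by (simp add: nform_coord_def cB_def)
    next
      case 3
      then have "nform_coord \<rho> k = Uf (k - 2 * g + 1) (p, 1)" using gq(2)[of "k - 2 * g + 1"] by (simp add: nform_coord_def)
      then show ?thesis using 3 by (simp add: Uf_def cU_def)
    next
      case 4
      then have ks: "\<not> k < g" "\<not> k < 2 * g" "\<not> k < 3 * g - 1" "k + 3 - 3 * g \<in> {1..g}"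
        using k genus by (auto simp: n_def)
      then have "nform_coord \<rho> k = Vf (k + 3 - 3 * g) (p, 1)"
        using gq(1)[OF ks(4)] by (simp only: nform_coord_def if_False)
      moreover have "k + 3 - 3 * g \<noteq> 1" "k + 3 - 3 * g < g" "3 * g + (k + 3 - 3 * g) - 3 = k"
        using 4 k genus unfolding n_def by arith+
      ultimately show ?thesis by (simp add: Vf_def cV_def)
    qed
    then show "cc k (nform \<rho>) = cc k p" using k by (simp add: nform_def cc_sum)
  qed
qed

lemma inj_pt: "inj_on pt \<Omega>"
proof (rule inj_onI)
  fix p q assume pq: "p \<in> \<Omega>" "q \<in> \<Omega>" "pt p = pt q"
  have "Rz (p, 1) \<in> Hom_Aff g" using pq(1) Rz_Hom by (simp add: \<Omega>_def)
  then show "p = q"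
    using nform_unique(2)[of "Rz (p, 1)" p] nform_unique(2)[of "Rz (p, 1)" q] pq by (simp add: pt_def)
qed

end

section \<open>The chart belongs to the atlas\<close>

context surface_chart
begin

definition U0 :: "surface_rep set set" where "U0 = pt ` \<Omega>"

definition \<phi> :: "surface_rep set \<Rightarrow> 'e" where "\<phi> = inv_into \<Omega> pt"

lemma \<phi>_pt [simp]: "p \<in> \<Omega> \<Longrightarrow> \<phi> (pt p) = p"
  unfolding \<phi>_def by (rule inv_into_f_f[OF inj_pt])

lemma \<phi>_U0: "\<phi> ` U0 = \<Omega>"
  by (auto simp: U0_def image_image)

lemma inj_\<phi>: "inj_on \<phi> U0"
  by (auto simp: U0_def inj_on_def)

lemma inv_\<phi>: "p \<in> \<Omega> \<Longrightarrow> inv_into U0 \<phi> p = pt p"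
  using inv_into_f_f[OF inj_\<phi>, of "pt p"] by (auto simp: U0_def)

lemma pt_in_U0: "p \<in> \<Omega> \<Longrightarrow> pt p \<in> U0"
  by (auto simp: U0_def)

lemma U0_char_var: "U0 \<subseteq> char_var g"
  using Rz_nonabelian by (auto simp: U0_def pt_def char_var_def)

lemma bounded_linear_cc: "bounded_linear (cc k)"
  using linear_cc linear_conv_bounded_linear by blast

lemma bounded_linear_cs: "bounded_linear (cs k)"
  using linear_cs linear_conv_bounded_linear by blast

lemma smooth_slice_coords:
  shows "smooth_on \<Omega> (\<lambda>p. cA i (p, 1))" "smooth_on \<Omega> (\<lambda>p. cB i (p, 1))" "smooth_on \<Omega> (\<lambda>p. cU i (p, 1))"
    "smooth_on \<Omega> (\<lambda>p. cV i (p, 1))"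
  using smooth_on_intros(1)[OF open_\<Omega>, of "1::complex"] smooth_on_intros(2)[OF open_\<Omega> bounded_linear_cc]
  by (simp_all add: cA_def cB_def cU_def cV_def[abs_def], cases "i = 1", simp_all)

lemma smooth_slice_UVf:
  assumes "i \<in> {1..g}"
  shows "smooth_on \<Omega> (\<lambda>p. Uf i (p, 1))" "smooth_on \<Omega> (\<lambda>p. Vf i (p, 1))"
proof -
  note s = smooth_on_intros[OF open_\<Omega>] smooth_on_mult_intros[OF open_\<Omega>] smooth_slice_coords
  have nz: "1 - cB g (p, 1) \<noteq> 0" if "p \<in> \<Omega>" for p
    using that genus by (auto simp: \<Omega>_def admissible_def regular_def)
  have t: "smooth_on \<Omega> (\<lambda>p. t j (p, 1))" for j
    unfolding t_def by (intro s(4,5,7) s(1) smooth_slice_coords)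
  have "smooth_on \<Omega> (\<lambda>p. (0 - (\<Sum>j\<in>{1..<g}. t j (p, 1))) / (1 - cB g (p, 1)))"
    by (intro s(8) s(5) s(6) t s(1) smooth_slice_coords nz)
  then show "smooth_on \<Omega> (\<lambda>p. Uf i (p, 1))"
    using smooth_slice_coords(3)[of i] by (cases "i < g") (auto simp: Uf_def)
  show "smooth_on \<Omega> (\<lambda>p. Vf i (p, 1))"
    using smooth_slice_coords(4)[of i] s(1)[of 0] by (cases "i < g") (auto simp: Vf_def)
qed

lemma smooth_rep_family_slice: "smooth_rep_family g \<Omega> (\<lambda>p. Rz (p, 1))"
  unfolding smooth_rep_family_def
proof (intro conjI ballI open_\<Omega> Rz_nonabelian)
  fix s assume s: "s \<in> surface_gens g"
  have gen: "Rz (p, 1) (surface_gen_elt g s) = gen_map (\<lambda>i. cA i (p, 1)) (\<lambda>i. Uf i (p, 1)) (\<lambda>i. cB i (p, 1)) (\<lambda>i. Vf i (p, 1)) s"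
    if "p \<in> \<Omega>" for p
    unfolding Rz_def by (rule rep_gen[OF rep_coords_Rz s]) (use that in \<open>simp add: \<Omega>_def\<close>)
  show "smooth_on \<Omega> (\<lambda>p. linear_part (Rz (p, 1) (surface_gen_elt g s)))"
  proof (cases s)
    case (GenA i)
    then show ?thesis by (intro smooth_on_cong[OF open_\<Omega> _ smooth_slice_coords(1)[of i]]) (simp add: GenA gen[unfolded GenA])
  next
    case (GenB i)
    then show ?thesis by (intro smooth_on_cong[OF open_\<Omega> _ smooth_slice_coords(2)[of i]]) (simp add: GenB gen[unfolded GenB])
  qed
  show "smooth_on \<Omega> (\<lambda>p. translation_part (Rz (p, 1) (surface_gen_elt g s)))"
  proof (cases s)
    case (GenA i)
    then show ?thesis using s by (intro smooth_on_cong[OF open_\<Omega> _ smooth_slice_UVf(1)[of i]]) (simp_all add: gen[unfolded GenA] GenA)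
  next
    case (GenB i)
    then show ?thesis using s by (intro smooth_on_cong[OF open_\<Omega> _ smooth_slice_UVf(2)[of i]]) (simp_all add: gen[unfolded GenB] GenB)
  qed
qed

lemma smooth_family_coords:
  assumes "smooth_rep_family g W \<sigma>" "i \<in> {1..g}"
  shows "smooth_on W (\<lambda>y. coordA g (\<sigma> y) i)" "smooth_on W (\<lambda>y. coordU g (\<sigma> y) i)"
    "smooth_on W (\<lambda>y. coordB g (\<sigma> y) i)" "smooth_on W (\<lambda>y. coordV g (\<sigma> y) i)"
proof -
  have "\<And>s. s \<in> surface_gens g \<Longrightarrow> smooth_on W (\<lambda>x. linear_part (\<sigma> x (surface_gen_elt g s))) \<and>
        smooth_on W (\<lambda>x. translation_part (\<sigma> x (surface_gen_elt g s)))"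
    using assms(1) unfolding smooth_rep_family_def by blast
  from this[of "GenA i"] this[of "GenB i"]
  show "smooth_on W (\<lambda>y. coordA g (\<sigma> y) i)" "smooth_on W (\<lambda>y. coordU g (\<sigma> y) i)"
    "smooth_on W (\<lambda>y. coordB g (\<sigma> y) i)" "smooth_on W (\<lambda>y. coordV g (\<sigma> y) i)"
    using assms(2) by (simp_all add: coordA_def coordU_def coordB_def coordV_def)
qed

lemma smooth_family_gauge:
  assumes "smooth_rep_family g W \<sigma>" "i \<in> {1..g}"
  shows "smooth_on W (\<lambda>y. gaugeU (\<sigma> y) i)" "smooth_on W (\<lambda>y. gaugeV (\<sigma> y) i)"
proof -
  have W: "open W" using assms(1) by (simp add: smooth_rep_family_def)
  have gg: "g \<in> {1..g}" using genus by auto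
  note s = smooth_on_intros[OF W] smooth_on_mult_intros[OF W]
  show "smooth_on W (\<lambda>y. gaugeU (\<sigma> y) i)" "smooth_on W (\<lambda>y. gaugeV (\<sigma> y) i)"
    unfolding gaugeU_def gaugeV_def
    by ((intro s(5,7) s(1) smooth_family_coords[OF assms] smooth_family_coords[OF assms(1) gg]; fail)+)
qed

lemma generic_open:
  assumes "smooth_rep_family g W \<sigma>"
  shows "open {y \<in> W. generic_rep (\<sigma> y)}"
proof -
  have W: "open W" using assms by (simp add: smooth_rep_family_def)
  have 1: "1 \<in> {1..g}" using genus by auto
  have pre: "open {y \<in> W. f y \<noteq> c}" if "smooth_on W f" for f :: "_ \<Rightarrow> complex" and c
  proof -
    have "open (W \<inter> f -` (- {c}))"
      by (rule continuous_open_preimage[OF smooth_on_imp_continuous_on[OF that] W]) auto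
    then show ?thesis by (simp add: Int_def vimage_def)
  qed
  have "{y \<in> W. generic_rep (\<sigma> y)} = (\<Inter>i\<in>{1..g}. {y \<in> W. coordB g (\<sigma> y) i \<noteq> 1}) \<inter> {y \<in> W. gaugeV (\<sigma> y) 1 \<noteq> 0}"
    using 1 by (auto simp: generic_rep_def)
  also have "open \<dots>"
    by (intro open_Int open_INT finite_atLeastAtMost ballI pre smooth_family_coords[OF assms] smooth_family_gauge[OF assms] 1)
  finally show ?thesis .
qed

lemma smooth_nform:
  assumes \<sigma>: "smooth_rep_family g W \<sigma>" and gen: "\<And>y. y \<in> W \<Longrightarrow> generic_rep (\<sigma> y)"
  shows "smooth_on W (\<lambda>y. nform (\<sigma> y))"
proof -
  have W: "open W" using \<sigma> by (simp add: smooth_rep_family_def)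
  note s = smooth_on_intros[OF W] smooth_on_mult_intros[OF W]
  have nz: "gaugeV (\<sigma> y) 1 \<noteq> 0" if "y \<in> W" for y using gen[OF that] by (simp add: generic_rep_def)
  have one: "1 \<in> {1..g}" using genus by auto
  have "smooth_on W (\<lambda>y. nform_coord (\<sigma> y) k)" if k: "k < n" for k
  proof -
    consider "k < g" | "g \<le> k" "k < 2 * g" | "2 * g \<le> k" "k < 3 * g - 1" | "3 * g - 1 \<le> k" by linarith
    then show ?thesis
    proof cases
      case 1
      then show ?thesis using smooth_family_coords(1)[OF \<sigma>, of "k + 1"] by (simp add: nform_coord_def)
    next
      case 2
      then show ?thesis using smooth_family_coords(3)[OF \<sigma>, of "k - g + 1"] by (simp add: nform_coord_def)
    next
      case 3
      have "k - 2 * g + 1 \<in> {1..g}" using 3 by auto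
      then have "smooth_on W (\<lambda>y. gaugeU (\<sigma> y) (k - 2 * g + 1) / gaugeV (\<sigma> y) 1)"
        by (intro s(8) smooth_family_gauge[OF \<sigma>] one nz)
      then show ?thesis using 3 by (simp add: nform_coord_def)
    next
      case 4
      then have ks: "\<not> k < g" "\<not> k < 2 * g" "\<not> k < 3 * g - 1" "k + 3 - 3 * g \<in> {1..g}"
        using k genus by (auto simp: n_def)
      have "smooth_on W (\<lambda>y. gaugeV (\<sigma> y) (k + 3 - 3 * g) / gaugeV (\<sigma> y) 1)"
        by (intro s(8) smooth_family_gauge[OF \<sigma>] one nz ks(4))
      then show ?thesis using ks by (simp only: nform_coord_def if_False)
    qed
  qed
  then show ?thesis unfolding nform_def
    by (intro s(6) s(3)[OF bounded_linear_cs]) auto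
qed

lemma family_in_U0_iff:
  assumes "\<rho> \<in> Hom_Aff g"
  shows "rep_class g \<rho> \<in> U0 \<longleftrightarrow> generic_rep \<rho>" and "generic_rep \<rho> \<Longrightarrow> \<phi> (rep_class g \<rho>) = nform \<rho>"
proof -
  show "rep_class g \<rho> \<in> U0 \<longleftrightarrow> generic_rep \<rho>"
  proof
    assume "rep_class g \<rho> \<in> U0"
    then obtain p where "p \<in> \<Omega>" "rep_class g \<rho> = pt p" unfolding U0_def by (elim imageE)
    then show "generic_rep \<rho>" by (rule nform_unique(1)[OF assms])
  next
    assume gen: "generic_rep \<rho>"
    show "rep_class g \<rho> \<in> U0" unfolding nform_class(2)[OF assms gen] by (rule pt_in_U0[OF nform_class(1)[OF assms gen]])
  qed
  show "\<phi> (rep_class g \<rho>) = nform \<rho>" if gen: "generic_rep \<rho>"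
    unfolding nform_class(2)[OF assms gen] by (rule \<phi>_pt[OF nform_class(1)[OF assms gen]])
qed

text \<open>The inverse of the chart is given by a smooth family of representations, and the chart itself is
  given by rational functions of the coordinates of a representation.\<close>

lemma chart_in_atlas: "(U0, \<phi>) \<in> (char_var_atlas g :: (surface_rep set, 'e) chart set)"
proof -
  have "smooth_to_char_var g (\<phi> ` U0) (inv_into U0 \<phi>)"
    unfolding smooth_to_char_var_def \<phi>_U0
  proof (intro conjI open_\<Omega> ballI exI)
    show "x \<in> \<Omega>" if "x \<in> \<Omega>" for x by (rule that)
    show "smooth_rep_family g \<Omega> (\<lambda>p. Rz (p, 1))" by (rule smooth_rep_family_slice)
    show "inv_into U0 \<phi> y = rep_class g (Rz (y, 1))" if "y \<in> \<Omega>" for y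
      unfolding inv_\<phi>[OF that] pt_def ..
  qed (rule order_refl)
  moreover have "open {x \<in> W. p x \<in> U0} \<and> smooth_on {x \<in> W. p x \<in> U0} (\<phi> \<circ> p)"
    if p: "smooth_to_char_var g W p" for W :: "'e set" and p
  proof -
    have loc: "\<exists>W'. open W' \<and> x \<in> W' \<and> W' \<subseteq> {x \<in> W. p x \<in> U0} \<and> smooth_on W' (\<phi> \<circ> p)"
      if x: "x \<in> W" "p x \<in> U0" for x
    proof -
      obtain W' \<sigma> where W': "x \<in> W'" "W' \<subseteq> W" "smooth_rep_family g W' \<sigma>" "\<And>y. y \<in> W' \<Longrightarrow> p y = rep_class g (\<sigma> y)"
        using bspec[OF conjunct2[OF p[unfolded smooth_to_char_var_def]] x(1)] by metis
      have hom: "\<sigma> y \<in> Hom_Aff g" if "y \<in> W'" for y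
        using W'(3) that by (auto simp: smooth_rep_family_def Hom_nonabelian_def)
      define Y where "Y = {y \<in> W'. generic_rep (\<sigma> y)}"
      have Y: "open Y" "Y \<subseteq> W'" using generic_open[OF W'(3)] by (auto simp: Y_def)
      have fam: "smooth_rep_family g Y \<sigma>"
        using W'(3) Y by (auto simp: smooth_rep_family_def intro: smooth_on_subset)
      have "smooth_on Y (\<lambda>y. nform (\<sigma> y))" by (rule smooth_nform[OF fam]) (simp add: Y_def)
      then have "smooth_on Y (\<phi> \<circ> p)"
        using Y W'(4) hom family_in_U0_iff(2) by (intro smooth_on_cong[OF Y(1) _ \<open>smooth_on Y (\<lambda>y. nform (\<sigma> y))\<close>]) (auto simp: Y_def)
      moreover have "x \<in> Y" using x W' hom family_in_U0_iff(1) by (auto simp: Y_def)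
      moreover have "Y \<subseteq> {x \<in> W. p x \<in> U0}" using W' hom family_in_U0_iff(1) by (auto simp: Y_def)
      ultimately show ?thesis using Y(1) by blast
    qed
    have "open {x \<in> W. p x \<in> U0}"
      by (subst open_subopen) (use loc in blast)
    moreover have "smooth_on {x \<in> W. p x \<in> U0} (\<phi> \<circ> p)"
      by (rule smooth_on_local) (use loc in blast)
    ultimately show ?thesis by blast
  qed
  ultimately show ?thesis
    using U0_char_var inj_\<phi> unfolding char_var_atlas_def by blast
qed

subsection \<open>Other charts, null sets and Borel sets\<close>

abbreviation "Atlas \<equiv> (char_var_atlas g :: (surface_rep set, 'e) chart set)"

lemma chart_transition:
  assumes 1: "(V, \<psi>) \<in> Atlas" and 2: "(V', \<psi>') \<in> Atlas"
  shows "open (\<psi> ` (V \<inter> V'))" "smooth_on (\<psi> ` (V \<inter> V')) (\<psi>' \<circ> inv_into V \<psi>)"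
proof -
  have inj: "inj_on \<psi> V" and sm: "smooth_to_char_var g (\<psi> ` V) (inv_into V \<psi>)"
    using 1 by (auto simp: char_var_atlas_def)
  have eq: "{x \<in> \<psi> ` V. inv_into V \<psi> x \<in> V'} = \<psi> ` (V \<inter> V')"
    using inj by (auto simp: inv_into_f_f)
  have "\<forall>(W::'e set) p. smooth_to_char_var g W p \<longrightarrow> open {x \<in> W. p x \<in> V'} \<and> smooth_on {x \<in> W. p x \<in> V'} (\<psi>' \<circ> p)"
    using 2 by (simp add: char_var_atlas_def)
  from this[rule_format, OF sm] show "open (\<psi> ` (V \<inter> V'))" "smooth_on (\<psi> ` (V \<inter> V')) (\<psi>' \<circ> inv_into V \<psi>)"
    unfolding eq by simp_all
qed

lemma atlas_open_pt:
  assumes "open Q" "Q \<subseteq> \<Omega>"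
  shows "atlas_open (char_var g) Atlas (pt ` Q)"
  unfolding atlas_open_def
proof (intro conjI ballI, use assms U0_char_var in \<open>force simp: U0_def\<close>, clarify)
  fix V \<psi> assume V: "(V, \<psi>) \<in> Atlas"
  have inj: "inj_on \<psi> V" using V by (auto simp: char_var_atlas_def)
  note tr = chart_transition[OF V chart_in_atlas]
  have "\<psi> ` (pt ` Q \<inter> V) = \<psi> ` (V \<inter> U0) \<inter> (\<phi> \<circ> inv_into V \<psi>) -` Q"
  proof (intro equalityI subsetI)
    fix x assume "x \<in> \<psi> ` (pt ` Q \<inter> V)"
    then obtain p where p: "p \<in> Q" "pt p \<in> V" "x = \<psi> (pt p)" by auto
    then show "x \<in> \<psi> ` (V \<inter> U0) \<inter> (\<phi> \<circ> inv_into V \<psi>) -` Q"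
      using assms(2) inv_into_f_f[OF inj, of "pt p"] pt_in_U0[of p] by auto
  next
    fix x assume "x \<in> \<psi> ` (V \<inter> U0) \<inter> (\<phi> \<circ> inv_into V \<psi>) -` Q"
    then obtain X where X: "X \<in> V" "X \<in> U0" "x = \<psi> X" "\<phi> X \<in> Q" using inv_into_f_f[OF inj] by auto
    then obtain q where "q \<in> \<Omega>" "X = pt q" by (auto simp: U0_def)
    then show "x \<in> \<psi> ` (pt ` Q \<inter> V)" using X by auto
  qed
  also have "open \<dots>"
    by (rule continuous_open_preimage[OF smooth_on_imp_continuous_on[OF tr(2)] tr(1) assms(1)])
  finally show "open (\<psi> ` (pt ` Q \<inter> V))" .
qed

text \<open>Transition maps between charts are smooth, hence map null sets to null sets.\<close>

lemma lebesgue_null_pt_iff: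
  assumes B: "B \<subseteq> \<Omega>"
  shows "lebesgue_null (char_var g) Atlas (pt ` B) \<longleftrightarrow> negligible B"
proof
  assume "lebesgue_null (char_var g) Atlas (pt ` B)"
  then have "\<phi> ` (pt ` B \<inter> U0) \<in> null_sets lebesgue" using chart_in_atlas by (auto simp: lebesgue_null_def)
  moreover have "pt ` B \<inter> U0 = pt ` B" using B by (auto simp: U0_def)
  moreover have "\<phi> ` pt ` B = B" using B by (force simp: image_image)
  ultimately show "negligible B" by (simp add: negligible_iff_null_sets)
next
  assume neg: "negligible B"
  show "lebesgue_null (char_var g) Atlas (pt ` B)"
    unfolding lebesgue_null_def
  proof (intro conjI ballI, use assms U0_char_var in \<open>force simp: U0_def\<close>, clarify)
    fix V \<psi> assume V: "(V, \<psi>) \<in> Atlas"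
    note tr = chart_transition[OF chart_in_atlas V]
    let ?B = "B \<inter> \<phi> ` (U0 \<inter> V)"
    have eq: "\<psi> ` (pt ` B \<inter> V) = (\<psi> \<circ> inv_into U0 \<phi>) ` ?B"
    proof (intro equalityI subsetI)
      fix x assume "x \<in> \<psi> ` (pt ` B \<inter> V)"
      then obtain p where p: "p \<in> B" "pt p \<in> V" "x = \<psi> (pt p)" by auto
      then have "p \<in> \<phi> ` (U0 \<inter> V)" using B pt_in_U0[of p] \<phi>_pt[of p] by (metis IntI image_eqI subsetD)
      then show "x \<in> (\<psi> \<circ> inv_into U0 \<phi>) ` ?B" using p B inv_\<phi>[of p] by (auto intro!: image_eqI[of _ _ p])
    next
      fix x assume "x \<in> (\<psi> \<circ> inv_into U0 \<phi>) ` ?B"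
      then obtain p X where p: "p \<in> B" "p = \<phi> X" "X \<in> U0" "X \<in> V" "x = \<psi> (inv_into U0 \<phi> p)" by auto
      then show "x \<in> \<psi> ` (pt ` B \<inter> V)" using B inv_\<phi>[of p] inv_into_f_f[OF inj_\<phi> p(3)] by auto
    qed
    have "negligible ((\<psi> \<circ> inv_into U0 \<phi>) ` ?B)"
    proof (rule negligible_differentiable_image_negligible[OF order_refl])
      show "negligible ?B" using neg by (rule negligible_subset) auto
      show "(\<psi> \<circ> inv_into U0 \<phi>) differentiable_on ?B"
        unfolding differentiable_on_def
        using smooth_on_imp_differentiable[OF tr(2)] by (auto intro: differentiable_at_withinI)
    qed
    then show "\<psi> ` (pt ` B \<inter> V) \<in> null_sets lebesgue" unfolding eq by (simp add: negligible_iff_null_sets)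
  qed
qed

lemma sets_atlas_borel: "sets (atlas_borel (char_var g) Atlas) = sigma_sets (char_var g) {V. atlas_open (char_var g) Atlas V}"
  "space (atlas_borel (char_var g) Atlas) = char_var g"
proof -
  have sub: "{V. atlas_open (char_var g) Atlas V} \<subseteq> Pow (char_var g)" by (auto simp: atlas_open_def)
  show "sets (atlas_borel (char_var g) Atlas) = sigma_sets (char_var g) {V. atlas_open (char_var g) Atlas V}"
    "space (atlas_borel (char_var g) Atlas) = char_var g"
    unfolding atlas_borel_def by (rule sets_measure_of[OF sub], rule space_measure_of[OF sub])
qed

lemma pt_preimage_borel:
  assumes "C \<in> sets (atlas_borel (char_var g) Atlas)"
  shows "{p \<in> \<Omega>. pt p \<in> C} \<in> sets borel"
  using assms unfolding sets_atlas_borel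
proof (induction rule: sigma_sets.induct)
  case (Basic V)
  then have "open (\<phi> ` (V \<inter> U0))" using chart_in_atlas by (auto simp: atlas_open_def)
  moreover have "\<phi> ` (V \<inter> U0) = {p \<in> \<Omega>. pt p \<in> V}"
    by (auto simp: U0_def intro!: image_eqI[of _ \<phi> "pt _"])
  ultimately show ?case by simp
next
  case (Compl V)
  have "{p \<in> \<Omega>. pt p \<in> char_var g - V} = \<Omega> - {p \<in> \<Omega>. pt p \<in> V}"
    using U0_char_var pt_in_U0 by auto
  then show ?case using Compl open_\<Omega> by auto
next
  case (Union V)
  have "{p \<in> \<Omega>. pt p \<in> (\<Union>i. V i)} = (\<Union>i. {p \<in> \<Omega>. pt p \<in> V i})" by auto
  then show ?case using Union by auto
qed auto

lemma pt_image_borel: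
  assumes "B \<in> sets borel"
  shows "pt ` (B \<inter> \<Omega>) \<in> sets (atlas_borel (char_var g) Atlas)"
proof -
  have op: "pt ` (Q \<inter> \<Omega>) \<in> sets (atlas_borel (char_var g) Atlas)" if "open Q" for Q
    unfolding sets_atlas_borel using atlas_open_pt[of "Q \<inter> \<Omega>"] that open_\<Omega> by auto
  have "B \<in> sigma_sets UNIV {S. open S}" using assms by (simp add: borel_def)
  then show ?thesis
  proof (induction rule: sigma_sets.induct)
    case (Basic Q)
    then show ?case using op by auto
  next
    case (Compl B)
    have "pt ` ((UNIV - B) \<inter> \<Omega>) = pt ` (UNIV \<inter> \<Omega>) - pt ` (B \<inter> \<Omega>)"
      using inj_pt by (auto simp: inj_on_def)
    then show ?case using Compl op[of UNIV] by auto
  next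
    case (Union B)
    have "pt ` ((\<Union>i. B i) \<inter> \<Omega>) = (\<Union>i. pt ` (B i \<inter> \<Omega>))" by auto
    then show ?case using Union by auto
  qed auto
qed

end

section \<open>The twists in the chart\<close>

context surface_chart
begin

text \<open>Scaling of the translation parts by a complex number, with the linear parts unchanged.\<close>

definition m :: "complex \<Rightarrow> 'e \<Rightarrow> 'e" where
  "m l p = (\<Sum>k<n. cs k (if k < 2 * g then cc k p else l * cc k p))"

text \<open>The same scaling on the model space with its extra coordinate.\<close>

definition M :: "complex \<Rightarrow> 'e \<times> complex \<Rightarrow> 'e \<times> complex" where
  "M l z = (m l (fst z), l * snd z)"

lemma cc_m: "k < n \<Longrightarrow> cc k (m l p) = (if k < 2 * g then cc k p else l * cc k p)"
  unfolding m_def by (rule cc_sum)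

lemma linear_m: "linear (m l)"
  by (rule linearI; rule cc_eqI) (auto simp: cc_m linear_add[OF linear_cc] linear_scale[OF linear_cc] distrib_left)

lemma linear_M: "linear (M l)"
  by (rule linearI)
     (auto simp: M_def linear_add[OF linear_m] linear_scale[OF linear_m] distrib_left)

lemma m_m: "m l (m q p) = m (l * q) p"
  by (rule cc_eqI) (auto simp: cc_m)

lemma m_1: "m 1 p = p"
  by (rule cc_eqI) (auto simp: cc_m)

lemma M_M: "M l (M q z) = M (l * q) z"
  by (simp add: M_def m_m)

lemma M_1: "M 1 z = z"
  by (simp add: M_def m_1)

lemma M_coords:
  "i \<in> {1..g} \<Longrightarrow> cA i (M l z) = cA i z" "i \<in> {1..g} \<Longrightarrow> cB i (M l z) = cB i z"
  "i \<in> {1..<g} \<Longrightarrow> cU i (M l z) = l * cU i z" "i \<in> {1..<g} \<Longrightarrow> cV i (M l z) = l * cV i z"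
  using genus by (auto simp: cA_def cB_def cU_def cV_def M_def cc_m n_def)

lemma m_cs: "k < n \<Longrightarrow> 2 * g \<le> k \<Longrightarrow> m l (cs k r) = cs k (l * r)"
  by (rule cc_eqI) (auto simp: cc_m cc_cs)

lemma M_dUV:
  assumes "i \<in> {1..<g}"
  shows "M l (dU i r) = dU i (l * r)" "M l (dV i r) = dV i (l * r)"
  using assms genus by (auto simp: M_def dU_def dV_def m_cs n_def linear_0[OF linear_m])

lemma M_regular: "regular (M l z) = regular z" "admissible (M l z) = admissible z"
  by (auto simp: regular_def admissible_def M_coords)

lemma M_t: "i \<in> {1..<g} \<Longrightarrow> t i (M l z) = l * t i z"
  by (auto simp: t_def M_coords algebra_simps)

lemma M_UVf:
  "i \<in> {1..g} \<Longrightarrow> Uf i (M l z) = l * Uf i z" "i \<in> {1..g} \<Longrightarrow> Vf i (M l z) = l * Vf i z"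
proof -
  have "(\<Sum>j\<in>{1..<g}. t j (M l z)) = l * (\<Sum>j\<in>{1..<g}. t j z)"
    unfolding sum_distrib_left by (intro sum.cong) (auto simp: M_t)
  then show "i \<in> {1..g} \<Longrightarrow> Uf i (M l z) = l * Uf i z"
    using genus by (auto simp: Uf_def M_coords)
  show "i \<in> {1..g} \<Longrightarrow> Vf i (M l z) = l * Vf i z" by (auto simp: Vf_def M_coords)
qed

lemma M_t': "i \<in> {1..<g} \<Longrightarrow> t' i (M l z) = l * t' i z"
  by (simp add: t'_def M_t M_UVf M_coords add_divide_distrib diff_divide_distrib algebra_simps)

lemma M_E:
  assumes "i \<in> {1..<g}"
  shows "E i (M l z) (l * r) = M l (E i z r)" "E' i (M l z) (l * r) = M l (E' i z r)"
  using assms M_dUV[of "Suc i"]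
  by (auto simp: E_def E'_def M_coords linear_add[OF linear_M] M_dUV linear_0[OF linear_M] mult.assoc)

lemma M_twist:
  assumes i: "i \<in> {1..<g}"
  shows "twist i r (M l z) = M l (twist i r z)" "twist' i r (M l z) = M l (twist' i r z)"
  using M_E[OF i, of l z "r * t i z"] M_E[OF i, of l z "r * t' i z"]
  by (auto simp: twist_def twist'_def M_regular M_t[OF i] M_t'[OF i] linear_add[OF linear_M] mult.left_commute)

text \<open>The twists and their inverses; both signs are needed because preimages under a mapping class are
  images under its inverse.\<close>

definition twist_pair :: "('e \<times> complex \<Rightarrow> 'e \<times> complex) \<Rightarrow> ('e \<times> complex \<Rightarrow> 'e \<times> complex) \<Rightarrow> bool" where
  "twist_pair f f' \<longleftrightarrow> (\<exists>i\<in>{1..<g}. \<exists>e.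
     f = twist i (csign e) \<and> f' = twist i (csign (\<not> e)) \<or> f = twist' i (csign e) \<and> f' = twist' i (csign (\<not> e)))"

lemma twist_pair_sym: "twist_pair f f' \<Longrightarrow> twist_pair f' f"
  unfolding twist_pair_def
  by (elim bexE exE, rule bexI, rule_tac x = "\<not> e" in exI) auto

lemma twist_pair_twist:
  "i \<in> {1..<g} \<Longrightarrow> \<exists>f'. twist_pair (twist i 1) f'" "i \<in> {1..<g} \<Longrightarrow> \<exists>f'. twist_pair (twist' i 1) f'"
proof -
  have 1: "1 = csign False" by (simp add: csign_def)
  show "i \<in> {1..<g} \<Longrightarrow> \<exists>f'. twist_pair (twist i 1) f'" "i \<in> {1..<g} \<Longrightarrow> \<exists>f'. twist_pair (twist' i 1) f'"
    unfolding twist_pair_def 1 by metis+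
qed

lemma twist_pair_preserving: "twist_pair f f' \<Longrightarrow> lebesgue_preserving f"
  using lebesgue_preserving_twist by (auto simp: twist_pair_def)

lemma twist_pair_M: "twist_pair f f' \<Longrightarrow> f (M l z) = M l (f z)"
  by (auto simp: twist_pair_def M_twist)

lemma twist_pair_admissible: "twist_pair f f' \<Longrightarrow> admissible (f z) = admissible z"
  by (auto simp: twist_pair_def admissible_twist)

lemma twist_pair_inverse:
  assumes "twist_pair f f'"
  shows "f' (f z) = z"
proof -
  have "twist i (- r) (twist i r z) = z \<and> twist' i (- r) (twist' i r z) = z" if i: "i \<in> {1..<g}" for i r
  proof (cases "regular z")
    case True
    have r: "regular (z + E i z q)" "regular (z + E' i z q)" "E i (z + E i z q) = E i z" "E' i (z + E' i z q) = E' i z" for q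
      using base_functionD[OF base_function_regular] base_functionD[OF base_function_E(1)[OF i]]
        base_functionD[OF base_function_E(2)[OF i]] fibre_part_E[OF i] True by auto
    have E0: "E i z 0 = 0" "E' i z 0 = 0" by (auto simp: E_def E'_def coord_zero)
    show ?thesis
      using E_add(1)[of i z "r * t i z" "- r * t i z"] E_add(2)[of i z "r * t' i z" "- r * t' i z"]
      by (simp add: twist_def twist'_def True r t_E[OF i i] t'_E[OF i True] E0 add.assoc)
  qed (simp add: twist_def twist'_def)
  moreover have "csign (\<not> e) = - csign e" for e by (simp add: csign_def)
  ultimately show ?thesis using assms unfolding twist_pair_def by metis
qed

subsection \<open>Mapping classes realising the twists\<close>

lemma outer_class_action:
  assumes "surface.inverse_substitutions g \<sigma> \<tau>" "X \<in> char_var g"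
  shows "mcg_action g (surface.outer_class g \<sigma>) (mcg_action g (surface.outer_class g \<tau>) X) = X"
proof -
  let ?C = "carrier (surface_group g)"
  obtain \<rho> where \<rho>: "\<rho> \<in> Hom_Aff g" "X = rep_class g \<rho>"
    using assms(2) by (auto simp: char_var_def Hom_nonabelian_def)
  have \<sigma>: "surface.relator_substitution g \<sigma>" "surface.relator_substitution g \<tau>"
    using assms(1) by (auto simp: surface.inverse_substitutions_def)
  have e: "surface.endomorphism g \<sigma> \<in> hom (surface_group g) (surface_group g)"
      "surface.endomorphism g \<tau> \<in> hom (surface_group g) (surface_group g)"
    using \<sigma> surface.endomorphism_hom by (simp_all add: surface_group_def)
  have h: "compose ?C \<rho> (surface.endomorphism g \<sigma>) \<in> Hom_Aff g"
    using e \<rho>(1) group.subgroup_self[OF group_presented_group, THEN subgroup.m_closed]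
    by (auto simp: Hom_Aff_def hom_def compose_def Pi_iff surface_group_def)
  have "compose ?C (compose ?C \<rho> (surface.endomorphism g \<sigma>)) (surface.endomorphism g \<tau>) = \<rho>"
    using surface.endomorphism_inverse[OF assms(1)] e \<rho>(1)
    by (auto simp: compose_def fun_eq_iff Hom_Aff_def extensional_def surface_group_def[symmetric] hom_def Pi_iff)
  then show ?thesis
    unfolding \<rho>(2) mcg_action_outer_class[OF assms(1) \<rho>(1)]
      mcg_action_outer_class[OF surface.inverse_substitutions_sym[OF assms(1)] h] by simp
qed

text \<open>The substitutions fix the relator, so that their outer classes preserve the fundamental class,
  and they act on coordinates by the twist maps.\<close>

lemma twist_pair_mapping_classes:
  assumes f: "twist_pair f f'" and \<xi>: "fundamental_class (surface_group g) \<xi>"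
  obtains F F' where "F \<in> carrier (mapping_class_group g \<xi>)"
    "\<And>z. admissible z \<Longrightarrow> mcg_action g F (rep_class g (Rz z)) = rep_class g (Rz (f z))"
    "\<And>z. admissible z \<Longrightarrow> mcg_action g F' (rep_class g (Rz z)) = rep_class g (Rz (f' z))"
    "\<And>X. X \<in> char_var g \<Longrightarrow> mcg_action g F' (mcg_action g F X) = X"
proof -
  obtain i e where i: "i \<in> {1..<g}" and fe: "f = twist i (csign e) \<and> f' = twist i (csign (\<not> e)) \<or>
      f = twist' i (csign e) \<and> f' = twist' i (csign (\<not> e))"
    using f unfolding twist_pair_def by (elim bexE exE) (rule that)
  have ig: "i \<in> {1..g}" using i by auto
  have sw: "surface.inverse_substitutions g (twist_substitution (signed_word e (commutator_word i)) i)
       (twist_substitution (signed_word (\<not> e) (commutator_word i)) i)" for e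
    using inverse_twist_substitutions[OF ig] surface.inverse_substitutions_sym[OF inverse_twist_substitutions[OF ig]]
    by (cases e) (auto simp: signed_word_def)
  have bw: "surface.inverse_substitutions g (bridge_twist_substitution (signed_word e (commutator_word i)) i)
       (bridge_twist_substitution (signed_word (\<not> e) (commutator_word i)) i)" for e
    using inverse_bridge_twist_substitutions[OF i] surface.inverse_substitutions_sym[OF inverse_bridge_twist_substitutions[OF i]]
    by (cases e) (auto simp: signed_word_def)
  obtain \<sigma> \<tau> where st: "surface.inverse_substitutions g \<sigma> \<tau>"
    "\<And>z. admissible z \<Longrightarrow> compose (carrier (surface_group g)) (Rz z) (surface.endomorphism g \<sigma>) = Rz (f z)"
    "\<And>z. admissible z \<Longrightarrow> compose (carrier (surface_group g)) (Rz z) (surface.endomorphism g \<tau>) = Rz (f' z)"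
  proof (use fe in \<open>elim disjE conjE\<close>)
    assume "f = twist i (csign e)" "f' = twist i (csign (\<not> e))"
    then show thesis by (intro that[OF sw[of e]]) (simp_all only: Rz_twist(1)[OF _ i])
  next
    assume "f = twist' i (csign e)" "f' = twist' i (csign (\<not> e))"
    then show thesis by (intro that[OF bw[of e]]) (simp_all only: Rz_twist(2)[OF _ i])
  qed
  note ts = surface.inverse_substitutions_sym[OF st(1)]
  show thesis
  proof (rule that[of "surface.outer_class g \<tau>" "surface.outer_class g \<sigma>"])
    show "surface.outer_class g \<tau> \<in> carrier (mapping_class_group g \<xi>)"
      by (rule outer_class_in_mapping_class_group[OF st(1) \<xi>])
  qed (simp_all add: outer_class_action[OF st(1)] mcg_action_outer_class[OF st(1) Rz_Hom] mcg_action_outer_class[OF ts Rz_Hom] st(2,3))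
qed

subsection \<open>The action in the chart\<close>

text \<open>The point of the slice on the orbit of the scaling group.\<close>

definition nf :: "'e \<times> complex \<Rightarrow> 'e" where
  "nf z = m (1 / snd z) (fst z)"

lemma nf_eq: "snd z \<noteq> 0 \<Longrightarrow> (nf z, 1) = M (1 / snd z) z"
  by (simp add: nf_def M_def)

lemma nf_M: "l \<noteq> 0 \<Longrightarrow> nf (M l z) = nf z"
  by (simp add: nf_def M_def m_m)

lemma Rz_M:
  assumes z: "admissible z" and l: "l \<noteq> 0"
  shows "rep_class g (Rz (M l z)) = rep_class g (Rz z)"
proof -
  note c = conjugate_rep_rep[OF rep_coords_Rz[OF z] l, of 0]
  have "conjugate_rep g (affine_map l 0) (Rz z) = Rz (M l z)"
    unfolding Rz_def conjunct2[OF c]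
    by (rule conjunct2[OF rep_cong[OF conjunct1[OF c]]]) (simp add: M_coords M_UVf)
  then show ?thesis
    using rep_class_conjugate[OF Rz_Hom[OF z], of "affine_map l 0"] l by simp
qed

lemma class_nf:
  assumes z: "admissible z" and nz: "snd z \<noteq> 0"
  shows "nf z \<in> \<Omega>" "rep_class g (Rz z) = pt (nf z)"
  using Rz_M[OF z, of "1 / snd z"] nz z by (auto simp: \<Omega>_def pt_def nf_eq M_regular)

lemma class_not_in_U0:
  assumes z: "admissible z" and nz: "snd z = 0"
  shows "rep_class g (Rz z) \<notin> U0"
proof -
  have "1 \<in> {1..g}" "g \<in> {1..g}" using genus by auto
  then have "gaugeV (Rz z) 1 = 0"
    using nz genus by (simp add: gaugeV_def coord_Rz[OF z] Vf_def cV_def)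
  then show ?thesis
    using family_in_U0_iff(1)[OF Rz_Hom[OF z]] by (simp add: generic_rep_def)
qed

text \<open>The points of the slice that stay in the domain of the chart.\<close>

definition Dom :: "('e \<times> complex \<Rightarrow> 'e \<times> complex) \<Rightarrow> 'e set" where
  "Dom f = {p \<in> \<Omega>. snd (f (p, 1)) \<noteq> 0}"

text \<open>The expression of the mapping class in the chart.\<close>

definition ind :: "('e \<times> complex \<Rightarrow> 'e \<times> complex) \<Rightarrow> 'e \<Rightarrow> 'e" where
  "ind f p = nf (f (p, 1))"

lemma ind_inverse:
  assumes f: "twist_pair f f'" and p: "p \<in> Dom f"
  shows "ind f p \<in> Dom f'" "ind f' (ind f p) = p"
proof -
  define z where "z = f (p, 1)"
  have z: "admissible z" "snd z \<noteq> 0"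
    using p twist_pair_admissible[OF f] by (auto simp: z_def Dom_def \<Omega>_def)
  have eq: "f' (ind f p, 1) = M (1 / snd z) (p, 1)"
    using twist_pair_M[OF twist_pair_sym[OF f], of "1 / snd z" z] twist_pair_inverse[OF f, of "(p, 1)"] nf_eq[OF z(2)]
    by (simp add: ind_def z_def)
  show "ind f p \<in> Dom f'"
    unfolding Dom_def mem_Collect_eq eq using class_nf(1)[OF z] z(2) by (simp add: ind_def M_def z_def)
  show "ind f' (ind f p) = p"
    unfolding ind_def[of f'] eq using z(2) by (simp add: nf_M) (simp add: nf_def m_1)
qed

text \<open>The preimage of a set in the chart lies again in the chart, although the mapping class does not
  preserve the chart: this uses the inverse mapping class on the whole character variety.\<close>

lemma twist_pair_action:
  assumes f: "twist_pair f f'" and \<xi>: "fundamental_class (surface_group g) \<xi>"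
  obtains F where "F \<in> carrier (mapping_class_group g \<xi>)"
    "\<And>p. p \<in> Dom f \<Longrightarrow> mcg_action g F (pt p) = pt (ind f p)"
    "\<And>p. p \<in> \<Omega> \<Longrightarrow> mcg_action g F (pt p) \<in> U0 \<longleftrightarrow> p \<in> Dom f"
    "\<And>B. B \<subseteq> Dom f' \<Longrightarrow> mcg_action g F -` (pt ` B) \<inter> char_var g = pt ` {p \<in> Dom f. ind f p \<in> B}"
proof -
  obtain F F' where F: "F \<in> carrier (mapping_class_group g \<xi>)"
    "\<And>z. admissible z \<Longrightarrow> mcg_action g F (rep_class g (Rz z)) = rep_class g (Rz (f z))"
    "\<And>z. admissible z \<Longrightarrow> mcg_action g F' (rep_class g (Rz z)) = rep_class g (Rz (f' z))"
    "\<And>X. X \<in> char_var g \<Longrightarrow> mcg_action g F' (mcg_action g F X) = X"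
    using twist_pair_mapping_classes[OF f \<xi>] by metis
  have act: "mcg_action g F (pt p) = pt (ind f p)" if p: "p \<in> Dom f" for p
    using p F(2)[of "(p, 1)"] class_nf(2)[of "f (p, 1)"] twist_pair_admissible[OF f]
    by (simp add: Dom_def \<Omega>_def pt_def ind_def)
  have act': "mcg_action g F' (pt p) = pt (ind f' p)" if p: "p \<in> Dom f'" for p
    using p F(3)[of "(p, 1)"] class_nf(2)[of "f' (p, 1)"] twist_pair_admissible[OF twist_pair_sym[OF f]]
    by (simp add: Dom_def \<Omega>_def pt_def ind_def)
  show thesis
  proof (rule that[OF F(1) act])
    show "mcg_action g F (pt p) \<in> U0 \<longleftrightarrow> p \<in> Dom f" if p: "p \<in> \<Omega>" for p
    proof (cases "snd (f (p, 1)) = 0")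
      case True
      then show ?thesis
        using p F(2)[of "(p, 1)"] class_not_in_U0[of "f (p, 1)"] twist_pair_admissible[OF f]
        by (simp add: \<Omega>_def pt_def Dom_def)
    next
      case False
      then have "p \<in> Dom f" using p by (simp add: Dom_def)
      then show ?thesis using act class_nf(1)[of "f (p, 1)"] False p twist_pair_admissible[OF f]
        by (auto simp: \<Omega>_def ind_def intro!: pt_in_U0)
    qed
    show "mcg_action g F -` (pt ` B) \<inter> char_var g = pt ` {p \<in> Dom f. ind f p \<in> B}" if B: "B \<subseteq> Dom f'" for B
    proof (intro equalityI subsetI)
      fix X assume "X \<in> mcg_action g F -` (pt ` B) \<inter> char_var g"
      then obtain q where q: "q \<in> B" "mcg_action g F X = pt q" "X \<in> char_var g" by auto
      then have "X = pt (ind f' q)" using F(4)[OF q(3)] act'[of q] B by auto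
      moreover have "ind f' q \<in> Dom f" "ind f (ind f' q) = q"
        using ind_inverse[OF twist_pair_sym[OF f], of q] B q(1) by auto
      ultimately show "X \<in> pt ` {p \<in> Dom f. ind f p \<in> B}" using q(1) by auto
    next
      fix X assume "X \<in> pt ` {p \<in> Dom f. ind f p \<in> B}"
      then obtain p where p: "p \<in> Dom f" "ind f p \<in> B" "X = pt p" by auto
      then have "X \<in> char_var g" using pt_in_U0[of p] U0_char_var by (auto simp: Dom_def)
      then show "X \<in> mcg_action g F -` (pt ` B) \<inter> char_var g" using p act[OF p(1)] by auto
    qed
  qed
qed

lemma borel_slice [measurable]: "(\<lambda>p. (p, 1)) \<in> borel_measurable (borel :: 'e measure)"
  by (intro borel_measurable_continuous_onI continuous_intros)

lemma borel_Omega [measurable]: "\<Omega> \<in> sets borel"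
  using open_\<Omega> by simp

lemma Dom_borel [measurable]:
  assumes "twist_pair f f'"
  shows "Dom f \<in> sets borel"
proof -
  note [measurable] = lebesgue_preservingD(1)[OF twist_pair_preserving[OF assms]]
  have "Dom f = \<Omega> \<inter> {p. snd (f (p, 1)) \<noteq> 0}" by (auto simp: Dom_def)
  also have "\<dots> \<in> sets borel" by measurable
  finally show ?thesis .
qed

text \<open>The twist preserves Lebesgue measure and the hyperplane where the extra coordinate vanishes is
  null. By homogeneity under scalings, nullity on the product descends to the slice.\<close>

lemma Dom_conull:
  assumes f: "twist_pair f f'"
  shows "\<Omega> - Dom f \<in> null_sets lborel"
proof -
  note [measurable] = lebesgue_preservingD(1)[OF twist_pair_preserving[OF f]]
  define N where "N = {p. snd (f (p, 1)) = 0}"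
  have N [measurable]: "N \<in> sets borel" unfolding N_def by measurable
  have null: "{z :: 'e \<times> complex. snd z = 0} \<in> null_sets lborel"
  proof (rule null_if_null_on_lines[where d = "(0, 1)"])
    show "{z :: 'e \<times> complex. snd z = 0} \<in> sets borel" by measurable
    fix z :: "'e \<times> complex"
    have "{x :: real. z + x *\<^sub>R (0, 1) \<in> {z. snd z = 0}} \<subseteq> {- Re (snd z)}"
      by (auto simp: complex_eq_iff)
    from countable_subset[OF this]
    show "emeasure lborel {x :: real. z + x *\<^sub>R (0, 1) \<in> {z. snd z = 0}} = 0"
      by (intro emeasure_lborel_countable) simp
  qed
  have "AE z in lborel. snd (f z) \<noteq> 0"
    by (rule lebesgue_preserving_AE[OF twist_pair_preserving[OF f]]) (use AE_not_in[OF null] in auto)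
  then have "AE z in (lborel :: 'e measure) \<Otimes>\<^sub>M (lborel :: complex measure). snd (f z) \<noteq> 0"
    unfolding lborel_prod .
  moreover have "{z. snd (f z) \<noteq> 0} \<in> sets ((lborel :: 'e measure) \<Otimes>\<^sub>M (lborel :: complex measure))"
    unfolding lborel_prod by measurable
  ultimately have "AE p in (lborel :: 'e measure). AE l in (lborel :: complex measure). snd (f (p, l)) \<noteq> 0"
    and mb: "{x \<in> space ((lborel :: 'e measure) \<Otimes>\<^sub>M (lborel :: complex measure)). snd (f (fst x, snd x)) \<noteq> 0}
      \<in> sets ((lborel :: 'e measure) \<Otimes>\<^sub>M (lborel :: complex measure))"
    by (auto simp: space_pair_measure intro: lborel_pair.AE_pair)
  then have "AE l in (lborel :: complex measure). AE p in (lborel :: 'e measure). snd (f (p, l)) \<noteq> 0"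
    using lborel_pair.AE_commute[OF mb] by simp
  moreover have "AE l in (lborel :: complex measure). l \<noteq> 0"
    by (rule AE_lborel_singleton)
  ultimately have ae: "AE l in (lborel :: complex measure). l \<noteq> 0 \<and> (AE p in (lborel :: 'e measure). snd (f (p, l)) \<noteq> 0)"
    by eventually_elim simp
  obtain l where l: "l \<noteq> 0" "AE p in lborel. snd (f (p, l)) \<noteq> 0"
  proof (rule ccontr)
    assume "\<not> thesis"
    then have "AE l in (lborel :: complex measure). False" using ae that by (auto elim: eventually_mono)
    then show False by (simp only: AE_lborel_const)
  qed
  have "AE p in lborel. p \<notin> N"
  proof -
    have "AE p in lborel. snd (f (m l p, l)) \<noteq> 0"
      by (rule AE_linear_bijection[OF linear_m linear_m[of "1 / l"] _ _ l(2)]) (use l(1) in \<open>simp_all add: m_m m_1\<close>)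
    moreover have "f (m l p, l) = M l (f (p, 1))" for p
      using twist_pair_M[OF f, of l "(p, 1)"] by (simp add: M_def)
    ultimately show ?thesis using l(1) by (simp add: N_def M_def)
  qed
  then have "AE p in lborel. p \<notin> \<Omega> - Dom f"
    by eventually_elim (auto simp: N_def Dom_def)
  moreover have "\<Omega> - Dom f \<in> sets borel" using Dom_borel[OF f] by measurable
  ultimately show ?thesis by (simp add: AE_iff_null_sets)
qed

end

section \<open>From an invariant measure to an invariant density\<close>

text \<open>A rotation other than the half turn is a product of three shears, and the half turn is the
  square of a quarter turn.\<close>

lemma lebesgue_preserving_rotation:
  fixes q :: complex
  assumes q: "cmod q = 1"
  shows "lebesgue_preserving (\<lambda>z. q * z)"
proof -
  have shears: "lebesgue_preserving (\<lambda>z. z + of_real (\<alpha> * Im z))" "lebesgue_preserving (\<lambda>z. z + \<i> * of_real (\<alpha> * Re z))" for \<alpha> :: real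
    by (rule lebesgue_preserving_along_action[where a = "\<lambda>r z. z + of_real r" and s = "\<lambda>z. \<alpha> * Im z"]
             lebesgue_preserving_along_action[where a = "\<lambda>r z. z + \<i> * of_real r" and s = "\<lambda>z. \<alpha> * Re z"];
        (auto simp: algebra_simps intro: lebesgue_preserving_translation)[1]; fail)+
  have *: "lebesgue_preserving (\<lambda>z. q * z)" if q: "cmod q = 1" "Re q \<noteq> - 1" for q
  proof -
    define \<alpha> where "\<alpha> = - Im q / (1 + Re q)"
    have "(Re q)\<^sup>2 + (Im q)\<^sup>2 = 1" using q(1) by (simp add: cmod_def)
    then have im: "(Im q)\<^sup>2 = (1 - Re q) * (1 + Re q)" by (simp add: algebra_simps power2_eq_square)
    have nz: "1 + Re q \<noteq> 0" using q(2) by linarith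
    have a: "1 + \<alpha> * Im q = Re q"
      using im nz by (simp add: \<alpha>_def power2_eq_square)
    have b: "\<alpha> + \<alpha> * (1 + \<alpha> * Im q) = - Im q"
    proof -
      have "\<alpha> + \<alpha> * Re q = \<alpha> * (1 + Re q)" by (simp add: distrib_left)
      also have "\<dots> = - Im q" using nz by (simp add: \<alpha>_def)
      finally show ?thesis unfolding a .
    qed
    have eq: "q * z = (let x = z + of_real (\<alpha> * Im z); y = x + \<i> * of_real (Im q * Re x) in y + of_real (\<alpha> * Im y))" for z
      using arg_cong[OF a, of "\<lambda>x. x * Re z"] arg_cong[OF a, of "\<lambda>x. x * Im z"] arg_cong[OF b, of "\<lambda>x. x * Im z"]
      by (simp add: Let_def complex_eq_iff algebra_simps)
    show ?thesis
      using lebesgue_preserving_compose[OF shears(1)[of \<alpha>] lebesgue_preserving_compose[OF shears(2)[of "Im q"] shears(1)[of \<alpha>]]]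
      unfolding eq Let_def .
  qed
  show ?thesis
  proof (cases "Re q = - 1")
    case True
    then have "q = - 1" using q by (auto simp: cmod_def complex_eq_iff)
    then show ?thesis
      using lebesgue_preserving_compose[OF *[of \<i>] *[of \<i>]] by (simp add: mult.assoc[symmetric])
  qed (use * q in simp)
qed

lemma lborel_diagonal:
  fixes f :: "'x::euclidean_space \<Rightarrow> 'x"
  assumes f: "linear f" and c: "\<And>j. j \<in> Basis \<Longrightarrow> f j = c j *\<^sub>R j" "\<And>j. j \<in> Basis \<Longrightarrow> c j \<noteq> 0"
    and h [measurable]: "h \<in> borel_measurable borel"
  shows "ennreal (\<Prod>j\<in>Basis. \<bar>c j\<bar>) * (\<integral>\<^sup>+x. h (f x) \<partial>lborel) = (\<integral>\<^sup>+x. h x \<partial>lborel)"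
proof -
  have fb [measurable]: "f \<in> borel_measurable borel"
    using f linear_continuous_on linear_conv_bounded_linear by (auto intro!: borel_measurable_continuous_onI)
  have "f x = f (\<Sum>j\<in>Basis. (x \<bullet> j) *\<^sub>R j)" for x by (simp add: euclidean_representation)
  then have fx: "f x = (\<Sum>j\<in>Basis. (c j * (x \<bullet> j)) *\<^sub>R j)" for x
    by (simp add: linear_sum[OF f] linear_scale[OF f] c(1) mult.commute)
  have "lborel = density (distr lborel borel f) (\<lambda>_. ennreal (\<Prod>j\<in>Basis. \<bar>c j\<bar>))"
    using lborel_affine_euclidean[of c 0] c(2) by (simp add: fx[abs_def])
  then have "(\<integral>\<^sup>+x. h x \<partial>lborel) = (\<integral>\<^sup>+x. h x \<partial>density (distr lborel borel f) (\<lambda>_. ennreal (\<Prod>j\<in>Basis. \<bar>c j\<bar>)))"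
    by metis
  also have "\<dots> = (\<integral>\<^sup>+x. ennreal (\<Prod>j\<in>Basis. \<bar>c j\<bar>) * h (f x) \<partial>lborel)"
    by (simp add: nn_integral_density nn_integral_distr)
  also have "\<dots> = ennreal (\<Prod>j\<in>Basis. \<bar>c j\<bar>) * (\<integral>\<^sup>+x. h (f x) \<partial>lborel)"
    by (rule nn_integral_cmult) measurable
  finally show ?thesis by simp
qed

lemma lborel_complex_scaling:
  fixes q :: complex
  assumes q: "q \<noteq> 0" and h [measurable]: "h \<in> borel_measurable borel"
  shows "ennreal ((cmod q)\<^sup>2) * (\<integral>\<^sup>+l. h (q * l) \<partial>lborel) = (\<integral>\<^sup>+l. h l \<partial>lborel)"
proof -
  define u where "u = q / of_real (cmod q)"
  have u: "cmod u = 1" using q by (simp add: u_def norm_divide)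
  have q_eq: "q * l = u * (cmod q *\<^sub>R l)" for l using q by (simp add: u_def scaleR_conv_of_real)
  have "ennreal (\<Prod>j\<in>(Basis::complex set). \<bar>cmod q\<bar>) * (\<integral>\<^sup>+l. h (u * (cmod q *\<^sub>R l)) \<partial>lborel) = (\<integral>\<^sup>+l. h (u * l) \<partial>lborel)"
    by (rule lborel_diagonal[where f = "\<lambda>l. cmod q *\<^sub>R l" and h = "\<lambda>l. h (u * l)"])
       (use q in \<open>auto intro!: linearI simp: algebra_simps\<close>)
  also have "\<dots> = (\<integral>\<^sup>+l. h l \<partial>lborel)"
    by (rule lebesgue_preservingD(2)[OF lebesgue_preserving_rotation[OF u] h])
  finally show ?thesis by (simp add: q_eq prod_constant)
qed

text \<open>The density of the Haar measure of the multiplicative group of complex numbers.\<close>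

definition haar_weight :: "complex \<Rightarrow> ennreal" where
  "haar_weight l = ennreal (1 / (cmod l)\<^sup>2)"

lemma borel_haar_weight [measurable]: "haar_weight \<in> borel_measurable borel"
  unfolding haar_weight_def[abs_def] by measurable

lemma haar_scaling:
  fixes q :: complex
  assumes q: "q \<noteq> 0" and h [measurable]: "h \<in> borel_measurable borel"
  shows "(\<integral>\<^sup>+l. h (q * l) * haar_weight l \<partial>lborel) = (\<integral>\<^sup>+l. h l * haar_weight l \<partial>lborel)"
proof -
  have w: "haar_weight l = ennreal ((cmod q)\<^sup>2) * haar_weight (q * l)" for l
    using q by (simp add: haar_weight_def norm_mult power_mult_distrib ennreal_mult[symmetric])
  have "(\<integral>\<^sup>+l. h (q * l) * haar_weight l \<partial>lborel)
      = (\<integral>\<^sup>+l. ennreal ((cmod q)\<^sup>2) * (h (q * l) * haar_weight (q * l)) \<partial>lborel)"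
  proof (rule nn_integral_cong)
    show "h (q * l) * haar_weight l = ennreal ((cmod q)\<^sup>2) * (h (q * l) * haar_weight (q * l))" for l
      unfolding w[of l] by (simp only: mult_ac)
  qed
  also have "\<dots> = ennreal ((cmod q)\<^sup>2) * (\<integral>\<^sup>+l. h (q * l) * haar_weight (q * l) \<partial>lborel)"
    by (rule nn_integral_cmult) measurable
  also have "\<dots> = (\<integral>\<^sup>+l. h l * haar_weight l \<partial>lborel)"
    by (rule lborel_complex_scaling[OF q, where h = "\<lambda>l. h l * haar_weight l"]) measurable
  finally show ?thesis .
qed

lemma haar_annulus:
  "0 < (\<integral>\<^sup>+l. indicator {l. 1 \<le> cmod l \<and> cmod l \<le> 2} l * haar_weight l \<partial>lborel)"
  "(\<integral>\<^sup>+l. indicator {l. 1 \<le> cmod l \<and> cmod l \<le> 2} l * haar_weight l \<partial>lborel) < \<infinity>"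
proof -
  let ?A = "{l. 1 \<le> cmod l \<and> cmod l \<le> 2}"
  have "(\<integral>\<^sup>+l. indicator ?A l * haar_weight l \<partial>lborel) \<le> (\<integral>\<^sup>+l. indicator (cball (0::complex) 2) l \<partial>lborel)"
    by (rule nn_integral_mono) (auto simp: indicator_def haar_weight_def divide_le_eq_1 intro!: ennreal_leI)
  also have "\<dots> < \<infinity>" using emeasure_lborel_cball_finite[of "0::complex" 2] by simp
  finally show "(\<integral>\<^sup>+l. indicator ?A l * haar_weight l \<partial>lborel) < \<infinity>" .
  have "0 < ennreal (1/4) * emeasure lborel (ball (3/2) (1/2) :: complex set)"
    using content_ball_pos[of "1/2" "3/2 :: complex"]
    by (auto simp: ennreal_zero_less_mult_iff measure_def zero_less_iff_neq_zero)
  also have "\<dots> = (\<integral>\<^sup>+l. ennreal (1/4) * indicator (ball (3/2) (1/2) :: complex set) l \<partial>lborel)"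
    by (subst nn_integral_cmult_indicator) auto
  also have "\<dots> \<le> (\<integral>\<^sup>+l. indicator ?A l * haar_weight l \<partial>lborel)"
  proof (rule nn_integral_mono)
    fix l :: complex
    show "ennreal (1/4) * indicator (ball (3/2) (1/2)) l \<le> indicator ?A l * haar_weight l"
    proof (cases "l \<in> ball (3/2) (1/2)")
      case True
      then have d: "cmod (l - 3/2) < 1/2" by (simp add: dist_norm norm_minus_commute)
      have n: "cmod (3/2 :: complex) = 3/2" by simp
      have "1 \<le> cmod l" "cmod l \<le> 2"
        using d norm_triangle_ineq2[of "3/2" l] norm_triangle_ineq2[of l "3/2"] unfolding n by (simp_all add: norm_minus_commute)
      moreover from this have "(cmod l)\<^sup>2 \<le> 4" "0 < (cmod l)\<^sup>2" using power_mono[of "cmod l" 2 2] by auto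
      ultimately show ?thesis using True
        by (auto simp: indicator_def haar_weight_def field_simps intro!: ennreal_leI)
    qed simp
  qed
  finally show "0 < (\<integral>\<^sup>+l. indicator ?A l * haar_weight l \<partial>lborel)" .
qed

context surface_chart
begin

lemma borel_cc [measurable]: "cc k \<in> borel_measurable borel" "cs k \<in> borel_measurable borel"
  by (rule linear_borel[OF linear_cc], rule linear_borel[OF linear_cs])

lemma borel_m_comp [measurable]:
  assumes [measurable]: "u \<in> borel_measurable K" "v \<in> borel_measurable K"
  shows "(\<lambda>x. m (u x) (v x)) \<in> borel_measurable K"
  unfolding m_def by measurable

lemma borel_nf [measurable]: "nf \<in> borel_measurable borel"
  unfolding nf_def[abs_def] by measurable

lemma borel_M [measurable]: "M l \<in> borel_measurable borel"
  by (rule linear_borel[OF linear_M])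

lemma coords_eqI:
  assumes "\<And>i. i \<in> {1..g} \<Longrightarrow> cA i y = cA i z \<and> cB i y = cB i z"
    and "\<And>i. i \<in> {1..<g} \<Longrightarrow> cU i y = cU i z \<and> cV i y = cV i z"
  shows "y = z"
proof (rule prod_eqI)
  show "snd y = snd z" using assms(2)[of 1] genus by (simp add: cV_def)
  show "fst y = fst z"
  proof (rule cc_eqI)
    fix k assume k: "k < n"
    consider "k < g" | "g \<le> k" "k < 2 * g" | "2 * g \<le> k" "k < 3 * g - 1" | "3 * g - 1 \<le> k" by linarith
    then show "cc k (fst y) = cc k (fst z)"
    proof cases
      case 1
      then show ?thesis using assms(1)[of "k + 1"] by (simp add: cA_def)
    next
      case 2
      then show ?thesis using assms(1)[of "k - g + 1"] by (simp add: cB_def)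
    next
      case 3
      then have "k - 2 * g + 1 \<in> {1..<g}" "2 * g + (k - 2 * g + 1) - 1 = k" by auto
      then show ?thesis using assms(2)[of "k - 2 * g + 1"] unfolding cU_def by metis
    next
      case 4
      then have "k + 3 - 3 * g \<in> {1..<g}" "k + 3 - 3 * g \<noteq> 1" "3 * g + (k + 3 - 3 * g) - 3 = k"
        using k genus unfolding n_def by auto
      then show ?thesis using assms(2)[of "k + 3 - 3 * g"] unfolding cV_def by metis
    qed
  qed
qed

text \<open>Doubling of the fibre is conjugation by a scaling, so that it acts trivially on conjugacy
  classes.\<close>

lemma add_fibre_part: "z + fibre_part z = M 2 z"
proof (rule coords_eqI)
  fix i
  show "cA i (z + fibre_part z) = cA i (M 2 z) \<and> cB i (z + fibre_part z) = cB i (M 2 z)" if "i \<in> {1..g}"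
    using that by (simp add: coord_add fibre_part_coord M_coords)
  show "cU i (z + fibre_part z) = cU i (M 2 z) \<and> cV i (z + fibre_part z) = cV i (M 2 z)" if i: "i \<in> {1..<g}"
  proof -
    have "cU i (fibre_part z) = (\<Sum>j\<in>{1..<g}. if i = j then cU j z else 0)"
      unfolding fibre_part_def linear_sum_coord using UV_fibre[OF i] by (intro sum.cong) (auto simp: coord_add)
    moreover have "cV i (fibre_part z) = (\<Sum>j\<in>{1..<g}. if i = j then cV j z else 0)"
      unfolding fibre_part_def linear_sum_coord using UV_fibre[OF i] by (intro sum.cong) (auto simp: coord_add)
    ultimately show ?thesis using i by (simp add: coord_add M_coords)
  qed
qed

lemma M_basis:
  assumes "j \<in> Basis"
  shows "M 2 j = j \<or> M 2 j = 2 *\<^sub>R j"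
proof -
  consider i where "i < 2 * n" "j = (b i, 0)" | r where "j = (0, r)"
  proof -
    consider u where "u \<in> Basis" "j = (u, 0)" | r where "j = (0, r)"
      using assms by (auto simp: Basis_prod_def)
    then show thesis
    proof cases
      case 1
      have "2 * n = 8 * g - 6" by (simp add: n_def)
      then have "b ` {..<2 * n} = Basis" using b by (simp add: bij_betw_def)
      with 1(1) obtain i where "i < 2 * n" "u = b i" by (metis imageE lessThan_iff)
      with 1(2) show thesis by (intro that(1)) simp_all
    qed (rule that(2))
  qed
  then show ?thesis
  proof cases
    case 1
    have bs: "b (2 * k) = cs k 1" "b (2 * k + 1) = cs k \<i>" for k by (simp_all add: cs_def)
    have "\<exists>k r. k < n \<and> b i = cs k r"
    proof (cases "even i")
      case True
      with 1(1) have "i div 2 < n \<and> b i = cs (i div 2) 1" using bs(1)[of "i div 2"] by auto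
      then show ?thesis by blast
    next
      case False
      with 1(1) have "i div 2 < n \<and> b i = cs (i div 2) \<i>" using bs(2)[of "i div 2"] by auto
      then show ?thesis by blast
    qed
    then obtain k r where k: "k < n" "b i = cs k r" by blast
    have "m 2 (cs k r) = cs k (if k < 2 * g then r else 2 * r)"
      by (rule cc_eqI) (auto simp: cc_m cc_cs k)
    moreover have "cs k (2 * r) = 2 *\<^sub>R cs k r"
      using linear_scale[OF linear_cs, of k 2 r] by (simp add: scaleR_conv_of_real)
    ultimately show ?thesis by (simp add: M_def 1 k)
  next
    case 2
    then show ?thesis by (simp add: M_def linear_0[OF linear_m] scaleR_conv_of_real)
  qed
qed

text \<open>In the standard basis the scaling is diagonal with entries one and two.\<close>

lemma M2_scaling:
  obtains K :: real where "1 < K" "\<And>h. h \<in> borel_measurable borel \<Longrightarrow>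
     ennreal K * (\<integral>\<^sup>+z. h (M 2 z) \<partial>lborel) = (\<integral>\<^sup>+z. h z \<partial>lborel)"
proof -
  define c :: "'e \<times> complex \<Rightarrow> real" where "c j = (if M 2 j = j then 1 else 2)" for j
  have one: "(0, 1) \<in> (Basis :: ('e \<times> complex) set)" by (simp add: Basis_prod_def Basis_complex_def)
  have "M 2 (0, 1) \<noteq> (0, 1)" by (simp add: M_def)
  then have c1: "c (0, 1) = 2" by (simp add: c_def)
  have "(\<Prod>j\<in>Basis. \<bar>c j\<bar>) = \<bar>c (0, 1)\<bar> * (\<Prod>j\<in>Basis - {(0, 1)}. \<bar>c j\<bar>)"
    by (rule prod.remove[OF _ one]) simp
  moreover have "1 \<le> (\<Prod>j\<in>Basis - {(0, 1)}. \<bar>c j\<bar>)"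
    by (rule prod_ge_1) (simp add: c_def)
  ultimately have "1 < (\<Prod>j\<in>Basis. \<bar>c j\<bar>)" by (simp add: c1)
  moreover have "ennreal (\<Prod>j\<in>Basis. \<bar>c j\<bar>) * (\<integral>\<^sup>+z. h (M 2 z) \<partial>lborel) = (\<integral>\<^sup>+z. h z \<partial>lborel)"
    if "h \<in> borel_measurable borel" for h
    by (rule lborel_diagonal[OF linear_M _ _ that]) (use M_basis in \<open>auto simp: c_def\<close>)
  ultimately show thesis by (rule that)
qed

lemma contracting_M: "contracting (M l z) = contracting z"
  by (auto simp: contracting_def M_regular \<kappa>_def \<kappa>'_def M_coords)

lemma borel_ind [measurable]:
  assumes "twist_pair f f'"
  shows "ind f \<in> borel_measurable borel"
proof -
  note [measurable] = lebesgue_preservingD(1)[OF twist_pair_preserving[OF assms]]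
  show ?thesis unfolding ind_def[abs_def] by measurable
qed

text \<open>The product of the measure on the slice with the Haar measure of the scaling group is a measure
  on the model space that is invariant under scalings and under the twists, because a twist
  commutes with scalings. Its density with respect to Lebesgue measure is then invariant under the
  twists, while doubling the fibre multiplies Lebesgue measure by a constant; this contradicts the
  result on invariant densities.\<close>

theorem no_invariant_chart_measure:
  fixes \<nu> :: "'e measure"
  assumes sets_\<nu> [measurable_cong]: "sets \<nu> = sets borel"
    and ac: "absolutely_continuous lborel \<nu>"
    and conc: "emeasure \<nu> (- \<Omega>) = 0"
    and inv: "\<And>f f' B. twist_pair f f' \<Longrightarrow> B \<in> sets borel \<Longrightarrow> B \<subseteq> Dom f' \<Longrightarrow>
        emeasure \<nu> {p \<in> Dom f. ind f p \<in> B} = emeasure \<nu> B"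
    and P: "P \<in> sets borel" "\<And>p. p \<in> P \<Longrightarrow> contracting (p, 1)"
    and P_meas: "0 < emeasure \<nu> P" "emeasure \<nu> P < \<infinity>"
  shows False
proof -
  note [measurable] = P(1)
  define fib where "fib G p = (\<integral>\<^sup>+l. G (M l (p, 1)) * haar_weight l \<partial>lborel)" for G :: "'e \<times> complex \<Rightarrow> ennreal" and p
  define J where "J G = (\<integral>\<^sup>+p. fib G p \<partial>\<nu>)" for G :: "'e \<times> complex \<Rightarrow> ennreal"
  have M1: "M l (p, 1) = (m l p, l)" for l p by (simp add: M_def)
  have kernel [measurable]: "(\<lambda>x. G (M (snd x) (fst x, 1)) * haar_weight (snd x)) \<in> borel_measurable (borel \<Otimes>\<^sub>M borel)"
    if [measurable]: "G \<in> borel_measurable borel" for G :: "'e \<times> complex \<Rightarrow> ennreal"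
  proof -
    have "(\<lambda>x :: 'e \<times> complex. (m (snd x) (fst x), snd x)) \<in> borel_measurable borel"
      by (rule borel_measurable_Pair_euclidean) measurable
    then have [measurable]: "(\<lambda>x :: 'e \<times> complex. (m (snd x) (fst x), snd x)) \<in> borel_measurable (borel \<Otimes>\<^sub>M borel)"
      by (simp only: borel_prod)
    show ?thesis unfolding M1 by measurable
  qed
  have fib_borel [measurable]: "fib G \<in> borel_measurable borel"
    if [measurable]: "G \<in> borel_measurable borel" for G
  proof -
    have "(\<lambda>x. G (M (snd x) (fst x, 1)) * haar_weight (snd x)) \<in> borel_measurable (borel \<Otimes>\<^sub>M lborel)"
      using kernel[OF that] by (simp cong: measurable_cong_sets sets_pair_measure_cong)
    from lborel.borel_measurable_nn_integral_fst[OF this] show ?thesis by (simp add: fib_def[abs_def])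
  qed
  have fib_M: "fib (\<lambda>z. G (M q z)) p = fib G p" if "q \<noteq> 0" "G \<in> borel_measurable borel" for G q p
  proof -
    have [measurable]: "(\<lambda>l. G (M l (p, 1))) \<in> borel_measurable borel"
    proof -
      have "(\<lambda>l :: complex. (m l p, l)) \<in> borel_measurable borel"
        by (rule borel_measurable_Pair_euclidean) measurable
      from measurable_compose[OF this that(2)] show ?thesis by (simp add: M1)
    qed
    have "fib (\<lambda>z. G (M q z)) p = (\<integral>\<^sup>+l. G (M (q * l) (p, 1)) * haar_weight l \<partial>lborel)"
      by (simp add: fib_def M_M)
    also have "\<dots> = fib G p" unfolding fib_def by (rule haar_scaling[OF that(1), where h = "\<lambda>l. G (M l (p, 1))"]) measurable
    finally show ?thesis .
  qed
  have J_M: "J (\<lambda>z. G (M q z)) = J G" if "q \<noteq> 0" "G \<in> borel_measurable borel" for G q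
    unfolding J_def ext[of "fib (\<lambda>z. G (M q z))" "fib G", OF fib_M[OF that]] ..
  have \<Omega>_AE: "AE p in \<nu>. p \<in> \<Omega>"
    by (rule AE_I'[of "- \<Omega>"]) (use conc sets_\<nu> in \<open>auto simp: null_sets_def\<close>)
  have Dom_AE: "AE p in \<nu>. p \<in> Dom f" if f: "twist_pair f f'" for f f'
  proof -
    have "AE p in \<nu>. p \<notin> \<Omega> - Dom f"
      using Dom_conull[OF f] ac AE_not_in unfolding absolutely_continuous_def by blast
    with \<Omega>_AE show ?thesis by eventually_elim auto
  qed
  have J_f: "J (\<lambda>z. G (f z)) = J G" if f: "twist_pair f f'" and G [measurable]: "G \<in> borel_measurable borel" for f f' G
  proof -
    note f' = twist_pair_sym[OF f]
    note [measurable] = Dom_borel[OF f] Dom_borel[OF f'] borel_ind[OF f] lebesgue_preservingD(1)[OF twist_pair_preserving[OF f]]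
    have step: "fib (\<lambda>z. G (f z)) p = fib G (ind f p)" if p: "p \<in> Dom f" for p
    proof -
      define s where "s = snd (f (p, 1))"
      have s: "s \<noteq> 0" using p by (simp add: s_def Dom_def)
      have "f (p, 1) = M s (ind f p, 1)"
        using nf_eq[of "f (p, 1)"] s by (simp add: ind_def s_def M_M M_1)
      then have "f (M l (p, 1)) = M s (M l (ind f p, 1))" for l
        using twist_pair_M[OF f] by (simp add: M_M mult.commute)
      then have "fib (\<lambda>z. G (f z)) p = fib (\<lambda>z. G (M s z)) (ind f p)" by (simp add: fib_def)
      then show ?thesis using fib_M[OF s G] by simp
    qed
    have eq: "distr (density \<nu> (indicator (Dom f))) borel (ind f) = density \<nu> (indicator (Dom f'))"
    proof (rule measure_eqI)
      show "sets (distr (density \<nu> (indicator (Dom f))) borel (ind f)) = sets (density \<nu> (indicator (Dom f')))"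
        by (simp add: sets_\<nu>)
      fix A assume "A \<in> sets (distr (density \<nu> (indicator (Dom f))) borel (ind f))"
      then have A [measurable]: "A \<in> sets borel" by simp
      have D: "{p \<in> Dom f. ind f p \<in> A \<inter> Dom f'} = Dom f \<inter> ind f -` A" using ind_inverse[OF f] by auto
      have "emeasure (distr (density \<nu> (indicator (Dom f))) borel (ind f)) A = emeasure (density \<nu> (indicator (Dom f))) (ind f -` A)"
        by (subst emeasure_distr) (auto simp: sets_eq_imp_space_eq[OF sets_\<nu>])
      also have "\<dots> = emeasure \<nu> (Dom f \<inter> ind f -` A)"
        using measurable_sets[OF borel_ind[OF f] A] by (subst emeasure_density) (auto simp: sets_\<nu> indicator_inter_arith[symmetric])
      also have "\<dots> = emeasure \<nu> (A \<inter> Dom f')"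
        unfolding D[symmetric] by (rule inv[OF f]) auto
      also have "\<dots> = emeasure (density \<nu> (indicator (Dom f'))) A"
        by (subst emeasure_density) (auto simp: sets_\<nu> indicator_inter_arith[symmetric] Int_commute)
      finally show "emeasure (distr (density \<nu> (indicator (Dom f))) borel (ind f)) A = emeasure (density \<nu> (indicator (Dom f'))) A" .
    qed
    have "J (\<lambda>z. G (f z)) = (\<integral>\<^sup>+p. indicator (Dom f) p * fib G (ind f p) \<partial>\<nu>)"
      unfolding J_def using Dom_AE[OF f] by (intro nn_integral_cong_AE) (auto elim!: eventually_mono simp: step)
    also have "\<dots> = (\<integral>\<^sup>+q. fib G q \<partial>distr (density \<nu> (indicator (Dom f))) borel (ind f))"
      by (simp add: nn_integral_distr nn_integral_density)
    also have "\<dots> = (\<integral>\<^sup>+q. indicator (Dom f') q * fib G q \<partial>\<nu>)"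
      unfolding eq by (simp add: nn_integral_density)
    also have "\<dots> = J G"
      unfolding J_def using Dom_AE[OF f'] by (intro nn_integral_cong_AE) (auto elim!: eventually_mono)
    finally show ?thesis .
  qed
  define Nu where "Nu = distr (density (\<nu> \<Otimes>\<^sub>M lborel) (\<lambda>x. haar_weight (snd x))) borel (\<lambda>x. M (snd x) (fst x, 1))"
  have psi [measurable]: "(\<lambda>x. M (snd x) (fst x, 1)) \<in> measurable (\<nu> \<Otimes>\<^sub>M lborel) borel"
  proof -
    have "(\<lambda>x :: 'e \<times> complex. (m (snd x) (fst x), snd x)) \<in> borel_measurable borel"
      by (rule borel_measurable_Pair_euclidean) measurable
    moreover have "sets (\<nu> \<Otimes>\<^sub>M (lborel :: complex measure)) = sets borel"
      unfolding borel_prod[symmetric] by (rule sets_pair_measure_cong) (simp_all add: sets_\<nu>)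
    ultimately show ?thesis unfolding M1 by (simp cong: measurable_cong_sets)
  qed
  have Nu: "(\<integral>\<^sup>+z. G z \<partial>Nu) = J G" if [measurable]: "G \<in> borel_measurable borel" for G
  proof -
    have mb: "(\<lambda>x. haar_weight (snd x) * G (M (snd x) (fst x, 1))) \<in> borel_measurable (\<nu> \<Otimes>\<^sub>M lborel)"
      by measurable
    have "(\<integral>\<^sup>+z. G z \<partial>Nu) = (\<integral>\<^sup>+x. haar_weight (snd x) * G (M (snd x) (fst x, 1)) \<partial>(\<nu> \<Otimes>\<^sub>M lborel))"
      unfolding Nu_def by (simp add: nn_integral_distr nn_integral_density)
    also have "\<dots> = J G"
      unfolding lborel.nn_integral_fst[OF mb, symmetric] J_def fib_def by (simp add: mult.commute)
    finally show ?thesis .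
  qed
  have Nu_sets: "sets Nu = sets borel" by (simp add: Nu_def)
  have "absolutely_continuous lborel Nu"
    unfolding absolutely_continuous_def
  proof
    fix N :: "('e \<times> complex) set" assume N: "N \<in> null_sets lborel"
    then have [measurable]: "N \<in> sets borel" by (auto simp: null_sets_def)
    have "AE p in (lborel :: 'e measure). AE l in (lborel :: complex measure). (p, l) \<notin> N"
      using AE_not_in[OF N] by (intro lborel_pair.AE_pair) (simp only: lborel_prod)
    moreover have "{x \<in> space ((lborel :: 'e measure) \<Otimes>\<^sub>M (lborel :: complex measure)). (fst x, snd x) \<notin> N}
        \<in> sets ((lborel :: 'e measure) \<Otimes>\<^sub>M (lborel :: complex measure))"
      unfolding lborel_prod by simp
    ultimately have "AE l in (lborel :: complex measure). AE p in (lborel :: 'e measure). (p, l) \<notin> N"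
      by (subst (asm) lborel_pair.AE_commute)
    moreover have "AE l in (lborel :: complex measure). l \<noteq> 0" by (rule AE_lborel_singleton)
    ultimately have "AE l in (lborel :: complex measure). AE p in (lborel :: 'e measure). (m l p, l) \<notin> N"
    proof eventually_elim
      case (elim l)
      show ?case
        by (rule AE_linear_bijection[OF linear_m linear_m[of "1 / l"] _ _ elim(1)]) (use elim(2) in \<open>simp_all add: m_m m_1\<close>)
    qed
    moreover have "{x \<in> space ((lborel :: 'e measure) \<Otimes>\<^sub>M (lborel :: complex measure)). (m (snd x) (fst x), snd x) \<notin> N}
        \<in> sets ((lborel :: 'e measure) \<Otimes>\<^sub>M (lborel :: complex measure))"
    proof -
      have [measurable]: "(\<lambda>x :: 'e \<times> complex. (m (snd x) (fst x), snd x)) \<in> borel_measurable borel"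
        by (rule borel_measurable_Pair_euclidean) measurable
      show ?thesis unfolding lborel_prod by measurable
    qed
    ultimately have "AE p in (lborel :: 'e measure). AE l in (lborel :: complex measure). (m l p, l) \<notin> N"
      by (subst lborel_pair.AE_commute)
    then have "AE p in \<nu>. AE l in (lborel :: complex measure). (m l p, l) \<notin> N"
      by (intro absolutely_continuous_AE[OF _ ac]) (simp add: sets_\<nu>)
    then have "AE p in \<nu>. fib (indicator N) p = 0"
    proof eventually_elim
      case (elim p)
      then have "AE l in lborel. indicator N (M l (p, 1)) * haar_weight l = 0"
        by eventually_elim (simp add: M1)
      then show ?case unfolding fib_def by (subst nn_integral_cong_AE[where v = "\<lambda>_. 0"]) simp_all
    qed
    then have "J (indicator N) = 0" unfolding J_def by (subst nn_integral_cong_AE[where v = "\<lambda>_. 0"]) simp_all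
    then show "N \<in> null_sets Nu" using Nu[of "indicator N"] by (simp add: null_sets_def Nu_sets)
  qed
  then obtain F where F [measurable]: "F \<in> borel_measurable borel" and dens: "density lborel F = Nu"
    using sigma_finite_measure.Radon_Nikodym[OF sigma_finite_lborel, of Nu] Nu_sets by auto
  have JF: "(\<integral>\<^sup>+z. F z * G z \<partial>lborel) = J G" if [measurable]: "G \<in> borel_measurable borel" for G
    unfolding Nu[OF that, symmetric] dens[symmetric] by (simp add: nn_integral_density)
  have unique: "AE z in lborel. F' z = F z"
    if [measurable]: "F' \<in> borel_measurable borel"
      and eq: "\<And>A. A \<in> sets borel \<Longrightarrow> (\<integral>\<^sup>+z. F' z * indicator A z \<partial>lborel) = J (indicator A)" for F'
  proof (rule sigma_finite_measure.density_unique[OF sigma_finite_lborel])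
    show "density lborel F' = density lborel F"
      by (rule measure_eqI) (simp_all add: emeasure_density eq JF)
  qed simp_all
  have inv_f: "AE z in lborel. F (f z) = F z" if f: "twist_pair f f'" for f f'
  proof (rule unique)
    note f' = twist_pair_sym[OF f]
    note [measurable] = lebesgue_preservingD(1)[OF twist_pair_preserving[OF f]] lebesgue_preservingD(1)[OF twist_pair_preserving[OF f']]
    show "(\<lambda>z. F (f z)) \<in> borel_measurable borel" by measurable
    fix A :: "('e \<times> complex) set" assume [measurable]: "A \<in> sets borel"
    have "(\<integral>\<^sup>+z. F (f z) * indicator A z \<partial>lborel) = (\<integral>\<^sup>+z. F (f z) * indicator A (f' (f z)) \<partial>lborel)"
      by (simp add: twist_pair_inverse[OF f])
    also have "\<dots> = (\<integral>\<^sup>+z. F z * indicator A (f' z) \<partial>lborel)"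
      by (rule lebesgue_preservingD(2)[OF twist_pair_preserving[OF f], where h = "\<lambda>z. F z * indicator A (f' z)"]) measurable
    also have "\<dots> = J (indicator A)"
      by (simp add: JF J_f[OF f'])
    finally show "(\<integral>\<^sup>+z. F (f z) * indicator A z \<partial>lborel) = J (indicator A)" .
  qed
  obtain K :: real where K: "1 < K" "\<And>h. h \<in> borel_measurable borel \<Longrightarrow>
     ennreal K * (\<integral>\<^sup>+z. h (M 2 z) \<partial>lborel) = (\<integral>\<^sup>+z. h z \<partial>lborel)"
    using M2_scaling by blast
  have scal: "AE z in lborel. ennreal K * F (z + fibre_part z) = F z"
  proof (rule unique)
    show "(\<lambda>z. ennreal K * F (z + fibre_part z)) \<in> borel_measurable borel" by measurable
    fix A :: "('e \<times> complex) set" assume [measurable]: "A \<in> sets borel"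
    have "(\<integral>\<^sup>+z. ennreal K * F (z + fibre_part z) * indicator A z \<partial>lborel)
        = (\<integral>\<^sup>+z. ennreal K * (F (M 2 z) * indicator A (M (1 / 2) (M 2 z))) \<partial>lborel)"
      by (simp add: add_fibre_part M_M M_1 mult.assoc)
    also have "\<dots> = ennreal K * (\<integral>\<^sup>+z. F (M 2 z) * indicator A (M (1 / 2) (M 2 z)) \<partial>lborel)"
      by (rule nn_integral_cmult) measurable
    also have "\<dots> = (\<integral>\<^sup>+z. F z * indicator A (M (1 / 2) z) \<partial>lborel)"
      by (rule K(2)[of "\<lambda>z. F z * indicator A (M (1 / 2) z)"]) measurable
    also have "\<dots> = J (indicator A)" by (simp add: JF J_M)
    finally show "(\<integral>\<^sup>+z. ennreal K * F (z + fibre_part z) * indicator A z \<partial>lborel) = J (indicator A)" .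
  qed
  let ?R = "{l :: complex. 1 \<le> cmod l \<and> cmod l \<le> 2}"
  define C where "C = {z. nf z \<in> P \<and> snd z \<in> ?R}"
  have C [measurable]: "C \<in> sets borel" unfolding C_def by measurable
  have contr: "contracting z" if "z \<in> C" for z
  proof -
    have "snd z \<noteq> 0" using that by (auto simp: C_def)
    moreover have "contracting (nf z, 1)" using that P(2) by (simp add: C_def)
    ultimately show ?thesis using contracting_M[of "1 / snd z" z] by (simp add: nf_eq)
  qed
  have fibC: "fib (indicator C) p = indicator P p * (\<integral>\<^sup>+l. indicator ?R l * haar_weight l \<partial>lborel)" for p
  proof -
    have "indicator C (M l (p, 1)) = indicator P p * (indicator ?R l :: ennreal)" for l
    proof (cases "l = 0")
      case False
      then show ?thesis using nf_M[OF False, of "(p, 1)"] by (auto simp: C_def M1 indicator_def nf_def m_1)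
    qed (simp add: C_def M1)
    then show ?thesis unfolding fib_def by (simp add: mult.assoc nn_integral_cmult)
  qed
  then have "J (indicator C) = emeasure \<nu> P * (\<integral>\<^sup>+l. indicator ?R l * haar_weight l \<partial>lborel)"
    unfolding J_def ext[of "fib (indicator C)", OF fibC] by (subst nn_integral_multc) (simp_all add: sets_\<nu>)
  then have "(\<integral>\<^sup>+z. F z * indicator C z \<partial>lborel) = emeasure \<nu> P * (\<integral>\<^sup>+l. indicator ?R l * haar_weight l \<partial>lborel)"
    by (simp add: JF)
  moreover have "(\<integral>\<^sup>+z. F z * indicator C z \<partial>lborel) \<in> {0, \<infinity>}"
  proof (rule no_twist_invariant_density[OF F _ _ scal _ _ C contr])
    fix i assume i: "i \<in> {1..<g}"
    show "AE z in lborel. F (twist i 1 z) = F z" "AE z in lborel. F (twist' i 1 z) = F z"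
      using twist_pair_twist[OF i] inv_f by blast+
  qed (use K(1) in \<open>simp_all add: ennreal_less_top\<close>)
  ultimately show False
    using P_meas haar_annulus by (auto simp: ennreal_mult_eq_top_iff)
qed

end

section \<open>Measures in the Lebesgue class\<close>

context surface_chart
begin

definition contracting_region :: "'e set" where
  "contracting_region = {p \<in> \<Omega>. contracting (p, 1)}"

lemma open_contracting_region: "open contracting_region"
proof -
  have c: "continuous_on UNIV (\<lambda>p. cB i (p, 1))" for i
    unfolding cB_def fst_conv
    using linear_continuous_on[OF linear_conv_bounded_linear[THEN iffD1, OF linear_cc]] by auto
  have "contracting_region = \<Omega> \<inter> (\<Inter>i\<in>{1..<g}. {p. cmod ((1 - cB i (p, 1))\<^sup>2 * (1 - cB (Suc i) (p, 1))\<^sup>2)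
      < cmod (cB i (p, 1) * cB (Suc i) (p, 1))})" (is "_ = _ \<inter> ?X")
  proof -
    have "contracting (p, 1) \<longleftrightarrow> p \<in> ?X" if p: "p \<in> \<Omega>" for p
    proof -
      have r: "regular (p, 1)" using p by (simp add: \<Omega>_def admissible_def)
      have "cmod (\<kappa> i (p, 1) * \<kappa>' i (p, 1)) < 1 \<longleftrightarrow> cmod ((1 - cB i (p, 1))\<^sup>2 * (1 - cB (Suc i) (p, 1))\<^sup>2)
          < cmod (cB i (p, 1) * cB (Suc i) (p, 1))" if i: "i \<in> {1..<g}" for i
      proof -
        have nz: "cB i (p, 1) * cB (Suc i) (p, 1) \<noteq> 0" using r i by (auto simp: regular_def)
        have "\<kappa> i (p, 1) * \<kappa>' i (p, 1) = - (((1 - cB i (p, 1))\<^sup>2 * (1 - cB (Suc i) (p, 1))\<^sup>2) / (cB i (p, 1) * cB (Suc i) (p, 1)))"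
          by (simp add: \<kappa>_def \<kappa>'_def power2_eq_square)
        then have "cmod (\<kappa> i (p, 1) * \<kappa>' i (p, 1)) = cmod ((1 - cB i (p, 1))\<^sup>2 * (1 - cB (Suc i) (p, 1))\<^sup>2) / cmod (cB i (p, 1) * cB (Suc i) (p, 1))"
          by (simp only: norm_minus_cancel norm_divide)
        moreover have "0 < cmod (cB i (p, 1) * cB (Suc i) (p, 1))" using nz by (simp only: zero_less_norm_iff) simp
        ultimately show ?thesis by (simp only: divide_less_eq_1_pos)
      qed
      then show ?thesis using r by (auto simp: contracting_def)
    qed
    then show ?thesis by (auto simp: contracting_region_def)
  qed
  also have "open \<dots>"
    by (intro open_Int open_\<Omega> open_INT finite_atLeastLessThan ballI open_Collect_less continuous_intros c)
  finally show ?thesis .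
qed

text \<open>All linear parts of the first kind equal to one and all of the second kind equal to one half.\<close>

lemma contracting_region_nonempty: "contracting_region \<noteq> {}"
proof -
  define p where "p = (\<Sum>k<n. cs k (if k < g then 1 else 1 / 2))"
  have A: "cA i (p, 1) = 1" "cB i (p, 1) = 1 / 2" if "i \<in> {1..g}" for i
  proof -
    have "i - 1 < n" "g + i - 1 < n" "i - 1 < g" "\<not> g + i - 1 < g" using that genus by (auto simp: n_def)
    then show "cA i (p, 1) = 1" "cB i (p, 1) = 1 / 2"
      unfolding cA_def cB_def p_def fst_conv by (simp_all only: cc_sum if_True if_False)
  qed
  have "regular (p, 1)" by (auto simp: A regular_def)
  then have "p \<in> contracting_region"
    by (auto simp: A contracting_region_def \<Omega>_def admissible_def contracting_def \<kappa>_def \<kappa>'_def norm_mult)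
  then show ?thesis by blast
qed

lemma contracting_region_not_null: "contracting_region \<notin> null_sets lborel"
proof
  assume "contracting_region \<in> null_sets lborel"
  then have "negligible contracting_region" by (simp add: negligible_iff_null_sets null_sets_completionI)
  then show False using open_not_negligible[OF open_contracting_region contracting_region_nonempty] by blast
qed

text \<open>A countable cover by sets of finite measure supplies a subset of the contracting region with
  finite positive measure.\<close>

lemma no_invariant_covered_measure:
  fixes \<nu> :: "'e measure" and X :: "nat \<Rightarrow> 'e set"
  assumes \<nu>: "sets \<nu> = sets borel" "absolutely_continuous lborel \<nu>" "emeasure \<nu> (- \<Omega>) = 0"
    and inv: "\<And>f f' B. twist_pair f f' \<Longrightarrow> B \<in> sets borel \<Longrightarrow> B \<subseteq> Dom f' \<Longrightarrow>
        emeasure \<nu> {p \<in> Dom f. ind f p \<in> B} = emeasure \<nu> B"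
    and X: "\<And>i. X i \<in> sets borel" "\<And>i. emeasure \<nu> (X i) \<noteq> \<infinity>" "contracting_region \<subseteq> (\<Union>i. X i)"
    and pos: "emeasure \<nu> contracting_region \<noteq> 0"
  shows False
proof -
  have C: "contracting_region \<in> sets borel" using open_contracting_region by simp
  have "\<exists>i. emeasure \<nu> (contracting_region \<inter> X i) \<noteq> 0"
  proof (rule ccontr)
    assume "\<not> ?thesis"
    then have "(\<Union>i. contracting_region \<inter> X i) \<in> null_sets \<nu>"
      using C X(1) \<nu>(1) by (intro null_sets_UN') (auto simp: null_sets_def)
    moreover have "(\<Union>i. contracting_region \<inter> X i) = contracting_region" using X(3) by auto
    ultimately show False using pos by (simp add: null_sets_def)
  qed
  then obtain i where i: "emeasure \<nu> (contracting_region \<inter> X i) \<noteq> 0" by blast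
  have "emeasure \<nu> (contracting_region \<inter> X i) \<le> emeasure \<nu> (X i)"
    using X(1) \<nu>(1) by (intro emeasure_mono) auto
  then have "emeasure \<nu> (contracting_region \<inter> X i) < \<infinity>" using X(2)[of i] by (simp add: top.not_eq_extremum order.strict_trans1)
  show False
  proof (rule no_invariant_chart_measure[OF \<nu>, where P = "contracting_region \<inter> X i"])
    show "emeasure \<nu> {p \<in> Dom f. ind f p \<in> B} = emeasure \<nu> B"
      if "twist_pair f f'" "B \<in> sets borel" "B \<subseteq> Dom f'" for f f' B by (rule inv[OF that])
    show "contracting_region \<inter> X i \<in> sets borel" using C X(1) by simp
    show "contracting (p, 1)" if "p \<in> contracting_region \<inter> X i" for p
      using that by (simp add: contracting_region_def)
    show "0 < emeasure \<nu> (contracting_region \<inter> X i)" by (rule zero_less_iff_neq_zero[THEN iffD2, OF i])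
  qed fact
qed

text \<open>The measure is transported to the slice by the chart.\<close>

theorem no_invariant_lebesgue_class_measure:
  assumes \<mu>: "in_lebesgue_class (char_var g) Atlas \<mu>"
    and \<xi>: "fundamental_class (surface_group g) \<xi>"
    and inv: "\<And>F. F \<in> carrier (mapping_class_group g \<xi>) \<Longrightarrow> invariant_measure \<mu> (mcg_action g F)"
  shows False
proof -
  have sets_\<mu>: "sets \<mu> = sets (atlas_borel (char_var g) Atlas)"
    and null: "\<And>N. N \<in> sets \<mu> \<Longrightarrow> emeasure \<mu> N = 0 \<longleftrightarrow> lebesgue_null (char_var g) Atlas N"
    and sf: "sigma_finite_measure \<mu>"
    using \<mu> by (auto simp: in_lebesgue_class_def)
  have space_\<mu>: "space \<mu> = char_var g" using sets_eq_imp_space_eq[OF sets_\<mu>] by (simp add: sets_atlas_borel)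
  have img: "pt ` (B \<inter> \<Omega>) \<in> sets \<mu>" if "B \<in> sets borel" for B
    unfolding sets_\<mu> by (rule pt_image_borel[OF that])
  have U0: "U0 \<in> sets \<mu>" using img[of UNIV] by (simp add: U0_def)
  have pre: "\<phi> -` B \<inter> U0 = pt ` (B \<inter> \<Omega>)" for B by (auto simp: U0_def)
  have \<phi>: "\<phi> \<in> measurable (restrict_space \<mu> U0) borel"
    by (rule measurableI) (auto simp: space_restrict_space sets_restrict_space_iff U0 space_\<mu> U0_char_var Int_absorb2 pre img pt_in_U0)
  define \<nu> where "\<nu> = distr (restrict_space \<mu> U0) borel \<phi>"
  have \<nu>: "emeasure \<nu> B = emeasure \<mu> (pt ` (B \<inter> \<Omega>))" if "B \<in> sets borel" for B
  proof -
    have "emeasure \<nu> B = emeasure (restrict_space \<mu> U0) (\<phi> -` B \<inter> U0)"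
      unfolding \<nu>_def using that \<phi> U0_char_var
      by (subst emeasure_distr) (auto simp: space_restrict_space space_\<mu> Int_absorb1 Int_absorb2)
    also have "\<dots> = emeasure \<mu> (pt ` (B \<inter> \<Omega>))"
      unfolding pre
    proof (rule emeasure_restrict_space)
      have "U0 \<inter> space \<mu> = U0" using U0_char_var space_\<mu> by auto
      then show "U0 \<inter> space \<mu> \<in> sets \<mu>" using U0 by simp
      show "pt ` (B \<inter> \<Omega>) \<subseteq> U0" by (auto simp: U0_def)
    qed
    finally show ?thesis .
  qed
  have zero: "emeasure \<nu> B = 0 \<longleftrightarrow> negligible (B \<inter> \<Omega>)" if "B \<in> sets borel" for B
    unfolding \<nu>[OF that] null[OF img[OF that]] by (rule lebesgue_null_pt_iff) auto
  obtain X :: "nat \<Rightarrow> surface_rep set set" where X: "range X \<subseteq> sets \<mu>" "(\<Union>i. X i) = space \<mu>" "\<And>i. emeasure \<mu> (X i) \<noteq> \<infinity>"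
    using sigma_finite_measure.sigma_finite[OF sf] by metis
  have Xi: "{p \<in> \<Omega>. pt p \<in> X i} \<in> sets borel" for i
    by (rule pt_preimage_borel) (use X(1) sets_\<mu> in auto)
  show False
  proof (rule no_invariant_covered_measure[of \<nu> "\<lambda>i. {p \<in> \<Omega>. pt p \<in> X i}"])
    show "sets \<nu> = sets borel" by (simp add: \<nu>_def)
    show "absolutely_continuous lborel \<nu>"
      unfolding absolutely_continuous_def
    proof
      fix N :: "'e set" assume N: "N \<in> null_sets lborel"
      then have "negligible N" by (simp add: negligible_iff_null_sets null_sets_completionI)
      then have "negligible (N \<inter> \<Omega>)" by (rule negligible_subset) simp
      moreover have "N \<in> sets borel" using N by (simp add: null_sets_def)
      ultimately show "N \<in> null_sets \<nu>" using zero[of N] by (simp add: null_sets_def \<nu>_def)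
    qed
    show "emeasure \<nu> (- \<Omega>) = 0" using \<nu>[of "- \<Omega>"] open_\<Omega> by simp
    show "emeasure \<nu> {p \<in> Dom f. ind f p \<in> B} = emeasure \<nu> B"
      if f: "twist_pair f f'" and B: "B \<in> sets borel" "B \<subseteq> Dom f'" for f f' B
    proof -
      obtain F where F: "F \<in> carrier (mapping_class_group g \<xi>)"
        "mcg_action g F -` (pt ` B) \<inter> char_var g = pt ` {p \<in> Dom f. ind f p \<in> B}"
      proof (rule twist_pair_action[OF f \<xi>])
        fix F assume F: "F \<in> carrier (mapping_class_group g \<xi>)"
          "\<And>B. B \<subseteq> Dom f' \<Longrightarrow> mcg_action g F -` (pt ` B) \<inter> char_var g = pt ` {p \<in> Dom f. ind f p \<in> B}"
        show thesis by (rule that[OF F(1) F(2)[OF B(2)]])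
      qed
      have B': "B \<inter> \<Omega> = B" "{p \<in> Dom f. ind f p \<in> B} \<inter> \<Omega> = {p \<in> Dom f. ind f p \<in> B}"
        using B(2) by (auto simp: Dom_def)
      have m: "{p \<in> Dom f. ind f p \<in> B} \<in> sets borel"
      proof -
        have "{p \<in> Dom f. ind f p \<in> B} = Dom f \<inter> (ind f -` B \<inter> space borel)" by auto
        then show ?thesis using Dom_borel[OF f] measurable_sets[OF borel_ind[OF f] B(1)] by simp
      qed
      have "emeasure \<mu> (mcg_action g F -` (pt ` B) \<inter> space \<mu>) = emeasure \<mu> (pt ` B)"
        using inv[OF F(1)] img[OF B(1)] by (simp add: invariant_measure_def B')
      then show ?thesis unfolding space_\<mu> F(2) using \<nu>[OF m] \<nu>[OF B(1)] by (simp add: B')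
    qed
    show "{p \<in> \<Omega>. pt p \<in> X i} \<in> sets borel" for i by (rule Xi)
    show "emeasure \<nu> {p \<in> \<Omega>. pt p \<in> X i} \<noteq> \<infinity>" for i
    proof -
      have "emeasure \<nu> {p \<in> \<Omega>. pt p \<in> X i} \<le> emeasure \<mu> (X i)"
        unfolding \<nu>[OF Xi] using X(1) by (intro emeasure_mono) auto
      then show ?thesis using X(3)[of i] by (auto simp: top_unique)
    qed
    show "contracting_region \<subseteq> (\<Union>i. {p \<in> \<Omega>. pt p \<in> X i})"
    proof
      fix p assume "p \<in> contracting_region"
      then have p: "p \<in> \<Omega>" by (simp add: contracting_region_def)
      then have "pt p \<in> (\<Union>i. X i)" using pt_in_U0[OF p] U0_char_var X(2) space_\<mu> by auto
      then show "p \<in> (\<Union>i. {p \<in> \<Omega>. pt p \<in> X i})" using p by auto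
    qed
    have "contracting_region \<inter> \<Omega> = contracting_region" by (auto simp: contracting_region_def)
    then show "emeasure \<nu> contracting_region \<noteq> 0"
      using zero[of contracting_region] open_contracting_region
        open_not_negligible[OF open_contracting_region contracting_region_nonempty] by simp
  qed
qed

end

section \<open>Symplectic forms\<close>

context surface_chart
begin

lemma smooth_slice_twist:
  assumes i: "i \<in> {1..<g}"
  shows "smooth_on \<Omega> (\<lambda>p. twist i r (p, 1))" "smooth_on \<Omega> (\<lambda>p. twist' i r (p, 1))"
proof -
  note s = smooth_on_intros[OF open_\<Omega>] smooth_on_mult_intros[OF open_\<Omega>]
  have i': "Suc i \<in> {1..g}" using i by auto
  have reg: "regular (p, 1)" if "p \<in> \<Omega>" for p using that by (simp add: \<Omega>_def admissible_def)
  have nz: "cB i (p, 1) \<noteq> 0" "cB (Suc i) (p, 1) \<noteq> 0" if "p \<in> \<Omega>" for p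
    using reg[OF that] i by (auto simp: regular_def)
  have bl: "bounded_linear (dU k)" "bounded_linear (dV k)" for k
    using lin(5,6) linear_conv_bounded_linear by blast+
  have "bounded_linear (\<lambda>p :: 'e. (p, 0 :: complex))"
    by (intro bounded_linear_Pair bounded_linear_ident bounded_linear_zero)
  from s(4)[OF s(2)[OF this] s(1)[of "(0, 1)"]]
  have pair: "smooth_on \<Omega> (\<lambda>p. (p, 1 :: complex))" by simp
  have t: "smooth_on \<Omega> (\<lambda>p. t i (p, 1))"
    unfolding t_def by (intro s(4,5,7) s(1) smooth_slice_coords)
  have t': "smooth_on \<Omega> (\<lambda>p. t' i (p, 1))"
    unfolding t'_def by (intro s(4,5,7,8) s(1) t smooth_slice_coords smooth_slice_UVf[OF i'] nz)
  have V: "smooth_on \<Omega> (\<lambda>p. V i (p, 1))" if "V = cV" for V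
    using smooth_slice_coords(4) that by simp
  have "smooth_on \<Omega> (\<lambda>p. (p, 1) + E i (p, 1) (r * t i (p, 1)))"
    unfolding E_def by (intro s(4) pair s(3)[OF bl(1)] s(3)[OF bl(2)] s(5,7) s(1) t smooth_slice_coords)
  then show "smooth_on \<Omega> (\<lambda>p. twist i r (p, 1))"
    by (rule smooth_on_cong[OF open_\<Omega>, rotated]) (simp add: twist_def reg)
  have last: "smooth_on \<Omega> (\<lambda>p. if Suc i < g then dU (Suc i) (r * t' i (p, 1) * ((1 - cB i (p, 1)) / cB (Suc i) (p, 1))) else 0)"
  proof (cases "Suc i < g")
    case True
    have "smooth_on \<Omega> (\<lambda>p. dU (Suc i) (r * t' i (p, 1) * ((1 - cB i (p, 1)) / cB (Suc i) (p, 1))))"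
      by (intro s(3)[OF bl(1)] s(5,7,8) s(1) t' smooth_slice_coords nz)
    then show ?thesis using True by simp
  qed (simp add: s(1))
  have "smooth_on \<Omega> (\<lambda>p. (p, 1) + E' i (p, 1) (r * t' i (p, 1)))"
    unfolding E'_def by (intro s(4) pair last s(3)[OF bl(1)] s(3)[OF bl(2)] s(5,7,8) s(1) t' smooth_slice_coords nz)
  then show "smooth_on \<Omega> (\<lambda>p. twist' i r (p, 1))"
    by (rule smooth_on_cong[OF open_\<Omega>, rotated]) (simp add: twist'_def reg)
qed

text \<open>The induced map is given by rational functions of the coordinates.\<close>

lemma smooth_ind:
  assumes f: "twist_pair f f'"
  shows "open (Dom f)" "smooth_on (Dom f) (ind f)"
proof -
  have sm: "smooth_on \<Omega> (\<lambda>p. f (p, 1))"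
    using f smooth_slice_twist unfolding twist_pair_def by blast
  have "continuous_on \<Omega> (\<lambda>p. snd (f (p, 1)))"
    by (intro continuous_on_snd smooth_on_imp_continuous_on[OF sm])
  then have "open (\<Omega> \<inter> (\<lambda>p. snd (f (p, 1))) -` (- {0}))"
    by (rule continuous_open_preimage[OF _ open_\<Omega>]) auto
  moreover have "\<Omega> \<inter> (\<lambda>p. snd (f (p, 1))) -` (- {0}) = Dom f" by (auto simp: Dom_def)
  ultimately show op: "open (Dom f)" by simp
  note s = smooth_on_intros[OF op] smooth_on_mult_intros[OF op]
  have F: "smooth_on (Dom f) (\<lambda>p. f (p, 1))" by (rule smooth_on_subset[OF sm]) (auto simp: Dom_def)
  have c: "smooth_on (Dom f) (\<lambda>p. cc k (fst (f (p, 1))))" for k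
    by (intro s(3)[OF bounded_linear_cc] s(3)[OF bounded_linear_fst] F)
  have q: "smooth_on (Dom f) (\<lambda>p. 1 / snd (f (p, 1)))"
    by (intro s(8) s(1) s(3)[OF bounded_linear_snd] F) (simp add: Dom_def)
  have "smooth_on (Dom f) (\<lambda>p. if k < 2 * g then cc k (fst (f (p, 1))) else 1 / snd (f (p, 1)) * cc k (fst (f (p, 1))))" for k
    using c s(7)[OF q c] by (cases "k < 2 * g") auto
  then show "smooth_on (Dom f) (ind f)"
    unfolding ind_def[abs_def] nf_def m_def by (intro s(6) s(3)[OF bounded_linear_cs]) auto
qed

lemma ind_derivative:
  assumes f: "twist_pair f f'" and p: "p \<in> Dom f"
  shows "(ind f has_derivative frechet_derivative (ind f) (at p)) (at p)"
  using smooth_on_imp_differentiable[OF smooth_ind(2)[OF f] p] by (simp add: frechet_derivative_works)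

lemma ind_derivative_inverse:
  assumes f: "twist_pair f f'" and y: "y \<in> Dom f'"
  shows "frechet_derivative (ind f') (at y) \<circ> frechet_derivative (ind f) (at (ind f' y)) = id"
proof -
  note f' = twist_pair_sym[OF f]
  define x where "x = ind f' y"
  have x: "x \<in> Dom f" "ind f x = y" using ind_inverse[OF f' y] by (simp_all add: x_def)
  have "(ind f' \<circ> ind f has_derivative frechet_derivative (ind f') (at y) \<circ> frechet_derivative (ind f) (at x)) (at x)"
    by (rule diff_chain_at[OF ind_derivative[OF f x(1)]]) (use ind_derivative[OF f' y] in \<open>simp add: x(2)\<close>)
  moreover have "(ind f' \<circ> ind f has_derivative id) (at x)"
    by (rule has_derivative_transform_within_open[OF has_derivative_id smooth_ind(1)[OF f] x(1)])
       (simp add: ind_inverse(2)[OF f])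
  ultimately show ?thesis unfolding x_def by (rule has_derivative_unique)
qed

text \<open>The volume that the form defines on the slice has a positive continuous density, and it is
  invariant under the maps induced by the twists.\<close>

theorem no_invariant_symplectic_form:
  assumes \<omega>: "symplectic_form Atlas \<omega>"
    and \<xi>: "fundamental_class (surface_group g) \<xi>"
    and pres: "\<And>F. F \<in> carrier (mapping_class_group g \<xi>) \<Longrightarrow> preserves_form Atlas \<omega> (mcg_action g F)"
  shows False
proof -
  define W where "W x = \<omega> (U0, \<phi>) x" for x
  have two: "\<forall>(U, \<phi>)\<in>Atlas. (\<forall>x\<in>\<phi> ` U. bilinear (\<omega> (U, \<phi>) x) \<and> (\<forall>v. \<omega> (U, \<phi>) x v v = 0)) \<and>
        (\<forall>v w. smooth_on (\<phi> ` U) (\<lambda>x. \<omega> (U, \<phi>) x v w))"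
    and nond: "\<forall>(U, \<phi>)\<in>Atlas. \<forall>x\<in>\<phi> ` U. \<forall>v. v \<noteq> 0 \<longrightarrow> (\<exists>w. \<omega> (U, \<phi>) x v w \<noteq> 0)"
    using \<omega> unfolding symplectic_form_def two_form_def nondegenerate_form_def by simp_all
  note two0 = bspec[OF two chart_in_atlas, unfolded prod.case \<phi>_U0]
  have bil: "bilinear (W x)" if "x \<in> \<Omega>" for x
    using two0 that unfolding W_def by blast
  have sm: "smooth_on \<Omega> (\<lambda>x. W x v w)" for v w
    using two0 unfolding W_def by blast
  have nd: "\<exists>w. W x v w \<noteq> 0" if "x \<in> \<Omega>" "v \<noteq> 0" for x v
    using bspec[OF nond chart_in_atlas, unfolded prod.case \<phi>_U0] that unfolding W_def by blast
  define f where "f x = indicator \<Omega> x *\<^sub>R sqrt \<bar>gram_det (W x)\<bar>" for x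
  have "continuous_on \<Omega> (\<lambda>x. gram_det (W x))"
    by (rule continuous_on_gram_det) (rule smooth_on_imp_continuous_on[OF sm])
  then have "continuous_on \<Omega> (\<lambda>x. sqrt \<bar>gram_det (W x)\<bar>)"
    by (intro continuous_intros)
  then have f [measurable]: "f \<in> borel_measurable borel"
    unfolding f_def[abs_def] by (rule borel_measurable_continuous_on_indicator[OF borel_Omega])
  have f0: "0 \<le> f x" for x by (simp add: f_def)
  have f_eq: "f x = sqrt \<bar>gram_det (W x)\<bar>" if "x \<in> \<Omega>" for x using that by (simp add: f_def)
  have f_pos: "0 < f x" if "x \<in> \<Omega>" for x
    using gram_det_nonzero[OF bil[OF that] nd[OF that]] f_eq[OF that] by simp
  define \<nu> where "\<nu> = density lborel (\<lambda>x. ennreal (f x))"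
  have \<nu>: "emeasure \<nu> B = (\<integral>\<^sup>+x. ennreal (f x) * indicator B x \<partial>lborel)" if "B \<in> sets borel" for B
    unfolding \<nu>_def using that by (subst emeasure_density) auto
  have "sigma_finite_measure \<nu>"
    unfolding \<nu>_def by (subst sigma_finite_measure.sigma_finite_iff_density_finite[OF sigma_finite_lborel]) auto
  then obtain X :: "nat \<Rightarrow> 'e set" where X: "range X \<subseteq> sets \<nu>" "(\<Union>i. X i) = space \<nu>" "\<And>i. emeasure \<nu> (X i) \<noteq> \<infinity>"
    using sigma_finite_measure.sigma_finite by metis
  show False
  proof (rule no_invariant_covered_measure[of \<nu> X])
    show "sets \<nu> = sets borel" by (simp add: \<nu>_def)
    show "absolutely_continuous lborel \<nu>" unfolding \<nu>_def by (rule absolutely_continuousI_density) simp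
    have "emeasure \<nu> (- \<Omega>) = (\<integral>\<^sup>+x. ennreal (f x) * indicator (- \<Omega>) x \<partial>lborel)"
      by (rule \<nu>) (use open_\<Omega> in simp)
    also have "\<dots> = (\<integral>\<^sup>+x. 0 \<partial>(lborel :: 'e measure))"
      by (rule nn_integral_cong) (simp add: f_def indicator_def)
    finally show "emeasure \<nu> (- \<Omega>) = 0" by simp
    show "X i \<in> sets borel" for i using X(1) by (auto simp: \<nu>_def)
    show "emeasure \<nu> (X i) \<noteq> \<infinity>" for i by (rule X(3))
    show "contracting_region \<subseteq> (\<Union>i. X i)" using X(2) by (simp add: \<nu>_def)
    show "emeasure \<nu> contracting_region \<noteq> 0"
    proof
      assume 0: "emeasure \<nu> contracting_region = 0"
      have C [measurable]: "contracting_region \<in> sets borel" using open_contracting_region by simp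
      have "AE x in lborel. ennreal (f x) * indicator contracting_region x = 0"
        using 0 unfolding \<nu>[OF C] by (subst (asm) nn_integral_0_iff_AE) measurable
      then have "AE x in lborel. x \<notin> contracting_region"
      proof eventually_elim
        case (elim x)
        have "x \<in> \<Omega>" if "x \<in> contracting_region" using that by (simp add: contracting_region_def)
        then show ?case using elim f_pos[of x] by (auto simp: indicator_def)
      qed
      then show False
        using contracting_region_not_null C by (simp add: AE_iff_null_sets[of _ lborel, simplified])
    qed
    show "emeasure \<nu> {p \<in> Dom h. ind h p \<in> B} = emeasure \<nu> B"
      if h: "twist_pair h h'" and B: "B \<in> sets borel" "B \<subseteq> Dom h'" for h h' B
    proof -
      note h' = twist_pair_sym[OF h]
      let ?S = "{p \<in> Dom h. ind h p \<in> B}"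
      have "?S = Dom h \<inter> (ind h -` B \<inter> space borel)" by auto
      then have S: "?S \<in> sets borel" using Dom_borel[OF h] measurable_sets[OF borel_ind[OF h] B(1)] by simp
      have D\<Omega>: "Dom h \<subseteq> \<Omega>" "Dom h' \<subseteq> \<Omega>" by (auto simp: Dom_def)
      have form: "W (ind h x) (frechet_derivative (ind h) (at x) v) (frechet_derivative (ind h) (at x) w) = W x v w"
        if x: "x \<in> Dom h" for x v w
      proof (rule twist_pair_action[OF h \<xi>])
        fix F assume F: "F \<in> carrier (mapping_class_group g \<xi>)"
          and act: "\<And>p. p \<in> Dom h \<Longrightarrow> mcg_action g F (pt p) = pt (ind h p)"
          and U: "\<And>p. p \<in> \<Omega> \<Longrightarrow> mcg_action g F (pt p) \<in> U0 \<longleftrightarrow> p \<in> Dom h"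
        have x\<Omega>: "x \<in> \<Omega>" using x D\<Omega> by blast
        let ?\<tau> = "\<phi> \<circ> mcg_action g F \<circ> inv_into U0 \<phi>"
        have \<tau>: "ind h p = ?\<tau> p" if p: "p \<in> Dom h" for p
        proof -
          have "p \<in> \<Omega>" using p D\<Omega> by blast
          moreover have "ind h p \<in> \<Omega>" using ind_inverse(1)[OF h p] D\<Omega> by blast
          ultimately show ?thesis using act[OF p] by (simp add: inv_\<phi>)
        qed
        have "(?\<tau> has_derivative frechet_derivative (ind h) (at x)) (at x)"
          by (rule has_derivative_transform_within_open[OF ind_derivative[OF h x] smooth_ind(1)[OF h] x \<tau>])
        then have der: "frechet_derivative ?\<tau> (at x) = frechet_derivative (ind h) (at x)"
          by (rule frechet_derivative_at[symmetric])
        have "pt x \<in> U0 \<inter> mcg_action g F -` U0" using pt_in_U0[OF x\<Omega>] U[OF x\<Omega>] x by simp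
        then have "\<phi> (pt x) \<in> \<phi> ` (U0 \<inter> mcg_action g F -` U0)" by (rule imageI)
        then have mem: "x \<in> \<phi> ` (U0 \<inter> mcg_action g F -` U0)" using x\<Omega> by simp
        have "\<forall>x\<in>\<phi> ` (U0 \<inter> mcg_action g F -` U0).
            let \<tau> = \<phi> \<circ> mcg_action g F \<circ> inv_into U0 \<phi>; D = frechet_derivative \<tau> (at x)
            in \<forall>v w. \<omega> (U0, \<phi>) (\<tau> x) (D v) (D w) = \<omega> (U0, \<phi>) x v w"
          by (rule bspec[OF bspec[OF pres[OF F, unfolded preserves_form_def] chart_in_atlas, unfolded prod.case] chart_in_atlas, unfolded prod.case])
        from bspec[OF this mem] show ?thesis
          unfolding Let_def der \<tau>[OF x, symmetric] W_def by blast
      qed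
      have "(\<integral>\<^sup>+x. ennreal (f x) * indicator ?S x \<partial>lborel) = (\<integral>\<^sup>+x. ennreal (f x) * indicator B x \<partial>lborel)"
      proof (rule gram_change_of_variables[where \<tau> = "ind h" and \<tau>' = "ind h'" and W = W and
            D = "\<lambda>x. frechet_derivative (ind h) (at x)" and D' = "\<lambda>x. frechet_derivative (ind h') (at x)"])
        show "(ind h has_derivative frechet_derivative (ind h) (at x)) (at x)" if "x \<in> ?S" for x
          by (rule ind_derivative[OF h]) (use that in simp)
        show "(ind h' has_derivative frechet_derivative (ind h') (at y)) (at y)" if "y \<in> B" for y
          by (rule ind_derivative[OF h']) (use that B in blast)
        show "ind h x \<in> B \<and> ind h' (ind h x) = x" if "x \<in> ?S" for x
          using that ind_inverse(2)[OF h] by simp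
        show "ind h' y \<in> ?S \<and> ind h (ind h' y) = y" if "y \<in> B" for y
          using ind_inverse[OF h', of y] that B(2) by auto
        show "frechet_derivative (ind h') (at y) \<circ> frechet_derivative (ind h) (at (ind h' y)) = id" if "y \<in> B" for y
          by (rule ind_derivative_inverse[OF h]) (use that B in blast)
        show "bilinear (W y)" if "y \<in> B" for y
          by (rule bil) (use that B D\<Omega> in blast)
        show "W (ind h x) (frechet_derivative (ind h) (at x) v) (frechet_derivative (ind h) (at x) w) = W x v w"
          if "x \<in> ?S" for x v w by (rule form) (use that in simp)
        show "f x = sqrt \<bar>gram_det (W x)\<bar>" if "x \<in> ?S \<union> B" for x
          by (rule f_eq) (use that B D\<Omega> in blast)
      qed (fact S B(1) f f0)+
      then show ?thesis by (simp only: \<nu>[OF S] \<nu>[OF B(1)])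
    qed
  qed
qed

end

theorem corollary19:
  fixes g :: nat
    and \<kappa> :: "surface_elt \<Rightarrow> surface_elt \<Rightarrow> int"
  assumes "g \<ge> 2"
    and "DIM('e::euclidean_space) = 8 * g - 6"
    and "fundamental_class (surface_group g) \<kappa>"
  shows "(\<nexists>\<mu>. in_lebesgue_class (char_var g)
                 (char_var_atlas g :: (surface_rep set, 'e) chart set) \<mu> \<and>
               (\<forall>F\<in>carrier (mapping_class_group g \<kappa>). invariant_measure \<mu> (mcg_action g F))) \<and>
         (\<nexists>\<omega>. symplectic_form (char_var_atlas g :: (surface_rep set, 'e) chart set) \<omega> \<and>
               (\<forall>F\<in>carrier (mapping_class_group g \<kappa>).
                  preserves_form (char_var_atlas g) \<omega> (mcg_action g F)))"
proof -
  obtain b :: "nat \<Rightarrow> 'e" where "bij_betw b {..<8 * g - 6} Basis"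
    using ex_bij_betw_nat_finite[of "Basis :: 'e set"] assms(2) by (auto simp: atLeast0LessThan)
  then interpret surface_chart g b
    using assms(1) by unfold_locales
  show ?thesis
    using no_invariant_lebesgue_class_measure[OF _ assms(3)] no_invariant_symplectic_form[OF _ assms(3)] by blast
qed

end
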